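(* Let $n\ge 1$ be an integer and $s\in(0,1)$. Let $k,m\in\mathbb{N}$ and let $u:\mathbb{R}^n\to\mathbb{R}$ be such that $u\in C^m(\overline{B_1})$ and $$\int_{B_1^c}\frac{|u(x)|}{|x|^{n+2s+k}}\,dx<+\infty.$$ Then, for any $\varepsilon>0$ there exist a function $u_\varepsilon:\mathbb{R}^n\to\mathbb{R}$ and $R_\varepsilon>1$ such that $$(-\Delta)^s u_\varepsilon \stackrel{k}{=} 0 \quad\text{in } B_1,$$ $$\|u_\varepsilon-u\|_{C^m(B_1)}\le\varepsilon,$$ $$\text{and}\quad u_\varepsilon=u\quad\text{in } B_{R_\varepsilon}^c.$$
   Context: Notation: $\mathbb{N}=\{0,1,2,\dots\}$; $B_r(x)$ is the open ball of radius $r$ centered at $x$ in $\mathbb{R}^n$, $B_r=B_r(0)$, and $B_r^c=\mathbb{R}^n\setminus B_r$. Functions are Lebesgue measurable. For $s\in(0,1)$ the fractional Laplacian is $$(-\Delta)^s w(x):=\lim_{\rho\searrow0}\int_{\mathbb{R}^n\setminus B_\rho(x)}\frac{w(x)-w(y)}{|x-y|^{n+2s}}\,dy,$$ and equations $(-\Delta)^s w=g$ in $B_1$ may be understood in the usual viscosity sense. For $k\in\mathbb{N}$ let $\mathcal{U}_k$ be the set of functions $u:\mathbb{R}^n\to\mathbb{R}$ that are continuous in $B_1$ and satisfy $\int_{\mathbb{R}^n}\frac{|u(x)|}{1+|x|^{n+2s+k}}\,dx<+\infty$. Let $\chi_R(x)=1$ if $x\in B_R$ and $\chi_R(x)=0$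 if $x\in\mathbb{R}^n\setminus B_R$. Definition (divergent fractional Laplacian). For $u\in\mathcal{U}_k$ and $f:B_1\to\mathbb{R}$, one writes $(-\Delta)^s u\stackrel{k}{=}f$ in $B_1$ if there exist a family of polynomials $P_R$ of degree at most $k-1$ (with $P_R=0$ when $k=0$) and functions $f_R:B_1\to\mathbb{R}$, indexed by (large) $R$, such that $(-\Delta)^s(\chi_R u)=f_R+P_R$ in $B_1$ in the viscosity sense, and $\lim_{R\to+\infty}f_R(x)=f(x)$ for every $x\in B_1$. *)

theory Defs
  imports "HOL-Analysis.Analysis"
begin

section \<open>Functions of class $C^m$\<close>

primrec iter_partial :: "'n::finite list \<Rightarrow> (real ^ 'n \<Rightarrow> real) \<Rightarrow> real ^ 'n \<Rightarrow> real" where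
  "iter_partial [] f = f"
| "iter_partial (i # ds) f = (\<lambda>x. frechet_derivative (iter_partial ds f) (at x) (axis i 1))"

text \<open>Only used for open \<open>U\<close>. The list \<open>ds\<close> of coordinate directions plays the role of a
  multi-index of order \<open>length ds\<close>.\<close>

definition C_on :: "nat \<Rightarrow> (real ^ 'n::finite) set \<Rightarrow> (real ^ 'n \<Rightarrow> real) \<Rightarrow> bool" where
  "C_on m U f \<longleftrightarrow>
     (\<forall>ds. length ds < m \<longrightarrow> (\<forall>x\<in>U. iter_partial ds f differentiable (at x))) \<and>
     (\<forall>ds. length ds \<le> m \<longrightarrow> continuous_on U (iter_partial ds f))"

text \<open>$f \in C^m(\overline U)$: all derivatives up to order \<open>m\<close> in \<open>U\<close> extend continuously to the
  closure, and \<open>f\<close> itself is its own extension.\<close>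

definition C_closure :: "nat \<Rightarrow> (real ^ 'n::finite) set \<Rightarrow> (real ^ 'n \<Rightarrow> real) \<Rightarrow> bool" where
  "C_closure m U f \<longleftrightarrow>
     C_on m U f \<and> continuous_on (closure U) f \<and>
     (\<forall>ds. length ds \<le> m \<longrightarrow>
        (\<exists>g. continuous_on (closure U) g \<and> (\<forall>x\<in>U. g x = iter_partial ds f x)))"

text \<open>The norm $\max_{|\alpha|\le m} \sup_U |\partial^\alpha f|$, with value $\infty$ if \<open>f\<close> is not
  of class $C^m$ in \<open>U\<close> or has an unbounded derivative.\<close>

definition C_norm :: "nat \<Rightarrow> (real ^ 'n::finite) set \<Rightarrow> (real ^ 'n \<Rightarrow> real) \<Rightarrow> ennreal" where
  "C_norm m U f =
     (if C_on m U f
      then (SUP ds\<in>{ds. length ds \<le> m}. SUP x\<in>U. ennreal \<bar>iter_partial ds f x\<bar>)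
      else \<infinity>)"


section \<open>Fractional Laplacian and viscosity solutions\<close>

definition weighted_L1 :: "real \<Rightarrow> nat \<Rightarrow> (real ^ 'n::finite \<Rightarrow> real) set" where
  "weighted_L1 s k = {u. u \<in> borel_measurable lebesgue \<and>
     integrable lebesgue
       (\<lambda>x. \<bar>u x\<bar> / (1 + norm x powr (real CARD('n) + 2 * s + real k)))}"

definition has_frac_laplacian ::
  "real \<Rightarrow> (real ^ 'n::finite \<Rightarrow> real) \<Rightarrow> real ^ 'n \<Rightarrow> real \<Rightarrow> bool" where
  "has_frac_laplacian s w x L \<longleftrightarrow>
     (\<forall>\<rho>>0. set_integrable lebesgue (- ball x \<rho>)
        (\<lambda>y. (w x - w y) / norm (x - y) powr (real CARD('n) + 2 * s))) \<and>
     ((\<lambda>\<rho>. set_lebesgue_integral lebesgue (- ball x \<rho>)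
        (\<lambda>y. (w x - w y) / norm (x - y) powr (real CARD('n) + 2 * s))) \<longlongrightarrow> L) (at_right 0)"

text \<open>Following Caffarelli and Silvestre: if a $C^2$ function \<open>\<phi>\<close> touches \<open>w\<close> from above at \<open>x\<close>, in
  a ball around \<open>x\<close>, then the operator is evaluated at \<open>x\<close> on the function which is \<open>\<phi>\<close> in that ball
  and \<open>w\<close> outside. Asking \<open>\<phi>\<close> to be $C^2$ in a neighbourhood \<open>N\<close> of the closed ball makes this value
  finite for \<open>w\<close> in the weighted space.\<close>

definition viscosity_subsolution ::
  "real \<Rightarrow> (real ^ 'n::finite) set \<Rightarrow> (real ^ 'n \<Rightarrow> real) \<Rightarrow> (real ^ 'n \<Rightarrow> real) \<Rightarrow> bool" where
  "viscosity_subsolution s \<Omega> w g \<longleftrightarrow>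
     (\<forall>x r N \<phi>. 0 < r \<and> cball x r \<subseteq> \<Omega> \<and> open N \<and> cball x r \<subseteq> N \<and> C_on 2 N \<phi> \<and>
        \<phi> x = w x \<and> (\<forall>y\<in>ball x r. w y \<le> \<phi> y) \<longrightarrow>
        (\<exists>L. has_frac_laplacian s (\<lambda>y. if y \<in> ball x r then \<phi> y else w y) x L \<and> L \<le> g x))"

definition viscosity_supersolution ::
  "real \<Rightarrow> (real ^ 'n::finite) set \<Rightarrow> (real ^ 'n \<Rightarrow> real) \<Rightarrow> (real ^ 'n \<Rightarrow> real) \<Rightarrow> bool" where
  "viscosity_supersolution s \<Omega> w g \<longleftrightarrow>
     (\<forall>x r N \<phi>. 0 < r \<and> cball x r \<subseteq> \<Omega> \<and> open N \<and> cball x r \<subseteq> N \<and> C_on 2 N \<phi> \<and>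
        \<phi> x = w x \<and> (\<forall>y\<in>ball x r. \<phi> y \<le> w y) \<longrightarrow>
        (\<exists>L. has_frac_laplacian s (\<lambda>y. if y \<in> ball x r then \<phi> y else w y) x L \<and> g x \<le> L))"

definition viscosity_solution ::
  "real \<Rightarrow> (real ^ 'n::finite) set \<Rightarrow> (real ^ 'n \<Rightarrow> real) \<Rightarrow> (real ^ 'n \<Rightarrow> real) \<Rightarrow> bool" where
  "viscosity_solution s \<Omega> w g \<longleftrightarrow>
     continuous_on \<Omega> w \<and> w \<in> weighted_L1 s 0 \<and>
     viscosity_subsolution s \<Omega> w g \<and> viscosity_supersolution s \<Omega> w g"


section \<open>Divergent fractional Laplacian\<close>

definition U_class :: "real \<Rightarrow> nat \<Rightarrow> (real ^ 'n::finite \<Rightarrow> real) set" where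
  "U_class s k = {u. continuous_on (ball 0 1) u \<and> u \<in> weighted_L1 s k}"

text \<open>Polynomials of degree at most $k - 1$; for \<open>k = 0\<close> the sum is empty and only the zero
  polynomial remains.\<close>

definition poly_degree_less :: "nat \<Rightarrow> (real ^ 'n::finite \<Rightarrow> real) \<Rightarrow> bool" where
  "poly_degree_less k P \<longleftrightarrow>
     (\<exists>c :: ('n \<Rightarrow> nat) \<Rightarrow> real.
        \<forall>x. P x = (\<Sum>\<alpha> | (\<Sum>i\<in>UNIV. \<alpha> i) < k. c \<alpha> * (\<Prod>i\<in>UNIV. (x $ i) ^ \<alpha> i)))"

text \<open>The functions \<open>f\<close> and \<open>F R\<close> matter only on the unit ball.\<close>

definition div_frac_laplacian_eq ::
  "real \<Rightarrow> nat \<Rightarrow> (real ^ 'n::finite \<Rightarrow> real) \<Rightarrow> (real ^ 'n \<Rightarrow> real) \<Rightarrow> bool" where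
  "div_frac_laplacian_eq s k u f \<longleftrightarrow>
     u \<in> U_class s k \<and>
     (\<exists>(P :: real \<Rightarrow> real ^ 'n \<Rightarrow> real) (F :: real \<Rightarrow> real ^ 'n \<Rightarrow> real).
        (\<forall>\<^sub>F R in at_top.
           poly_degree_less k (P R) \<and>
           viscosity_solution s (ball 0 1)
             (\<lambda>x. indicator (ball 0 R) x * u x) (\<lambda>x. F R x + P R x)) \<and>
        (\<forall>x\<in>ball 0 1. ((\<lambda>R. F R x) \<longlongrightarrow> f x) at_top))"

end

theory Submission
  imports Defs
begin

text \<open>On the unit ball a monomial of degree \<open>d\<close> is the sum of an absolutely convergent trigonometric
  series without zero frequency, with coefficients growing at most exponentially in \<open>d\<close>. Dividing the
  coefficients by the symbol of the operator gives bounded $C^N$ functions whose fractional Laplacian is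
  that monomial on the ball. Hence the contribution \<open>\<integral> v(y) |x - y|\<^bsup>-n-2s\<^esup> dy\<close> of data \<open>v\<close> supported in
  \<open>|y| \<ge> R\<close>, \<open>R\<close> large, can be cancelled: expand the kernel in monomials in \<open>x\<close>, drop the terms of degree
  less than \<open>k\<close>, which are the divergent polynomial part, and superpose the solutions for the rest.

  The function \<open>u\<close> is close in $C^m$ to a trigonometric polynomial, so for approximation by functions
  harmonic in the ball it suffices to treat a plane wave with frequency \<open>\<kappa>\<close>. Its fractional Laplacian is a
  power series in \<open>\<kappa> \<bullet> x\<close>. The half-spaces \<open>b < \<kappa> \<bullet> y\<close> have potentials proportional to
  \<open>(b - \<kappa> \<bullet> x)\<^bsup>-2s\<^esup>\<close>, all of whose Taylor coefficients are nonzero, so that combinations of their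
  indicators reproduce any such power series up to a small error, and the error is removed with the
  solutions for monomials.

  Given a harmonic approximant \<open>A\<close>, prescribing \<open>u\<close> outside \<open>B\<^sub>R\<close> requires a correction \<open>w\<close> that cancels the
  tail of \<open>u - A - w\<close>. For \<open>R\<close> large this is a contraction on bounded continuous functions with a small
  fixed point, and \<open>A + w\<close>, replaced by \<open>u\<close> outside \<open>B\<^sub>R\<close>, is the required function.\<close>

subsection \<open>The kernel\<close>

text \<open>The monomial solver alone cannot remove the fractional Laplacian of a plane wave: its
  solution need not be small and would spoil the approximation. Half-space indicators vanish on the
  ball, so they change the operator there but not the function; only the small remaining error goes
  to the solver, whose answer is then small with its derivatives.

  The frequency 0 is excluded because the symbol vanishes there. On the ball the constant 1 gets
  half-odd frequencies, taken from a smoothed square wave, and each coordinate gets integer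
  frequencies, so that no product of them reaches 0. Exponential growth in the degree is affordable
  because a term of degree \<open>d\<close> in the expansion of the kernel decays like
  \<open>norm y\<close> to the power \<open>- d\<close>, which wins for large \<open>R\<close>.

  The correction \<open>w\<close> is itself cut off outside the ball of radius \<open>R\<close>, so
  it has to cancel its own tail too; hence a fixed point equation instead of a formula. All
  functions involved agree on the ball with a C^2 function and satisfy their equations pointwise, so
  viscosity only enters through a comparison at touching points.\<close>

definition fker :: "real \<Rightarrow> real ^ 'n::finite \<Rightarrow> real" where
  "fker s z = norm z powr - (real CARD('n) + 2 * s)"

lemma fker_nonneg [simp]: "0 \<le> fker s z"
  by (simp add: fker_def)

lemma fker_minus [simp]: "fker s (- z) = fker s z"
  by (simp add: fker_def)

lemma fker_commute: "fker s (x - y) = fker s (y - x)"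
  by (simp add: fker_def norm_minus_commute)

lemma fker_measurable [measurable]: "fker s \<in> borel_measurable borel"
  unfolding fker_def by measurable

lemma divide_norm_powr:
  "c / norm (z :: real ^ 'n::finite) powr (real CARD('n) + 2 * s) = c * fker s z"
  unfolding fker_def powr_minus by (simp add: divide_inverse)

lemma fker_scaleR:
  assumes "0 < t"
  shows "fker s (t *\<^sub>R (z :: real ^ 'n::finite)) = t powr - (real CARD('n) + 2 * s) * fker s z"
  using assms by (simp add: fker_def powr_mult)

section \<open>Integrability of the kernel against \<open>min 1 ((norm z)^2)\<close>\<close>

lemma has_integral_indicator_mult:
  fixes f :: "real \<Rightarrow> real"
  assumes "(f has_integral I) S"
  shows "((\<lambda>t. indicator S t * f t) has_integral I) UNIV"
proof -
  have "(\<lambda>t. indicator S t * f t) = (\<lambda>t. if t \<in> S then f t else 0)" by auto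
  then show ?thesis using assms by (simp add: has_integral_restrict_UNIV)
qed

text \<open>Near 0 the integrand behaves like \<open>t powr (1-2 * s)\<close>, integrable since
  \<open>s < 1\<close>; at infinity like \<open>t powr (-2 * s-1)\<close>, integrable since
  \<open>0 < s\<close>. The constant \<open>V\<close> will be the volume of the unit ball.\<close>

lemma nn_integral_fker_aux:
  fixes s :: real
  assumes s: "0 < s" "s < 1" and V: "0 \<le> V"
  shows "(\<integral>\<^sup>+t. ennreal (indicator {0<..} t * (t powr (-2 * s-1) * min 1 (t^2)) * V) \<partial>lborel) < \<infinity>"
proof -
  have 1: "(\<integral>\<^sup>+t. ennreal (indicator {0..1} t * t powr (1-2 * s)) \<partial>lborel) < \<infinity>"
  proof -
    have "((\<lambda>t. indicator {0..1} t * t powr (1-2 * s)) has_integral (1 powr (1-2 * s+1) / (1-2 * s+1))) UNIV"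
      using s by (intro has_integral_indicator_mult has_integral_powr_from_0) auto
    then show ?thesis
      by (subst nn_integral_has_integral_lborel) auto
  qed
  have 2: "(\<integral>\<^sup>+t. ennreal (indicator {1..} t * t powr (-2 * s-1)) \<partial>lborel) < \<infinity>"
  proof -
    have "((\<lambda>t. indicator {1..} t * t powr (-2 * s-1)) has_integral (- (1 powr (-2 * s-1+1)) / (-2 * s-1+1))) UNIV"
      using s by (intro has_integral_indicator_mult has_integral_powr_to_inf) auto
    then show ?thesis
      by (subst nn_integral_has_integral_lborel) auto
  qed
  have "(\<integral>\<^sup>+t. ennreal (indicator {0<..} t * (t powr (-2 * s-1) * min 1 (t^2)) * V) \<partial>lborel)
      \<le> (\<integral>\<^sup>+t. (ennreal (indicator {0..1} t * t powr (1-2 * s)) + ennreal (indicator {1..} t * t powr (-2 * s-1))) * ennreal V \<partial>lborel)"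
  proof (rule nn_integral_mono)
    fix t :: real
    have *: "t powr (-2 * s-1) * t^2 = t powr (1-2 * s)" if "t > 0"
    proof -
      have "t powr (-2 * s-1) * t powr 2 = t powr (1-2 * s)" by (simp add: powr_add[symmetric])
      then show ?thesis using that by simp
    qed
    have "indicator {0<..} t * (t powr (-2 * s-1) * min 1 (t^2))
        \<le> indicator {0..1} t * t powr (1-2 * s) + indicator {1..} t * t powr (-2 * s-1)"
    proof -
      have "t powr (-2 * s-1) * min 1 (t^2) \<le> t powr (-2 * s-1) * t^2"
           "t powr (-2 * s-1) * min 1 (t^2) \<le> t powr (-2 * s-1) * 1"
        by (intro mult_left_mono; simp)+
      then show ?thesis
        using *
        by (cases "t \<le> 1"; cases "t > 0") (auto simp: indicator_def add_increasing)
    qed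
    then show "ennreal (indicator {0<..} t * (t powr (-2 * s-1) * min 1 (t^2)) * V)
      \<le> (ennreal (indicator {0..1} t * t powr (1-2 * s)) + ennreal (indicator {1..} t * t powr (-2 * s-1))) * ennreal V"
      using V by (subst ennreal_plus[symmetric]; (subst ennreal_mult[symmetric])?)
        (auto simp del: ennreal_plus intro!: ennreal_leI mult_right_mono)
  qed
  also have "\<dots> = ((\<integral>\<^sup>+t. ennreal (indicator {0..1} t * t powr (1-2 * s)) \<partial>lborel)
      + (\<integral>\<^sup>+t. ennreal (indicator {1..} t * t powr (-2 * s-1)) \<partial>lborel)) * ennreal V"
    by (simp add: nn_integral_multc nn_integral_add)
  also have "\<dots> < \<infinity>"
    using 1 2 by (simp add: ennreal_mult_less_top)
  finally show ?thesis .
qed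

text \<open>A layer-cake argument replaces polar coordinates: \<open>r powr (-a)\<close> is
  \<open>a\<close> times the integral of \<open>t powr (-a-1)\<close> over \<open>t > r\<close>, the
  factor \<open>min 1 (r^2)\<close> may be enlarged to \<open>min 1 (t^2)\<close>, and Tonelli turns
  the integral in \<open>z\<close> into the volume of the ball of radius \<open>t\<close>.\<close>

lemma integrable_min_fker:
  fixes s :: real
  assumes s: "0 < s" "s < 1"
  shows "integrable lborel (\<lambda>z :: real ^ 'n::finite. min 1 ((norm z)^2) * fker s z)"
proof (rule integrableI_nonneg)
  define n where "n = real CARD('n)"
  define a where "a = n + 2 * s"
  have a: "a > 0" using s by (simp add: a_def n_def add_pos_pos)
  define \<phi> where "\<phi> t = indicator {0<..} t * (t powr (-a-1) * min 1 (t^2))" for t :: real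
  have \<phi>0: "0 \<le> \<phi> t" for t by (simp add: \<phi>_def)
  have [measurable]: "\<phi> \<in> borel_measurable borel" unfolding \<phi>_def by measurable
  have A: "ennreal (min 1 ((norm z)^2) * fker s z)
      \<le> (\<integral>\<^sup>+t. ennreal a * (ennreal (\<phi> t) * indicator {z. norm z < t} z) \<partial>lborel)" for z :: "real ^ 'n"
  proof (cases "z = 0")
    case False
    define r where "r = norm z"
    have r: "r > 0" using False by (simp add: r_def)
    have "((\<lambda>t. t powr (-a-1)) has_integral (r powr (-a) / a)) {r..}"
      using has_integral_powr_to_inf[of "-a-1" r] a r by simp
    then have "((\<lambda>t. indicator {r..} t * t powr (-a-1)) has_integral (r powr (-a) / a)) UNIV"
      by (rule has_integral_indicator_mult)
    then have "(\<integral>\<^sup>+t. ennreal (indicator {r..} t * t powr (-a-1)) \<partial>lborel) = ennreal (r powr (-a) / a)"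
      by (subst nn_integral_has_integral_lborel) auto
    then have "ennreal (a * min 1 (r^2) * (r powr (-a) / a))
        = ennreal (a * min 1 (r^2)) * (\<integral>\<^sup>+t. ennreal (indicator {r..} t * t powr (-a-1)) \<partial>lborel)"
      using a by (subst ennreal_mult) auto
    also have "\<dots> = (\<integral>\<^sup>+t. ennreal (a * min 1 (r^2)) * ennreal (indicator {r..} t * t powr (-a-1)) \<partial>lborel)"
      by (subst nn_integral_cmult) auto
    also have "\<dots> \<le> (\<integral>\<^sup>+t. ennreal a * (ennreal (\<phi> t) * indicator {z. norm z < t} z) \<partial>lborel)"
    proof (rule nn_integral_mono_AE)
      \<comment> \<open>The half-line \<open>{r..}\<close> contains \<open>t = r\<close>, while the
        other indicator asks for \<open>norm z < t\<close>; the two disagree only at this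
        point.\<close>
      have "AE t in lborel. t \<noteq> r" by (rule AE_lborel_singleton)
      then show "AE t in lborel. ennreal (a * min 1 (r^2)) * ennreal (indicator {r..} t * t powr (-a-1))
          \<le> ennreal a * (ennreal (\<phi> t) * indicator {z. norm z < t} z)"
      proof (rule AE_mp, intro AE_I2 impI)
        fix t :: real assume "t \<noteq> r"
        show "ennreal (a * min 1 (r^2)) * ennreal (indicator {r..} t * t powr (-a-1))
          \<le> ennreal a * (ennreal (\<phi> t) * indicator {z. norm z < t} z)"
        proof (cases "t > r")
          case True
          have "min 1 (r^2) \<le> min 1 (t^2)"
            using True r by (simp add: min_def) (smt (verit) power_mono)
          then have "a * min 1 (r^2) * t powr (-a-1) \<le> a * \<phi> t"
            using True r a by (simp add: \<phi>_def indicator_def mult.commute mult_left_mono mult_right_mono)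
          then have "ennreal (a * min 1 (r^2) * t powr (-a-1)) \<le> ennreal (a * \<phi> t)" by (rule ennreal_leI)
          then show ?thesis using True r a \<phi>0[of t]
            by (simp add: ennreal_mult r_def[symmetric] indicator_def)
        qed (use \<open>t \<noteq> r\<close> in \<open>auto simp: indicator_def\<close>)
      qed
    qed
    finally show ?thesis
      using a by (simp add: fker_def r_def a_def n_def)
  qed (simp add: fker_def)
  have "(\<integral>\<^sup>+z. ennreal (min 1 ((norm (z::real^'n))^2) * fker s z) \<partial>lborel)
      \<le> (\<integral>\<^sup>+z. (\<integral>\<^sup>+t. ennreal a * (ennreal (\<phi> t) * indicator {z. norm z < t} (z::real^'n)) \<partial>lborel) \<partial>lborel)"
    by (rule nn_integral_mono) (rule A)
  also have "\<dots> = (\<integral>\<^sup>+t. (\<integral>\<^sup>+z. ennreal a * (ennreal (\<phi> t) * indicator {z. norm z < t} (z::real^'n)) \<partial>lborel) \<partial>lborel)"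
  proof (rule lborel_pair.Fubini')
    have "{p :: real \<times> (real^'n). norm (snd p) < fst p} \<in> sets borel"
      by (intro borel_open open_Collect_less continuous_intros)
    moreover have "(\<lambda>(t, z::real^'n). ennreal a * (ennreal (\<phi> t) * indicator {z. norm z < t} z))
       = (\<lambda>p. ennreal a * (ennreal (\<phi> (fst p)) * indicator {p. norm (snd p) < fst p} p))"
      by (auto simp: fun_eq_iff indicator_def)
    ultimately show "(\<lambda>(t, z::real^'n). ennreal a * (ennreal (\<phi> t) * indicator {z. norm z < t} z))
        \<in> borel_measurable (lborel \<Otimes>\<^sub>M lborel)"
      by (simp add: borel_prod[symmetric] lborel_prod)
  qed
  also have "\<dots> \<le> (\<integral>\<^sup>+t. ennreal a * ennreal (indicator {0<..} t * (t powr (-2 * s-1) * min 1 (t^2)) * unit_ball_vol n) \<partial>lborel)"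
  proof (rule nn_integral_mono)
    fix t :: real
    have eq: "{z. norm z < t} = ball (0::real^'n) t" by (auto simp: dist_norm)
    show "(\<integral>\<^sup>+z. ennreal a * (ennreal (\<phi> t) * indicator {z. norm z < t} (z::real^'n)) \<partial>lborel)
      \<le> ennreal a * ennreal (indicator {0<..} t * (t powr (-2 * s-1) * min 1 (t^2)) * unit_ball_vol n)"
    proof (cases "t > 0")
      case True
      have "t powr (-a-1) * t ^ CARD('n) = t powr (-2 * s-1)"
      proof -
      have "t ^ CARD('n) = t powr n" using True by (simp add: n_def powr_realpow)
      then show ?thesis by (simp add: powr_add[symmetric] a_def)
    qed
      then have *: "\<phi> t * (unit_ball_vol n * t ^ CARD('n)) = indicator {0<..} t * (t powr (-2 * s-1) * min 1 (t^2)) * unit_ball_vol n"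
        using True by (simp add: \<phi>_def mult_ac)
      have "(\<integral>\<^sup>+z. ennreal a * (ennreal (\<phi> t) * indicator {z. norm z < t} (z::real^'n)) \<partial>lborel)
         = ennreal a * (ennreal (\<phi> t) * emeasure lborel (ball (0::real^'n) t))"
        by (simp add: nn_integral_cmult eq)
      also have "\<dots> = ennreal a * ennreal (\<phi> t * (unit_ball_vol n * t ^ CARD('n)))"
        using True \<phi>0 by (simp add: emeasure_ball n_def ennreal_mult)
      finally show ?thesis unfolding * by simp
    qed (auto simp: \<phi>_def)
  qed
  also have "\<dots> = ennreal a * (\<integral>\<^sup>+t. ennreal (indicator {0<..} t * (t powr (-2 * s-1) * min 1 (t^2)) * unit_ball_vol n) \<partial>lborel)"
    by (rule nn_integral_cmult) measurable
  also have "\<dots> < \<infinity>"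
    using nn_integral_fker_aux[OF s, of "unit_ball_vol n"] a by (simp add: ennreal_mult_less_top n_def)
  finally show "(\<integral>\<^sup>+z. ennreal (min 1 ((norm (z::real^'n))^2) * fker s z) \<partial>lborel) < \<infinity>" .
qed auto

section \<open>Affine changes of variables\<close>

lemma lborel_integral_translate:
  fixes f :: "'a::euclidean_space \<Rightarrow> real"
  assumes "f \<in> borel_measurable borel"
  shows "(\<integral>z. f (x + z) \<partial>lborel) = (\<integral>z. f z \<partial>lborel)"
    and "integrable lborel (\<lambda>z. f (x + z)) \<longleftrightarrow> integrable lborel f"
proof -
  have "(\<integral>z. f z \<partial>lborel) = (\<integral>z. f z \<partial>distr lborel borel ((+) x))"
    by (simp add: lborel_distr_plus)
  also have "\<dots> = (\<integral>z. f (x + z) \<partial>lborel)"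
    using assms by (subst integral_distr) auto
  finally show "(\<integral>z. f (x + z) \<partial>lborel) = (\<integral>z. f z \<partial>lborel)" by simp
  have "integrable lborel f \<longleftrightarrow> integrable (distr lborel borel ((+) x)) f"
    by (simp add: lborel_distr_plus)
  also have "\<dots> \<longleftrightarrow> integrable lborel (\<lambda>z. f (x + z))"
    using assms by (subst integrable_distr_eq) auto
  finally show "integrable lborel (\<lambda>z. f (x + z)) \<longleftrightarrow> integrable lborel f" by simp
qed

lemma lborel_integral_scale:
  fixes f :: "'a::euclidean_space \<Rightarrow> real"
  assumes "f \<in> borel_measurable borel" "c \<noteq> 0"
  shows "(\<integral>z. f (c *\<^sub>R z) \<partial>lborel) = (\<integral>z. f z \<partial>lborel) / \<bar>c\<bar> ^ DIM('a)"
    and "integrable lborel (\<lambda>z. f (c *\<^sub>R z)) \<longleftrightarrow> integrable lborel f"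
proof -
  have L: "lborel = density (distr lborel borel (\<lambda>x::'a. c *\<^sub>R x)) (\<lambda>_. \<bar>c\<bar>^DIM('a))"
    using lborel_affine[OF assms(2), of "0::'a"] by simp
  have "(\<integral>z. f z \<partial>lborel) = (\<integral>z. f z \<partial>density (distr lborel borel (\<lambda>x::'a. c *\<^sub>R x)) (\<lambda>_. \<bar>c\<bar>^DIM('a)))"
    using L by simp
  also have "\<dots> = (\<integral>z. \<bar>c\<bar>^DIM('a) *\<^sub>R f z \<partial>distr lborel borel (\<lambda>x::'a. c *\<^sub>R x))"
    using assms by (subst integral_density) auto
  also have "\<dots> = \<bar>c\<bar>^DIM('a) * (\<integral>z. f (c *\<^sub>R z) \<partial>lborel)"
    using assms by (subst integral_distr) auto
  finally show "(\<integral>z. f (c *\<^sub>R z) \<partial>lborel) = (\<integral>z. f z \<partial>lborel) / \<bar>c\<bar> ^ DIM('a)"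
    using assms by simp
  have "integrable lborel f \<longleftrightarrow> integrable (density (distr lborel borel (\<lambda>x::'a. c *\<^sub>R x)) (\<lambda>_. \<bar>c\<bar>^DIM('a))) f"
    using L by simp
  also have "\<dots> \<longleftrightarrow> integrable (distr lborel borel (\<lambda>x::'a. c *\<^sub>R x)) (\<lambda>z. \<bar>c\<bar>^DIM('a) *\<^sub>R f z)"
    using assms by (subst integrable_density) auto
  also have "\<dots> \<longleftrightarrow> integrable lborel (\<lambda>z. \<bar>c\<bar>^DIM('a) *\<^sub>R f (c *\<^sub>R z))"
    using assms by (subst integrable_distr_eq) auto
  also have "\<dots> \<longleftrightarrow> integrable lborel (\<lambda>z. f (c *\<^sub>R z))"
    using assms by simp
  finally show "integrable lborel (\<lambda>z. f (c *\<^sub>R z)) \<longleftrightarrow> integrable lborel f" by simp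
qed

lemma lborel_integral_reflect:
  fixes f :: "'a::euclidean_space \<Rightarrow> real"
  assumes "f \<in> borel_measurable borel"
  shows "(\<integral>z. f (- z) \<partial>lborel) = (\<integral>z. f z \<partial>lborel)"
    and "integrable lborel (\<lambda>z. f (- z)) \<longleftrightarrow> integrable lborel f"
  using lborel_integral_scale[OF assms, of "-1"] by auto

text \<open>The kernel contributes \<open>t powr (n + 2 * s)\<close> and the Jacobian
  \<open>t powr (- n)\<close>, where \<open>n\<close> is the dimension. Both the homogeneity of the
  symbol and the half-space potentials come from this.\<close>

lemma fker_integral_scale:
  fixes f :: "real ^ 'n::finite \<Rightarrow> real"
  assumes [measurable]: "f \<in> borel_measurable borel" and "0 < t"
  shows "(\<integral>z. f (t *\<^sub>R z) * fker s z \<partial>lborel) = t powr (2 * s) * (\<integral>z. f z * fker s z \<partial>lborel)"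
proof -
  have "(\<integral>z. f (t *\<^sub>R z) * fker s z \<partial>lborel) = (\<integral>z. t powr (real CARD('n) + 2 * s) * (f (t *\<^sub>R z) * fker s (t *\<^sub>R z)) \<partial>lborel)"
    using assms by (intro Bochner_Integration.integral_cong refl)
      (simp only: fker_scaleR[OF assms(2)] powr_minus, simp add: field_simps)
  also have "\<dots> = t powr (real CARD('n) + 2 * s) * ((\<integral>z. f z * fker s z \<partial>lborel) / t ^ CARD('n))"
    using assms lborel_integral_scale(1)[of "\<lambda>z. f z * fker s z" t] by simp
  also have "\<dots> = t powr (2 * s) * (\<integral>z. f z * fker s z \<partial>lborel)"
    using assms by (simp add: powr_add powr_realpow field_simps)
  finally show ?thesis .
qed

lemma integrable_fker_far:
  fixes s :: real
  assumes s: "0 < s" "s < 1" and "0 < \<rho>"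
  shows "integrable lborel (\<lambda>z :: real ^ 'n::finite. indicator {z. \<rho> \<le> norm z} z * fker s z)"
proof (rule Bochner_Integration.integrable_bound)
  show "integrable lborel (\<lambda>z :: real ^ 'n. (1 / min 1 (\<rho>^2)) * (min 1 ((norm z)^2) * fker s z))"
    by (intro integrable_mult_right integrable_min_fker s)
  show "AE z in lborel. norm (indicator {z. \<rho> \<le> norm z} z * fker s z)
      \<le> norm ((1 / min 1 (\<rho>^2)) * (min 1 ((norm z)^2) * fker s (z::real^'n)))"
  proof (rule AE_I2)
    fix z :: "real^'n"
    have "1 * fker s z \<le> ((1 / min 1 (\<rho>^2)) * min 1 ((norm z)^2)) * fker s z" if "\<rho> \<le> norm z"
    proof (rule mult_right_mono)
      have "min 1 (\<rho>^2) \<le> min 1 ((norm z)^2)" "0 < min 1 (\<rho>^2)"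
        using that assms by (auto simp: min_def) (smt (verit) power_mono)+
      then show "1 \<le> (1 / min 1 (\<rho>^2)) * min 1 ((norm z)^2)" by (simp add: field_simps)
    qed simp
    moreover have "0 < min 1 (\<rho>^2)" using assms by simp
    ultimately show "norm (indicator {z. \<rho> \<le> norm z} z * fker s z)
      \<le> norm ((1 / min 1 (\<rho>^2)) * (min 1 ((norm z)^2) * fker s z))"
      by (auto simp: indicator_def abs_mult mult.assoc)
  qed
qed measurable

subsection \<open>Pointwise evaluation of the fractional Laplacian\<close>

lemma has_frac_laplacian_iff:
  "has_frac_laplacian s w (x :: real ^ 'n::finite) L \<longleftrightarrow>
     (\<forall>\<rho>>0. set_integrable lebesgue (- ball x \<rho>) (\<lambda>y. (w x - w y) * fker s (x - y))) \<and>
     ((\<lambda>\<rho>. set_lebesgue_integral lebesgue (- ball x \<rho>) (\<lambda>y. (w x - w y) * fker s (x - y)))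
        \<longlongrightarrow> L) (at_right 0)"
  unfolding has_frac_laplacian_def divide_norm_powr ..

lemma has_frac_laplacian_add:
  assumes "has_frac_laplacian s v x L" "has_frac_laplacian s w x K"
  shows "has_frac_laplacian s (\<lambda>y. v y + w y) x (L + K)"
proof -
  have eq: "(v x + w x - (v y + w y)) * fker s (x - y)
      = (v x - v y) * fker s (x - y) + (w x - w y) * fker s (x - y)" for y
    by (simp add: algebra_simps)
  have i: "set_integrable lebesgue (- ball x \<rho>) (\<lambda>y. (v x - v y) * fker s (x - y))"
    "set_integrable lebesgue (- ball x \<rho>) (\<lambda>y. (w x - w y) * fker s (x - y))" if "\<rho> > 0" for \<rho>
    using assms that unfolding has_frac_laplacian_iff by blast+
  have "((\<lambda>\<rho>. set_lebesgue_integral lebesgue (- ball x \<rho>) (\<lambda>y. (v x - v y) * fker s (x - y))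
       + set_lebesgue_integral lebesgue (- ball x \<rho>) (\<lambda>y. (w x - w y) * fker s (x - y))) \<longlongrightarrow> L + K) (at_right 0)"
    using assms unfolding has_frac_laplacian_iff by (intro tendsto_add) blast+
  moreover have "\<forall>\<^sub>F \<rho> in at_right 0.
       set_lebesgue_integral lebesgue (- ball x \<rho>) (\<lambda>y. (v x - v y) * fker s (x - y))
       + set_lebesgue_integral lebesgue (- ball x \<rho>) (\<lambda>y. (w x - w y) * fker s (x - y))
       = set_lebesgue_integral lebesgue (- ball x \<rho>) (\<lambda>y. (v x + w x - (v y + w y)) * fker s (x - y))"
    using eventually_at_right_less[of "0::real"]
    by eventually_elim (use i in \<open>simp add: eq set_integral_add\<close>)
  ultimately have "((\<lambda>\<rho>. set_lebesgue_integral lebesgue (- ball x \<rho>)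
      (\<lambda>y. (v x + w x - (v y + w y)) * fker s (x - y))) \<longlongrightarrow> L + K) (at_right 0)"
    by (rule Lim_transform_eventually)
  then show ?thesis
    unfolding has_frac_laplacian_iff using i by (simp add: eq)
qed

text \<open>If \<open>v x = 0\<close> and \<open>v\<close> is integrable against the kernel, the
  principal value is an ordinary integral, by dominated convergence. It serves for data supported
  away from \<open>x\<close> and for the gap between a test function and the function it
  touches.\<close>

lemma has_frac_laplacian_vanishing:
  fixes x :: "real ^ 'n::finite"
  assumes vx: "v x = 0" and i: "integrable lebesgue (\<lambda>y. v y * fker s (x - y))"
  shows "has_frac_laplacian s v x (- (\<integral>y. v y * fker s (x - y) \<partial>lebesgue))"
proof -
  have int: "set_integrable lebesgue (- ball x \<rho>) (\<lambda>y. (v x - v y) * fker s (x - y))" for \<rho>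
    unfolding set_integrable_def vx
    by (rule integrable_mult_indicator) (use i in simp_all)
  moreover have "((\<lambda>\<rho>. set_lebesgue_integral lebesgue (- ball x \<rho>) (\<lambda>y. (v x - v y) * fker s (x - y)))
      \<longlongrightarrow> (\<integral>y. - (v y * fker s (x - y)) \<partial>lebesgue)) (at_right 0)"
  proof (rule tendsto_at_right_sequentially[of _ 1])
    fix S :: "nat \<Rightarrow> real" assume S: "\<And>n. 0 < S n" "S \<longlonglongrightarrow> 0"
    show "(\<lambda>n. set_lebesgue_integral lebesgue (- ball x (S n)) (\<lambda>y. (v x - v y) * fker s (x - y)))
        \<longlonglongrightarrow> (\<integral>y. - (v y * fker s (x - y)) \<partial>lebesgue)"
      unfolding set_lebesgue_integral_def
    proof (rule integral_dominated_convergence[where w="\<lambda>y. \<bar>v y * fker s (x - y)\<bar>"])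
      show "integrable lebesgue (\<lambda>y. \<bar>v y * fker s (x - y)\<bar>)" using i by simp
      show "AE y in lebesgue. (\<lambda>n. indicator (- ball x (S n)) y *\<^sub>R ((v x - v y) * fker s (x - y)))
          \<longlonglongrightarrow> - (v y * fker s (x - y))"
      proof (rule AE_I2)
        fix y
        show "(\<lambda>n. indicator (- ball x (S n)) y *\<^sub>R ((v x - v y) * fker s (x - y)))
          \<longlonglongrightarrow> - (v y * fker s (x - y))"
        proof (cases "y = x")
          case False
          have "\<forall>\<^sub>F n in sequentially. S n < dist x y"
            using S(2) False by (intro order_tendstoD(2)) auto
          then have "\<forall>\<^sub>F n in sequentially. indicator (- ball x (S n)) y *\<^sub>R ((v x - v y) * fker s (x - y))
              = - (v y * fker s (x - y))"
            by eventually_elim (simp add: vx)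
          then show ?thesis by (rule tendsto_eventually)
        qed (simp add: vx)
      qed
      show "AE y in lebesgue. norm (indicator (- ball x (S n)) y *\<^sub>R ((v x - v y) * fker s (x - y)))
          \<le> \<bar>v y * fker s (x - y)\<bar>" for n
        by (intro AE_I2) (simp add: vx indicator_def)
      show "(\<lambda>y. indicator (- ball x (S n)) y *\<^sub>R ((v x - v y) * fker s (x - y))) \<in> borel_measurable lebesgue" for n
        using int[of "S n"] unfolding set_integrable_def by (rule borel_measurable_integrable)
      show "(\<lambda>y. - (v y * fker s (x - y))) \<in> borel_measurable lebesgue"
        using i by simp
    qed
  qed simp
  ultimately show ?thesis
    unfolding has_frac_laplacian_iff by simp
qed

text \<open>Averaging over \<open>z\<close> and \<open>- z\<close> replaces first differences, which
  in general are not integrable against the kernel near 0, by second differences, which are of order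
  \<open>(norm z)^2\<close>. The principal value then becomes an absolutely convergent
  integral.\<close>

lemma has_frac_laplacian_second_difference:
  fixes W :: "real ^ 'n::finite \<Rightarrow> real"
  assumes s: "0 < s" "s < 1"
    and W[measurable]: "W \<in> borel_measurable borel" and K: "\<And>y. \<bar>W y\<bar> \<le> K"
    and C: "\<And>z. \<bar>2 * W x - W (x + z) - W (x - z)\<bar> \<le> C * min 1 ((norm z)^2)"
  shows "has_frac_laplacian s W x ((\<integral>z. (2 * W x - W (x + z) - W (x - z)) * fker s z \<partial>lborel) / 2)"
proof -
  define D where "D z = 2 * W x - W (x + z) - W (x - z)" for z
  have [measurable]: "D \<in> borel_measurable borel" unfolding D_def by measurable
  define f where "f \<rho> y = indicator (- ball x \<rho>) y * ((W x - W y) * fker s (x - y))" for \<rho> y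
  define h where "h \<rho> z = indicator {z. \<rho> \<le> norm z} z * ((W x - W (x + z)) * fker s z)" for \<rho> z
  have [measurable]: "f \<rho> \<in> borel_measurable borel" "h \<rho> \<in> borel_measurable borel" for \<rho>
    unfolding f_def h_def by measurable
  have fh: "f \<rho> (x + z) = h \<rho> z" for \<rho> z
    by (auto simp: f_def h_def indicator_def dist_norm)
  have K0: "0 \<le> K" using K[of 0] by linarith
  have ih: "integrable lborel (h \<rho>)" if "\<rho> > 0" for \<rho>
  proof (rule Bochner_Integration.integrable_bound)
    show "integrable lborel (\<lambda>z::real^'n. (2 * K) * (indicator {z. \<rho> \<le> norm z} z * fker s z))"
      by (intro integrable_mult_right integrable_fker_far s that)
    show "AE z in lborel. norm (h \<rho> z) \<le> norm ((2 * K) * (indicator {z. \<rho> \<le> norm z} z * fker s z))"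
    proof (rule AE_I2)
      fix z
      have "\<bar>W x - W (x + z)\<bar> \<le> 2 * K" using K[of x] K[of "x + z"] by linarith
      then show "norm (h \<rho> z) \<le> norm ((2 * K) * (indicator {z. \<rho> \<le> norm z} z * fker s z))"
        using K0 by (auto simp: h_def abs_mult indicator_def intro!: mult_right_mono)
    qed
  qed measurable
  have fi: "integrable lborel (f \<rho>)" and If: "(\<integral>y. f \<rho> y \<partial>lborel) = (\<integral>z. h \<rho> z \<partial>lborel)" if "\<rho> > 0" for \<rho>
    using lborel_integral_translate[of "f \<rho>" x] ih[OF that] by (simp_all add: fh)
  have Ih: "(\<integral>z. h \<rho> z \<partial>lborel) = (\<integral>z. indicator {z. \<rho> \<le> norm z} z * (D z * fker s z) \<partial>lborel) / 2" if "\<rho> > 0" for \<rho>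
  proof -
    have i': "integrable lborel (\<lambda>z. h \<rho> (- z))" and I': "(\<integral>z. h \<rho> (- z) \<partial>lborel) = (\<integral>z. h \<rho> z \<partial>lborel)"
      using lborel_integral_reflect[of "h \<rho>"] ih[OF that] by simp_all
    have "(\<integral>z. indicator {z. \<rho> \<le> norm z} z * (D z * fker s z) \<partial>lborel) = (\<integral>z. h \<rho> z + h \<rho> (- z) \<partial>lborel)"
      by (intro Bochner_Integration.integral_cong) (auto simp: h_def D_def indicator_def algebra_simps)
    also have "\<dots> = 2 * (\<integral>z. h \<rho> z \<partial>lborel)"
      using i' I' ih[OF that] by simp
    finally show ?thesis by simp
  qed
  have sf: "set_lebesgue_integral lebesgue (- ball x \<rho>) (\<lambda>y. (W x - W y) * fker s (x - y)) = (\<integral>y. f \<rho> y \<partial>lborel)" for \<rho>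
    unfolding set_lebesgue_integral_def f_def by (subst integral_completion) auto
  have lim: "((\<lambda>\<rho>. (\<integral>z. indicator {z. \<rho> \<le> norm z} z * (D z * fker s z) \<partial>lborel))
      \<longlongrightarrow> (\<integral>z. D z * fker s z \<partial>lborel)) (at_right 0)"
  proof (rule tendsto_at_right_sequentially[of _ 1])
    fix S :: "nat \<Rightarrow> real" assume S: "\<And>n. 0 < S n" "S \<longlonglongrightarrow> 0"
    show "(\<lambda>n. (\<integral>z. indicator {z. S n \<le> norm z} z * (D z * fker s z) \<partial>lborel)) \<longlonglongrightarrow> (\<integral>z. D z * fker s z \<partial>lborel)"
    proof (rule integral_dominated_convergence[where w="\<lambda>z. C * (min 1 ((norm z)^2) * fker s z)"])
      show "integrable lborel (\<lambda>z::real^'n. C * (min 1 ((norm z)^2) * fker s z))"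
        by (intro integrable_mult_right integrable_min_fker s)
      show "AE z in lborel. (\<lambda>n. indicator {z. S n \<le> norm z} z * (D z * fker s z)) \<longlonglongrightarrow> D z * fker s z"
      proof (rule AE_I2)
        fix z :: "real^'n"
        show "(\<lambda>n. indicator {z. S n \<le> norm z} z * (D z * fker s z)) \<longlonglongrightarrow> D z * fker s z"
        proof (cases "z = 0")
          case False
          have "\<forall>\<^sub>F n in sequentially. S n < norm z"
            using S(2) False by (intro order_tendstoD(2)) auto
          then have "\<forall>\<^sub>F n in sequentially. indicator {z. S n \<le> norm z} z * (D z * fker s z) = D z * fker s z"
            by eventually_elim auto
          then show ?thesis by (rule tendsto_eventually)
        qed (simp add: fker_def)
      qed
      show "AE z in lborel. norm (indicator {z. S n \<le> norm z} z * (D z * fker s z)) \<le> C * (min 1 ((norm z)^2) * fker s z)" for n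
      proof (rule AE_I2)
        fix z
        have "\<bar>D z\<bar> * fker s z \<le> C * min 1 ((norm z)^2) * fker s z"
          using C[of z] by (intro mult_right_mono) (auto simp: D_def)
        then show "norm (indicator {z. S n \<le> norm z} z * (D z * fker s z)) \<le> C * (min 1 ((norm z)^2) * fker s z)"
          by (auto simp: indicator_def abs_mult mult.assoc) (smt (verit) fker_nonneg mult_nonneg_nonneg abs_ge_zero)
      qed
    qed measurable
  qed simp
  have "set_integrable lebesgue (- ball x \<rho>) (\<lambda>y. (W x - W y) * fker s (x - y))" if "\<rho> > 0" for \<rho>
    using fi[OF that] unfolding set_integrable_def f_def by (subst integrable_completion) auto
  moreover have "((\<lambda>\<rho>. set_lebesgue_integral lebesgue (- ball x \<rho>) (\<lambda>y. (W x - W y) * fker s (x - y)))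
      \<longlongrightarrow> (\<integral>z. D z * fker s z \<partial>lborel) / 2) (at_right 0)"
  proof (rule Lim_transform_eventually[OF tendsto_divide[OF lim tendsto_const]])
    show "\<forall>\<^sub>F \<rho> in at_right 0. (\<integral>z. indicator {z. \<rho> \<le> norm z} z * (D z * fker s z) \<partial>lborel) / 2
       = set_lebesgue_integral lebesgue (- ball x \<rho>) (\<lambda>y. (W x - W y) * fker s (x - y))"
      using eventually_at_right_less[of "0::real"] by eventually_elim (simp add: sf If Ih)
  qed simp
  ultimately show ?thesis unfolding has_frac_laplacian_iff D_def by blast
qed

subsection \<open>The Fourier symbol\<close>

text \<open>A constant multiple of \<open>norm \<xi> powr (2 * s)\<close>. The constant is never
  computed: homogeneity, continuity and positivity suffice, so that rotation invariance does not
  have to be invoked.\<close>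

definition lam :: "real \<Rightarrow> real ^ 'n::finite \<Rightarrow> real" where
  "lam s \<xi> = (\<integral>z. (1 - cos (\<xi> \<bullet> z)) * fker s z \<partial>lborel)"

lemma one_minus_cos_le: "1 - cos (t::real) \<le> t^2 / 2"
proof -
  have "1 - cos t = 2 * (sin (t/2))^2"
    using cos_double_sin[of "t/2"] by simp
  also have "\<dots> \<le> 2 * (t/2)^2"
    using abs_le_square_iff[THEN iffD1, OF abs_sin_x_le_abs_x[of "t/2"]] by (intro mult_left_mono) simp_all
  finally show ?thesis by (simp add: power2_eq_square)
qed

lemma one_minus_cos_inner_le:
  "1 - cos (\<xi> \<bullet> z) \<le> (2 + (norm \<xi>)^2) * min 1 ((norm (z::'a::real_inner))^2)"
proof (cases "norm z \<le> 1")
  case True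
  then have "min 1 ((norm z)^2) = (norm z)^2" by (intro min_absorb2 power_le_one) auto
  moreover have "1 - cos (\<xi> \<bullet> z) \<le> (\<xi> \<bullet> z)^2 / 2" by (rule one_minus_cos_le)
  moreover have "(\<xi> \<bullet> z)^2 \<le> (norm \<xi> * norm z)^2"
    using Cauchy_Schwarz_ineq2[of \<xi> z] by (simp add: abs_le_square_iff[symmetric])
  moreover have "(norm \<xi> * norm z)^2 = (norm \<xi>)^2 * (norm z)^2" by (simp add: power_mult_distrib)
  ultimately show ?thesis
    by (simp add: algebra_simps) (smt (verit) zero_le_power2 mult_nonneg_nonneg)
next
  case False
  then have "min 1 ((norm z)^2) = 1" by (intro min_absorb1 one_le_power) auto
  moreover have "1 - cos (\<xi> \<bullet> z) \<le> 2" using cos_ge_minus_one[of "\<xi> \<bullet> z"] by linarith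
  ultimately show ?thesis by (simp add: add_increasing2)
qed

lemma lam_integrable:
  assumes "0 < s" "s < 1"
  shows "integrable lborel (\<lambda>z :: real ^ 'n::finite. (1 - cos (\<xi> \<bullet> z)) * fker s z)"
proof (rule Bochner_Integration.integrable_bound)
  show "integrable lborel (\<lambda>z::real^'n. (2 + (norm \<xi>)^2) * (min 1 ((norm z)^2) * fker s z))"
    by (intro integrable_mult_right integrable_min_fker assms)
  show "AE z in lborel. norm ((1 - cos (\<xi> \<bullet> z)) * fker s z) \<le> norm ((2 + (norm \<xi>)^2) * (min 1 ((norm z)^2) * fker s z))"
  proof (rule AE_I2)
    fix z
    show "norm ((1 - cos (\<xi> \<bullet> z)) * fker s z) \<le> norm ((2 + (norm \<xi>)^2) * (min 1 ((norm z)^2) * fker s z))"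
      using mult_right_mono[OF one_minus_cos_inner_le[of \<xi> z], of "fker s z"] by (simp add: abs_mult mult.assoc)
  qed
qed measurable

lemma lam_nonneg: "0 \<le> lam s \<xi>"
  unfolding lam_def by (intro Bochner_Integration.integral_nonneg) simp

lemma lam_0 [simp]: "lam s 0 = 0"
  by (simp add: lam_def)

lemma lam_le:
  fixes \<xi> :: "real ^ 'n::finite"
  assumes "0 < s" "s < 1"
  shows "lam s \<xi> \<le> (2 + (norm \<xi>)^2) * (\<integral>z. min 1 ((norm (z :: real^'n))^2) * fker s z \<partial>lborel)"
proof -
  have "lam s \<xi> \<le> (\<integral>z. (2 + (norm \<xi>)^2) * (min 1 ((norm (z :: real^'n))^2) * fker s z) \<partial>lborel)"
    unfolding lam_def
  proof (rule integral_mono)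
    show "integrable lborel (\<lambda>z::real^'n. (2 + (norm \<xi>)^2) * (min 1 ((norm z)^2) * fker s z))"
      by (intro integrable_mult_right integrable_min_fker assms)
    show "(1 - cos (\<xi> \<bullet> z)) * fker s z \<le> (2 + (norm \<xi>)^2) * (min 1 ((norm z)^2) * fker s z)" for z
      using mult_right_mono[OF one_minus_cos_inner_le[of \<xi> z], of "fker s z"] by (simp add: mult.assoc)
  qed (rule lam_integrable[OF assms])
  then show ?thesis by simp
qed

lemma integral_pos_isCont:
  fixes f :: "'a::euclidean_space \<Rightarrow> real"
  assumes i: "integrable lborel f" and nn: "\<And>z. 0 \<le> f z" and p: "0 < f p" "isCont f p"
  shows "0 < (\<integral>z. f z \<partial>lborel)"
proof -
  have "\<forall>\<^sub>F z in at p. f p / 2 < f z"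
    using p by (intro order_tendstoD(1)[of f "f p"]) (auto simp: isCont_def)
  then obtain d where d: "d > 0" "\<And>z. z \<noteq> p \<Longrightarrow> dist z p < d \<Longrightarrow> f p / 2 < f z"
    by (auto simp: eventually_at)
  have ge: "f p / 2 \<le> f z" if "z \<in> ball p d" for z
    using d(2)[of z] that p by (cases "z = p") (auto simp: dist_commute)
  have "0 < (f p / 2) * measure lborel (ball p d)"
    using content_ball_pos[OF d(1)] p by simp
  also have "\<dots> = (\<integral>z. indicator (ball p d) z * (f p / 2) \<partial>lborel)"
    by (subst Bochner_Integration.integral_mult_left_zero) simp
  also have "\<dots> \<le> (\<integral>z. f z \<partial>lborel)"
  proof (rule integral_mono[OF _ i])
    show "integrable lborel (\<lambda>z. indicator (ball p d) z * (f p / 2))"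
      using emeasure_lborel_ball_finite[of p d]
      by (intro integrable_mult_left integrable_real_indicator) (auto simp: less_top)
    show "indicator (ball p d) z * (f p / 2) \<le> f z" for z
      using ge[of z] nn[of z] by (cases "z \<in> ball p d") auto
  qed
  finally show ?thesis .
qed

lemma isCont_fker:
  assumes "z \<noteq> 0"
  shows "isCont (fker s) (z :: real ^ 'n::finite)"
  unfolding fker_def using assms by (intro continuous_intros) auto

lemma lam_pos:
  fixes \<xi> :: "real ^ 'n::finite"
  assumes s: "0 < s" "s < 1" and "\<xi> \<noteq> 0"
  shows "0 < lam s \<xi>"
  unfolding lam_def
proof (rule integral_pos_isCont[OF lam_integrable[OF s]])
  \<comment> \<open>The multiple of \<open>\<xi>\<close> with \<open>\<xi> \<bullet> p = pi\<close>,
    where \<open>1 - cos\<close> takes its maximum 2.\<close>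
  define p where "p = (pi / (\<xi> \<bullet> \<xi>)) *\<^sub>R \<xi>"
  have "\<xi> \<bullet> \<xi> \<noteq> 0" using assms by simp
  then have \<xi>p: "\<xi> \<bullet> p = pi" "p \<noteq> 0" using assms(3) by (auto simp: p_def)
  show "0 < (1 - cos (\<xi> \<bullet> p)) * fker s p"
    using \<xi>p by (simp add: fker_def)
  show "isCont (\<lambda>z. (1 - cos (\<xi> \<bullet> z)) * fker s z) p"
    using isCont_fker[OF \<xi>p(2)] by (intro continuous_intros) auto
qed simp

lemma continuous_lam:
  assumes s: "0 < s" "s < 1"
  shows "continuous_on UNIV (lam s :: real ^ 'n::finite \<Rightarrow> real)"
  unfolding continuous_on_sequentially
proof (intro ballI allI impI, elim conjE)
  fix X :: "nat \<Rightarrow> real ^ 'n" and \<xi> assume X: "X \<longlonglongrightarrow> \<xi>"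
  then have "Bseq X" using convergentI convergent_imp_Bseq by blast
  then obtain B where B: "\<And>n. norm (X n) \<le> B" by (auto simp: Bseq_def)
  show "(lam s \<circ> X) \<longlonglongrightarrow> lam s \<xi>"
    unfolding lam_def comp_def
  proof (rule integral_dominated_convergence[where w="\<lambda>z. (2 + B^2) * (min 1 ((norm z)^2) * fker s z)"])
    show "integrable lborel (\<lambda>z::real^'n. (2 + B^2) * (min 1 ((norm z)^2) * fker s z))"
      by (intro integrable_mult_right integrable_min_fker s)
    show "AE z in lborel. (\<lambda>n. (1 - cos (X n \<bullet> z)) * fker s z) \<longlonglongrightarrow> (1 - cos (\<xi> \<bullet> z)) * fker s z"
      by (intro AE_I2 tendsto_intros X)
    show "AE z in lborel. norm ((1 - cos (X n \<bullet> z)) * fker s z) \<le> (2 + B^2) * (min 1 ((norm z)^2) * fker s z)" for n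
    proof (rule AE_I2)
      fix z :: "real^'n"
      have "(2 + (norm (X n))^2) * min 1 ((norm z)^2) \<le> (2 + B^2) * min 1 ((norm z)^2)"
        using B[of n] by (intro mult_right_mono add_left_mono power_mono) auto
      then have "1 - cos (X n \<bullet> z) \<le> (2 + B^2) * min 1 ((norm z)^2)"
        using one_minus_cos_inner_le[of "X n" z] by linarith
      then show "norm ((1 - cos (X n \<bullet> z)) * fker s z) \<le> (2 + B^2) * (min 1 ((norm z)^2) * fker s z)"
        using mult_right_mono[of _ _ "fker s z"] by (simp add: abs_mult mult.assoc[symmetric])
    qed
  qed measurable
qed

lemma lam_scaleR:
  assumes "0 < t"
  shows "lam s (t *\<^sub>R (\<xi> :: real ^ 'n::finite)) = t powr (2 * s) * lam s \<xi>"
  using fker_integral_scale[of "\<lambda>z. 1 - cos (\<xi> \<bullet> z)" t s] assms by (simp add: lam_def)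

text \<open>A minimum over the unit sphere is carried outward by homogeneity. The radius 1/2 is the
  smallest size of the frequencies in the monomial series.\<close>

lemma lam_lower_bound:
  assumes s: "0 < s" "s < 1"
  shows "\<exists>c>0. \<forall>\<xi> :: real ^ 'n::finite. 1/2 \<le> norm \<xi> \<longrightarrow> c \<le> lam s \<xi>"
proof -
  have "compact (sphere 0 1 :: (real^'n) set)" "sphere 0 1 \<noteq> ({} :: (real^'n) set)"
    by (auto simp: sphere_eq_empty)
  from continuous_attains_inf[OF this continuous_on_subset[OF continuous_lam[OF s] subset_UNIV]]
  obtain w :: "real^'n" where "w \<in> sphere 0 1" "\<forall>v\<in>sphere 0 1. lam s w \<le> lam s (v :: real^'n)"
    by blast
  then have w: "norm w = 1" "\<And>v :: real^'n. norm v = 1 \<Longrightarrow> lam s w \<le> lam s v" by auto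
  have c: "lam s w > 0" using lam_pos[OF s, of w] w(1) by fastforce
  have "(1/2) powr (2 * s) * lam s w \<le> lam s \<xi>" if "1/2 \<le> norm \<xi>" for \<xi> :: "real^'n"
  proof -
    have pos: "norm \<xi> > 0" using that by linarith
    have "(1/2) powr (2 * s) * lam s w \<le> norm \<xi> powr (2 * s) * lam s (sgn \<xi>)"
      using that s w(2)[of "sgn \<xi>"] c pos
      by (intro mult_mono powr_mono2) (auto simp: norm_sgn)
    also have "\<dots> = lam s (norm \<xi> *\<^sub>R sgn \<xi>)" using lam_scaleR[OF pos, of s "sgn \<xi>"] by simp
    also have "norm \<xi> *\<^sub>R sgn \<xi> = \<xi>" using pos by (simp add: sgn_div_norm)
    finally show ?thesis .
  qed
  then show ?thesis using c by (intro exI[of _ "(1/2) powr (2 * s) * lam s w"]) auto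
qed

subsection \<open>Half-space indicators\<close>

definition hsc :: "real \<Rightarrow> real ^ 'n::finite \<Rightarrow> real" where
  "hsc s \<kappa> = (\<integral>z. indicator {z. 1 < \<kappa> \<bullet> z} z * fker s z \<partial>lborel)"

lemma half_space_integrable:
  fixes x \<kappa> :: "real ^ 'n::finite"
  assumes s: "0 < s" "s < 1" and \<kappa>: "\<kappa> \<bullet> x < b"
  shows "integrable lborel (\<lambda>y. indicator {y. b < \<kappa> \<bullet> y} y * fker s (x - y))"
proof -
  have *: "integrable lborel (\<lambda>z. indicator {z. b - \<kappa> \<bullet> x < \<kappa> \<bullet> z} z * fker s z)"
  proof (cases "\<kappa> = 0")
    case False
    define \<rho> where "\<rho> = (b - \<kappa> \<bullet> x) / norm \<kappa>"
    have \<rho>: "\<rho> > 0" using \<kappa> False by (simp add: \<rho>_def)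
    show ?thesis
    proof (rule Bochner_Integration.integrable_bound[OF integrable_fker_far[OF s \<rho>]])
      show "AE z in lborel. norm (indicator {z. b - \<kappa> \<bullet> x < \<kappa> \<bullet> z} z * fker s z)
         \<le> norm (indicator {z. \<rho> \<le> norm z} z * fker s z)"
      proof (rule AE_I2)
        fix z
        have "\<rho> \<le> norm z" if "b - \<kappa> \<bullet> x < \<kappa> \<bullet> z"
        proof -
          have "b - \<kappa> \<bullet> x \<le> norm \<kappa> * norm z" using that norm_cauchy_schwarz[of \<kappa> z] by linarith
          then show ?thesis using False by (simp add: \<rho>_def field_simps)
        qed
        then show "norm (indicator {z. b - \<kappa> \<bullet> x < \<kappa> \<bullet> z} z * fker s z)
         \<le> norm (indicator {z. \<rho> \<le> norm z} z * fker s z)" by (auto simp: indicator_def)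
      qed
    qed measurable
  qed (use \<kappa> in simp)
  have "integrable lborel (\<lambda>z. (\<lambda>y. indicator {y. b < \<kappa> \<bullet> y} y * fker s (x - y)) (x + z))"
    using * by (simp add: indicator_def inner_add_right algebra_simps)
  then show ?thesis
    by (subst (asm) lborel_integral_translate(2)) measurable
qed

text \<open>Translating by \<open>x\<close> and scaling by the gap
  \<open>b - \<kappa> \<bullet> x\<close> reduces every such half-space to the reference one in
  \<open>hsc\<close>. The potential is thus an explicit function of
  \<open>\<kappa> \<bullet> x\<close> alone, with a binomial Taylor series.\<close>

lemma half_space_integral:
  fixes x \<kappa> :: "real ^ 'n::finite"
  assumes \<kappa>: "\<kappa> \<bullet> x < b"
  shows "(\<integral>y. indicator {y. b < \<kappa> \<bullet> y} y * fker s (x - y) \<partial>lborel) = (b - \<kappa> \<bullet> x) powr (- 2 * s) * hsc s \<kappa>"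
proof -
  define \<beta> where "\<beta> = b - \<kappa> \<bullet> x"
  have \<beta>: "\<beta> > 0" using \<kappa> by (simp add: \<beta>_def)
  have "(\<integral>y. indicator {y. b < \<kappa> \<bullet> y} y * fker s (x - y) \<partial>lborel)
     = (\<integral>z. indicator {y. b < \<kappa> \<bullet> y} (x + z) * fker s (x - (x + z)) \<partial>lborel)"
    by (subst lborel_integral_translate(1)[of "\<lambda>y. indicator {y. b < \<kappa> \<bullet> y} y * fker s (x - y)"]) auto
  also have "\<dots> = (\<integral>z. indicator {z. 1 < \<kappa> \<bullet> z} ((1/\<beta>) *\<^sub>R z) * fker s z \<partial>lborel)"
    using \<beta> by (intro Bochner_Integration.integral_cong)
       (auto simp: indicator_def inner_add_right field_simps \<beta>_def)
  also have "\<dots> = (1/\<beta>) powr (2 * s) * hsc s \<kappa>"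
    unfolding hsc_def using \<beta> by (intro fker_integral_scale) auto
  also have "(1/\<beta>) powr (2 * s) = \<beta> powr (- 2 * s)"
    using \<beta> by (simp add: powr_divide powr_minus_divide)
  finally show ?thesis by (simp add: \<beta>_def)
qed

lemma hsc_pos:
  fixes \<kappa> :: "real ^ 'n::finite"
  assumes s: "0 < s" "s < 1" and "\<kappa> \<noteq> 0"
  shows "0 < hsc s \<kappa>"
proof -
  have int: "integrable lborel (\<lambda>z. indicator {z. 1 < \<kappa> \<bullet> z} z * fker s z)"
    using half_space_integrable[OF s, of \<kappa> 0 1] by simp
  define p where "p = (2 / (\<kappa> \<bullet> \<kappa>)) *\<^sub>R \<kappa>"
  have "\<kappa> \<bullet> \<kappa> \<noteq> 0" using assms by simp
  then have p: "\<kappa> \<bullet> p = 2" "p \<noteq> 0" using assms(3) by (auto simp: p_def)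
  show ?thesis unfolding hsc_def
  proof (rule integral_pos_isCont[OF int])
    show "0 < indicator {z. 1 < \<kappa> \<bullet> z} p * fker s p"
      using p by (simp add: fker_def)
    have "open {z. 1 < \<kappa> \<bullet> z}" by (intro open_Collect_less continuous_intros)
    then have "\<forall>\<^sub>F z in nhds p. z \<in> {z. 1 < \<kappa> \<bullet> z}"
      using p by (intro eventually_nhds_in_open) auto
    then have ev: "\<forall>\<^sub>F z in nhds p. fker s z = indicator {z. 1 < \<kappa> \<bullet> z} z * fker s z"
      by eventually_elim simp
    then show "isCont (\<lambda>z. indicator {z. 1 < \<kappa> \<bullet> z} z * fker s z) p"
      using isCont_fker[OF p(2)] isCont_cong[OF ev] by simp
  qed simp
qed

subsection \<open>Calculus of functions of class $C^m$\<close>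

lemma iter_partial_append: "iter_partial (ds @ es) f = iter_partial ds (iter_partial es f)"
  by (induction ds) simp_all

text \<open>Differentiability is not assumed: \<open>frechet_derivative\<close> chooses from the set
  of all derivatives, and this set is the same for both functions.\<close>

lemma frechet_derivative_cong_open:
  assumes "open U" "x \<in> U" "\<And>y. y \<in> U \<Longrightarrow> f y = g y"
  shows "frechet_derivative f (at x) = frechet_derivative g (at x)"
proof -
  have "(f has_derivative D) (at x) \<longleftrightarrow> (g has_derivative D) (at x)" for D
    using has_derivative_transform_within_open[of f D x UNIV U g]
      has_derivative_transform_within_open[of g D x UNIV U f] assms by auto
  then show ?thesis unfolding frechet_derivative_def by simp
qed

lemma iter_partial_cong:
  assumes "open U" "\<And>y. y \<in> U \<Longrightarrow> f y = g y" "x \<in> U"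
  shows "iter_partial ds f x = iter_partial ds g x"
  using assms(3)
proof (induction ds arbitrary: x)
  case (Cons i ds)
  then show ?case
    using frechet_derivative_cong_open[OF assms(1) Cons.prems, of "iter_partial ds f" "iter_partial ds g"]
    by simp
qed (use assms in simp)

lemma differentiable_cong_open:
  assumes "open U" "x \<in> U" "\<And>y. y \<in> U \<Longrightarrow> f y = g y" "f differentiable (at x)"
  shows "g differentiable (at x)"
  using assms has_derivative_transform_within_open[of f _ x UNIV U g]
  unfolding differentiable_def by blast

lemma C_on_cong:
  assumes "open U" "\<And>y. y \<in> U \<Longrightarrow> f y = g y" "C_on m U f"
  shows "C_on m U g"
proof -
  have eq: "iter_partial ds f y = iter_partial ds g y" if "y \<in> U" for ds y
    using iter_partial_cong[OF assms(1,2) that] by simp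
  show ?thesis
    using assms(3) unfolding C_on_def
    by (auto intro: differentiable_cong_open[OF assms(1) _ eq] cong: continuous_on_cong simp: eq
        dest: continuous_on_cong[OF refl eq, THEN iffD1])
qed

lemma C_on_0: "C_on 0 U f \<longleftrightarrow> continuous_on U f"
  by (simp add: C_on_def)

lemma C_on_mono: "C_on m U f \<Longrightarrow> m' \<le> m \<Longrightarrow> C_on m' U f"
  by (auto simp: C_on_def)

lemma C_on_subset: "C_on m U f \<Longrightarrow> V \<subseteq> U \<Longrightarrow> C_on m V f"
  unfolding C_on_def by (meson continuous_on_subset subsetD)

lemma C_on_imp_continuous_on: "C_on m U f \<Longrightarrow> continuous_on U f"
  using C_on_mono[of m U f 0] by (simp add: C_on_0)

text \<open>\<open>iter_partial\<close> recurses on the outermost derivative, whereas this splits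
  off the innermost one, the last entry of the list. Only then do inductions over the order apply
  the hypothesis to a partial derivative of the original function.\<close>

lemma C_on_Suc:
  assumes "open U"
  shows "C_on (Suc m) U f \<longleftrightarrow>
    (\<forall>x\<in>U. f differentiable (at x)) \<and> (\<forall>i. C_on m U (iter_partial [i] f))"
proof (intro iffI conjI allI)
  assume C: "C_on (Suc m) U f"
  from C show "\<forall>x\<in>U. f differentiable (at x)"
    unfolding C_on_def by (metis iter_partial.simps(1) list.size(3) zero_less_Suc)
  fix i
  have "iter_partial ds (iter_partial [i] f) = iter_partial (ds @ [i]) f" for ds
    by (simp only: iter_partial_append)
  moreover have "length (ds @ [i]) = Suc (length ds)" for ds by simp
  ultimately show "C_on m U (iter_partial [i] f)"
    using C unfolding C_on_def by (metis Suc_le_mono Suc_less_eq)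
next
  assume R: "(\<forall>x\<in>U. f differentiable (at x)) \<and> (\<forall>i. C_on m U (iter_partial [i] f))"
  have d: "iter_partial ds f differentiable (at x)" if "length ds < Suc m" "x \<in> U" for ds x
    using that
  proof (cases ds rule: rev_exhaust)
    case (snoc es i)
    then show ?thesis using R that unfolding C_on_def snoc iter_partial_append by auto
  qed (use R in simp)
  have "continuous_on U (iter_partial ds f)" if "length ds \<le> Suc m" for ds
  proof (cases ds rule: rev_exhaust)
    case Nil
    have "continuous_on U f"
      using R differentiable_imp_continuous_within[of f _ UNIV] assms
      by (auto simp: continuous_on_eq_continuous_at)
    then show ?thesis using Nil by simp
  next
    case (snoc es i)
    then show ?thesis using R that unfolding C_on_def snoc iter_partial_append by auto
  qed
  then show "C_on (Suc m) U f" using d unfolding C_on_def by auto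
qed

lemma iter_partial_1: "iter_partial [i] f = (\<lambda>x. frechet_derivative f (at x) (axis i 1))"
  by simp

text \<open>Membership and formula are proved together, by splitting off the innermost derivative.
  Since the first-order identity is known only on \<open>U\<close>, it is substituted under further
  derivatives by locality on open sets.\<close>

lemma C_on_lincomb_aux:
  assumes U: "open U" and "C_on m U f" "C_on m U g"
  shows "C_on m U (\<lambda>x. a * f x + b * g x) \<and>
    (\<forall>ds. length ds \<le> m \<longrightarrow> (\<forall>x\<in>U. iter_partial ds (\<lambda>x. a * f x + b * g x) x
       = a * iter_partial ds f x + b * iter_partial ds g x))"
  using assms(2,3)
proof (induction m arbitrary: f g)
  case 0
  then show ?case by (auto simp: C_on_0 intro!: continuous_intros)
next
  case (Suc m)
  let ?h = "\<lambda>x. a * f x + b * g x"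
  have df: "f differentiable (at x)" "g differentiable (at x)" if "x \<in> U" for x
    using Suc.prems that by (auto simp: C_on_Suc[OF U])
  have D: "(?h has_derivative (\<lambda>v. a * frechet_derivative f (at x) v + b * frechet_derivative g (at x) v)) (at x)"
    if "x \<in> U" for x
    using df[OF that, unfolded frechet_derivative_works] by (auto intro!: derivative_eq_intros)
  have p: "iter_partial [i] ?h x = a * iter_partial [i] f x + b * iter_partial [i] g x" if "x \<in> U" for i x
    unfolding iter_partial_1 frechet_derivative_at[OF D[OF that], symmetric] ..
  have C: "C_on m U (iter_partial [i] f)" "C_on m U (iter_partial [i] g)" for i
    using Suc.prems by (auto simp: C_on_Suc[OF U])
  note IH = Suc.IH[OF C]
  have 1: "C_on m U (iter_partial [i] ?h)" for i
    by (rule C_on_cong[OF U p[symmetric]]) (use IH in auto)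
  have "iter_partial ds ?h x = a * iter_partial ds f x + b * iter_partial ds g x"
    if "length ds \<le> Suc m" "x \<in> U" for ds x
  proof (cases ds rule: rev_exhaust)
    case (snoc es i)
    have "iter_partial es (iter_partial [i] ?h) x
        = iter_partial es (\<lambda>x. a * iter_partial [i] f x + b * iter_partial [i] g x) x"
      by (rule iter_partial_cong[OF U p that(2)])
    then show ?thesis using IH that unfolding snoc iter_partial_append by auto
  qed simp
  moreover have "C_on (Suc m) U ?h"
    unfolding C_on_Suc[OF U] using 1 D by (auto simp: differentiable_def)
  ultimately show ?case by blast
qed

lemmas C_on_lincomb = C_on_lincomb_aux[THEN conjunct1]

lemma iter_partial_lincomb:
  assumes "open U" "C_on m U f" "C_on m U g" "length ds \<le> m" "x \<in> U"
  shows "iter_partial ds (\<lambda>x. a * f x + b * g x) x = a * iter_partial ds f x + b * iter_partial ds g x"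
  using C_on_lincomb_aux[OF assms(1-3)] assms(4,5) by blast

lemma C_on_add: "open U \<Longrightarrow> C_on m U f \<Longrightarrow> C_on m U g \<Longrightarrow> C_on m U (\<lambda>x. f x + g x)"
  using C_on_lincomb[of U m f g 1 1] by simp

lemma C_on_diff: "open U \<Longrightarrow> C_on m U f \<Longrightarrow> C_on m U g \<Longrightarrow> C_on m U (\<lambda>x. f x - g x)"
  using C_on_lincomb[of U m f g 1 "-1"] by simp

lemma C_on_cmult: "open U \<Longrightarrow> C_on m U f \<Longrightarrow> C_on m U (\<lambda>x. c * f x)"
  using C_on_lincomb[of U m f f c 0] by simp

lemma iter_partial_add:
  "open U \<Longrightarrow> C_on m U f \<Longrightarrow> C_on m U g \<Longrightarrow> length ds \<le> m \<Longrightarrow> x \<in> U \<Longrightarrow>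
    iter_partial ds (\<lambda>x. f x + g x) x = iter_partial ds f x + iter_partial ds g x"
  using iter_partial_lincomb[of U m f g ds x 1 1] by simp

lemma iter_partial_diff:
  "open U \<Longrightarrow> C_on m U f \<Longrightarrow> C_on m U g \<Longrightarrow> length ds \<le> m \<Longrightarrow> x \<in> U \<Longrightarrow>
    iter_partial ds (\<lambda>x. f x - g x) x = iter_partial ds f x - iter_partial ds g x"
  using iter_partial_lincomb[of U m f g ds x 1 "-1"] by simp

lemma C_on_const: "C_on m U (\<lambda>_ :: real ^ 'n::finite. c)"
proof -
  have "\<exists>d. iter_partial ds (\<lambda>_ :: real ^ 'n. c) = (\<lambda>_. d)" for ds
    by (induction ds) auto
  then have "iter_partial ds (\<lambda>_ :: real ^ 'n. c) differentiable (at x)"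
    "continuous_on U (iter_partial ds (\<lambda>_ :: real ^ 'n. c))" for ds x
    by (metis differentiable_const, metis continuous_on_const)
  then show ?thesis by (simp add: C_on_def)
qed

lemma C_on_sum:
  assumes "open U" "\<And>i. i \<in> I \<Longrightarrow> C_on m U (f i)"
  shows "C_on m U (\<lambda>x. \<Sum>i\<in>I. f i x)"
  using assms(2)
  by (induction I rule: infinite_finite_induct) (auto intro!: C_on_const C_on_add assms(1))

lemma C_on_mult:
  assumes U: "open U" and "C_on m U f" "C_on m U g"
  shows "C_on m U (\<lambda>x. f x * g x)"
  using assms(2,3)
proof (induction m arbitrary: f g)
  case 0
  then show ?case by (auto simp: C_on_0 intro!: continuous_intros)
next
  case (Suc m)
  have df: "f differentiable (at x)" "g differentiable (at x)" if "x \<in> U" for x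
    using Suc.prems that by (auto simp: C_on_Suc[OF U])
  have D: "((\<lambda>x. f x * g x) has_derivative (\<lambda>v. f x * frechet_derivative g (at x) v + frechet_derivative f (at x) v * g x)) (at x)"
    if "x \<in> U" for x
    using df[OF that, unfolded frechet_derivative_works] by (auto intro!: derivative_eq_intros)
  have p: "iter_partial [i] (\<lambda>x. f x * g x) x = f x * iter_partial [i] g x + iter_partial [i] f x * g x" if "x \<in> U" for i x
    unfolding iter_partial_1 frechet_derivative_at[OF D[OF that], symmetric] ..
  have C: "C_on m U (iter_partial [i] f)" "C_on m U (iter_partial [i] g)" "C_on m U f" "C_on m U g" for i
    using Suc.prems C_on_mono[of "Suc m" U _ m] by (auto simp: C_on_Suc[OF U])
  have "C_on m U (iter_partial [i] (\<lambda>x. f x * g x))" for i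
    by (rule C_on_cong[OF U p[symmetric]]) (auto intro!: C_on_add U Suc.IH C simp del: iter_partial.simps)
  then show ?case
    unfolding C_on_Suc[OF U] using D by (auto simp: differentiable_def)
qed

lemma C_on_component: "C_on m U (\<lambda>x :: real ^ 'n::finite. x $ i)"
proof -
  have D: "((\<lambda>x :: real ^ 'n. x $ i) has_derivative (\<lambda>v. v $ i)) (at x)" for x
    by (rule bounded_linear_imp_has_derivative[OF bounded_linear_vec_nth])
  have p: "iter_partial [j] (\<lambda>x :: real ^ 'n. x $ i) = (\<lambda>_. axis j 1 $ i)" for j
    unfolding iter_partial_1 frechet_derivative_at[OF D, symmetric] ..
  have "C_on m UNIV (\<lambda>x :: real ^ 'n. x $ i)"
  proof (cases m)
    case 0
    then show ?thesis by (auto simp: C_on_0 intro!: continuous_intros)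
  next
    case (Suc m')
    then show ?thesis using D by (auto simp: C_on_Suc p C_on_const differentiable_def simp del: iter_partial.simps)
  qed
  then show ?thesis by (rule C_on_subset) simp
qed

lemma has_real_derivative_max_power:
  assumes "2 \<le> j"
  shows "((\<lambda>t::real. (max 0 t) ^ j) has_real_derivative real j * (max 0 t) ^ (j - 1)) (at t)"
proof -
  consider "t > 0" | "t < 0" | "t = 0" by linarith
  then show ?thesis
  proof cases
    case 1
    have "((\<lambda>t::real. t ^ j) has_real_derivative real j * t ^ (j - 1)) (at t)"
      by (auto intro!: derivative_eq_intros)
    then have "((\<lambda>t::real. (max 0 t) ^ j) has_real_derivative real j * t ^ (j - 1)) (at t)"
      by (rule has_field_derivative_transform_within_open[where S="{0<..}"]) (use 1 in auto)
    then show ?thesis using 1 by simp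
  next
    case 2
    have "((\<lambda>t::real. 0) has_real_derivative 0) (at t)" by simp
    then have "((\<lambda>t::real. (max 0 t) ^ j) has_real_derivative 0) (at t)"
      by (rule has_field_derivative_transform_within_open[where S="{..<0}"]) (use 2 assms in \<open>auto simp: max_def\<close>)
    then show ?thesis using 2 assms by (simp add: power_0_left)
  next
    case 3
    have "((\<lambda>y::real. (max 0 y) ^ j / y) \<longlongrightarrow> 0) (at 0)"
    proof (rule Lim_null_comparison[where g="\<lambda>y. \<bar>y\<bar> ^ (j - 1)"])
      show "\<forall>\<^sub>F y in at 0. norm ((max 0 y) ^ j / y) \<le> \<bar>y\<bar> ^ (j - 1)"
      proof (rule always_eventually, intro allI)
        fix y :: real
        obtain k where k: "j = Suc k" using assms by (cases j) auto
        show "norm ((max 0 y) ^ j / y) \<le> \<bar>y\<bar> ^ (j - 1)"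
          by (cases "y > 0") (auto simp: k max_def)
      qed
      show "((\<lambda>y::real. \<bar>y\<bar> ^ (j - 1)) \<longlongrightarrow> 0) (at 0)"
        using assms tendsto_power[OF tendsto_rabs[OF tendsto_ident_at[of "0::real" UNIV]], of "j - 1"]
        by (simp add: power_0_left)
    qed
    then show ?thesis using 3 assms by (simp add: has_field_derivative_iff power_0_left)
  qed
qed

text \<open>Only finitely many derivatives ever matter, so truncated powers take the place of smooth
  bump functions in the cutoff.\<close>

lemma C_on_max_power:
  assumes U: "open U" and "C_on m U f" "m < j"
  shows "C_on m U (\<lambda>x. (max 0 (f x)) ^ j)"
  using assms(2,3)
proof (induction m arbitrary: j)
  case 0
  then show ?case by (auto simp: C_on_0 intro!: continuous_intros)
next
  case (Suc m)
  have D: "((\<lambda>x. (max 0 (f x)) ^ j) has_derivative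
      (\<lambda>v. real j * (max 0 (f x)) ^ (j - 1) * frechet_derivative f (at x) v)) (at x)" if "x \<in> U" for x
  proof -
    have "(f has_derivative frechet_derivative f (at x)) (at x)"
      using Suc.prems that by (auto simp: C_on_Suc[OF U] frechet_derivative_works)
    from has_derivative_compose[OF this has_real_derivative_max_power[of j "f x", unfolded has_field_derivative_def]]
    show ?thesis using Suc.prems by simp
  qed
  have p: "iter_partial [i] (\<lambda>x. (max 0 (f x)) ^ j) x = real j * (max 0 (f x)) ^ (j - 1) * iter_partial [i] f x"
    if "x \<in> U" for i x
    unfolding iter_partial_1 frechet_derivative_at[OF D[OF that], symmetric] ..
  have "C_on m U (\<lambda>x. (max 0 (f x)) ^ (j - 1))"
    using Suc.prems by (intro Suc.IH) (auto intro: C_on_mono)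
  then have "C_on m U (iter_partial [i] (\<lambda>x. (max 0 (f x)) ^ j))" for i
    using Suc.prems by (intro C_on_cong[OF U p[symmetric]] C_on_mult C_on_cmult U) (auto simp: C_on_Suc[OF U])
  then show ?case
    unfolding C_on_Suc[OF U] using D by (auto simp: differentiable_def)
qed

lemma C_on_dilation:
  fixes r :: real and f :: "real ^ 'n::finite \<Rightarrow> real"
  assumes U: "open U" and "C_on m U f"
  defines "V \<equiv> {x. r *\<^sub>R x \<in> U}"
  shows "C_on m V (\<lambda>x. f (r *\<^sub>R x)) \<and>
    (\<forall>ds. length ds \<le> m \<longrightarrow> (\<forall>x\<in>V. iter_partial ds (\<lambda>x. f (r *\<^sub>R x)) x = r ^ length ds * iter_partial ds f (r *\<^sub>R x)))"
proof -
  have V: "open V" unfolding V_def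
    using continuous_open_vimage[OF U, of "\<lambda>x. r *\<^sub>R x"] by (auto simp: vimage_def intro!: continuous_intros)
  show ?thesis using assms(2)
  proof (induction m arbitrary: f)
    case 0
    then show ?case
      by (auto simp: C_on_0 V_def intro!: continuous_on_compose2[of U f] continuous_intros)
  next
    case (Suc m)
    have D: "((\<lambda>x. f (r *\<^sub>R x)) has_derivative (\<lambda>v. frechet_derivative f (at (r *\<^sub>R x)) (r *\<^sub>R v))) (at x)"
      if "x \<in> V" for x
    proof -
      have "(f has_derivative frechet_derivative f (at (r *\<^sub>R x))) (at (r *\<^sub>R x))"
        using Suc.prems that by (auto simp: C_on_Suc[OF U] frechet_derivative_works V_def)
      moreover have "((\<lambda>x. r *\<^sub>R x) has_derivative (\<lambda>v. r *\<^sub>R v)) (at x)" by (auto intro!: derivative_eq_intros)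
      ultimately show ?thesis using has_derivative_compose by blast
    qed
    have p: "iter_partial [i] (\<lambda>x. f (r *\<^sub>R x)) x = r * iter_partial [i] f (r *\<^sub>R x)" if "x \<in> V" for i x
    proof -
      have "linear (frechet_derivative f (at (r *\<^sub>R x)))"
        using Suc.prems that by (auto simp: C_on_Suc[OF U] V_def intro!: linear_frechet_derivative)
      then show ?thesis
        unfolding iter_partial_1 frechet_derivative_at[OF D[OF that], symmetric]
        by (simp add: linear_scale)
    qed
    have "C_on m U (iter_partial [i] f)" for i
      using Suc.prems by (auto simp: C_on_Suc[OF U])
    note IH = Suc.IH[OF this]
    have 1: "C_on m V (iter_partial [i] (\<lambda>x. f (r *\<^sub>R x)))" for i
      by (rule C_on_cong[OF V p[symmetric]]) (use IH in \<open>auto intro!: C_on_cmult[OF V] simp del: iter_partial.simps\<close>)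
    have "iter_partial ds (\<lambda>x. f (r *\<^sub>R x)) x = r ^ length ds * iter_partial ds f (r *\<^sub>R x)"
      if "length ds \<le> Suc m" "x \<in> V" for ds x
    proof (cases ds rule: rev_exhaust)
      case (snoc es i)
      let ?g = "\<lambda>x. iter_partial [i] f (r *\<^sub>R x)"
      have "iter_partial es (iter_partial [i] (\<lambda>x. f (r *\<^sub>R x))) x = iter_partial es (\<lambda>x. r * ?g x) x"
        by (rule iter_partial_cong[OF V p that(2)])
      also have "\<dots> = r * iter_partial es ?g x"
        using iter_partial_lincomb[OF V, of m ?g ?g es x r 0] IH that snoc by simp
      also have "iter_partial es ?g x = r ^ length es * iter_partial es (iter_partial [i] f) (r *\<^sub>R x)"
        using IH that snoc by auto
      finally show ?thesis unfolding snoc iter_partial_append by (simp add: mult_ac)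
    qed simp
    moreover have "C_on (Suc m) V (\<lambda>x. f (r *\<^sub>R x))"
      unfolding C_on_Suc[OF V] using 1 D by (auto simp: differentiable_def)
    ultimately show ?case by blast
  qed
qed

lemma frechet_derivative_expand:
  fixes f :: "real ^ 'n::finite \<Rightarrow> real"
  assumes "f differentiable (at x)"
  shows "frechet_derivative f (at x) v = (\<Sum>i\<in>UNIV. v $ i * iter_partial [i] f x)"
proof -
  have lin: "linear (frechet_derivative f (at x))" by (rule linear_frechet_derivative[OF assms])
  have "frechet_derivative f (at x) v = frechet_derivative f (at x) (\<Sum>i\<in>UNIV. v $ i *\<^sub>R axis i 1)"
    using basis_expansion[of v] by (simp add: scalar_mult_eq_scaleR)
  also have "\<dots> = (\<Sum>i\<in>UNIV. v $ i * iter_partial [i] f x)"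
    by (simp add: linear_sum[OF lin] linear_scale[OF lin])
  finally show ?thesis .
qed

text \<open>The mean value inequality is used twice: bounded second derivatives make the gradient
  Lipschitz near \<open>x\<close>, and the Lipschitz gradient bounds the remainder
  quadratically.\<close>

lemma C_on_2_Taylor:
  fixes f :: "real ^ 'n::finite \<Rightarrow> real"
  assumes N: "open N" "C_on 2 N f" "x \<in> N"
  shows "\<exists>r>0. \<exists>C\<ge>0. r \<le> 1 \<and> ball x r \<subseteq> N \<and>
    (\<forall>y\<in>ball x r. \<bar>f y - f x - frechet_derivative f (at x) (y - x)\<bar> \<le> C * (norm (y - x))^2)"
proof -
  obtain r0 where r0: "r0 > 0" "cball x r0 \<subseteq> N" using N(1,3) open_contains_cball by blast
  define r where "r = min 1 r0"
  have r: "r > 0" "r \<le> 1" "cball x r \<subseteq> N" using r0 by (auto simp: r_def subset_iff)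
  have C2: "C_on (Suc (Suc 0)) N f" using N(2) by (simp add: numeral_2_eq_2)
  have d1: "f differentiable (at z)" if "z \<in> N" for z
    using C2 that by (auto simp: C_on_Suc[OF N(1)])
  have d2: "iter_partial [i] f differentiable (at z)" if "z \<in> N" for z i
    using C2 that by (auto simp: C_on_Suc[OF N(1)])
  have c2: "continuous_on N (iter_partial [j] (iter_partial [i] f))" for i j
    using C2 unfolding C_on_Suc[OF N(1)] C_on_0 by blast
  have ex: "\<exists>B. \<forall>z\<in>cball x r. \<bar>iter_partial [j] (iter_partial [i] f) z\<bar> \<le> B" for i j
  proof -
    have "compact (iter_partial [j] (iter_partial [i] f) ` cball x r)"
      by (intro compact_continuous_image continuous_on_subset[OF c2] r compact_cball)
    then have "bounded (iter_partial [j] (iter_partial [i] f) ` cball x r)" by (rule compact_imp_bounded)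
    then show ?thesis unfolding bounded_iff by auto
  qed
  define B where "B i j = (SOME B. \<forall>z\<in>cball x r. \<bar>iter_partial [j] (iter_partial [i] f) z\<bar> \<le> B)" for i j
  have B: "\<bar>iter_partial [j] (iter_partial [i] f) z\<bar> \<le> B i j" if "z \<in> cball x r" for i j z
    using someI_ex[OF ex[of j i]] that unfolding B_def by blast
  define b where "b = (\<Sum>i\<in>UNIV. \<Sum>j\<in>UNIV. \<bar>B i j\<bar>)"
  have b0: "b \<ge> 0" unfolding b_def by (intro sum_nonneg) auto
  have bij: "(\<Sum>j\<in>UNIV. \<bar>B i j\<bar>) \<le> b" for i
    unfolding b_def by (rule member_le_sum) (auto intro: sum_nonneg)
  have lip: "\<bar>iter_partial [i] f z - iter_partial [i] f x\<bar> \<le> b * norm (z - x)" if "z \<in> cball x r" for z i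
  proof -
    have "norm (iter_partial [i] f z - iter_partial [i] f x) \<le> b * norm (z - x)"
    proof (rule differentiable_bound[OF convex_cball])
      fix y assume y: "y \<in> cball x r"
      then have yN: "y \<in> N" using r by blast
      show "(iter_partial [i] f has_derivative frechet_derivative (iter_partial [i] f) (at y)) (at y within cball x r)"
        using d2[OF yN, of i] unfolding frechet_derivative_works by (rule has_derivative_at_withinI)
      show "onorm (frechet_derivative (iter_partial [i] f) (at y)) \<le> b"
      proof (rule onorm_le)
        fix v
        have "\<bar>\<Sum>j\<in>UNIV. v $ j * iter_partial [j] (iter_partial [i] f) y\<bar> \<le> (\<Sum>j\<in>UNIV. \<bar>v $ j * iter_partial [j] (iter_partial [i] f) y\<bar>)"
          by (rule sum_abs)
        also have "\<dots> \<le> (\<Sum>j\<in>UNIV. norm v * \<bar>B i j\<bar>)"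
          unfolding abs_mult
          by (intro sum_mono mult_mono component_le_norm_cart) (use B[OF y] in \<open>auto intro: order_trans[OF _ abs_ge_self]\<close>)
        also have "\<dots> \<le> b * norm v"
          using mult_left_mono[OF bij[of i], of "norm v"] by (simp add: sum_distrib_left mult.commute)
        finally show "norm (frechet_derivative (iter_partial [i] f) (at y) v) \<le> b * norm v"
          unfolding frechet_derivative_expand[OF d2[OF yN]] by simp
      qed
    qed (use that r in auto)
    then show ?thesis by simp
  qed
  define C where "C = real CARD('n) * b"
  have C0: "C \<ge> 0" using b0 by (simp add: C_def)
  have "\<bar>f y - f x - frechet_derivative f (at x) (y - x)\<bar> \<le> C * (norm (y - x))^2" if y: "y \<in> ball x r" for y
  proof -
    define \<rho> where "\<rho> = norm (y - x)"
    have sub: "cball x \<rho> \<subseteq> cball x r" using y by (auto simp: \<rho>_def dist_norm norm_minus_commute)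
    \<comment> \<open>After subtracting the linear part, the derivative at points within distance
      \<open>\<rho>\<close> of \<open>x\<close> has norm at most \<open>C * \<rho>\<close>, and
      \<open>y\<close> lies at distance exactly \<open>\<rho>\<close>.\<close>
    define g where "g z = f z - frechet_derivative f (at x) (z - x)" for z
    have xN: "x \<in> N" by (rule N(3))
    have lin: "bounded_linear (frechet_derivative f (at x))"
      using d1[OF xN] unfolding frechet_derivative_works by (rule has_derivative_bounded_linear)
    have "norm (g y - g x) \<le> (C * \<rho>) * norm (y - x)"
    proof (rule differentiable_bound[OF convex_cball[of x \<rho>]])
      fix z assume z: "z \<in> cball x \<rho>"
      then have zr: "z \<in> cball x r" and zN: "z \<in> N" using sub r by blast+
      have "(f has_derivative frechet_derivative f (at z)) (at z within cball x \<rho>)"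
        using d1[OF zN] unfolding frechet_derivative_works by (rule has_derivative_at_withinI)
      moreover have "((\<lambda>z. frechet_derivative f (at x) (z - x)) has_derivative frechet_derivative f (at x)) (at z within cball x \<rho>)"
        by (rule bounded_linear.has_derivative[OF lin, of "\<lambda>z. z - x" "\<lambda>h. h", simplified])
           (auto intro!: derivative_eq_intros)
      ultimately show "(g has_derivative (\<lambda>v. frechet_derivative f (at z) v - frechet_derivative f (at x) v)) (at z within cball x \<rho>)"
        unfolding g_def by (rule has_derivative_diff)
      show "onorm (\<lambda>v. frechet_derivative f (at z) v - frechet_derivative f (at x) v) \<le> C * \<rho>"
      proof (rule onorm_le)
        fix v
        have "norm (frechet_derivative f (at z) v - frechet_derivative f (at x) v)
            = \<bar>\<Sum>i\<in>UNIV. v $ i * (iter_partial [i] f z - iter_partial [i] f x)\<bar>"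
          unfolding frechet_derivative_expand[OF d1[OF zN]] frechet_derivative_expand[OF d1[OF xN]]
          by (simp add: sum_subtractf[symmetric] right_diff_distrib del: iter_partial.simps)
        also have "\<dots> \<le> (\<Sum>i\<in>UNIV. \<bar>v $ i * (iter_partial [i] f z - iter_partial [i] f x)\<bar>)"
          by (rule sum_abs)
        also have "\<dots> \<le> (\<Sum>i\<in>(UNIV::'n set). norm v * (b * \<rho>))"
          unfolding abs_mult
        proof (intro sum_mono mult_mono component_le_norm_cart)
          fix i
          have "norm (z - x) \<le> \<rho>" using z by (simp add: dist_norm norm_minus_commute)
          then show "\<bar>iter_partial [i] f z - iter_partial [i] f x\<bar> \<le> b * \<rho>"
            using lip[OF zr, of i] mult_left_mono[OF _ b0] by (meson order_trans)
        qed auto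
        finally show "norm (frechet_derivative f (at z) v - frechet_derivative f (at x) v) \<le> C * \<rho> * norm v"
          by (simp add: C_def mult_ac)
      qed
    qed (auto simp: \<rho>_def dist_norm norm_minus_commute)
    moreover have "frechet_derivative f (at x) 0 = 0"
      using bounded_linear.linear[OF lin] linear_0 by blast
    ultimately show ?thesis by (simp add: g_def \<rho>_def power2_eq_square mult_ac algebra_simps)
  qed
  then show ?thesis using r C0 by (intro exI[of _ r] conjI exI[of _ C]) auto
qed

subsection \<open>Classical solutions are viscosity solutions\<close>

text \<open>On the ball \<open>w\<close> equals the C^2 function \<open>T\<close>, so
  \<open>\<phi> - T\<close> has an extremum at \<open>x\<close>, its gradient vanishes there, and it
  is \<open>O((norm (y - x))^2)\<close>. The touching function is therefore \<open>w\<close> plus a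
  correction \<open>d\<close> that is absolutely integrable against the kernel, and the sign of
  \<open>d\<close> decides between sub- and supersolution.\<close>

lemma touching_has_frac_laplacian:
  fixes w T \<phi> :: "real ^ 'n::finite \<Rightarrow> real"
  assumes s: "0 < s" "s < 1" and T: "C_on 2 UNIV T" "\<And>y. y \<in> ball x r \<Longrightarrow> w y = T y"
    and h: "has_frac_laplacian s w x g"
    and r: "0 < r" and N: "open N" "cball x r \<subseteq> N" "C_on 2 N \<phi>"
    and touch: "\<phi> x = w x" "(\<forall>y\<in>ball x r. w y \<le> \<phi> y) \<or> (\<forall>y\<in>ball x r. \<phi> y \<le> w y)"
  defines "d \<equiv> \<lambda>y. if y \<in> ball x r then \<phi> y - w y else 0"
  shows "has_frac_laplacian s (\<lambda>y. if y \<in> ball x r then \<phi> y else w y) x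
    (g - (\<integral>y. d y * fker s (x - y) \<partial>lebesgue))"
proof -
  define \<psi> where "\<psi> y = \<phi> y - T y" for y
  have C\<psi>: "C_on 2 N \<psi>" unfolding \<psi>_def
    by (rule C_on_diff[OF N(1,3)]) (rule C_on_subset[OF T(1)], simp)
  have xr: "x \<in> ball x r" using r by simp
  have xN: "x \<in> N" using N(2) r by auto
  have d_eq: "d y = indicator (ball x r) y *\<^sub>R \<psi> y" for y
    using T(2) by (simp add: d_def \<psi>_def)
  have \<psi>x: "\<psi> x = 0" using touch(1) T(2)[OF xr] by (simp add: \<psi>_def)
  have sgn: "(\<forall>y\<in>ball x r. \<psi> y \<le> \<psi> x) \<or> (\<forall>y\<in>ball x r. \<psi> x \<le> \<psi> y)"
    using touch(2) T(2) \<psi>x by (auto simp: \<psi>_def)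
  have "\<psi> differentiable (at x)"
    using C\<psi> xN unfolding numeral_2_eq_2 C_on_Suc[OF N(1)] by blast
  then have "frechet_derivative \<psi> (at x) = (\<lambda>v. 0)"
    unfolding frechet_derivative_works
    by (rule differential_zero_maxmin[OF xr open_ball _ sgn])
  with C_on_2_Taylor[OF N(1) C\<psi> xN] \<psi>x obtain r1 C where r1: "r1 > 0" "r1 \<le> 1" "C \<ge> 0"
    and q: "\<And>y. y \<in> ball x r1 \<Longrightarrow> \<bar>\<psi> y\<bar> \<le> C * (norm (y - x))^2"
    by auto
  have "bounded (\<psi> ` cball x r)"
    by (intro compact_imp_bounded compact_continuous_image compact_cball
        continuous_on_subset[OF C_on_imp_continuous_on[OF C\<psi>] N(2)])
  then obtain K where K: "\<And>y. y \<in> cball x r \<Longrightarrow> \<bar>\<psi> y\<bar> \<le> K" unfolding bounded_iff by (auto simp del: mem_cball)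
  have K0: "K \<ge> 0" using K[of x] r by auto
  \<comment> \<open>The summand \<open>C\<close> serves close to \<open>x\<close>. Elsewhere in the
    ball of radius \<open>r\<close>, \<open>norm (y - x)\<close> is at least \<open>r1\<close>, and
    the bound \<open>K\<close> equals \<open>K / r1^2 * r1^2\<close>.\<close>
  define c where "c = C + K / r1^2"
  have c0: "c \<ge> 0" using r1 K0 by (simp add: c_def)
  have le: "\<bar>d y\<bar> \<le> c * min 1 ((norm (y - x))^2)" for y
  proof (cases "y \<in> ball x r")
    case True
    show ?thesis
    proof (cases "y \<in> ball x r1")
      case y1: True
      then have "norm (y - x) \<le> 1" using r1 by (auto simp: dist_norm norm_minus_commute)
      then have "min 1 ((norm (y - x))^2) = (norm (y - x))^2" by (intro min_absorb2 power_le_one) auto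
      moreover have "C * (norm (y - x))^2 \<le> c * (norm (y - x))^2"
        using K0 by (intro mult_right_mono) (auto simp: c_def)
      ultimately show ?thesis using q[OF y1] True by (simp add: d_eq)
    next
      case False
      then have "r1 \<le> norm (y - x)" by (auto simp: dist_norm norm_minus_commute)
      then have "r1^2 \<le> min 1 ((norm (y - x))^2)"
        using r1 by (auto intro!: power_mono power_le_one)
      then have "K / r1^2 * r1^2 \<le> c * min 1 ((norm (y - x))^2)"
        using r1 K0 c0 by (intro mult_mono) (auto simp: c_def)
      moreover have "\<bar>\<psi> y\<bar> \<le> K" using True by (intro K) auto
      ultimately show ?thesis using True r1 by (simp add: d_eq)
    qed
  qed (use c0 in \<open>simp add: d_eq\<close>)
  have dm: "d \<in> borel_measurable borel"
    unfolding d_eq[abs_def]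
    by (rule borel_measurable_continuous_on_indicator)
       (use N(2) in \<open>auto intro!: continuous_on_subset[OF C_on_imp_continuous_on[OF C\<psi>]] simp: subset_iff\<close>)
  have m: "(\<lambda>y. d y * fker s (x - y)) \<in> borel_measurable lborel"
    using dm by measurable
  have "integrable lborel (\<lambda>y. d y * fker s (x - y))"
  proof (rule Bochner_Integration.integrable_bound)
    let ?f = "\<lambda>y. c * (min 1 ((norm (y - x))^2) * fker s (y - x))"
    have "integrable lborel (\<lambda>z. ?f (x + z))"
      by (simp add: integrable_min_fker[OF s])
    then show "integrable lborel ?f"
      by (subst (asm) lborel_integral_translate(2)) measurable
    show "(\<lambda>y. d y * fker s (x - y)) \<in> borel_measurable lborel" by (rule m)
    show "AE y in lborel. norm (d y * fker s (x - y)) \<le> norm (?f y)"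
    proof (rule AE_I2)
      fix y
      have "\<bar>d y\<bar> * fker s (y - x) \<le> c * min 1 ((norm (y - x))^2) * fker s (y - x)"
        by (intro mult_right_mono le) simp
      then show "norm (d y * fker s (x - y)) \<le> norm (?f y)"
        using c0 by (simp add: abs_mult fker_commute[of s x] mult.assoc)
    qed
  qed
  then have "integrable lebesgue (\<lambda>y. d y * fker s (x - y))"
    using m by (simp add: integrable_completion)
  then have "has_frac_laplacian s d x (- (\<integral>y. d y * fker s (x - y) \<partial>lebesgue))"
    by (intro has_frac_laplacian_vanishing) (auto simp: d_eq \<psi>x)
  from has_frac_laplacian_add[OF h this]
  have "has_frac_laplacian s (\<lambda>y. w y + d y) x (g - (\<integral>y. d y * fker s (x - y) \<partial>lebesgue))"
    by simp
  also have "(\<lambda>y. w y + d y) = (\<lambda>y. if y \<in> ball x r then \<phi> y else w y)"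
    by (auto simp: d_def)
  finally show ?thesis .
qed

text \<open>Pointwise solutions that agree on \<open>\<Omega>\<close> with a C^2 function are
  viscosity solutions: a test function from above adds a nonnegative \<open>d\<close> and so lowers
  the operator, one from below raises it.\<close>

lemma viscosity_solutionI:
  fixes w T g :: "real ^ 'n::finite \<Rightarrow> real"
  assumes s: "0 < s" "s < 1" and T: "C_on 2 UNIV T" "\<And>y. y \<in> \<Omega> \<Longrightarrow> w y = T y"
    and w: "w \<in> weighted_L1 s 0"
    and h: "\<And>x. x \<in> \<Omega> \<Longrightarrow> has_frac_laplacian s w x (g x)"
  shows "viscosity_solution s \<Omega> w g"
  unfolding viscosity_solution_def
proof (intro conjI)
  have "continuous_on \<Omega> T"
    by (rule continuous_on_subset[OF C_on_imp_continuous_on[OF T(1)]]) simp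
  then show "continuous_on \<Omega> w"
    using T(2) by (simp cong: continuous_on_cong)
  show "w \<in> weighted_L1 s 0" by (rule w)
  show "viscosity_subsolution s \<Omega> w g"
    unfolding viscosity_subsolution_def
  proof (intro allI impI, elim conjE)
    fix x r N \<phi> assume A: "0 < r" "cball x r \<subseteq> \<Omega>" "open N" "cball x r \<subseteq> N" "C_on 2 N \<phi>"
      "\<phi> x = w x" "\<forall>y\<in>ball x r. w y \<le> \<phi> y"
    have sub: "x \<in> \<Omega>" "\<And>y. y \<in> ball x r \<Longrightarrow> w y = T y" using A(1,2) T(2) by (auto simp: subset_iff)
    show "\<exists>L. has_frac_laplacian s (\<lambda>y. if y \<in> ball x r then \<phi> y else w y) x L \<and> L \<le> g x"
      using touching_has_frac_laplacian[OF s T(1) sub(2) h[OF sub(1)] A(1,3-6)] A(7)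
      by (auto intro!: exI conjI Bochner_Integration.integral_nonneg mult_nonneg_nonneg)
  qed
  show "viscosity_supersolution s \<Omega> w g"
    unfolding viscosity_supersolution_def
  proof (intro allI impI, elim conjE)
    fix x r N \<phi> assume A: "0 < r" "cball x r \<subseteq> \<Omega>" "open N" "cball x r \<subseteq> N" "C_on 2 N \<phi>"
      "\<phi> x = w x" "\<forall>y\<in>ball x r. \<phi> y \<le> w y"
    have sub: "x \<in> \<Omega>" "\<And>y. y \<in> ball x r \<Longrightarrow> w y = T y" using A(1,2) T(2) by (auto simp: subset_iff)
    let ?d = "\<lambda>y. if y \<in> ball x r then \<phi> y - w y else 0"
    have "0 \<le> (\<integral>y. - (?d y * fker s (x - y)) \<partial>lebesgue)"
      using A(7) by (intro Bochner_Integration.integral_nonneg) (auto simp: mult_nonpos_nonneg)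
    then have "(\<integral>y. ?d y * fker s (x - y) \<partial>lebesgue) \<le> 0" by simp
    then show "\<exists>L. has_frac_laplacian s (\<lambda>y. if y \<in> ball x r then \<phi> y else w y) x L \<and> g x \<le> L"
      using touching_has_frac_laplacian[OF s T(1) sub(2) h[OF sub(1)] A(1,3-6)] A(7) by auto
  qed
qed

subsection \<open>Absolutely convergent trigonometric series\<close>

lemma summable_on_bounded:
  fixes f :: "'i \<Rightarrow> 'b::banach"
  assumes "g summable_on A" "\<And>i. i \<in> A \<Longrightarrow> norm (f i) \<le> g i"
  shows "f summable_on A"
proof (rule abs_summable_summable, rule Infinite_Sum.abs_summable_on_comparison_test)
  have "norm (g i) = g i" if "i \<in> A" for i
    using order_trans[OF norm_ge_zero assms(2)[OF that]] by simp
  then show "(\<lambda>i. norm (g i)) summable_on A" using assms(1) by (simp cong: summable_on_cong)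
  show "norm (f i) \<le> norm (g i)" if "i \<in> A" for i using assms(2)[OF that] by simp
qed

lemma norm_infsum_le_infsum:
  fixes f :: "'i \<Rightarrow> 'b::banach"
  assumes "g summable_on A" "\<And>i. i \<in> A \<Longrightarrow> norm (f i) \<le> g i"
  shows "norm (infsum f A) \<le> infsum g A"
  by (rule norm_infsum_le[OF has_sum_infsum[OF summable_on_bounded[OF assms]] has_sum_infsum[OF assms(1)] assms(2)])

lemma infsum_diff_sum:
  fixes f :: "'i \<Rightarrow> 'b::banach"
  assumes "f summable_on A" "finite F" "F \<subseteq> A"
  shows "infsum f A - sum f F = infsum f (A - F)"
proof -
  have "infsum f (F \<union> (A - F)) = infsum f F + infsum f (A - F)"
    using assms by (intro infsum_Un_disjoint summable_on_subset_banach[OF assms(1)]) auto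
  moreover have "F \<union> (A - F) = A" using assms(3) by auto
  ultimately show ?thesis using assms(2) by simp
qed

text \<open>Infinite sums converge here along finite subsets rather than along a sequence. Sums and
  integrals are interchanged by integrating this uniform error bound instead of by dominated
  convergence.\<close>

lemma infsum_tail_bound:
  fixes f :: "'i \<Rightarrow> 'b::banach"
  assumes g: "g summable_on A" "\<And>i. i \<in> A \<Longrightarrow> norm (f i) \<le> g i" and F: "finite F" "F \<subseteq> A"
  shows "norm (infsum f A - sum f F) \<le> infsum g A - sum g F"
proof -
  have "g summable_on (A - F)" by (rule summable_on_subset_banach[OF g(1)]) auto
  then have "norm (infsum f (A - F)) \<le> infsum g (A - F)"
    by (rule norm_infsum_le_infsum) (use g(2) in auto)
  moreover have "f summable_on A" by (rule summable_on_bounded[OF g])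
  ultimately show ?thesis
    by (simp add: infsum_diff_sum[OF _ F] g(1))
qed

lemma has_sum_minus:
  fixes f g :: "'i \<Rightarrow> 'b::real_normed_vector"
  assumes "(f has_sum S) A" "(g has_sum T) A"
  shows "((\<lambda>i. f i - g i) has_sum (S - T)) A"
  using has_sum_add[OF assms(1), where g="\<lambda>i. - g i" and b="- T"] has_sum_uminus[where f=g and a="- T" and A=A] assms(2) by simp

lemma summable_on_minus:
  fixes f g :: "'i \<Rightarrow> 'b::real_normed_vector"
  assumes "f summable_on A" "g summable_on A"
  shows "(\<lambda>i. f i - g i) summable_on A"
  using assms has_sum_minus unfolding summable_on_def by blast

lemma infsum_tail_tendsto_0:
  fixes g :: "'i \<Rightarrow> real"
  assumes "g summable_on A"
  shows "((\<lambda>F. infsum g A - sum g F) \<longlongrightarrow> 0) (finite_subsets_at_top A)"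
  using tendsto_diff[OF tendsto_const infsum_tendsto[OF assms], of "infsum g A"] by simp

definition tsum :: "('i \<Rightarrow> complex) \<Rightarrow> ('i \<Rightarrow> real ^ 'n::finite) \<Rightarrow> real ^ 'n \<Rightarrow> complex" where
  "tsum a \<xi> x = (\<Sum>\<^sub>\<infinity>i. a i * cis (\<xi> i \<bullet> x))"

text \<open>A weighted Wiener algebra condition. The weight of order \<open>M\<close> controls
  derivatives up to order \<open>M\<close>, and \<open>1 + norm\<close> instead of
  \<open>norm\<close> makes the norm submultiplicative. Frequencies are arbitrary and may repeat, so
  the sums need not be periodic.\<close>

definition tadm :: "nat \<Rightarrow> ('i \<Rightarrow> complex) \<Rightarrow> ('i \<Rightarrow> real ^ 'n::finite) \<Rightarrow> bool" where
  "tadm M a \<xi> \<longleftrightarrow> (\<lambda>i. cmod (a i) * (1 + norm (\<xi> i)) ^ M) summable_on UNIV"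

definition tnorm :: "nat \<Rightarrow> ('i \<Rightarrow> complex) \<Rightarrow> ('i \<Rightarrow> real ^ 'n::finite) \<Rightarrow> real" where
  "tnorm M a \<xi> = (\<Sum>\<^sub>\<infinity>i. cmod (a i) * (1 + norm (\<xi> i)) ^ M)"

lemma tnorm_nonneg: "0 \<le> tnorm M a \<xi>"
  unfolding tnorm_def by (rule infsum_nonneg) simp

lemma tadm_bounded:
  assumes "tadm M a \<xi>" "\<And>i. cmod (b i) * (1 + norm (\<xi> i)) ^ N \<le> c * (cmod (a i) * (1 + norm (\<xi> i)) ^ M)"
  shows "tadm N b \<xi>" "tnorm N b \<xi> \<le> c * tnorm M a \<xi>"
proof -
  have s: "(\<lambda>i. c * (cmod (a i) * (1 + norm (\<xi> i)) ^ M)) summable_on UNIV"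
    using assms(1) unfolding tadm_def by (rule summable_on_cmult_right)
  show "tadm N b \<xi>" unfolding tadm_def
    by (rule summable_on_bounded[OF s]) (use assms(2) in simp)
  then show "tnorm N b \<xi> \<le> c * tnorm M a \<xi>"
    unfolding tnorm_def infsum_cmult_right'[symmetric] tadm_def
    by (rule infsum_mono[OF _ s]) (rule assms(2))
qed

lemma tadm_mono:
  assumes "tadm M a \<xi>" "N \<le> M"
  shows "tadm N a \<xi>" "tnorm N a \<xi> \<le> tnorm M a \<xi>"
proof -
  have "cmod (a i) * (1 + norm (\<xi> i)) ^ N \<le> 1 * (cmod (a i) * (1 + norm (\<xi> i)) ^ M)" for i
    using assms(2) by (auto intro!: mult_left_mono power_increasing)
  from tadm_bounded[OF assms(1) this] show "tadm N a \<xi>" "tnorm N a \<xi> \<le> tnorm M a \<xi>" by simp_all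
qed

lemma tsum_summable:
  assumes "tadm 0 a \<xi>"
  shows "(\<lambda>i. a i * cis (\<xi> i \<bullet> x)) summable_on UNIV"
  using assms unfolding tadm_def by (rule summable_on_bounded) (simp add: norm_mult)

lemma tsum_bound:
  assumes "tadm 0 a \<xi>"
  shows "cmod (tsum a \<xi> x) \<le> tnorm 0 a \<xi>"
  using assms unfolding tadm_def tsum_def tnorm_def
  by (rule norm_infsum_le_infsum) (simp add: norm_mult)

lemma tsum_cmult: "tsum (\<lambda>i. c * a i) \<xi> x = c * tsum a \<xi> x"
  unfolding tsum_def by (simp add: mult.assoc infsum_cmult_right')

lemma tsum_add:
  assumes "tadm 0 a \<xi>" "tadm 0 b \<xi>"
  shows "tsum (\<lambda>i. a i + b i) \<xi> x = tsum a \<xi> x + tsum b \<xi> x"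
  unfolding tsum_def distrib_right by (rule infsum_add[OF tsum_summable[OF assms(1)] tsum_summable[OF assms(2)]])

lemma cmod_cis_minus_1: "cmod (cis t - 1) \<le> \<bar>t\<bar>"
proof -
  have "(cmod (cis t - 1))^2 = (cos t - 1)^2 + (sin t)^2" by (simp add: cmod_power2)
  also have "\<dots> = 2 * (1 - cos t)"
    using sin_cos_squared_add[of t] by (simp add: power2_eq_square algebra_simps)
  also have "\<dots> \<le> t^2" using one_minus_cos_le[of t] by simp
  finally show ?thesis by (metis abs_le_square_iff abs_norm_cancel)
qed

lemma cmod_cis_Taylor: "cmod (cis t - 1 - \<i> * t) \<le> t^2"
proof -
  define f where "f u = cis u - 1 - \<i> * of_real u" for u :: real
  have "norm (f t - f 0) \<le> \<bar>t\<bar> * norm (t - 0)"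
  proof (rule differentiable_bound[of "cball 0 \<bar>t\<bar>"])
    fix u :: real assume u: "u \<in> cball 0 \<bar>t\<bar>"
    show "(f has_derivative (\<lambda>v. of_real v * (\<i> * (cis u - 1)))) (at u within cball 0 \<bar>t\<bar>)"
      unfolding f_def by (auto intro!: derivative_eq_intros simp: algebra_simps scaleR_conv_of_real)
    show "onorm (\<lambda>v. of_real v * (\<i> * (cis u - 1))) \<le> \<bar>t\<bar>"
    proof (rule onorm_le)
      fix v :: real
      have l: "cmod (cis u - 1) \<le> \<bar>t\<bar>" using cmod_cis_minus_1[of u] u by simp
      show "norm (of_real v * (\<i> * (cis u - 1))) \<le> \<bar>t\<bar> * norm v"
        using mult_right_mono[OF l, of "\<bar>v\<bar>"] by (simp add: norm_mult mult.commute)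
    qed
  qed auto
  then show ?thesis by (simp add: f_def power2_eq_square)
qed

text \<open>The remainder estimate \<open>cmod_cis_Taylor\<close> is summed directly; it is
  quadratic in the frequency, hence the weight of order 2 for a single derivative.\<close>

lemma tsum_has_derivative:
  fixes \<xi> :: "'i \<Rightarrow> real ^ 'n::finite"
  assumes a: "tadm 2 a \<xi>"
  shows "((\<lambda>x. Re (tsum a \<xi> x)) has_derivative
    (\<lambda>v. Re (tsum (\<lambda>i. \<i> * of_real (\<xi> i \<bullet> v) * a i) \<xi> x))) (at x)"
proof -
  have a1: "tadm 1 a \<xi>" and a0: "tadm 0 a \<xi>" by (rule tadm_mono[OF a], simp)+
  define D where "D v = (\<lambda>i. \<i> * of_real (\<xi> i \<bullet> v) * a i)" for v
  have bD: "cmod (D v i) * (1 + norm (\<xi> i)) ^ 0 \<le> norm v * (cmod (a i) * (1 + norm (\<xi> i)) ^ 1)" for v i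
  proof -
    have "\<bar>\<xi> i \<bullet> v\<bar> * cmod (a i) \<le> (norm v * (1 + norm (\<xi> i))) * cmod (a i)"
    proof (rule mult_right_mono)
      have "\<bar>\<xi> i \<bullet> v\<bar> \<le> norm (\<xi> i) * norm v" by (rule Cauchy_Schwarz_ineq2)
      then show "\<bar>\<xi> i \<bullet> v\<bar> \<le> norm v * (1 + norm (\<xi> i))"
        using norm_ge_zero[of v] by (simp add: algebra_simps del: norm_ge_zero)
    qed simp
    then show ?thesis by (simp add: D_def norm_mult mult_ac)
  qed
  note D0 = tadm_bounded[OF a1 bD]
  show ?thesis
  proof (rule has_derivativeI)
    show "bounded_linear (\<lambda>v. Re (tsum (\<lambda>i. \<i> * of_real (\<xi> i \<bullet> v) * a i) \<xi> x))"
    proof (rule bounded_linear_intro[where K="tnorm 1 a \<xi>"])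
      fix v w :: "real^'n" and r :: real
      have "D (v + w) = (\<lambda>i. D v i + D w i)" by (simp add: D_def inner_add_right algebra_simps)
      then have "tsum (D (v + w)) \<xi> x = tsum (D v) \<xi> x + tsum (D w) \<xi> x"
        using tsum_add[OF D0(1) D0(1)] by simp
      then show "Re (tsum (\<lambda>i. \<i> * of_real (\<xi> i \<bullet> (v + w)) * a i) \<xi> x)
         = Re (tsum (\<lambda>i. \<i> * of_real (\<xi> i \<bullet> v) * a i) \<xi> x) + Re (tsum (\<lambda>i. \<i> * of_real (\<xi> i \<bullet> w) * a i) \<xi> x)"
        unfolding D_def by simp
      have "D (r *\<^sub>R v) = (\<lambda>i. of_real r * D v i)" by (simp add: D_def algebra_simps)
      then have "tsum (D (r *\<^sub>R v)) \<xi> x = of_real r * tsum (D v) \<xi> x"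
        by (simp add: tsum_cmult)
      then show "Re (tsum (\<lambda>i. \<i> * of_real (\<xi> i \<bullet> (r *\<^sub>R v)) * a i) \<xi> x)
          = r *\<^sub>R Re (tsum (\<lambda>i. \<i> * of_real (\<xi> i \<bullet> v) * a i) \<xi> x)"
        unfolding D_def by simp
      have "\<bar>Re (tsum (D v) \<xi> x)\<bar> \<le> cmod (tsum (D v) \<xi> x)" by (rule abs_Re_le_cmod)
      also have "\<dots> \<le> tnorm 0 (D v) \<xi>" by (rule tsum_bound[OF D0(1)])
      also have "\<dots> \<le> norm v * tnorm 1 a \<xi>" by (rule D0(2))
      finally show "norm (Re (tsum (\<lambda>i. \<i> * of_real (\<xi> i \<bullet> v) * a i) \<xi> x)) \<le> norm v * tnorm 1 a \<xi>"
        unfolding D_def by simp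
    qed
    have est: "\<bar>Re (tsum a \<xi> y) - Re (tsum a \<xi> x) - Re (tsum (D (y - x)) \<xi> x)\<bar> \<le> (norm (y - x))^2 * tnorm 2 a \<xi>" for y
    proof -
      define h where "h = y - x"
      have "tsum a \<xi> y - tsum a \<xi> x - tsum (D h) \<xi> x
         = (\<Sum>\<^sub>\<infinity>i. a i * cis (\<xi> i \<bullet> y) - a i * cis (\<xi> i \<bullet> x) - D h i * cis (\<xi> i \<bullet> x))"
        unfolding tsum_def
        by (rule infsumI[symmetric, OF has_sum_minus[OF has_sum_minus]])
           (simp_all add: tsum_summable[OF a0] tsum_summable[OF D0(1)])
      also have "\<dots> = (\<Sum>\<^sub>\<infinity>i. a i * cis (\<xi> i \<bullet> x) * (cis (\<xi> i \<bullet> h) - 1 - \<i> * of_real (\<xi> i \<bullet> h)))"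
        by (intro infsum_cong) (simp add: D_def h_def inner_diff_right algebra_simps cis_mult)
      finally have eq: "tsum a \<xi> y - tsum a \<xi> x - tsum (D h) \<xi> x = \<dots>" .
      have "cmod (tsum a \<xi> y - tsum a \<xi> x - tsum (D h) \<xi> x) \<le> (\<Sum>\<^sub>\<infinity>i. (norm h)^2 * (cmod (a i) * (1 + norm (\<xi> i)) ^ 2))"
        unfolding eq
      proof (rule norm_infsum_le_infsum)
        show "(\<lambda>i. (norm h)^2 * (cmod (a i) * (1 + norm (\<xi> i)) ^ 2)) summable_on UNIV"
          using a unfolding tadm_def by (rule summable_on_cmult_right)
        fix i
        have "cmod (cis (\<xi> i \<bullet> h) - 1 - \<i> * of_real (\<xi> i \<bullet> h)) \<le> (\<xi> i \<bullet> h)^2" by (rule cmod_cis_Taylor)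
        also have "\<dots> \<le> ((1 + norm (\<xi> i)) * norm h)^2"
        proof -
          have "\<bar>\<xi> i \<bullet> h\<bar> \<le> norm (\<xi> i) * norm h" by (rule Cauchy_Schwarz_ineq2)
          also have "\<dots> \<le> (1 + norm (\<xi> i)) * norm h" by (intro mult_right_mono) auto
          finally have "\<bar>\<xi> i \<bullet> h\<bar> \<le> \<bar>(1 + norm (\<xi> i)) * norm h\<bar>" by linarith
          then show ?thesis unfolding abs_le_square_iff .
        qed
        finally have "cmod (a i) * cmod (cis (\<xi> i \<bullet> h) - 1 - \<i> * of_real (\<xi> i \<bullet> h))
           \<le> cmod (a i) * ((1 + norm (\<xi> i)) * norm h)^2" by (rule mult_left_mono) simp
        then show "norm (a i * cis (\<xi> i \<bullet> x) * (cis (\<xi> i \<bullet> h) - 1 - \<i> * of_real (\<xi> i \<bullet> h)))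
           \<le> (norm h)^2 * (cmod (a i) * (1 + norm (\<xi> i)) ^ 2)"
          by (simp add: norm_mult power_mult_distrib mult_ac)
      qed
      also have "\<dots> = (norm h)^2 * tnorm 2 a \<xi>" by (simp add: tnorm_def infsum_cmult_right')
      finally show ?thesis
        using abs_Re_le_cmod[of "tsum a \<xi> y - tsum a \<xi> x - tsum (D h) \<xi> x"] by (simp add: h_def)
    qed
    show "((\<lambda>y. ((Re (tsum a \<xi> y) - Re (tsum a \<xi> x)) - Re (tsum (\<lambda>i. \<i> * of_real (\<xi> i \<bullet> (y - x)) * a i) \<xi> x)) /\<^sub>R norm (y - x))
       \<longlongrightarrow> 0) (at x)"
    proof (rule Lim_null_comparison)
      show "\<forall>\<^sub>F y in at x. norm (((Re (tsum a \<xi> y) - Re (tsum a \<xi> x)) - Re (tsum (\<lambda>i. \<i> * of_real (\<xi> i \<bullet> (y - x)) * a i) \<xi> x)) /\<^sub>R norm (y - x))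
          \<le> norm (y - x) * tnorm 2 a \<xi>"
      proof (rule always_eventually, intro allI)
        fix y
        show "norm (((Re (tsum a \<xi> y) - Re (tsum a \<xi> x)) - Re (tsum (\<lambda>i. \<i> * of_real (\<xi> i \<bullet> (y - x)) * a i) \<xi> x)) /\<^sub>R norm (y - x))
          \<le> norm (y - x) * tnorm 2 a \<xi>"
          using est[of y] tnorm_nonneg[of 2 a \<xi>] unfolding D_def
          by (cases "y = x") (simp_all add: divide_simps power2_eq_square mult_ac)
      qed
      have "((\<lambda>y. norm (y - x) * tnorm 2 a \<xi>) \<longlongrightarrow> norm (x - x) * tnorm 2 a \<xi>) (at x)"
        by (intro tendsto_intros)
      then show "((\<lambda>y. norm (y - x) * tnorm 2 a \<xi>) \<longlongrightarrow> 0) (at x)" by simp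
    qed
  qed
qed

section \<open>Higher derivatives of trigonometric series\<close>

definition tdiff :: "'n list \<Rightarrow> ('i \<Rightarrow> complex) \<Rightarrow> ('i \<Rightarrow> real ^ 'n::finite) \<Rightarrow> 'i \<Rightarrow> complex" where
  "tdiff ds a \<xi> i = prod_list (map (\<lambda>k. \<i> * of_real (\<xi> i $ k)) ds) * a i"

lemma cmod_tdiff_le: "cmod (tdiff ds a \<xi> i) \<le> (1 + norm (\<xi> i)) ^ length ds * cmod (a i)"
proof (induction ds)
  case (Cons k ds)
  have "cmod (tdiff (k # ds) a \<xi> i) = \<bar>\<xi> i $ k\<bar> * cmod (tdiff ds a \<xi> i)"
    by (simp add: tdiff_def norm_mult)
  also have "\<dots> \<le> (1 + norm (\<xi> i)) * ((1 + norm (\<xi> i)) ^ length ds * cmod (a i))"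
    using component_le_norm_cart[of "\<xi> i" k] by (intro mult_mono Cons) auto
  finally show ?case by (simp add: mult_ac)
qed (simp add: tdiff_def)

lemma tadm_tdiff:
  assumes "tadm (N + length ds) a \<xi>"
  shows "tadm N (tdiff ds a \<xi>) \<xi>" "tnorm N (tdiff ds a \<xi>) \<xi> \<le> tnorm (N + length ds) a \<xi>"
proof -
  have "cmod (tdiff ds a \<xi> i) * (1 + norm (\<xi> i)) ^ N \<le> 1 * (cmod (a i) * (1 + norm (\<xi> i)) ^ (N + length ds))" for i
    using mult_right_mono[OF cmod_tdiff_le[of ds a \<xi> i], of "(1 + norm (\<xi> i)) ^ N"]
    by (simp add: power_add mult_ac)
  from tadm_bounded[OF assms this]
  show "tadm N (tdiff ds a \<xi>) \<xi>" "tnorm N (tdiff ds a \<xi>) \<xi> \<le> tnorm (N + length ds) a \<xi>" by simp_all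
qed

lemma iter_partial_tsum:
  assumes "tadm (length ds + 1) a \<xi>"
  shows "iter_partial ds (\<lambda>x. Re (tsum a \<xi> x)) = (\<lambda>x. Re (tsum (tdiff ds a \<xi>) \<xi> x))"
  using assms
proof (induction ds)
  case Nil
  have "tdiff [] a \<xi> = a" by (auto simp: tdiff_def)
  then show ?case by simp
next
  case (Cons k ds)
  have "tadm (2 + length ds) a \<xi>" using Cons.prems by (simp add: numeral_2_eq_2)
  from tsum_has_derivative[OF tadm_tdiff(1)[OF this]]
  have "frechet_derivative (\<lambda>x. Re (tsum (tdiff ds a \<xi>) \<xi> x)) (at x)
     = (\<lambda>v. Re (tsum (\<lambda>i. \<i> * of_real (\<xi> i \<bullet> v) * tdiff ds a \<xi> i) \<xi> x))" for x
    by (rule frechet_derivative_at[symmetric])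
  moreover have "(\<lambda>i. \<i> * of_real (\<xi> i \<bullet> axis k 1) * tdiff ds a \<xi> i) = tdiff (k # ds) a \<xi>"
    by (auto simp: tdiff_def inner_axis mult_ac)
  moreover have "tadm (length ds + 1) a \<xi>" by (rule tadm_mono[OF Cons.prems]) simp
  ultimately show ?case using Cons.IH by simp
qed

lemma tsum_differentiable:
  assumes "tadm 2 a \<xi>"
  shows "(\<lambda>x. Re (tsum a \<xi> x)) differentiable (at x)"
  using tsum_has_derivative[OF assms] unfolding differentiable_def by blast

text \<open>With two extra orders, even the derivatives of order \<open>M\<close> are differentiable
  by the quadratic estimate, which yields their continuity for free.\<close>

lemma tsum_C_on:
  assumes "tadm (M + 2) a \<xi>"
  shows "C_on M U (\<lambda>x. Re (tsum a \<xi> x))"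
proof -
  have d: "iter_partial ds (\<lambda>x. Re (tsum a \<xi> x)) differentiable (at x)" if "length ds \<le> M" for ds x
  proof -
    have "tadm (length ds + 1) a \<xi>" "tadm (2 + length ds) a \<xi>"
      by (rule tadm_mono[OF assms], use that in simp)+
    then show ?thesis by (simp add: iter_partial_tsum tsum_differentiable tadm_tdiff)
  qed
  then have "continuous_on U (iter_partial ds (\<lambda>x. Re (tsum a \<xi> x)))" if "length ds \<le> M" for ds
    using that by (meson continuous_at_imp_continuous_on differentiable_imp_continuous_within)
  then show ?thesis using d unfolding C_on_def by auto
qed

lemma iter_partial_tsum_bound:
  assumes "tadm (M + 2) a \<xi>" "length ds \<le> M"
  shows "\<bar>iter_partial ds (\<lambda>x. Re (tsum a \<xi> x)) x\<bar> \<le> tnorm M a \<xi>"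
proof -
  have t: "tadm (length ds + 1) a \<xi>" "tadm (0 + length ds) a \<xi>" "tadm M a \<xi>"
    by (rule tadm_mono[OF assms(1)], use assms(2) in simp)+
  have "\<bar>Re (tsum (tdiff ds a \<xi>) \<xi> x)\<bar> \<le> cmod (tsum (tdiff ds a \<xi>) \<xi> x)" by (rule abs_Re_le_cmod)
  also have "\<dots> \<le> tnorm 0 (tdiff ds a \<xi>) \<xi>" by (rule tsum_bound[OF tadm_tdiff(1)[OF t(2)]])
  also have "\<dots> \<le> tnorm (0 + length ds) a \<xi>" by (rule tadm_tdiff(2)[OF t(2)])
  also have "\<dots> \<le> tnorm M a \<xi>" using tadm_mono(2)[OF t(3), of "length ds"] assms(2) by simp
  finally show ?thesis using iter_partial_tsum[OF t(1)] by simp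
qed

lemma tsum_continuous_on:
  assumes "tadm 2 a \<xi>"
  shows "continuous_on U (\<lambda>x. Re (tsum a \<xi> x))"
  using tsum_C_on[of 0 a \<xi> U] assms by (simp add: C_on_0 numeral_2_eq_2)

section \<open>The operator acts diagonally on trigonometric series\<close>

lemma tadm_lam:
  fixes \<xi> :: "'i \<Rightarrow> real ^ 'n::finite"
  assumes s: "0 < s" "s < 1" and a: "tadm 2 a \<xi>"
  shows "tadm 0 (\<lambda>i. of_real (lam s (\<xi> i)) * a i) \<xi>"
    "tnorm 0 (\<lambda>i. of_real (lam s (\<xi> i)) * a i) \<xi>
      \<le> 2 * (\<integral>z. min 1 ((norm (z :: real^'n))^2) * fker s z \<partial>lborel) * tnorm 2 a \<xi>"
proof -
  define I where "I = (\<integral>z. min 1 ((norm (z :: real^'n))^2) * fker s z \<partial>lborel)"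
  have I0: "0 \<le> I" unfolding I_def by (intro Bochner_Integration.integral_nonneg) simp
  have "cmod (of_real (lam s (\<xi> i)) * a i) * (1 + norm (\<xi> i)) ^ 0 \<le> (2 * I) * (cmod (a i) * (1 + norm (\<xi> i)) ^ 2)" for i
  proof -
    have "lam s (\<xi> i) \<le> (2 + (norm (\<xi> i))^2) * I" using lam_le[OF s, of "\<xi> i"] by (simp add: I_def)
    also have "\<dots> \<le> (2 * (1 + norm (\<xi> i))^2) * I"
      by (intro mult_right_mono I0) (auto simp: power2_eq_square algebra_simps)
    finally have l: "lam s (\<xi> i) \<le> 2 * (1 + norm (\<xi> i))^2 * I" .
    show ?thesis
      using lam_nonneg[of s "\<xi> i"] mult_right_mono[OF l, of "cmod (a i)"]
      by (simp add: norm_mult mult_ac)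
  qed
  from tadm_bounded[OF a this] show "tadm 0 (\<lambda>i. of_real (lam s (\<xi> i)) * a i) \<xi>"
    "tnorm 0 (\<lambda>i. of_real (lam s (\<xi> i)) * a i) \<xi>
      \<le> 2 * (\<integral>z. min 1 ((norm (z :: real^'n))^2) * fker s z \<partial>lborel) * tnorm 2 a \<xi>"
    by (simp_all add: I_def)
qed

text \<open>Each exponential is an eigenfunction with eigenvalue \<open>lam s (\<xi> i)\<close>.
  Weight 2 makes the termwise second differences at most a summable \<open>g i\<close> times
  \<open>min 1 ((norm z)^2)\<close>, uniformly in \<open>z\<close>, so the sum may be taken out of
  the integral.\<close>

lemma tsum_has_frac_laplacian:
  fixes \<xi> :: "'i \<Rightarrow> real ^ 'n::finite"
  assumes s: "0 < s" "s < 1" and a: "tadm 2 a \<xi>"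
  shows "has_frac_laplacian s (\<lambda>x. Re (tsum a \<xi> x)) x (Re (tsum (\<lambda>i. of_real (lam s (\<xi> i)) * a i) \<xi> x))"
proof -
  have a0: "tadm 0 a \<xi>" by (rule tadm_mono[OF a]) simp
  define W where "W x = Re (tsum a \<xi> x)" for x
  define c where "c i = Re (a i * cis (\<xi> i \<bullet> x))" for i
  have c: "\<bar>c i\<bar> \<le> cmod (a i)" for i
    using abs_Re_le_cmod[of "a i * cis (\<xi> i \<bullet> x)"] by (simp add: c_def norm_mult)
  define m where "m z = min 1 ((norm (z::real^'n))^2)" for z
  have m0: "0 \<le> m z" for z by (simp add: m_def)
  define g where "g i = 4 * (cmod (a i) * (1 + norm (\<xi> i)) ^ 2)" for i
  have g: "g summable_on UNIV"
    using a unfolding tadm_def g_def by (rule summable_on_cmult_right)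
  define D where "D z = 2 * W x - W (x + z) - W (x - z)" for z
  \<comment> \<open>The second difference of one exponential: the sine parts at \<open>z\<close> and
    \<open>- z\<close> cancel and \<open>1 - cos\<close> remains.\<close>
  define f where "f z i = c i * (2 * (1 - cos (\<xi> i \<bullet> z)))" for z i
  have fg: "norm (f z i) \<le> g i * m z" for z i
  proof -
    have "\<bar>c i\<bar> * (2 * (1 - cos (\<xi> i \<bullet> z))) \<le> cmod (a i) * (2 * ((2 + (norm (\<xi> i))^2) * m z))"
      using one_minus_cos_inner_le[of "\<xi> i" z] by (intro mult_mono c) (auto simp: m_def)
    also have "\<dots> \<le> cmod (a i) * (2 * (2 * (1 + norm (\<xi> i)) ^ 2 * m z))"
      by (intro mult_left_mono mult_right_mono m0) (auto simp: power2_eq_square algebra_simps)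
    finally show ?thesis by (simp add: f_def g_def abs_mult mult_ac)
  qed
  have D: "D z = (\<Sum>\<^sub>\<infinity>i. f z i)" for z
  proof -
    have "D z = Re (2 * tsum a \<xi> x - tsum a \<xi> (x + z) - tsum a \<xi> (x - z))"
      by (simp add: D_def W_def)
    also have "2 * tsum a \<xi> x - tsum a \<xi> (x + z) - tsum a \<xi> (x - z)
       = (\<Sum>\<^sub>\<infinity>i. 2 * (a i * cis (\<xi> i \<bullet> x)) - a i * cis (\<xi> i \<bullet> (x + z)) - a i * cis (\<xi> i \<bullet> (x - z)))"
      unfolding tsum_def
      by (rule infsumI[symmetric, OF has_sum_minus[OF has_sum_minus[OF has_sum_cmult_right]]])
         (simp_all add: tsum_summable[OF a0])
    also have "Re \<dots> = (\<Sum>\<^sub>\<infinity>i. Re (2 * (a i * cis (\<xi> i \<bullet> x)) - a i * cis (\<xi> i \<bullet> (x + z)) - a i * cis (\<xi> i \<bullet> (x - z))))"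
      by (rule infsum_Re[symmetric])
         (intro summable_on_minus summable_on_cmult_right tsum_summable[OF a0])
    also have "\<dots> = (\<Sum>\<^sub>\<infinity>i. f z i)"
      by (rule infsum_cong)
         (simp add: f_def c_def inner_add_right inner_diff_right cos_add cos_diff sin_add sin_diff algebra_simps)
    finally show ?thesis .
  qed
  have gm: "(\<lambda>i. g i * m z) summable_on UNIV" for z by (rule summable_on_cmult_left[OF g])
  have Dle: "\<bar>D z\<bar> \<le> infsum g UNIV * m z" for z
    using norm_infsum_le_infsum[OF gm fg, of z] by (simp add: D infsum_cmult_left')
  have Dtail: "\<bar>D z - sum (f z) F\<bar> \<le> (infsum g UNIV - sum g F) * m z" if "finite F" for z F
    using infsum_tail_bound[OF gm fg that, of z] by (simp add: D infsum_cmult_left' left_diff_distrib sum_distrib_right)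
  have Wc: "continuous_on UNIV W" unfolding W_def by (rule tsum_continuous_on[OF a])
  then have [measurable]: "W \<in> borel_measurable borel" by (rule borel_measurable_continuous_onI)
  have [measurable]: "D \<in> borel_measurable borel" unfolding D_def by measurable
  have W: "\<bar>W y\<bar> \<le> tnorm 0 a \<xi>" for y
    using tsum_bound[OF a0, of y] abs_Re_le_cmod[of "tsum a \<xi> y"] by (simp add: W_def)
  have h: "has_frac_laplacian s W x ((\<integral>z. D z * fker s z \<partial>lborel) / 2)"
    unfolding D_def by (rule has_frac_laplacian_second_difference[OF s _ W Dle[unfolded D_def m_def]]) measurable
  have im: "integrable lborel (\<lambda>z. m z * fker s z)" unfolding m_def by (rule integrable_min_fker[OF s])
  have iD: "integrable lborel (\<lambda>z. D z * fker s z)"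
  proof (rule Bochner_Integration.integrable_bound)
    show "integrable lborel (\<lambda>z. infsum g UNIV * (m z * fker s z))" using im by simp
    show "AE z in lborel. norm (D z * fker s z) \<le> norm (infsum g UNIV * (m z * fker s z))"
    proof (rule AE_I2)
      fix z
      have "\<bar>D z * fker s z\<bar> \<le> infsum g UNIV * (m z * fker s z)"
        using mult_right_mono[OF Dle[of z], of "fker s z"] by (simp only: abs_mult mult.assoc fker_nonneg abs_of_nonneg)
      also have "\<dots> \<le> \<bar>infsum g UNIV * (m z * fker s z)\<bar>" by (rule abs_ge_self)
      finally show "norm (D z * fker s z) \<le> norm (infsum g UNIV * (m z * fker s z))" by simp
    qed
  qed measurable
  have if': "integrable lborel (\<lambda>z. sum (f z) F * fker s z)"
    and If: "(\<integral>z. sum (f z) F * fker s z \<partial>lborel) = 2 * (\<Sum>i\<in>F. c i * lam s (\<xi> i))" for F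
  proof -
    have e: "sum (f z) F * fker s z = (\<Sum>i\<in>F. 2 * c i * ((1 - cos (\<xi> i \<bullet> z)) * fker s z))" for z
      unfolding f_def sum_distrib_right by (intro sum.cong) (auto simp: algebra_simps)
    show "integrable lborel (\<lambda>z. sum (f z) F * fker s z)"
      unfolding e by (intro Bochner_Integration.integrable_sum integrable_mult_right lam_integrable s)
    show "(\<integral>z. sum (f z) F * fker s z \<partial>lborel) = 2 * (\<Sum>i\<in>F. c i * lam s (\<xi> i))"
    proof -
      have "(\<integral>z. sum (f z) F * fker s z \<partial>lborel) = (\<Sum>i\<in>F. \<integral>z. 2 * c i * ((1 - cos (\<xi> i \<bullet> z)) * fker s z) \<partial>lborel)"
        unfolding e by (intro Bochner_Integration.integral_sum integrable_mult_right lam_integrable s)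
      also have "\<dots> = (\<Sum>i\<in>F. 2 * c i * lam s (\<xi> i))"
        by (simp only: integral_mult_right_zero lam_def)
      finally show ?thesis by (simp add: sum_distrib_left mult.assoc)
    qed
  qed
  define I where "I = (\<integral>z. m z * fker s z \<partial>lborel)"
  \<comment> \<open>For each finite \<open>F\<close> the error is the integral of the tail of the
    series, at most the tail of \<open>g\<close> times \<open>I\<close>, which tends to 0.\<close>
  have "((\<lambda>i. c i * lam s (\<xi> i)) has_sum ((\<integral>z. D z * fker s z \<partial>lborel) / 2)) UNIV"
    unfolding has_sum_def
  proof (rule Lim_null[THEN iffD2], rule Lim_null_comparison)
    show "\<forall>\<^sub>F F in finite_subsets_at_top UNIV.
       norm ((\<Sum>i\<in>F. c i * lam s (\<xi> i)) - (\<integral>z. D z * fker s z \<partial>lborel) / 2) \<le> (infsum g UNIV - sum g F) * I"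
    proof (rule eventually_finite_subsets_at_top_weakI)
      fix F :: "'i set" assume F: "finite F"
      have t0: "0 \<le> infsum g UNIV - sum g F"
        using finite_sum_le_infsum[OF g F] by (simp add: g_def)
      have "\<bar>(\<integral>z. D z * fker s z \<partial>lborel) - (\<integral>z. sum (f z) F * fker s z \<partial>lborel)\<bar>
         = \<bar>\<integral>z. (D z - sum (f z) F) * fker s z \<partial>lborel\<bar>"
        using iD if' by (simp add: left_diff_distrib)
      also have "\<dots> \<le> (\<integral>z. (infsum g UNIV - sum g F) * (m z * fker s z) \<partial>lborel)"
      proof (rule integral_abs_bound_integral)
        show "integrable lborel (\<lambda>z. (D z - sum (f z) F) * fker s z)"
          using iD if' by (simp add: left_diff_distrib)
        show "integrable lborel (\<lambda>z. (infsum g UNIV - sum g F) * (m z * fker s z))" using im by simp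
        show "\<bar>(D z - sum (f z) F) * fker s z\<bar> \<le> (infsum g UNIV - sum g F) * (m z * fker s z)" for z
          using mult_right_mono[OF Dtail[OF F, of z], of "fker s z"] by (simp add: abs_mult mult.assoc)
      qed
      finally have "\<bar>(\<integral>z. D z * fker s z \<partial>lborel) - 2 * (\<Sum>i\<in>F. c i * lam s (\<xi> i))\<bar> \<le> (infsum g UNIV - sum g F) * I"
        by (simp add: If I_def)
      moreover have "0 \<le> (infsum g UNIV - sum g F) * I"
        using t0 m0 by (auto simp: I_def intro!: mult_nonneg_nonneg Bochner_Integration.integral_nonneg)
      ultimately show "norm ((\<Sum>i\<in>F. c i * lam s (\<xi> i)) - (\<integral>z. D z * fker s z \<partial>lborel) / 2) \<le> (infsum g UNIV - sum g F) * I"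
        by (simp add: abs_if split: if_splits)
    qed
    show "((\<lambda>F. (infsum g UNIV - sum g F) * I) \<longlongrightarrow> 0) (finite_subsets_at_top UNIV)"
      using tendsto_mult_right[OF infsum_tail_tendsto_0[OF g], of I] by simp
  qed
  then have sum: "(\<Sum>\<^sub>\<infinity>i. c i * lam s (\<xi> i)) = (\<integral>z. D z * fker s z \<partial>lborel) / 2" by (rule infsumI)
  have "tadm 0 (\<lambda>i. of_real (lam s (\<xi> i)) * a i) \<xi>" by (rule tadm_lam(1)[OF s a])
  from tsum_summable[OF this, of x]
  have "Re (tsum (\<lambda>i. of_real (lam s (\<xi> i)) * a i) \<xi> x) = (\<Sum>\<^sub>\<infinity>i. Re (of_real (lam s (\<xi> i)) * a i * cis (\<xi> i \<bullet> x)))"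
    unfolding tsum_def by (rule infsum_Re[symmetric])
  also have "\<dots> = (\<Sum>\<^sub>\<infinity>i. c i * lam s (\<xi> i))"
    by (rule infsum_cong) (simp add: c_def algebra_simps)
  also have "\<dots> = (\<integral>z. D z * fker s z \<partial>lborel) / 2" by (rule sum)
  finally show ?thesis using h unfolding W_def[abs_def] by (simp only:)
qed

subsection \<open>Products and reindexing\<close>

lemma summable_on_product_nonneg:
  fixes f :: "'i \<Rightarrow> real" and g :: "'j \<Rightarrow> real"
  assumes "f summable_on UNIV" "g summable_on UNIV" "\<And>i. 0 \<le> f i" "\<And>j. 0 \<le> g j"
  shows "(\<lambda>(i, j). f i * g j) summable_on UNIV"
    "infsum (\<lambda>(i, j). f i * g j) UNIV = infsum f UNIV * infsum g UNIV"
proof -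
  have hs: "((\<lambda>j. f i * g j) has_sum (f i * infsum g UNIV)) UNIV" for i
    by (intro has_sum_cmult_right has_sum_infsum assms)
  have "(\<lambda>(i, j). f i * g j) summable_on (SIGMA i:UNIV. UNIV)"
    by (rule summable_on_SigmaI[where g="\<lambda>i. f i * infsum g UNIV"])
       (use hs assms in \<open>auto intro: summable_on_cmult_left\<close>)
  then show s: "(\<lambda>(i, j). f i * g j) summable_on UNIV" by simp
  have "((\<lambda>(i, j). f i * g j) has_sum (infsum f UNIV * infsum g UNIV)) (SIGMA i:UNIV. UNIV)"
    by (rule has_sum_SigmaI[where g="\<lambda>i. f i * infsum g UNIV"])
       (use s hs assms in \<open>auto intro: has_sum_cmult_left\<close>)
  then show "infsum (\<lambda>(i, j). f i * g j) UNIV = infsum f UNIV * infsum g UNIV"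
    by (intro infsumI) simp
qed

text \<open>Frequencies add and coefficients multiply. The norm is submultiplicative because
  \<open>1 + norm (\<xi> + \<eta>)\<close> is at most
  \<open>(1 + norm \<xi>) * (1 + norm \<eta>)\<close>.\<close>

lemma tsum_product:
  fixes a :: "'i \<Rightarrow> complex" and b :: "'j \<Rightarrow> complex" and \<xi> :: "'i \<Rightarrow> real ^ 'n::finite"
  assumes a: "tadm M a \<xi>" and b: "tadm M b \<eta>"
  defines "c \<equiv> \<lambda>(i, j). a i * b j" and "\<zeta> \<equiv> \<lambda>(i, j). \<xi> i + \<eta> j"
  shows "tadm M c \<zeta>" "tnorm M c \<zeta> \<le> tnorm M a \<xi> * tnorm M b \<eta>"
    "tsum c \<zeta> x = tsum a \<xi> x * tsum b \<eta> x"
proof -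
  define A where "A i = cmod (a i) * (1 + norm (\<xi> i)) ^ M" for i
  define B where "B j = cmod (b j) * (1 + norm (\<eta> j)) ^ M" for j
  have AB: "A summable_on UNIV" "B summable_on UNIV" using a b unfolding tadm_def A_def B_def .
  have AB0: "0 \<le> A i" "0 \<le> B j" for i j by (simp_all add: A_def B_def)
  note P = summable_on_product_nonneg[OF AB AB0]
  have le: "cmod (c p) * (1 + norm (\<zeta> p)) ^ M \<le> (\<lambda>(i, j). A i * B j) p" for p
  proof (cases p)
    case (Pair i j)
    have "1 + norm (\<xi> i + \<eta> j) \<le> (1 + norm (\<xi> i)) * (1 + norm (\<eta> j))"
      using norm_triangle_ineq[of "\<xi> i" "\<eta> j"] mult_nonneg_nonneg[OF norm_ge_zero norm_ge_zero, of "\<xi> i" "\<eta> j"]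
      by (simp add: algebra_simps del: norm_ge_zero mult_nonneg_nonneg)
    then have "(1 + norm (\<xi> i + \<eta> j)) ^ M \<le> ((1 + norm (\<xi> i)) * (1 + norm (\<eta> j))) ^ M"
      by (intro power_mono) auto
    then have "cmod (a i) * cmod (b j) * (1 + norm (\<xi> i + \<eta> j)) ^ M \<le> cmod (a i) * cmod (b j) * ((1 + norm (\<xi> i)) * (1 + norm (\<eta> j))) ^ M"
      by (intro mult_left_mono) auto
    then show ?thesis unfolding Pair c_def \<zeta>_def A_def B_def
      by (simp add: norm_mult power_mult_distrib mult_ac)
  qed
  show c: "tadm M c \<zeta>" unfolding tadm_def
    by (rule summable_on_bounded[OF P(1)]) (use le in simp)
  then show "tnorm M c \<zeta> \<le> tnorm M a \<xi> * tnorm M b \<eta>"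
    using infsum_mono[OF _ P(1) le] P(2) by (simp add: tadm_def tnorm_def A_def B_def)
  have c0: "tadm 0 c \<zeta>" and a0: "tadm 0 a \<xi>" and b0: "tadm 0 b \<eta>"
    using tadm_mono(1)[OF c] tadm_mono(1)[OF a] tadm_mono(1)[OF b] by auto
  have "(\<lambda>p. c p * cis (\<zeta> p \<bullet> x)) summable_on (UNIV \<times> UNIV)"
    using tsum_summable[OF c0, of x] by simp
  from infsum_Sigma_banach[OF this]
  have "tsum c \<zeta> x = (\<Sum>\<^sub>\<infinity>i. \<Sum>\<^sub>\<infinity>j. c (i, j) * cis (\<zeta> (i, j) \<bullet> x))"
    by (simp add: tsum_def)
  also have "\<dots> = (\<Sum>\<^sub>\<infinity>i. \<Sum>\<^sub>\<infinity>j. (a i * cis (\<xi> i \<bullet> x)) * (b j * cis (\<eta> j \<bullet> x)))"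
    by (intro infsum_cong) (simp add: c_def \<zeta>_def inner_add_left cis_mult[symmetric] mult_ac)
  also have "\<dots> = tsum a \<xi> x * tsum b \<eta> x"
    by (simp add: tsum_def infsum_cmult_right' infsum_cmult_left')
  finally show "tsum c \<zeta> x = tsum a \<xi> x * tsum b \<eta> x" .
qed

lemma infsum_eqI_has_sum:
  fixes f :: "'i \<Rightarrow> 'b::{comm_monoid_add,t2_space}"
  assumes "\<And>S. (f has_sum S) A \<longleftrightarrow> (g has_sum S) B"
  shows "infsum f A = infsum g B"
proof (cases "f summable_on A")
  case True
  then have "(g has_sum infsum f A) B" using assms has_sum_infsum by blast
  then show ?thesis by (simp add: infsumI)
next
  case False
  then have "\<not> g summable_on B" using assms unfolding summable_on_def by blast
  with False show ?thesis by (simp add: infsum_not_exists)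
qed

text \<open>Every product changes the index type to a product type; returning to \<open>nat\<close>
  allows an induction over the factors of a monomial. Naturals that encode no index get coefficient
  0, so statements about frequencies are made only where the coefficient is nonzero.\<close>

lemma tsum_reindex:
  fixes a :: "'i::countable \<Rightarrow> complex" and \<xi> :: "'i \<Rightarrow> real ^ 'n::finite"
  obtains a' :: "nat \<Rightarrow> complex" and \<xi>' where
    "\<And>M. tadm M a' \<xi>' \<longleftrightarrow> tadm M a \<xi>" "\<And>M. tnorm M a' \<xi>' = tnorm M a \<xi>"
    "\<And>x. tsum a' \<xi>' x = tsum a \<xi> x" "\<And>n. a' n \<noteq> 0 \<Longrightarrow> \<exists>i. a' n = a i \<and> \<xi>' n = \<xi> i"
proof -
  define a' where "a' n = (if n \<in> range (to_nat :: 'i \<Rightarrow> nat) then a (from_nat n) else 0)" for n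
  define \<xi>' where "\<xi>' n = \<xi> (from_nat n)" for n :: nat
  have key: "(F has_sum S) UNIV \<longleftrightarrow> ((\<lambda>i::'i. F (to_nat i)) has_sum S) UNIV"
    if "\<And>n. n \<notin> range (to_nat :: 'i \<Rightarrow> nat) \<Longrightarrow> F n = 0" for F :: "nat \<Rightarrow> 'b::{comm_monoid_add,topological_space}" and S
  proof -
    have "(F has_sum S) UNIV \<longleftrightarrow> (F has_sum S) (range (to_nat :: 'i \<Rightarrow> nat))"
      by (rule has_sum_cong_neutral) (use that in auto)
    also have "\<dots> \<longleftrightarrow> ((F \<circ> to_nat) has_sum S) (UNIV :: 'i set)"
      by (rule has_sum_reindex) simp
    finally show ?thesis by (simp add: comp_def)
  qed
  show thesis
  proof
    fix M
    let ?F = "\<lambda>n. cmod (a' n) * (1 + norm (\<xi>' n)) ^ M"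
    have F: "(?F has_sum S) UNIV \<longleftrightarrow> ((\<lambda>i. cmod (a i) * (1 + norm (\<xi> i)) ^ M) has_sum S) UNIV" for S
      by (subst key) (auto simp: a'_def \<xi>'_def)
    show "tadm M a' \<xi>' \<longleftrightarrow> tadm M a \<xi>"
      unfolding tadm_def summable_on_def F ..
    show "tnorm M a' \<xi>' = tnorm M a \<xi>"
      unfolding tnorm_def by (rule infsum_eqI_has_sum[OF F])
  next
    fix x
    let ?F = "\<lambda>n. a' n * cis (\<xi>' n \<bullet> x)"
    have F: "(?F has_sum S) UNIV \<longleftrightarrow> ((\<lambda>i. a i * cis (\<xi> i \<bullet> x)) has_sum S) UNIV" for S
      by (subst key) (auto simp: a'_def \<xi>'_def)
    show "tsum a' \<xi>' x = tsum a \<xi> x"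
      unfolding tsum_def by (rule infsum_eqI_has_sum[OF F])
  next
    show "\<exists>i. a' n = a i \<and> \<xi>' n = \<xi> i" if "a' n \<noteq> 0" for n
      using that by (auto simp: a'_def \<xi>'_def split: if_splits)
  qed
qed

subsection \<open>A smooth Fourier series equal to 1 near the origin\<close>

text \<open>It is used in two ways: averaging a cosine series over a window is a difference quotient
  of its antiderivative, and integrating a series equal to 1 yields a series equal to
  \<open>t\<close>.\<close>

lemma sin_series_has_field_derivative:
  fixes c \<kappa> :: "nat \<Rightarrow> real"
  assumes c: "summable (\<lambda>i. \<bar>c i\<bar>)" and \<kappa>: "\<And>i. 1 \<le> \<kappa> i"
  shows "((\<lambda>t. \<Sum>i. c i * sin (\<kappa> i * t) / \<kappa> i) has_field_derivative (\<Sum>i. c i * cos (\<kappa> i * t))) (at t)"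
proof (rule has_field_derivative_series'(2)[where S=UNIV and ?x0.0="0::real" and x=t
    and f="\<lambda>i t. c i * sin (\<kappa> i * t) / \<kappa> i" and f'="\<lambda>i t. c i * cos (\<kappa> i * t)"])
  fix n :: nat and x :: real
  have "\<kappa> n \<noteq> 0" using \<kappa>[of n] by linarith
  then show "((\<lambda>t. c n * sin (\<kappa> n * t) / \<kappa> n) has_field_derivative c n * cos (\<kappa> n * x)) (at x within UNIV)"
    by (auto intro!: derivative_eq_intros)
next
  show "uniformly_convergent_on UNIV (\<lambda>n x. \<Sum>i<n. c i * cos (\<kappa> i * x))"
    by (rule Weierstrass_m_test'[OF _ c]) (simp add: abs_mult mult_left_le)
qed auto

text \<open>This is the square wave as a boundary value: on the right half of the unit circle
  \<open>(1 - \<i> * z) / (1 + \<i> * z)\<close> is a positive multiple of \<open>- \<i>\<close>, so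
  its logarithm has constant imaginary part.\<close>

lemma Re_Arctan_cis:
  assumes "0 < cos t"
  shows "Re (Arctan (cis t)) = pi / 4"
proof -
  have s1: "sin t < 1"
  proof (rule ccontr)
    assume "\<not> sin t < 1"
    then have "sin t = 1" using sin_le_one[of t] by linarith
    then have "cos t = 0" using sin_cos_squared_add[of t] by simp
    then show False using assms by simp
  qed
  define q where "q = cos t / (1 - sin t)"
  have q: "q > 0" using assms s1 by (simp add: q_def)
  have nz: "1 + \<i> * cis t \<noteq> 0" using s1 by (auto simp: complex_eq_iff)
  have "q * cos t = 1 + sin t" 
  proof -
    have "(cos t)^2 = (1 + sin t) * (1 - sin t)"
      using sin_cos_squared_add[of t] by (simp add: power2_eq_square algebra_simps)
    then show ?thesis using s1 by (simp add: q_def power2_eq_square)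
  qed
  moreover have "q * (1 - sin t) = cos t" using s1 by (simp add: q_def)
  ultimately have "1 - \<i> * cis t = of_real q * (- \<i>) * (1 + \<i> * cis t)"
    by (simp add: complex_eq_iff algebra_simps)
  then have "(1 - \<i> * cis t) / (1 + \<i> * cis t) = of_real q * (- \<i>)" using nz by simp
  then show ?thesis
    using Ln_times_of_real[OF q, of "- \<i>"] q by (simp add: Arctan_def Ln_of_real)
qed

text \<open>\<open>Arctan\<close> is singular only on the imaginary axis outside the open unit disc.
  The sector \<open>\<bar>t\<bar> \<le> T < pi / 2\<close> avoids this set up to radius 1, and
  uniform continuity on a compact set gives the radial limit uniformly in \<open>t\<close>.\<close>

lemma Re_Arctan_limit:
  assumes T: "0 \<le> T" "T < pi / 2" and e: "0 < e"
  shows "\<forall>\<^sub>F r in at_left 1. \<forall>t. \<bar>t\<bar> \<le> T \<longrightarrow> \<bar>Re (Arctan (of_real r * cis t)) - pi / 4\<bar> \<le> e"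
proof -
  define f where "f p = Arctan (of_real (fst p) * cis (snd p))" for p :: "real \<times> real"
  have cosp: "0 < cos t" if "\<bar>t\<bar> \<le> T" for t
    using that T by (intro cos_gt_zero_pi) auto
  have "continuous_on ({0..1} \<times> {-T..T}) f"
    unfolding f_def
  proof (rule continuous_on_compose2[of "(\<lambda>p. of_real (fst p) * cis (snd p)) ` ({0..1} \<times> {-T..T})" Arctan])
    show "continuous_on ((\<lambda>p. complex_of_real (fst p) * cis (snd p)) ` ({0..1} \<times> {-T..T})) Arctan"
    proof (rule continuous_on_Arctan)
      fix z assume z: "z \<in> (\<lambda>p. complex_of_real (fst p) * cis (snd p)) ` ({0..1} \<times> {-T..T})" "Re z = 0"
      then obtain p where p: "p \<in> {0..1} \<times> {-T..T}" "z = of_real (fst p) * cis (snd p)" by blast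
      define r where "r = fst p"
      define t where "t = snd p"
      have rt: "\<bar>t\<bar> \<le> T" "z = of_real r * cis t" using p by (auto simp: r_def t_def abs_le_iff)
      then have "r * cos t = 0" using z(2) by simp
      then have "r = 0" using cosp[OF rt(1)] by simp
      then show "\<bar>Im z\<bar> < 1" using rt by simp
    qed
  qed (auto intro!: continuous_intros continuous_on_compose2[OF continuous_on_cis])
  then have uc: "uniformly_continuous_on ({0..1} \<times> {-T..T}) f"
    by (rule compact_uniformly_continuous) (intro compact_Times compact_Icc)
  then obtain d where d: "d > 0" "\<And>p p'. p \<in> {0..1} \<times> {-T..T} \<Longrightarrow> p' \<in> {0..1} \<times> {-T..T} \<Longrightarrow> dist p' p < d \<Longrightarrow> dist (f p') (f p) < e"
    unfolding uniformly_continuous_on_def using e by blast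
  have "\<forall>\<^sub>F r in at_left 1. r \<in> {max 0 (1 - d) <..< 1}"
    using d(1) by (intro eventually_at_left_field[THEN iffD2]) (auto intro!: exI[of _ "max 0 (1 - d)"])
  then show ?thesis
  proof eventually_elim
    case (elim r)
    show ?case
    proof (intro allI impI)
      fix t assume t: "\<bar>t\<bar> \<le> T"
      have "dist (f (r, t)) (f (1, t)) < e"
        using elim t by (intro d(2)) (auto simp: dist_Pair_Pair dist_real_def)
      moreover have "\<bar>Re (f (r, t)) - Re (f (1, t))\<bar> \<le> dist (f (r, t)) (f (1, t))"
        using abs_Re_le_cmod[of "f (r, t) - f (1, t)"] by (simp add: dist_norm)
      ultimately show "\<bar>Re (Arctan (of_real r * cis t)) - pi / 4\<bar> \<le> e"
        using Re_Arctan_cis[OF cosp[OF t]] by (simp add: f_def)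
    qed
  qed
qed

text \<open>The series of the square wave is made rapidly convergent by repeatedly averaging over windows of
  half-width \<open>h\<close>, which multiplies the coefficients by \<open>sn\<close> and does not change the sum away from the jumps.\<close>

lemma smooth_cos_series:
  "\<exists>d :: nat \<Rightarrow> real. summable (\<lambda>i. \<bar>d i\<bar> * (2 * real i + 2) ^ M) \<and>
     (\<forall>t. \<bar>t\<bar> \<le> 1 \<longrightarrow> (\<Sum>i. d i * cos ((2 * real i + 1) * t)) = 1)"
proof -
  \<comment> \<open>The estimate starts on \<open>\<bar>t\<bar> \<le> 5/4\<close>, inside
    \<open>pi / 2\<close>. Each averaging costs \<open>h\<close>, so \<open>M + 1\<close> of them
    cost 1/4 and leave \<open>\<bar>t\<bar> \<le> 1\<close>.\<close>
  define h where "h = 1 / (4 * (real M + 1))"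
  have h: "h > 0" "real (M + 1) * h = 1 / 4" by (simp_all add: h_def)
  define \<kappa> where "\<kappa> i = 2 * real i + 1" for i
  have \<kappa>: "1 \<le> \<kappa> i" for i by (simp add: \<kappa>_def)
  define sn where "sn i = sin (\<kappa> i * h) / (\<kappa> i * h)" for i
  have sn1: "\<bar>sn i\<bar> \<le> 1" for i
    using abs_sin_x_le_abs_x[of "\<kappa> i * h"] h \<kappa>[of i] by (simp add: sn_def abs_mult divide_simps)
  have sn2: "\<bar>sn i\<bar> \<le> 1 / (\<kappa> i * h)" for i
    using abs_sin_le_one[of "\<kappa> i * h"] h \<kappa>[of i] by (simp add: sn_def abs_mult divide_simps)
  \<comment> \<open>The Abel factor with \<open>r < 1\<close> makes the slowly decaying square wave
    series absolutely convergent, so that termwise integration is legitimate; \<open>r\<close> tends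
    to 1 only at the end.\<close>
  define c where "c j r i = (-1) ^ i * r ^ (2 * i + 1) / \<kappa> i * sn i ^ j" for j i :: nat and r :: real
  have c_le: "\<bar>c j r i\<bar> \<le> r ^ i" if "0 < r" "r < 1" for j r i
  proof -
    have "\<bar>c j r i\<bar> = r ^ (2 * i + 1) / \<kappa> i * \<bar>sn i\<bar> ^ j"
      using that \<kappa>[of i] by (simp add: c_def abs_mult power_abs)
    also have "\<dots> \<le> r ^ (2 * i + 1) / 1 * 1"
      using that \<kappa>[of i] sn1[of i] by (intro mult_mono divide_left_mono power_le_one) auto
    also have "\<dots> = r ^ (2 * i + 1)" by simp
    also have "\<dots> \<le> r ^ i" by (rule power_decreasing) (use that in auto)
    finally show ?thesis .
  qed
  have sum_c: "summable (\<lambda>i. \<bar>c j r i\<bar>)" if "0 < r" "r < 1" for j r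
    by (rule summable_comparison_test'[of "\<lambda>i. r ^ i"]) (use that c_le in \<open>auto intro: summable_geometric\<close>)
  define G where "G j r t = (\<Sum>i. c j r i * cos (\<kappa> i * t))" for j r t
  have G0: "G 0 r t = Re (Arctan (of_real r * cis t))" if "0 < r" "r < 1" for r t
  proof -
    have "norm (of_real r * cis t) < 1" using that by (simp add: norm_mult)
    from sums_Re[OF Arctan_series(2)[OF this]]
    have "(\<lambda>n. Re ((-1) ^ n / of_nat (2 * n + 1) * (of_real r * cis t) ^ (2 * n + 1))) sums Re (Arctan (of_real r * cis t))" .
    moreover have "Re ((-1) ^ n / of_nat (2 * n + 1) * (of_real r * cis t) ^ (2 * n + 1)) = c 0 r n * cos (\<kappa> n * t)" for n
    proof -
      have "(-1) ^ n / of_nat (2 * n + 1) * (of_real r * cis t) ^ (2 * n + 1)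
          = of_real ((-1) ^ n * r ^ (2 * n + 1) / \<kappa> n) * cis (\<kappa> n * t)"
        by (simp only: power_mult_distrib Complex.DeMoivre) (simp add: \<kappa>_def add_ac)
      then show ?thesis by (simp add: c_def)
    qed
    ultimately show ?thesis by (simp add: G_def sums_iff)
  qed
  have smooth: "\<bar>G j r t - p\<bar> \<le> E"
    if r: "0 < r" "r < 1" and E: "\<And>t. \<bar>t\<bar> \<le> 5/4 \<Longrightarrow> \<bar>G 0 r t - p\<bar> \<le> E" and t: "\<bar>t\<bar> \<le> 5/4 - real j * h" for j r t p E
    using t
  proof (induction j arbitrary: t)
    case 0
    then show ?case using E by simp
  next
    case (Suc j)
    \<comment> \<open>By the mean value theorem the window average of \<open>G j r\<close> at
      \<open>t\<close> is a value \<open>G j r z\<close> with \<open>z\<close> inside the window, so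
      it inherits the bound at once.\<close>
    define S where "S t = (\<Sum>i. c j r i * sin (\<kappa> i * t) / \<kappa> i)" for t
    have S': "(S has_field_derivative G j r t) (at t)" for t
      unfolding S_def G_def by (rule sin_series_has_field_derivative[OF sum_c[OF r] \<kappa>])
    have "t - h < t + h" using h by simp
    from MVT2[OF this S'] obtain z where z: "t - h < z" "z < t + h" "S (t + h) - S (t - h) = 2 * h * G j r z"
      by auto
    have sm: "summable (\<lambda>i. c j r i * sin (\<kappa> i * u) / \<kappa> i)" for u
    proof (rule summable_comparison_test'[OF sum_c[OF r, of j]])
      fix n
      have "\<bar>c j r n\<bar> * \<bar>sin (\<kappa> n * u)\<bar> / \<kappa> n \<le> \<bar>c j r n\<bar> * 1 / 1"
        using \<kappa>[of n] by (intro frac_le mult_left_mono) auto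
      then show "norm (c j r n * sin (\<kappa> n * u) / \<kappa> n) \<le> \<bar>c j r n\<bar>"
        using \<kappa>[of n] by (simp add: abs_mult)
    qed
    have "S (t + h) - S (t - h) = (\<Sum>i. c j r i * sin (\<kappa> i * (t + h)) / \<kappa> i - c j r i * sin (\<kappa> i * (t - h)) / \<kappa> i)"
      unfolding S_def by (rule suminf_diff[OF sm sm])
    also have "\<dots> = (\<Sum>i. 2 * h * (c (Suc j) r i * cos (\<kappa> i * t)))"
    proof (rule suminf_cong)
      fix i
      have "sin (\<kappa> i * (t + h)) - sin (\<kappa> i * (t - h)) = 2 * cos (\<kappa> i * t) * (sn i * (\<kappa> i * h))"
        using h \<kappa>[of i] by (simp add: sn_def distrib_left right_diff_distrib sin_add sin_diff)
      then have "c j r i * sin (\<kappa> i * (t + h)) / \<kappa> i - c j r i * sin (\<kappa> i * (t - h)) / \<kappa> i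
         = c j r i * (2 * cos (\<kappa> i * t) * (sn i * (\<kappa> i * h))) / \<kappa> i"
        by (simp add: diff_divide_distrib[symmetric] right_diff_distrib[symmetric])
      also have "\<dots> = 2 * h * (c (Suc j) r i * cos (\<kappa> i * t))"
        using \<kappa>[of i] by (simp add: c_def)
      finally show "c j r i * sin (\<kappa> i * (t + h)) / \<kappa> i - c j r i * sin (\<kappa> i * (t - h)) / \<kappa> i = \<dots>" .
    qed
    also have "\<dots> = 2 * h * G (Suc j) r t"
      unfolding G_def
    proof (rule suminf_mult)
      show "summable (\<lambda>i. c (Suc j) r i * cos (\<kappa> i * t))"
        by (rule summable_comparison_test'[OF sum_c[OF r, of "Suc j"]]) (simp add: abs_mult mult_left_le)
    qed
    finally have "G (Suc j) r t = G j r z" using z(3) h by simp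
    moreover have "\<bar>z\<bar> \<le> 5/4 - real j * h" using z Suc.prems by (simp add: algebra_simps abs_le_iff abs_if split: if_splits)
    ultimately show ?case using Suc.IH by simp
  qed
  \<comment> \<open>One factor \<open>1 / \<kappa> i\<close> from the square wave and
    \<open>M + 1\<close> from \<open>sn\<close> give decay of order \<open>M + 2\<close>; the weight
    of order \<open>M\<close> leaves a summable square. The factor \<open>4 / pi\<close> normalises
    the value \<open>pi / 4\<close> to 1.\<close>
  define j where "j = M + 1"
  define d where "d i = (4 / pi) * ((-1) ^ i / \<kappa> i * sn i ^ j)" for i
  define K where "K = (4 / pi) * (1 / h) ^ j * 2 ^ M"
  have d_le: "\<bar>d i\<bar> * (2 * real i + 2) ^ M \<le> K * (1 / real (Suc i) ^ 2)" for i
  proof -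
    have "\<bar>d i\<bar> = (4 / pi) * (1 / \<kappa> i * \<bar>sn i\<bar> ^ j)"
      using \<kappa>[of i] by (simp add: d_def abs_mult power_abs)
    also have "\<dots> \<le> (4 / pi) * (1 / \<kappa> i * (1 / (\<kappa> i * h)) ^ j)"
      using \<kappa>[of i] by (intro mult_left_mono power_mono sn2) auto
    also have "1 / \<kappa> i * (1 / (\<kappa> i * h)) ^ j = (1 / h) ^ j * (1 / \<kappa> i ^ (M + 2))"
      using \<kappa>[of i] h by (simp add: j_def power_one_over power_mult_distrib field_simps)
    finally have "\<bar>d i\<bar> \<le> (4 / pi) * (1 / h) ^ j * (1 / \<kappa> i ^ (M + 2))" by simp
    moreover have "(2 * real i + 2) ^ M \<le> (2 * \<kappa> i) ^ M"
      by (intro power_mono) (auto simp: \<kappa>_def)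
    ultimately have "\<bar>d i\<bar> * (2 * real i + 2) ^ M \<le> ((4 / pi) * (1 / h) ^ j * (1 / \<kappa> i ^ (M + 2))) * (2 * \<kappa> i) ^ M"
      using h by (intro mult_mono) auto
    also have "\<dots> = K * (1 / \<kappa> i ^ 2)"
      using \<kappa>[of i] by (simp add: K_def power_mult_distrib power_add power2_eq_square)
    also have "\<dots> \<le> K * (1 / real (Suc i) ^ 2)"
      using h by (intro mult_left_mono divide_left_mono power_mono) (auto simp: K_def \<kappa>_def)
    finally show ?thesis .
  qed
  have sq: "summable (\<lambda>i. 1 / real (Suc i) ^ 2)"
    using inverse_power_summable[of 2, where ?'a=real] by (subst summable_Suc_iff[of "\<lambda>i. 1 / real i ^ 2"]) (simp add: field_simps)
  have sd: "summable (\<lambda>i. \<bar>d i\<bar> * (2 * real i + 2) ^ M)"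
    by (rule summable_comparison_test'[OF summable_mult[OF sq, of K]]) (use d_le in simp)
  have d1: "\<bar>d i\<bar> \<le> \<bar>d i\<bar> * (2 * real i + 2) ^ M" for i
    by (simp add: mult_le_cancel_left1 one_le_power)
  have sd0: "summable (\<lambda>i. \<bar>d i\<bar>)"
    by (rule summable_comparison_test'[OF sd]) (use d1 in simp)
  have "(\<Sum>i. d i * cos (\<kappa> i * t)) = 1" if t: "\<bar>t\<bar> \<le> 1" for t
  proof -
    \<comment> \<open>After the averagings the coefficients \<open>d\<close> are absolutely
      summable, so \<open>\<psi>\<close> is continuous up to \<open>r = 1\<close>, where it is the
      wanted sum; below 1 it equals \<open>(4 / pi) * G j r t\<close>, which is under
      control.\<close>
    define \<psi> where "\<psi> r = (\<Sum>i. (d i * cos (\<kappa> i * t)) * r ^ (2 * i + 1))" for r :: real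
    have "uniform_limit {0..1} (\<lambda>n r. \<Sum>i<n. (d i * cos (\<kappa> i * t)) * r ^ (2 * i + 1)) \<psi> sequentially"
      unfolding \<psi>_def
    proof (rule Weierstrass_m_test[OF _ sd0])
      fix n and r :: real assume r: "r \<in> {0..1}"
      have "\<bar>d n\<bar> * \<bar>cos (\<kappa> n * t)\<bar> * r ^ (2 * n + 1) \<le> \<bar>d n\<bar> * 1 * 1"
        using r by (intro mult_mono power_le_one) auto
      then show "norm (d n * cos (\<kappa> n * t) * r ^ (2 * n + 1)) \<le> \<bar>d n\<bar>"
        using r by (simp add: abs_mult)
    qed
    then have "continuous_on {0..1} \<psi>"
      by (rule uniform_limit_theorem[rotated]) (auto intro!: always_eventually continuous_intros)
    then have lim: "(\<psi> \<longlongrightarrow> \<psi> 1) (at_left 1)"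
      using continuous_on_Icc_at_leftD[of 0 1 \<psi>] by simp
    have \<psi>G: "\<psi> r = (4 / pi) * G j r t" if "0 < r" "r < 1" for r
    proof -
      have "summable (\<lambda>i. c j r i * cos (\<kappa> i * t))"
        by (rule summable_comparison_test'[OF sum_c[OF that, of j]]) (simp add: abs_mult mult_left_le)
      from suminf_mult[OF this, of "4 / pi"] show ?thesis
        by (simp add: \<psi>_def G_def d_def c_def mult_ac)
    qed
    have bd: "\<bar>\<psi> 1 - 1\<bar> \<le> (4 / pi) * e" if e: "e > 0" for e
    proof (rule tendsto_upperbound[where F="at_left (1::real)"])
      show "((\<lambda>r. \<bar>\<psi> r - 1\<bar>) \<longlongrightarrow> \<bar>\<psi> 1 - 1\<bar>) (at_left 1)"
        by (intro tendsto_intros lim)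
      have T0: "0 \<le> (5/4::real)" by simp
      have T: "(5/4::real) < pi / 2" using pi_gt3 by simp
      have ev01: "\<forall>\<^sub>F r in at_left (1::real). 0 < r \<and> r < 1"
        by (intro eventually_at_left_field[THEN iffD2]) (auto intro!: exI[of _ 0])
      show "\<forall>\<^sub>F r in at_left 1. \<bar>\<psi> r - 1\<bar> \<le> (4 / pi) * e"
        using Re_Arctan_limit[OF T0 T e] ev01
      proof eventually_elim
        case (elim r)
        have "\<bar>G j r t - pi / 4\<bar> \<le> e"
        proof (rule smooth)
          show "\<bar>G 0 r t - pi / 4\<bar> \<le> e" if "\<bar>t\<bar> \<le> 5/4" for t
            using elim that by (simp add: G0)
          have "real j * h = 1 / 4" using h by (simp add: j_def)
          then show "\<bar>t\<bar> \<le> 5/4 - real j * h" using t by simp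
        qed (use elim in auto)
        then have "(4 / pi) * \<bar>G j r t - pi / 4\<bar> \<le> (4 / pi) * e" by (intro mult_left_mono) auto
        moreover have "(4 / pi) * \<bar>G j r t - pi / 4\<bar> = \<bar>\<psi> r - 1\<bar>"
        proof -
          have "\<psi> r - 1 = (4 / pi) * (G j r t - pi / 4)"
            using elim by (simp add: \<psi>G right_diff_distrib)
          then show ?thesis by (simp only: abs_mult) simp
        qed
        ultimately show ?case by simp
      qed
    qed auto
    have "\<bar>\<psi> 1 - 1\<bar> \<le> 0"
      by (rule field_le_epsilon) (use bd[of "_ * pi / 4"] in simp)
    then have "\<psi> 1 = 1" by simp
    then show ?thesis by (simp add: \<psi>_def)
  qed
  then show ?thesis using sd unfolding \<kappa>_def by blast
qed

subsection \<open>Monomials as trigonometric series\<close>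

text \<open>Multi-indices are encoded as words of coordinates: products become concatenations, and
  powers of sums expand without multinomial coefficients. Different words may denote the same
  monomial.\<close>

definition mon :: "'n list \<Rightarrow> real ^ 'n::finite \<Rightarrow> real" where
  "mon ks x = prod_list (map (\<lambda>k. x $ k) ks)"

lemma mon_Nil [simp]: "mon [] x = 1" and mon_Cons [simp]: "mon (k # ks) x = x $ k * mon ks x"
  by (simp_all add: mon_def)

lemma mon_append: "mon (ks @ ls) x = mon ks x * mon ls x"
  by (simp add: mon_def)

lemma abs_component_less_1:
  fixes x :: "real ^ 'n::finite"
  assumes "x \<in> ball 0 1"
  shows "\<bar>x $ k\<bar> < 1"
  using component_le_norm_cart[of x k] assms by simp

lemma abs_mon_le_1: "x \<in> ball 0 1 \<Longrightarrow> \<bar>mon ks x\<bar> \<le> 1"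
proof (induction ks)
  case (Cons k ks)
  then show ?case using abs_component_less_1[of x k] by (simp add: abs_mult mult_le_one)
qed simp

text \<open>Each frequency is paired with its negative and the conjugate coefficient, which makes
  the complex series real-valued.\<close>

lemma coordinate_series:
  fixes c :: "nat \<Rightarrow> complex" and \<mu> :: "nat \<Rightarrow> real" and k :: "'n::finite"
  assumes sm: "summable (\<lambda>i. cmod (c i) * (1 + \<bar>\<mu> i\<bar>) ^ M)"
  obtains a and \<xi> :: "nat \<Rightarrow> real ^ 'n" where "tadm M a \<xi>"
    "\<And>x. tsum a \<xi> x = of_real (\<Sum>i. 2 * Re (c i * cis (\<mu> i * x $ k)))"
    "\<And>n. a n \<noteq> 0 \<Longrightarrow> \<exists>i. \<xi> n = axis k (\<mu> i) \<or> \<xi> n = axis k (- \<mu> i)"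
proof -
  define A where "A p = (if snd p then c (fst p) else cnj (c (fst p)))" for p :: "nat \<times> bool"
  define X :: "nat \<times> bool \<Rightarrow> real ^ 'n" where "X p = axis k (if snd p then \<mu> (fst p) else - \<mu> (fst p))" for p
  have nX: "norm (X p) = \<bar>\<mu> (fst p)\<bar>" for p by (simp add: X_def norm_eq_sqrt_inner inner_axis_axis)
  have "(\<lambda>i. cmod (c i) * (1 + \<bar>\<mu> i\<bar>) ^ M) summable_on UNIV"
    by (rule summable_nonneg_imp_summable_on[OF sm]) simp
  from summable_on_product_nonneg(1)[OF this, of "\<lambda>_ :: bool. 1"]
  have "(\<lambda>(i, _ :: bool). cmod (c i) * (1 + \<bar>\<mu> i\<bar>) ^ M * 1) summable_on UNIV" by simp
  then have adm: "tadm M A X"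
    unfolding tadm_def by (rule summable_on_bounded) (auto simp: A_def nX)
  have ts: "tsum A X x = of_real (\<Sum>i. 2 * Re (c i * cis (\<mu> i * x $ k)))" for x
  proof -
    have "tadm 0 A X" by (rule tadm_mono[OF adm]) simp
    then have "(\<lambda>p. A p * cis (X p \<bullet> x)) summable_on (UNIV \<times> UNIV)"
      using tsum_summable[of A X x] by simp
    from infsum_Sigma_banach[OF this]
    have "tsum A X x = (\<Sum>\<^sub>\<infinity>i. \<Sum>\<^sub>\<infinity>b. A (i, b) * cis (X (i, b) \<bullet> x))"
      by (simp add: tsum_def)
    also have "\<dots> = (\<Sum>\<^sub>\<infinity>i. of_real (2 * Re (c i * cis (\<mu> i * x $ k))))"
      by (rule infsum_cong)
         (simp add: UNIV_bool A_def X_def inner_axis' complex_eq_iff)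
    also have "\<dots> = of_real (\<Sum>i. 2 * Re (c i * cis (\<mu> i * x $ k)))"
    proof (rule infsumI, rule norm_summable_imp_has_sum)
      have le: "\<bar>2 * Re (c i * cis (\<mu> i * x $ k))\<bar> \<le> 2 * (cmod (c i) * (1 + \<bar>\<mu> i\<bar>) ^ M)" for i
      proof -
        have "\<bar>Re (c i * cis (\<mu> i * x $ k))\<bar> \<le> cmod (c i)"
          using abs_Re_le_cmod[of "c i * cis (\<mu> i * x $ k)"] by (simp add: norm_mult)
        also have "\<dots> \<le> cmod (c i) * (1 + \<bar>\<mu> i\<bar>) ^ M" by (simp add: mult_le_cancel_left1 one_le_power)
        finally show ?thesis by simp
      qed
      have "summable (\<lambda>i. \<bar>2 * Re (c i * cis (\<mu> i * x $ k))\<bar>)"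
        by (rule summable_comparison_test'[OF summable_mult[OF sm, of 2]]) (use le in simp)
      then show "summable (\<lambda>i. norm (complex_of_real (2 * Re (c i * cis (\<mu> i * x $ k)))))"
        by (simp only: norm_of_real)
      show "(\<lambda>i. complex_of_real (2 * Re (c i * cis (\<mu> i * x $ k)))) sums of_real (\<Sum>i. 2 * Re (c i * cis (\<mu> i * x $ k)))"
        by (intro sums_of_real summable_sums summable_rabs_cancel[OF \<open>summable (\<lambda>i. \<bar>2 * Re (c i * cis (\<mu> i * x $ k))\<bar>)\<close>])
    qed
    finally show ?thesis .
  qed
  obtain a :: "nat \<Rightarrow> complex" and \<xi> where r: "\<And>M. tadm M a \<xi> \<longleftrightarrow> tadm M A X" "\<And>M. tnorm M a \<xi> = tnorm M A X"
    "\<And>x. tsum a \<xi> x = tsum A X x" "\<And>n. a n \<noteq> 0 \<Longrightarrow> \<exists>i. a n = A i \<and> \<xi> n = X i"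
    by (rule tsum_reindex[of A X]) blast
  show thesis
  proof (rule that[of a \<xi>])
    show "\<exists>i. \<xi> n = axis k (\<mu> i) \<or> \<xi> n = axis k (- \<mu> i)" if n: "a n \<noteq> 0" for n
      using r(4)[OF n] by (auto simp: X_def)
  qed (use r ts adm in auto)
qed

text \<open>The cosine series is evaluated at half the coordinate, which turns odd frequencies into
  half-odd ones. The recorded parity is what keeps frequency 0 out of all later products.\<close>

lemma constant_coordinate_series:
  fixes k :: "'n::finite"
  obtains a and \<xi> :: "nat \<Rightarrow> real ^ 'n" where "tadm M a \<xi>"
    "\<And>x. x \<in> ball 0 1 \<Longrightarrow> tsum a \<xi> x = 1"
    "\<And>n. a n \<noteq> 0 \<Longrightarrow> \<exists>j::int. odd j \<and> 2 * \<xi> n $ k = of_int j"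
proof -
  obtain d where d: "summable (\<lambda>i. \<bar>d i\<bar> * (2 * real i + 2) ^ M)"
    "\<And>t. \<bar>t\<bar> \<le> 1 \<Longrightarrow> (\<Sum>i. d i * cos ((2 * real i + 1) * t)) = 1"
    using smooth_cos_series[of M] by blast
  have "summable (\<lambda>i. cmod (of_real (d i / 2)) * (1 + \<bar>(2 * real i + 1) / 2\<bar>) ^ M)"
  proof (rule summable_comparison_test'[OF d(1)])
    fix n
    have "\<bar>d n\<bar> / 2 * (1 + (2 * real n + 1) / 2) ^ M \<le> \<bar>d n\<bar> * (2 * real n + 2) ^ M"
      by (intro mult_mono power_mono) auto
    then show "norm (cmod (of_real (d n / 2)) * (1 + \<bar>(2 * real n + 1) / 2\<bar>) ^ M) \<le> \<bar>d n\<bar> * (2 * real n + 2) ^ M"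
      by (simp add: norm_divide)
  qed
  then obtain a and \<xi> :: "nat \<Rightarrow> real ^ 'n" where a: "tadm M a \<xi>"
    "\<And>x. tsum a \<xi> x = of_real (\<Sum>i. 2 * Re (of_real (d i / 2) * cis ((2 * real i + 1) / 2 * x $ k)))"
    "\<And>n. a n \<noteq> 0 \<Longrightarrow> \<exists>i. \<xi> n = axis k ((2 * real i + 1) / 2) \<or> \<xi> n = axis k (- ((2 * real i + 1) / 2))"
    by (rule coordinate_series[where k=k]) blast
  show thesis
  proof (rule that[of a \<xi>])
    fix x :: "real ^ 'n" assume x: "x \<in> ball 0 1"
    have "(\<Sum>i. d i * cos ((2 * real i + 1) * (x $ k / 2))) = 1"
      using abs_component_less_1[OF x, of k] by (intro d(2)) auto
    then show "tsum a \<xi> x = 1" by (simp add: a(2))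
  next
    fix n assume "a n \<noteq> 0"
    from a(3)[OF this] obtain i where i: "\<xi> n = axis k ((2 * real i + 1) / 2) \<or> \<xi> n = axis k (- ((2 * real i + 1) / 2))"
      by blast
    have "2 * \<xi> n $ k = of_int (2 * int i + 1) \<or> 2 * \<xi> n $ k = of_int (- (2 * int i + 1))"
      using i by (elim disjE) (simp_all add: field_simps)
    moreover have "odd (2 * int i + 1)" "odd (- (2 * int i + 1))" by simp_all
    ultimately show "\<exists>j::int. odd j \<and> 2 * \<xi> n $ k = of_int j" by blast
  qed (rule a(1))
qed

text \<open>The antiderivative of a series equal to 1 on \<open>{-1..1}\<close> that vanishes at 0
  is \<open>t\<close> there. Its frequencies stay integers.\<close>

lemma linear_coordinate_series:
  fixes k :: "'n::finite"
  obtains a and \<xi> :: "nat \<Rightarrow> real ^ 'n" where "tadm M a \<xi>"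
    "\<And>x. x \<in> ball 0 1 \<Longrightarrow> tsum a \<xi> x = of_real (x $ k)"
    "\<And>n l. a n \<noteq> 0 \<Longrightarrow> \<exists>j::int. \<xi> n $ l = of_int j"
proof -
  obtain d where d: "summable (\<lambda>i. \<bar>d i\<bar> * (2 * real i + 2) ^ M)"
    "\<And>t. \<bar>t\<bar> \<le> 1 \<Longrightarrow> (\<Sum>i. d i * cos ((2 * real i + 1) * t)) = 1"
    using smooth_cos_series[of M] by blast
  define \<kappa> where "\<kappa> i = 2 * real i + 1" for i
  have \<kappa>: "1 \<le> \<kappa> i" for i by (simp add: \<kappa>_def)
  have d1: "\<bar>d i\<bar> \<le> \<bar>d i\<bar> * (2 * real i + 2) ^ M" for i
    by (simp add: mult_le_cancel_left1 one_le_power)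
  have sd0: "summable (\<lambda>i. \<bar>d i\<bar>)"
    by (rule summable_comparison_test'[OF d(1)]) (use d1 in simp)
  have lin: "(\<Sum>i. d i * sin (\<kappa> i * t) / \<kappa> i) = t" if "\<bar>t\<bar> \<le> 1" for t
  proof -
    define D where "D t = (\<Sum>i. d i * sin (\<kappa> i * t) / \<kappa> i) - t" for t
    have "(D has_field_derivative 0) (at t within {-1..1})" if "t \<in> {-1..1}" for t
    proof -
      have "((\<lambda>t. \<Sum>i. d i * sin (\<kappa> i * t) / \<kappa> i) has_field_derivative 1) (at t)"
        using sin_series_has_field_derivative[of d \<kappa> t, OF sd0 \<kappa>] d(2)[of t] that
        by (simp add: \<kappa>_def abs_le_iff)
      then have "(D has_field_derivative 1 - 1) (at t)"
        unfolding D_def by (intro DERIV_diff DERIV_ident)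
      then show ?thesis by (simp add: has_field_derivative_at_within)
    qed
    from has_field_derivative_zero_constant[OF _ this] obtain C where C: "\<forall>t\<in>{-1..1}. D t = C" by auto
    have "D 0 = 0" by (simp add: D_def)
    then have "D t = 0" using C that by (auto simp: abs_le_iff)
    then show ?thesis by (simp add: D_def)
  qed
  have "summable (\<lambda>i. cmod (- \<i> * of_real (d i / (2 * \<kappa> i))) * (1 + \<bar>\<kappa> i\<bar>) ^ M)"
  proof (rule summable_comparison_test'[OF d(1)])
    fix n
    have "\<bar>d n\<bar> / (2 * \<kappa> n) \<le> \<bar>d n\<bar> / 1" using \<kappa>[of n] by (intro divide_left_mono) auto
    then have "\<bar>d n\<bar> / (2 * \<kappa> n) * (1 + \<kappa> n) ^ M \<le> \<bar>d n\<bar> * (2 * real n + 2) ^ M"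
      by (intro mult_mono power_mono) (auto simp: \<kappa>_def)
    then show "norm (cmod (- \<i> * of_real (d n / (2 * \<kappa> n))) * (1 + \<bar>\<kappa> n\<bar>) ^ M) \<le> \<bar>d n\<bar> * (2 * real n + 2) ^ M"
      using \<kappa>[of n] by (simp add: norm_mult norm_divide)
  qed
  then obtain a and \<xi> :: "nat \<Rightarrow> real ^ 'n" where a: "tadm M a \<xi>"
    "\<And>x. tsum a \<xi> x = of_real (\<Sum>i. 2 * Re (- \<i> * of_real (d i / (2 * \<kappa> i)) * cis (\<kappa> i * x $ k)))"
    "\<And>n. a n \<noteq> 0 \<Longrightarrow> \<exists>i. \<xi> n = axis k (\<kappa> i) \<or> \<xi> n = axis k (- \<kappa> i)"
    by (rule coordinate_series[where k=k]) blast
  show thesis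
  proof (rule that[of a \<xi>])
    fix x :: "real ^ 'n" assume x: "x \<in> ball 0 1"
    have "2 * Re (- \<i> * of_real (d i / (2 * \<kappa> i)) * cis (\<kappa> i * x $ k)) = d i * sin (\<kappa> i * x $ k) / \<kappa> i" for i
      using \<kappa>[of i] by simp
    then show "tsum a \<xi> x = of_real (x $ k)"
      using lin[of "x $ k"] abs_component_less_1[OF x, of k] by (simp add: a(2))
  next
    fix n l assume "a n \<noteq> 0"
    from a(3)[OF this] obtain i where i: "\<xi> n = axis k (\<kappa> i) \<or> \<xi> n = axis k (- \<kappa> i)" by blast
    have "\<xi> n $ l = of_int (2 * int i + 1) \<or> \<xi> n $ l = of_int (- (2 * int i + 1)) \<or> \<xi> n $ l = of_int 0"
      using i by (cases "l = k") (auto simp: \<kappa>_def axis_def)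
    then show "\<exists>j::int. \<xi> n $ l = of_int j" by blast
  qed (rule a(1))
qed

text \<open>Induction over the factors, starting from the half-odd series for 1. The invariant is
  that twice the frequency has an odd \<open>l\<close>-th coordinate: adding integer frequencies
  preserves it, and it forces norm at least 1/2. Submultiplicativity gives the growth
  \<open>B ^ length ks\<close>.\<close>

lemma monomial_series:
  "\<exists>B0 B. 0 \<le> B0 \<and> 1 \<le> B \<and> (\<forall>ks :: 'n::finite list. \<exists>a (\<xi> :: nat \<Rightarrow> real ^ 'n).
     tadm M a \<xi> \<and> tnorm M a \<xi> \<le> B0 * B ^ length ks \<and> (\<forall>n. a n \<noteq> 0 \<longrightarrow> 1/2 \<le> norm (\<xi> n)) \<and>
     (\<forall>x\<in>ball 0 1. tsum a \<xi> x = of_real (mon ks x)))"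
proof -
  define l :: 'n where "l = undefined"
  obtain g and \<gamma> :: "nat \<Rightarrow> real ^ 'n" where g: "tadm M g \<gamma>" "\<And>x. x \<in> ball 0 1 \<Longrightarrow> tsum g \<gamma> x = 1"
    "\<And>n. g n \<noteq> 0 \<Longrightarrow> \<exists>j::int. odd j \<and> 2 * \<gamma> n $ l = of_int j"
    by (rule constant_coordinate_series[where k=l and M=M]) blast
  have "\<forall>k::'n. \<exists>a (\<xi> :: nat \<Rightarrow> real ^ 'n). tadm M a \<xi> \<and> (\<forall>x\<in>ball 0 1. tsum a \<xi> x = of_real (x $ k)) \<and>
     (\<forall>n l. a n \<noteq> 0 \<longrightarrow> (\<exists>j::int. \<xi> n $ l = of_int j))"
  proof
    fix k :: 'n
    show "\<exists>a (\<xi> :: nat \<Rightarrow> real ^ 'n). tadm M a \<xi> \<and> (\<forall>x\<in>ball 0 1. tsum a \<xi> x = of_real (x $ k)) \<and>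
     (\<forall>n l. a n \<noteq> 0 \<longrightarrow> (\<exists>j::int. \<xi> n $ l = of_int j))"
      by (rule linear_coordinate_series[where k=k and M=M]) blast
  qed
  then obtain f and \<phi> :: "'n \<Rightarrow> nat \<Rightarrow> real ^ 'n" where f: "\<And>k. tadm M (f k) (\<phi> k)"
    "\<And>k x. x \<in> ball 0 1 \<Longrightarrow> tsum (f k) (\<phi> k) x = of_real (x $ k)"
    "\<And>k n l. f k n \<noteq> 0 \<Longrightarrow> \<exists>j::int. \<phi> k n $ l = of_int j"
    by metis
  define B where "B = 1 + (\<Sum>k\<in>UNIV. tnorm M (f k) (\<phi> k))"
  have B: "tnorm M (f k) (\<phi> k) \<le> B" for k
    using member_le_sum[of k UNIV "\<lambda>k. tnorm M (f k) (\<phi> k)"] by (simp add: B_def tnorm_nonneg)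
  have B1: "1 \<le> B" by (simp add: B_def sum_nonneg tnorm_nonneg)
  have "\<exists>a (\<xi> :: nat \<Rightarrow> real ^ 'n). tadm M a \<xi> \<and> tnorm M a \<xi> \<le> tnorm M g \<gamma> * B ^ length ks \<and>
     (\<forall>n. a n \<noteq> 0 \<longrightarrow> (\<exists>j::int. odd j \<and> 2 * \<xi> n $ l = of_int j)) \<and>
     (\<forall>x\<in>ball 0 1. tsum a \<xi> x = of_real (mon ks x))" for ks
  proof (induction ks)
    case Nil
    then show ?case using g by (intro exI[of _ g] exI[of _ \<gamma>]) auto
  next
    case (Cons k ks)
    then obtain a and \<xi> :: "nat \<Rightarrow> real ^ 'n" where a: "tadm M a \<xi>" "tnorm M a \<xi> \<le> tnorm M g \<gamma> * B ^ length ks"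
     "\<And>n. a n \<noteq> 0 \<Longrightarrow> \<exists>j::int. odd j \<and> 2 * \<xi> n $ l = of_int j"
     "\<And>x. x \<in> ball 0 1 \<Longrightarrow> tsum a \<xi> x = of_real (mon ks x)" by blast
    define c where "c = (\<lambda>(i, j). f k i * a j)"
    define \<zeta> where "\<zeta> = (\<lambda>(i, j). \<phi> k i + \<xi> j)"
    note P = tsum_product[OF f(1)[of k] a(1), folded c_def \<zeta>_def]
    obtain a' :: "nat \<Rightarrow> complex" and \<xi>' where r: "\<And>M. tadm M a' \<xi>' \<longleftrightarrow> tadm M c \<zeta>" "\<And>M. tnorm M a' \<xi>' = tnorm M c \<zeta>"
      "\<And>x. tsum a' \<xi>' x = tsum c \<zeta> x" "\<And>n. a' n \<noteq> 0 \<Longrightarrow> \<exists>i. a' n = c i \<and> \<xi>' n = \<zeta> i"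
      by (rule tsum_reindex[of c \<zeta>]) blast
    have "tnorm M a' \<xi>' \<le> tnorm M (f k) (\<phi> k) * tnorm M a \<xi>" using P(2) r(2) by simp
    also have "\<dots> \<le> B * (tnorm M g \<gamma> * B ^ length ks)"
      using B1 by (intro mult_mono B a(2)) (auto simp: tnorm_nonneg)
    finally have n: "tnorm M a' \<xi>' \<le> tnorm M g \<gamma> * B ^ length (k # ks)" by (simp add: mult_ac)
    have "\<exists>j::int. odd j \<and> 2 * \<xi>' n $ l = of_int j" if "a' n \<noteq> 0" for n
    proof -
      from r(4)[OF that] obtain i j where ij: "a' n = f k i * a j" "\<xi>' n = \<phi> k i + \<xi> j"
        by (auto simp: c_def \<zeta>_def)
      then have "f k i \<noteq> 0" "a j \<noteq> 0" using that by auto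
      then obtain p q :: int where "\<phi> k i $ l = of_int p" "odd q" "2 * \<xi> j $ l = of_int q"
        using f(3) a(3) by metis
      then have "odd (2 * p + q)" "2 * \<xi>' n $ l = of_int (2 * p + q)" by (simp_all add: ij)
      then show ?thesis by blast
    qed
    moreover have "tsum a' \<xi>' x = of_real (mon (k # ks) x)" if "x \<in> ball 0 1" for x
      using P(3) r(3) f(2)[OF that] a(4)[OF that] by simp
    ultimately show ?case using n P(1) r(1) by blast
  qed
  moreover have "1/2 \<le> norm v" if "odd j" "2 * v $ l = of_int j" for j :: int and v :: "real ^ 'n"
  proof -
    have "j \<noteq> 0" using that(1) by auto
    then have "1 \<le> \<bar>real_of_int j\<bar>" by linarith
    then have "1 \<le> 2 * \<bar>v $ l\<bar>" using that(2) by linarith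
    then show ?thesis using component_le_norm_cart[of v l] by linarith
  qed
  ultimately show ?thesis
    using B1 tnorm_nonneg[of M g \<gamma>] by (intro exI[of _ "tnorm M g \<gamma>"] exI[of _ B]) meson
qed

text \<open>The series \<open>A ks\<close>, \<open>X ks\<close> converge to bounded functions on the
  whole space; only their image under the operator is prescribed, and only on the unit ball. The
  base \<open>B\<close> decides how large \<open>R\<close> must be for far data to be
  handled.\<close>

definition mon_solver :: "real \<Rightarrow> nat \<Rightarrow> ('n::finite list \<Rightarrow> nat \<Rightarrow> complex) \<Rightarrow>
    ('n list \<Rightarrow> nat \<Rightarrow> real ^ 'n) \<Rightarrow> real \<Rightarrow> real \<Rightarrow> bool" where
  "mon_solver s M A X C B \<longleftrightarrow> 0 \<le> C \<and> 1 \<le> B \<and>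
     (\<forall>ks. tadm M (A ks) (X ks) \<and> tnorm M (A ks) (X ks) \<le> C * B ^ length ks \<and>
       (\<forall>x\<in>ball 0 1. tsum (\<lambda>j. of_real (lam s (X ks j)) * A ks j) (X ks) x = of_real (mon ks x)))"

text \<open>The coefficients of the monomial series are divided by the symbol, which is at least
  \<open>c\<close> wherever a coefficient is nonzero, so the bounds only worsen by
  \<open>1 / c\<close>.\<close>

lemma mon_solver_exists:
  assumes s: "0 < s" "s < 1"
  obtains A and X :: "'n::finite list \<Rightarrow> nat \<Rightarrow> real ^ 'n" and C B where "mon_solver s M A X C B"
proof -
  obtain c where c: "c > 0" "\<And>\<xi> :: real ^ 'n. 1/2 \<le> norm \<xi> \<Longrightarrow> c \<le> lam s \<xi>"
    using lam_lower_bound[OF s] by blast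
  obtain B0 B where B: "0 \<le> B0" "1 \<le> B" "\<forall>ks :: 'n list. \<exists>a (\<xi> :: nat \<Rightarrow> real ^ 'n).
     tadm M a \<xi> \<and> tnorm M a \<xi> \<le> B0 * B ^ length ks \<and> (\<forall>n. a n \<noteq> 0 \<longrightarrow> 1/2 \<le> norm (\<xi> n)) \<and>
     (\<forall>x\<in>ball 0 1. tsum a \<xi> x = of_real (mon ks x))"
    using monomial_series[where 'n='n and M=M] by blast
  from B(3) obtain a and X :: "'n list \<Rightarrow> nat \<Rightarrow> real ^ 'n" where a: "\<And>ks. tadm M (a ks) (X ks)"
    "\<And>ks. tnorm M (a ks) (X ks) \<le> B0 * B ^ length ks" "\<And>ks n. a ks n \<noteq> 0 \<Longrightarrow> 1/2 \<le> norm (X ks n)"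
    "\<And>ks x. x \<in> ball 0 1 \<Longrightarrow> tsum (a ks) (X ks) x = of_real (mon ks x)"
    by metis
  define A where "A ks j = a ks j / of_real (lam s (X ks j))" for ks j
  have "cmod (A ks j) * (1 + norm (X ks j)) ^ M \<le> (1 / c) * (cmod (a ks j) * (1 + norm (X ks j)) ^ M)" for ks j
  proof (cases "a ks j = 0")
    case False
    have l: "c \<le> lam s (X ks j)" by (rule c(2)[OF a(3)[OF False]])
    then have "cmod (A ks j) = cmod (a ks j) / lam s (X ks j)" using c(1) by (simp add: A_def norm_divide)
    also have "\<dots> \<le> cmod (a ks j) / c" using l c(1) by (intro divide_left_mono mult_pos_pos) auto
    finally show ?thesis using mult_right_mono[of "cmod (A ks j)" "cmod (a ks j) / c" "(1 + norm (X ks j)) ^ M"] by simp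
  qed (simp add: A_def)
  note t = tadm_bounded[OF a(1) this]
  have "of_real (lam s (X ks j)) * A ks j = a ks j" for ks j
    using c a(3)[of ks j] by (cases "a ks j = 0") (auto simp: A_def, smt (verit, best))
  then have e: "tsum (\<lambda>j. of_real (lam s (X ks j)) * A ks j) (X ks) x = of_real (mon ks x)" if "x \<in> ball 0 1" for ks x
    using a(4)[OF that] by simp
  have "tnorm M (A ks) (X ks) \<le> (B0 / c) * B ^ length ks" for ks
    using order_trans[OF t(2) mult_left_mono[OF a(2)]] c(1) by simp
  then have "mon_solver s M A X (B0 / c) B"
    unfolding mon_solver_def using t(1) e B c(1) by auto
  then show thesis by (rule that)
qed

lemma tsum_superposition:
  fixes A :: "'i \<Rightarrow> 'j \<Rightarrow> complex" and X :: "'i \<Rightarrow> 'j \<Rightarrow> real ^ 'n::finite"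
  assumes A: "\<And>i. tadm M (A i) (X i)" "\<And>i. tnorm M (A i) (X i) \<le> N i"
    and c: "(\<lambda>i. \<bar>c i\<bar> * N i) summable_on UNIV"
  defines "a \<equiv> \<lambda>(i, j). of_real (c i) * A i j" and "\<xi> \<equiv> \<lambda>(i, j). X i j"
  shows "tadm M a \<xi>" "tnorm M a \<xi> \<le> (\<Sum>\<^sub>\<infinity>i. \<bar>c i\<bar> * N i)"
    "tsum a \<xi> x = (\<Sum>\<^sub>\<infinity>i. of_real (c i) * tsum (A i) (X i) x)"
proof -
  define f where "f p = cmod (a p) * (1 + norm (\<xi> p)) ^ M" for p
  have hs: "((\<lambda>j. f (i, j)) has_sum (\<bar>c i\<bar> * tnorm M (A i) (X i))) UNIV" for i
  proof -
    have "((\<lambda>j. \<bar>c i\<bar> * (cmod (A i j) * (1 + norm (X i j)) ^ M)) has_sum (\<bar>c i\<bar> * tnorm M (A i) (X i))) UNIV"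
      using A(1)[of i] unfolding tadm_def tnorm_def by (intro has_sum_cmult_right has_sum_infsum)
    then show ?thesis by (simp add: f_def a_def \<xi>_def norm_mult mult.assoc)
  qed
  have le: "norm (\<bar>c i\<bar> * tnorm M (A i) (X i)) \<le> \<bar>c i\<bar> * N i" for i
    using A(2)[of i] tnorm_nonneg[of M "A i" "X i"] by (simp add: abs_mult mult_left_mono)
  have s1: "(\<lambda>i. \<bar>c i\<bar> * tnorm M (A i) (X i)) summable_on UNIV"
    by (rule summable_on_bounded[OF c le])
  have s2: "f summable_on (SIGMA i:UNIV. UNIV)"
    by (rule summable_on_SigmaI[OF hs s1]) (simp add: f_def)
  then show t: "tadm M a \<xi>" unfolding tadm_def f_def by simp
  have "(f has_sum infsum (\<lambda>i. \<bar>c i\<bar> * tnorm M (A i) (X i)) UNIV) (SIGMA i:UNIV. UNIV)"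
    by (rule has_sum_SigmaI[OF hs has_sum_infsum[OF s1] s2])
  then have "tnorm M a \<xi> = infsum (\<lambda>i. \<bar>c i\<bar> * tnorm M (A i) (X i)) UNIV"
    unfolding tnorm_def f_def by (intro infsumI) simp
  also have "\<dots> \<le> (\<Sum>\<^sub>\<infinity>i. \<bar>c i\<bar> * N i)"
    by (rule infsum_mono[OF s1 c]) (use le in \<open>simp add: abs_mult tnorm_nonneg\<close>)
  finally show "tnorm M a \<xi> \<le> (\<Sum>\<^sub>\<infinity>i. \<bar>c i\<bar> * N i)" .
  have "tadm 0 a \<xi>" by (rule tadm_mono[OF t]) simp
  then have "(\<lambda>p. a p * cis (\<xi> p \<bullet> x)) summable_on (UNIV \<times> UNIV)"
    using tsum_summable[of a \<xi> x] by simp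
  from infsum_Sigma_banach[OF this]
  have "tsum a \<xi> x = (\<Sum>\<^sub>\<infinity>i. \<Sum>\<^sub>\<infinity>j. a (i, j) * cis (\<xi> (i, j) \<bullet> x))"
    by (simp add: tsum_def)
  also have "\<dots> = (\<Sum>\<^sub>\<infinity>i. of_real (c i) * tsum (A i) (X i) x)"
    by (simp add: tsum_def a_def \<xi>_def mult.assoc infsum_cmult_right')
  finally show "tsum a \<xi> x = (\<Sum>\<^sub>\<infinity>i. of_real (c i) * tsum (A i) (X i) x)" .
qed

text \<open>The superposition is made twice, for the solutions and for their images under the
  symbol. The second one loses two orders of weight by \<open>tadm_lam\<close>, which explains
  \<open>2 \<le> M\<close>.\<close>

lemma superposed_solution:
  fixes c :: "'i \<Rightarrow> real" and ks :: "'i \<Rightarrow> 'n::finite list"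
  assumes s: "0 < s" "s < 1" and sol: "mon_solver s M A X C B" and M: "2 \<le> M"
    and c: "(\<lambda>i. \<bar>c i\<bar> * B ^ length (ks i)) summable_on UNIV"
  defines "a \<equiv> \<lambda>(i, j). of_real (c i) * A (ks i) j" and "\<xi> \<equiv> \<lambda>(i, j). X (ks i) j"
  shows "tadm M a \<xi>" "tnorm M a \<xi> \<le> C * (\<Sum>\<^sub>\<infinity>i. \<bar>c i\<bar> * B ^ length (ks i))"
    "x \<in> ball 0 1 \<Longrightarrow> has_frac_laplacian s (\<lambda>x. Re (tsum a \<xi> x)) x (\<Sum>\<^sub>\<infinity>i. c i * mon (ks i) x)"
proof -
  have A: "tadm M (A (ks i)) (X (ks i))" "tnorm M (A (ks i)) (X (ks i)) \<le> C * B ^ length (ks i)" for i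
    using sol unfolding mon_solver_def by blast+
  have c': "(\<lambda>i. \<bar>c i\<bar> * (C * B ^ length (ks i))) summable_on UNIV"
    using summable_on_cmult_right[OF c, of C] by (simp add: mult_ac)
  have i: "(\<Sum>\<^sub>\<infinity>i. \<bar>c i\<bar> * (C * B ^ length (ks i))) = C * (\<Sum>\<^sub>\<infinity>i. \<bar>c i\<bar> * B ^ length (ks i))"
    by (simp add: infsum_cmult_right'[symmetric] mult_ac)
  note S = tsum_superposition[OF A c', folded a_def \<xi>_def]
  show t: "tadm M a \<xi>" and "tnorm M a \<xi> \<le> C * (\<Sum>\<^sub>\<infinity>i. \<bar>c i\<bar> * B ^ length (ks i))"
    using S(1,2) by (simp_all add: i)
  assume x: "x \<in> ball 0 1"
  have t2: "tadm 2 a \<xi>" by (rule tadm_mono[OF t M])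
  define K where "K = 2 * (\<integral>z. min 1 ((norm (z :: real^'n))^2) * fker s z \<partial>lborel)"
  have K0: "0 \<le> K" unfolding K_def by (intro mult_nonneg_nonneg Bochner_Integration.integral_nonneg) auto
  define A' where "A' i j = of_real (lam s (X (ks i) j)) * A (ks i) j" for i j
  have A2: "tadm 2 (A (ks i)) (X (ks i))" for i by (rule tadm_mono[OF A(1) M])
  have A': "tadm 0 (A' i) (X (ks i))" "tnorm 0 (A' i) (X (ks i)) \<le> K * (C * B ^ length (ks i))" for i
  proof -
    show "tadm 0 (A' i) (X (ks i))" unfolding A'_def by (rule tadm_lam(1)[OF s A2])
    have "tnorm 0 (A' i) (X (ks i)) \<le> K * tnorm 2 (A (ks i)) (X (ks i))"
      unfolding A'_def K_def by (rule tadm_lam(2)[OF s A2])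
    also have "\<dots> \<le> K * (C * B ^ length (ks i))"
      using tadm_mono(2)[OF A(1) M] A(2) by (intro mult_left_mono K0) (meson order_trans)
    finally show "tnorm 0 (A' i) (X (ks i)) \<le> K * (C * B ^ length (ks i))" .
  qed
  have c'': "(\<lambda>i. \<bar>c i\<bar> * (K * (C * B ^ length (ks i)))) summable_on UNIV"
    using summable_on_cmult_right[OF c', of K] by (simp add: mult_ac)
  have "(\<lambda>p. of_real (lam s (\<xi> p)) * a p) = (\<lambda>(i, j). of_real (c i) * A' i j)"
    by (auto simp: a_def \<xi>_def A'_def fun_eq_iff)
  then have "tsum (\<lambda>p. of_real (lam s (\<xi> p)) * a p) \<xi> x = tsum (\<lambda>(i, j). of_real (c i) * A' i j) (\<lambda>(i, j). X (ks i) j) x"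
    by (simp add: \<xi>_def)
  also have "\<dots> = (\<Sum>\<^sub>\<infinity>i. of_real (c i) * tsum (A' i) (X (ks i)) x)"
    by (rule tsum_superposition(3)[OF A' c''])
  also have "\<dots> = (\<Sum>\<^sub>\<infinity>i. of_real (c i * mon (ks i) x))"
    using sol x unfolding mon_solver_def A'_def by simp
  also have "\<dots> = of_real (\<Sum>\<^sub>\<infinity>i. c i * mon (ks i) x)"
  proof (rule infsumI, rule has_sum_of_real, rule has_sum_infsum)
    show "(\<lambda>i. c i * mon (ks i) x) summable_on UNIV"
    proof (rule summable_on_bounded[OF c])
      fix i
      have "1 \<le> B ^ length (ks i)"
        using sol unfolding mon_solver_def by (intro one_le_power) blast
      then have "\<bar>c i\<bar> * \<bar>mon (ks i) x\<bar> \<le> \<bar>c i\<bar> * B ^ length (ks i)"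
        using abs_mon_le_1[OF x, of "ks i"] by (intro mult_left_mono) auto
      then show "norm (c i * mon (ks i) x) \<le> \<bar>c i\<bar> * B ^ length (ks i)" by (simp add: abs_mult)
    qed
  qed
  finally show "has_frac_laplacian s (\<lambda>x. Re (tsum a \<xi> x)) x (\<Sum>\<^sub>\<infinity>i. c i * mon (ks i) x)"
    using tsum_has_frac_laplacian[OF s t2, of x] by simp
qed

subsection \<open>Sums over words\<close>

lemma finite_words: "finite {w :: 'l::finite list. length w = i}"
  using finite_lists_length_eq[of "UNIV :: 'l set" i] by simp

lemma sum_words_prod:
  fixes \<phi> :: "'l::finite \<Rightarrow> real"
  shows "(\<Sum>w | length w = i. prod_list (map \<phi> w)) = (\<Sum>l\<in>UNIV. \<phi> l) ^ i"
proof (induction i)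
  case (Suc i)
  have eq: "{w :: 'l list. length w = Suc i} = (\<lambda>(l, w). l # w) ` (UNIV \<times> {w. length w = i})"
    by (auto simp: length_Suc_conv image_iff)
  have inj: "inj_on (\<lambda>(l, w). l # w) (UNIV \<times> {w :: 'l list. length w = i})"
    by (auto simp: inj_on_def)
  have "(\<Sum>w | length w = Suc i. prod_list (map \<phi> w)) = (\<Sum>(l, w)\<in>UNIV \<times> {w. length w = i}. \<phi> l * prod_list (map \<phi> w))"
    unfolding eq by (subst sum.reindex[OF inj]) (auto intro!: sum.cong)
  also have "\<dots> = (\<Sum>l\<in>UNIV. \<phi> l) * (\<Sum>w | length w = i. prod_list (map \<phi> w))"
    by (simp add: sum.cartesian_product[symmetric] sum_product)
  finally show ?case by (simp add: Suc)
qed simp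

text \<open>A power series evaluated at a finite sum of letters becomes a single absolutely
  convergent sum over all words. Convergence is demanded with absolute values on every letter, which
  is stronger than convergence at the sum.\<close>

lemma has_sum_words:
  fixes \<phi> :: "'l::finite \<Rightarrow> real" and f :: "nat \<Rightarrow> real"
  assumes sm: "summable (\<lambda>i. \<bar>f i\<bar> * (\<Sum>l\<in>UNIV. \<bar>\<phi> l\<bar>) ^ i)"
  shows "(\<lambda>w. \<bar>f (length w)\<bar> * prod_list (map (\<lambda>l. \<bar>\<phi> l\<bar>) w)) summable_on UNIV"
    "((\<lambda>w. f (length w) * prod_list (map \<phi> w)) has_sum (\<Sum>i. f i * (\<Sum>l\<in>UNIV. \<phi> l) ^ i)) UNIV"
proof -
  define L where "L i = {w :: 'l list. length w = i}" for i
  \<comment> \<open>Words are grouped by length, so that each inner sum is finite and given by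
    \<open>sum_words_prod\<close>.\<close>
  have bij: "inj_on snd (SIGMA i:UNIV. L i)" "snd ` (SIGMA i:UNIV. L i) = UNIV"
    by (auto simp: inj_on_def L_def image_iff)
  have fin: "((\<lambda>w. g (length w) * prod_list (map \<psi> w)) has_sum (g i * (\<Sum>l\<in>UNIV. \<psi> l) ^ i)) (L i)"
    for g :: "nat \<Rightarrow> real" and \<psi> i
  proof (rule has_sum_finiteI)
    show "finite (L i)" unfolding L_def by (rule finite_words)
    have "(\<Sum>w\<in>L i. g (length w) * prod_list (map \<psi> w)) = (\<Sum>w\<in>L i. g i * prod_list (map \<psi> w))"
      by (rule sum.cong) (auto simp: L_def)
    also have "\<dots> = g i * (\<Sum>l\<in>UNIV. \<psi> l) ^ i"
      by (simp add: sum_distrib_left[symmetric] L_def sum_words_prod)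
    finally show "g i * (\<Sum>l\<in>UNIV. \<psi> l) ^ i = (\<Sum>w\<in>L i. g (length w) * prod_list (map \<psi> w))" ..
  qed
  have pn: "0 \<le> prod_list (map (\<lambda>l. \<bar>\<phi> l\<bar>) w)" for w by (induction w) auto
  define F where "F p = \<bar>f (length (snd p))\<bar> * prod_list (map (\<lambda>l. \<bar>\<phi> l\<bar>) (snd p))" for p :: "nat \<times> 'l list"
  have sF: "F summable_on (SIGMA i:UNIV. L i)"
  proof (rule summable_on_SigmaI)
    show "((\<lambda>w. F (i, w)) has_sum \<bar>f i\<bar> * (\<Sum>l\<in>UNIV. \<bar>\<phi> l\<bar>) ^ i) (L i)" for i
      using fin[of "\<lambda>i. \<bar>f i\<bar>" "\<lambda>l. \<bar>\<phi> l\<bar>" i] by (simp add: F_def)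
    show "(\<lambda>i. \<bar>f i\<bar> * (\<Sum>l\<in>UNIV. \<bar>\<phi> l\<bar>) ^ i) summable_on UNIV"
      by (rule summable_nonneg_imp_summable_on[OF sm]) (simp add: sum_nonneg)
  qed (auto simp: F_def pn)
  define G where "G p = f (length (snd p)) * prod_list (map \<phi> (snd p))" for p :: "nat \<times> 'l list"
  have abs_prod: "\<bar>prod_list (map \<phi> w)\<bar> = prod_list (map (\<lambda>l. \<bar>\<phi> l\<bar>) w)" for w
    by (induction w) (auto simp: abs_mult)
  have sG: "G summable_on (SIGMA i:UNIV. L i)"
    by (rule summable_on_bounded[OF sF]) (simp add: F_def G_def abs_mult abs_prod)
  have sa: "summable (\<lambda>i. \<bar>f i * (\<Sum>l\<in>UNIV. \<phi> l) ^ i\<bar>)"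
  proof (rule summable_comparison_test'[OF sm])
    show "norm \<bar>f n * (\<Sum>l\<in>UNIV. \<phi> l) ^ n\<bar> \<le> \<bar>f n\<bar> * (\<Sum>l\<in>UNIV. \<bar>\<phi> l\<bar>) ^ n" for n
      by (simp add: abs_mult power_abs mult_left_mono power_mono sum_abs)
  qed
  have "((\<lambda>i. f i * (\<Sum>l\<in>UNIV. \<phi> l) ^ i) has_sum (\<Sum>i. f i * (\<Sum>l\<in>UNIV. \<phi> l) ^ i)) UNIV"
    by (rule norm_summable_imp_has_sum[OF _ summable_sums[OF summable_rabs_cancel[OF sa]]]) (use sa in simp)
  from has_sum_SigmaI[OF _ this sG]
  have "(G has_sum (\<Sum>i. f i * (\<Sum>l\<in>UNIV. \<phi> l) ^ i)) (SIGMA i:UNIV. L i)"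
    using fin[of f \<phi>] by (simp add: G_def)
  then show "((\<lambda>w. f (length w) * prod_list (map \<phi> w)) has_sum (\<Sum>i. f i * (\<Sum>l\<in>UNIV. \<phi> l) ^ i)) UNIV"
    using has_sum_reindex[OF bij(1), of "\<lambda>w. f (length w) * prod_list (map \<phi> w)"]
    unfolding bij(2) comp_def G_def by simp
  from sF show "(\<lambda>w. \<bar>f (length w)\<bar> * prod_list (map (\<lambda>l. \<bar>\<phi> l\<bar>) w)) summable_on UNIV"
    using summable_on_reindex[OF bij(1), of "\<lambda>w. \<bar>f (length w)\<bar> * prod_list (map (\<lambda>l. \<bar>\<phi> l\<bar>) w)"]
    unfolding bij(2) comp_def F_def by simp
qed

text \<open>The series converges at the larger radius \<open>r\<close>, halfway between
  \<open>\<bar>q\<bar>\<close> and 1, hence absolutely at \<open>q\<close>.\<close>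

lemma binomial_series_summable:
  fixes q :: real
  assumes "\<bar>q\<bar> < 1"
  shows "summable (\<lambda>i. \<bar>p gchoose i\<bar> * \<bar>q\<bar> ^ i)"
proof -
  define r where "r = (1 + \<bar>q\<bar>) / 2"
  have r: "\<bar>r\<bar> < 1" "norm q < norm r" using assms by (auto simp: r_def)
  have "summable (\<lambda>i. (p gchoose i) * r ^ i)" using gen_binomial_real[OF r(1), of p] by (rule sums_summable)
  from powser_insidea[OF this r(2)] show ?thesis by (simp add: abs_mult power_abs)
qed

subsection \<open>Expansion of the kernel\<close>

text \<open>For \<open>z = (2 x \<bullet> y - |x|\<^sup>2) / |y|\<^sup>2\<close> one has \<open>|x - y|\<^sup>2 = |y|\<^sup>2 (1 - z)\<close>. A letter is a summand of
  \<open>z\<close>: \<open>(k, False)\<close> stands for \<open>2 y\<^sub>k x\<^sub>k / |y|\<^sup>2\<close> and \<open>(k, True)\<close> for \<open>- x\<^sub>k\<^sup>2 / |y|\<^sup>2\<close>.\<close>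

definition lcoords :: "'n \<times> bool \<Rightarrow> 'n list" where
  "lcoords l = (if snd l then [fst l, fst l] else [fst l])"

definition wcoords :: "('n \<times> bool) list \<Rightarrow> 'n list" where
  "wcoords w = concat (map lcoords w)"

definition leta :: "'n \<times> bool \<Rightarrow> real ^ 'n::finite \<Rightarrow> real" where
  "leta l y = (if snd l then - 1 / (norm y)^2 else 2 * y $ fst l / (norm y)^2)"

definition weta :: "('n \<times> bool) list \<Rightarrow> real ^ 'n::finite \<Rightarrow> real" where
  "weta w y = prod_list (map (\<lambda>l. leta l y) w)"

text \<open>The Taylor coefficients in \<open>z\<close> of \<open>(1 - z)\<close> to the power
  \<open>- (n + 2 * s) / 2\<close>; the type argument carries the dimension
  \<open>n\<close>.\<close>

definition kcoef :: "real \<Rightarrow> 'n::finite itself \<Rightarrow> nat \<Rightarrow> real" where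
  "kcoef s _ i = (- (real CARD('n) + 2 * s) / 2 gchoose i) * (-1) ^ i"

lemma mon_concat: "mon (concat kss) x = prod_list (map (\<lambda>ks. mon ks x) kss)"
  by (induction kss) (auto simp: mon_append)

lemma mon_wcoords: "mon (wcoords w) x = prod_list (map (\<lambda>l. mon (lcoords l) x) w)"
  by (simp add: wcoords_def mon_concat comp_def)

lemma prod_list_map_mult: "prod_list (map (\<lambda>l. f l * g l) w) = prod_list (map f w) * prod_list (map g w)"
  for f g :: "'l \<Rightarrow> real"
  by (induction w) (auto simp: mult_ac)

lemma length_wcoords: "length w \<le> length (wcoords w)"
  by (induction w) (auto simp: wcoords_def lcoords_def)

lemma sum_letters:
  fixes x y :: "real ^ 'n::finite"
  shows "(\<Sum>l\<in>UNIV. leta l y * mon (lcoords l) x) = (2 * (x \<bullet> y) - (norm x)^2) / (norm y)^2"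
proof -
  have "(\<Sum>l\<in>UNIV. leta l y * mon (lcoords l) x)
      = (\<Sum>k\<in>UNIV. \<Sum>b\<in>UNIV. leta (k, b) y * mon (lcoords (k, b)) x)"
    by (simp add: sum.cartesian_product UNIV_Times_UNIV[symmetric] del: UNIV_Times_UNIV)
  also have "\<dots> = (\<Sum>k\<in>UNIV. (2 * (x $ k * y $ k) - x $ k * x $ k) / (norm y)^2)"
    by (rule sum.cong) (auto simp: UNIV_bool leta_def lcoords_def diff_divide_distrib mult_ac)
  also have "\<dots> = (2 * (x \<bullet> y) - (norm x)^2) / (norm y)^2"
    by (simp add: sum_divide_distrib[symmetric] sum_subtractf sum_distrib_left[symmetric]
        power2_norm_eq_inner inner_vec_def)
  finally show ?thesis .
qed

text \<open>Each degree in \<open>x\<close> is paid for by one factor \<open>1 / norm y\<close>: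
  letters of degree 1 are of size \<open>1 / norm y\<close> and letters of degree 2 of its square.
  This matching of degree and decay underlies all later tail estimates.\<close>

lemma leta_bound:
  assumes "y \<noteq> 0"
  shows "\<bar>leta l y\<bar> \<le> 2 * (1 / norm (y :: real ^ 'n::finite)) ^ length (lcoords l)"
proof (cases "snd l")
  case True
  moreover have "1 / (norm y)^2 \<le> 2 / (norm y)^2" by (intro divide_right_mono) auto
  ultimately show ?thesis by (simp add: leta_def lcoords_def power2_eq_square)
next
  case False
  have "2 * \<bar>y $ fst l\<bar> / (norm y)^2 \<le> 2 * norm y / (norm y)^2"
    using component_le_norm_cart[of y "fst l"] by (intro divide_right_mono) auto
  then show ?thesis using False assms by (simp add: leta_def lcoords_def power2_eq_square abs_mult)
qed

lemma weta_bound: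
  assumes "y \<noteq> 0"
  shows "\<bar>weta w y\<bar> \<le> 2 ^ length w * (1 / norm (y :: real ^ 'n::finite)) ^ length (wcoords w)"
proof (induction w)
  case (Cons l w)
  have "\<bar>weta (l # w) y\<bar> = \<bar>leta l y\<bar> * \<bar>weta w y\<bar>" by (simp add: weta_def abs_mult)
  also have "\<dots> \<le> (2 * (1 / norm y) ^ length (lcoords l)) * (2 ^ length w * (1 / norm y) ^ length (wcoords w))"
    by (intro mult_mono leta_bound assms Cons) auto
  also have "\<dots> = 2 ^ length (l # w) * (1 / norm y) ^ length (wcoords (l # w))"
    by (simp add: wcoords_def power_add)
  finally show ?case .
qed (simp add: weta_def wcoords_def)

lemma prod_letters: "prod_list (map (\<lambda>l. 2 * q ^ length (lcoords l)) w) = 2 ^ length w * q ^ length (wcoords w)"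
  for q :: real
  by (induction w) (auto simp: wcoords_def power_add)

lemma weta_measurable [measurable]: "weta w \<in> borel_measurable borel"
proof -
  have [measurable]: "leta l \<in> borel_measurable borel" for l :: "'a \<times> bool"
    unfolding leta_def by (cases "snd l") simp_all
  show ?thesis unfolding weta_def
    by (induction w) simp_all
qed

text \<open>The condition \<open>3 < norm y\<close> gives \<open>\<bar>z\<bar> < 1\<close> and hence
  the binomial series in \<open>z\<close>. Splitting into words needs summability with the absolute
  values of the letters, which \<open>\<bar>z\<bar> < 1\<close> does not provide.\<close>

lemma fker_expansion:
  fixes x y :: "real ^ 'n::finite"
  assumes x: "x \<in> ball 0 1" and y: "3 < norm y"
  assumes sm: "(\<lambda>w. \<bar>kcoef s TYPE('n) (length w)\<bar> * prod_list (map (\<lambda>l. \<bar>leta l y * mon (lcoords l) x\<bar>) w)) summable_on UNIV"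
  assumes sm': "summable (\<lambda>i. \<bar>kcoef s TYPE('n) i\<bar> * (\<Sum>l\<in>UNIV. \<bar>leta l y * mon (lcoords l) x\<bar>) ^ i)"
  shows "((\<lambda>w. kcoef s TYPE('n) (length w) * (fker s y * weta w y * mon (wcoords w) x)) has_sum fker s (x - y)) UNIV"
proof -
  define a where "a = real CARD('n) + 2 * s"
  define z where "z = (2 * (x \<bullet> y) - (norm x)^2) / (norm y)^2"
  have y0: "norm y > 0" using y by linarith
  have nx: "norm x < 1" using x by simp
  have "\<bar>2 * (x \<bullet> y) - (norm x)^2\<bar> \<le> 2 * norm y + 1"
  proof -
    have "\<bar>x \<bullet> y\<bar> \<le> norm x * norm y" by (rule Cauchy_Schwarz_ineq2)
    also have "\<dots> \<le> 1 * norm y" using nx by (intro mult_right_mono) auto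
    finally have "\<bar>x \<bullet> y\<bar> \<le> norm y" by simp
    moreover have "(norm x)^2 \<le> 1" using nx by (intro power_le_one) auto
    moreover have "0 \<le> (norm x)^2" by simp
    ultimately show ?thesis by linarith
  qed
  also have "\<dots> < (norm y)^2"
  proof -
    have "3 * norm y < norm y * norm y" using y by (intro mult_strict_right_mono) auto
    then show ?thesis using y by (simp add: power2_eq_square)
  qed
  finally have z1: "\<bar>z\<bar> < 1" using y0 by (simp add: z_def abs_divide)
  have "(norm (x - y))^2 = (norm y)^2 * (1 - z)"
    using y0 by (simp add: z_def power2_norm_eq_inner inner_diff_left inner_diff_right inner_commute field_simps)
  then have "norm (x - y) = norm y * sqrt (1 - z)"
    by (metis norm_ge_zero real_sqrt_abs2 real_sqrt_mult power2_eq_square real_sqrt_unique)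
  then have "fker s (x - y) = norm y powr - a * (sqrt (1 - z)) powr - a"
    using z1 by (simp add: fker_def a_def powr_mult)
  also have "(sqrt (1 - z)) powr - a = (1 - z) powr (- a / 2)"
    using z1 by (simp add: powr_half_sqrt[symmetric] powr_powr)
  finally have f: "fker s (x - y) = fker s y * (1 - z) powr (- a / 2)" by (simp add: fker_def a_def)
  have "(\<lambda>n. (- a / 2 gchoose n) * (- z) ^ n) sums (1 + (- z)) powr (- a / 2)"
    by (rule gen_binomial_real) (use z1 in simp)
  moreover have "(- a / 2 gchoose n) * (- z) ^ n = kcoef s TYPE('n) n * z ^ n" for n
    by (simp add: kcoef_def a_def power_minus[of z])
  ultimately have "(\<Sum>n. kcoef s TYPE('n) n * z ^ n) = (1 - z) powr (- a / 2)"
    by (simp add: sums_iff)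
  with has_sum_words(2)[OF sm'] sum_letters[of y x]
  have "((\<lambda>w. kcoef s TYPE('n) (length w) * prod_list (map (\<lambda>l. leta l y * mon (lcoords l) x) w)) has_sum (1 - z) powr (- a / 2)) UNIV"
    by (simp add: z_def)
  from has_sum_cmult_right[OF this, of "fker s y"] show ?thesis
    unfolding f by (simp add: prod_list_map_mult weta_def mon_wcoords mult_ac)
qed

subsection \<open>Polynomials\<close>

lemma finite_multi_indices: "finite {\<alpha> :: 'n::finite \<Rightarrow> nat. (\<Sum>i\<in>UNIV. \<alpha> i) < k}"
proof (rule finite_subset)
  show "{\<alpha> :: 'n \<Rightarrow> nat. (\<Sum>i\<in>UNIV. \<alpha> i) < k} \<subseteq> PiE UNIV (\<lambda>_. {..<k})"
  proof (intro subsetI)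
    fix \<alpha> :: "'n \<Rightarrow> nat" assume "\<alpha> \<in> {\<alpha>. (\<Sum>i\<in>UNIV. \<alpha> i) < k}"
    then have "\<alpha> i < k" for i using member_le_sum[of i UNIV \<alpha>] by simp
    then show "\<alpha> \<in> PiE UNIV (\<lambda>_. {..<k})" by auto
  qed
qed (intro finite_PiE; simp)

lemma poly_degree_less_add:
  assumes "poly_degree_less k P" "poly_degree_less k Q"
  shows "poly_degree_less k (\<lambda>x. P x + Q x)"
proof -
  obtain c d where "\<And>x. P x = (\<Sum>\<alpha> | (\<Sum>i\<in>UNIV. \<alpha> i) < k. c \<alpha> * (\<Prod>i\<in>UNIV. (x $ i) ^ \<alpha> i))"
    "\<And>x. Q x = (\<Sum>\<alpha> | (\<Sum>i\<in>UNIV. \<alpha> i) < k. d \<alpha> * (\<Prod>i\<in>UNIV. (x $ i) ^ \<alpha> i))"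
    using assms unfolding poly_degree_less_def by blast
  then show ?thesis unfolding poly_degree_less_def
    by (intro exI[of _ "\<lambda>\<alpha>. c \<alpha> + d \<alpha>"]) (simp add: distrib_right sum.distrib)
qed

lemma poly_degree_less_sum:
  assumes "\<And>i. i \<in> I \<Longrightarrow> poly_degree_less k (P i)"
  shows "poly_degree_less k (\<lambda>x. \<Sum>i\<in>I. P i x)"
  using assms
proof (induction I rule: infinite_finite_induct)
  case (insert i I)
  then show ?case by (simp add: poly_degree_less_add)
qed (auto simp: poly_degree_less_def intro!: exI[of _ "\<lambda>_. 0"])

lemma mon_eq_prod_powers: "mon ks x = (\<Prod>i\<in>UNIV. (x $ i) ^ count_list ks i)"
proof (induction ks)
  case (Cons k ks)
  have "(\<Prod>i\<in>UNIV. (x $ i) ^ count_list (k # ks) i) = (\<Prod>i\<in>UNIV. (if i = k then x $ i else 1) * (x $ i) ^ count_list ks i)"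
    by (rule prod.cong) auto
  also have "\<dots> = x $ k * mon ks x" by (simp add: prod.distrib Cons)
  finally show ?case by simp
qed simp

lemma sum_count_list: "(\<Sum>i\<in>UNIV. count_list ks (i :: 'n::finite)) = length ks"
proof (induction ks)
  case (Cons k ks)
  have "(\<Sum>i\<in>UNIV. count_list (k # ks) i) = (\<Sum>i\<in>UNIV. (if i = k then 1 else 0) + count_list ks i)"
    by (rule sum.cong) auto
  then show ?case by (simp add: sum.distrib Cons)
qed simp

text \<open>This passes from words to the multi-indices used for polynomials: the coefficient
  function is concentrated on the letter counts of \<open>ks\<close>.\<close>

lemma poly_degree_less_mon:
  assumes "length ks < k"
  shows "poly_degree_less k (\<lambda>x. c * mon ks x)"
  unfolding poly_degree_less_def
proof (intro exI allI)
  fix x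
  let ?S = "{\<alpha>. (\<Sum>i\<in>UNIV. \<alpha> i) < k}"
  have "(\<Sum>\<alpha>\<in>?S. (if \<alpha> = count_list ks then c else 0) * (\<Prod>i\<in>UNIV. (x $ i) ^ \<alpha> i))
     = (\<Sum>\<alpha>\<in>?S. if \<alpha> = count_list ks then c * mon ks x else 0)"
    by (rule sum.cong) (auto simp: mon_eq_prod_powers)
  also have "\<dots> = c * mon ks x"
    using assms by (simp add: finite_multi_indices sum_count_list)
  finally show "c * mon ks x = (\<Sum>\<alpha>\<in>?S. (if \<alpha> = count_list ks then c else 0) * (\<Prod>i\<in>UNIV. (x $ i) ^ \<alpha> i))" ..
qed

subsection \<open>Cancelling the tail\<close>

lemma borel_measurable_lebesgueI: "f \<in> borel_measurable borel \<Longrightarrow> f \<in> borel_measurable lebesgue"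
  by (rule measurable_completion) simp

definition tint :: "real \<Rightarrow> nat \<Rightarrow> real \<Rightarrow> (real ^ 'n::finite \<Rightarrow> real) \<Rightarrow> bool" where
  "tint s k R v \<longleftrightarrow> v \<in> borel_measurable lebesgue \<and>
     integrable lebesgue (\<lambda>y. indicator {y. R \<le> norm y} y * (\<bar>v y\<bar> * fker s y * (1 / norm y) ^ k))"

definition tau :: "real \<Rightarrow> nat \<Rightarrow> real \<Rightarrow> (real ^ 'n::finite \<Rightarrow> real) \<Rightarrow> real" where
  "tau s k R v = (\<integral>y. indicator {y. R \<le> norm y} y * (\<bar>v y\<bar> * fker s y * (1 / norm y) ^ k) \<partial>lebesgue)"

text \<open>The contribution of the word \<open>w\<close> to the Taylor coefficients at the origin
  of the potential of \<open>v\<close> outside radius \<open>R\<close>. Words with the same monomial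
  are kept apart.\<close>

definition tcoef :: "real \<Rightarrow> real \<Rightarrow> (real ^ 'n::finite \<Rightarrow> real) \<Rightarrow> ('n \<times> bool) list \<Rightarrow> real" where
  "tcoef s R v w = kcoef s TYPE('n) (length w) *
     (\<integral>y. indicator {y. R \<le> norm y} y * (v y * fker s y * weta w y) \<partial>lebesgue)"

text \<open>Words of degree less than \<open>k\<close> are discarded because their coefficients need not exist when \<open>v\<close> is
  only integrable against the weight of order \<open>k\<close>.\<close>

definition ccoef :: "real \<Rightarrow> nat \<Rightarrow> real \<Rightarrow> (real ^ 'n::finite \<Rightarrow> real) \<Rightarrow> ('n \<times> bool) list \<Rightarrow> real" where
  "ccoef s k R v w = (if k \<le> length (wcoords w) then tcoef s R v w else 0)"

text \<open>The potential of the far data without its part of degree less than \<open>k\<close>. It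
  makes sense even when the potential itself diverges.\<close>

definition tail :: "real \<Rightarrow> nat \<Rightarrow> real \<Rightarrow> (real ^ 'n::finite \<Rightarrow> real) \<Rightarrow> real ^ 'n \<Rightarrow> real" where
  "tail s k R v x = (\<Sum>\<^sub>\<infinity>w. ccoef s k R v w * mon (wcoords w) x)"

definition tsa where
  "tsa A s k R v = (\<lambda>(w, j). complex_of_real (ccoef s k R v w) * A (wcoords w) j)"

definition tsx where
  "tsx X = (\<lambda>(w, j). X (wcoords w) j)"

definition tsol where
  "tsol A X s k R v x = Re (tsum (tsa A s k R v) (tsx X) x)"

text \<open>A majorant for the contribution of a word in which every degree is worth a factor
  \<open>q\<close>.\<close>

definition kbd :: "real \<Rightarrow> real \<Rightarrow> ('n::finite \<times> bool) list \<Rightarrow> real" where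
  "kbd s q w = \<bar>kcoef s TYPE('n) (length w)\<bar> * (2 ^ length w * q ^ length (wcoords w))"

text \<open>There are twice as many letters as coordinates, each worth at most \<open>2 * q\<close>.
  The value 1/2 lies safely inside the unit radius of convergence of the binomial series.\<close>

lemma sum_letters_bound:
  assumes "0 \<le> q" "8 * real CARD('n) * q \<le> 1"
  shows "(\<Sum>l\<in>(UNIV :: ('n::finite \<times> bool) set). 2 * q ^ length (lcoords l)) \<le> 1 / 2"
proof -
  have "1 \<le> real CARD('n)" using zero_less_card_finite[where 'a='n] by linarith
  then have "8 * 1 * q \<le> 8 * real CARD('n) * q" using assms(1) by (intro mult_right_mono) auto
  then have q1: "q \<le> 1" using assms by linarith
  have "2 * q ^ length (lcoords l) \<le> 2 * q" for l :: "'n \<times> bool"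
    using mult_left_mono[OF q1 assms(1)] by (simp add: lcoords_def)
  then have "(\<Sum>l\<in>(UNIV :: ('n \<times> bool) set). 2 * q ^ length (lcoords l)) \<le> (\<Sum>l\<in>(UNIV :: ('n \<times> bool) set). 2 * q)"
    by (intro sum_mono) auto
  also have "\<dots> = 4 * real CARD('n) * q"
    by (simp add: card_UNIV_bool)
  finally show ?thesis using assms(2) by linarith
qed

lemma kbd_summable:
  assumes "0 \<le> q" "8 * real CARD('n) * q \<le> 1"
  shows "(kbd s q :: ('n::finite \<times> bool) list \<Rightarrow> real) summable_on UNIV"
proof -
  have "summable (\<lambda>i. \<bar>kcoef s TYPE('n) i\<bar> * (\<Sum>l\<in>(UNIV :: ('n \<times> bool) set). \<bar>2 * q ^ length (lcoords l)\<bar>) ^ i)"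
  proof (rule summable_comparison_test')
    show "summable (\<lambda>i. \<bar>- (real CARD('n) + 2 * s) / 2 gchoose i\<bar> * \<bar>1 / 2 :: real\<bar> ^ i)"
      by (rule binomial_series_summable) simp
    show "norm (\<bar>kcoef s TYPE('n) i\<bar> * (\<Sum>l\<in>(UNIV :: ('n \<times> bool) set). \<bar>2 * q ^ length (lcoords l)\<bar>) ^ i)
        \<le> \<bar>- (real CARD('n) + 2 * s) / 2 gchoose i\<bar> * \<bar>1 / 2 :: real\<bar> ^ i" for i
    proof -
      have "(\<Sum>l\<in>(UNIV :: ('n \<times> bool) set). \<bar>2 * q ^ length (lcoords l)\<bar>) ^ i \<le> (1 / 2) ^ i"
        using sum_letters_bound[OF assms] assms(1) by (intro power_mono) (auto simp: abs_mult sum_nonneg)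
      then show ?thesis
        by (auto simp: kcoef_def abs_mult power_abs sum_nonneg intro!: mult_left_mono)
    qed
  qed
  from has_sum_words(1)[OF this] show ?thesis
    using assms(1) by (simp add: kbd_def[abs_def] prod_letters abs_mult)
qed

lemma kbd_nonneg: "0 \<le> q \<Longrightarrow> 0 \<le> kbd s q w"
  by (simp add: kbd_def)

lemma tint_mono:
  fixes v :: "real ^ 'n::finite \<Rightarrow> real"
  assumes "tint s k R v" "1 \<le> R" "k \<le> k'"
  shows "tint s k' R v"
  unfolding tint_def
proof
  show v: "v \<in> borel_measurable lebesgue" using assms(1) by (simp add: tint_def)
  show "integrable lebesgue (\<lambda>y. indicator {y. R \<le> norm y} y * (\<bar>v y\<bar> * fker s y * (1 / norm y) ^ k'))"
  proof (rule Bochner_Integration.integrable_bound)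
    show "integrable lebesgue (\<lambda>y. indicator {y. R \<le> norm y} y * (\<bar>v y\<bar> * fker s y * (1 / norm y) ^ k))"
      using assms(1) by (simp add: tint_def)
    have [measurable]: "fker s \<in> borel_measurable lebesgue" "(\<lambda>y. (1 / norm y) ^ k') \<in> borel_measurable lebesgue"
      "indicator {y. R \<le> norm y} \<in> borel_measurable lebesgue"
      by (rule borel_measurable_lebesgueI, measurable)+
    note v[measurable]
    show "(\<lambda>y. indicator {y. R \<le> norm y} y * (\<bar>v y\<bar> * fker s y * (1 / norm y) ^ k')) \<in> borel_measurable lebesgue"
      by measurable
    show "AE y in lebesgue. norm (indicator {y. R \<le> norm y} y * (\<bar>v y\<bar> * fker s y * (1 / norm y) ^ k'))
      \<le> norm (indicator {y. R \<le> norm y} y * (\<bar>v y\<bar> * fker s y * (1 / norm y) ^ k))"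
    proof (rule AE_I2)
      fix y :: "real ^ 'n"
      have "(1 / norm y) ^ k' \<le> (1 / norm y) ^ k" if "R \<le> norm y"
        using that assms by (intro power_decreasing) (auto simp: divide_le_eq)
      then show "norm (indicator {y. R \<le> norm y} y * (\<bar>v y\<bar> * fker s y * (1 / norm y) ^ k'))
        \<le> norm (indicator {y. R \<le> norm y} y * (\<bar>v y\<bar> * fker s y * (1 / norm y) ^ k))"
        by (auto simp: indicator_def abs_mult power_abs intro!: mult_left_mono)
    qed
  qed
qed

lemma tau_nonneg: "0 \<le> tau s k R v"
  unfolding tau_def by (intro Bochner_Integration.integral_nonneg) auto

text \<open>Of the decay \<open>1 / norm y\<close> to the power of the degree, \<open>k\<close>
  factors are spent on the weight that makes \<open>v\<close> integrable; the others are bounded by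
  \<open>1 / r\<close>. The radius \<open>r\<close> is kept apart from \<open>R\<close> so that
  constants can be independent of \<open>R\<close>.\<close>

lemma word_integrable:
  fixes v :: "real ^ 'n::finite \<Rightarrow> real"
  assumes v: "tint s k R v" and R: "1 \<le> r" "r \<le> R" and w: "k \<le> length (wcoords w)"
  shows "integrable lebesgue (\<lambda>y. indicator {y. R \<le> norm y} y * (v y * fker s y * weta w y))"
    "\<bar>\<integral>y. indicator {y. R \<le> norm y} y * (v y * fker s y * weta w y) \<partial>lebesgue\<bar>
       \<le> 2 ^ length w * (1 / r) ^ (length (wcoords w) - k) * tau s k R v"
proof -
  let ?g = "\<lambda>y. indicator {y. R \<le> norm y} y * (v y * fker s y * weta w y)"
  let ?c = "2 ^ length w * (1 / r) ^ (length (wcoords w) - k)"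
  let ?h = "\<lambda>y. ?c * (indicator {y. R \<le> norm y} y * (\<bar>v y\<bar> * fker s y * (1 / norm y) ^ k))"
  have h: "integrable lebesgue ?h" using v by (simp add: tint_def)
  have le: "\<bar>?g y\<bar> \<le> ?h y" for y
  proof (cases "R \<le> norm y")
    case True
    then have y: "y \<noteq> 0" "r \<le> norm y" using R by auto
    have "(1 / norm y) ^ length (wcoords w) = (1 / norm y) ^ (length (wcoords w) - k) * (1 / norm y) ^ k"
      using w by (simp add: power_add[symmetric])
    also have "\<dots> \<le> (1 / r) ^ (length (wcoords w) - k) * (1 / norm y) ^ k"
      using y R by (intro mult_right_mono power_mono divide_left_mono) auto
    finally have "2 ^ length w * (1 / norm y) ^ length (wcoords w) \<le> ?c * (1 / norm y) ^ k"
      by (simp add: mult.assoc)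
    then have "\<bar>weta w y\<bar> \<le> ?c * (1 / norm y) ^ k" using weta_bound[OF y(1), of w] by linarith
    then have "\<bar>v y\<bar> * fker s y * \<bar>weta w y\<bar> \<le> \<bar>v y\<bar> * fker s y * (?c * (1 / norm y) ^ k)"
      by (intro mult_left_mono) auto
    then show ?thesis using True by (simp add: abs_mult mult_ac)
  qed simp
  have [measurable]: "fker s \<in> borel_measurable lebesgue" "weta w \<in> borel_measurable lebesgue"
    "indicator {y. R \<le> norm y} \<in> borel_measurable lebesgue"
    by (rule borel_measurable_lebesgueI, measurable)+
  have [measurable]: "v \<in> borel_measurable lebesgue" using v by (simp add: tint_def)
  show g: "integrable lebesgue ?g"
  proof (rule Bochner_Integration.integrable_bound[OF h])
    show "AE y in lebesgue. norm (?g y) \<le> norm (?h y)"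
      unfolding real_norm_def by (intro AE_I2 order_trans[OF le abs_ge_self])
  qed measurable
  have "\<bar>\<integral>y. ?g y \<partial>lebesgue\<bar> \<le> (\<integral>y. ?h y \<partial>lebesgue)"
    by (rule integral_abs_bound_integral[OF g h le])
  then show "\<bar>\<integral>y. ?g y \<partial>lebesgue\<bar> \<le> ?c * tau s k R v" by (simp add: tau_def)
qed

lemma ccoef_bound:
  fixes v :: "real ^ 'n::finite \<Rightarrow> real"
  assumes v: "tint s k R v" and r: "1 \<le> r" "r \<le> R" and B: "0 \<le> B"
  shows "\<bar>ccoef s k R v w\<bar> * B ^ length (wcoords w) \<le> r ^ k * tau s k R v * kbd s (B / r) w"
proof (cases "k \<le> length (wcoords w)")
  case True
  have "\<bar>ccoef s k R v w\<bar> * B ^ length (wcoords w)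
     \<le> \<bar>kcoef s TYPE('n) (length w)\<bar> * (2 ^ length w * (1 / r) ^ (length (wcoords w) - k) * tau s k R v) * B ^ length (wcoords w)"
    using word_integrable(2)[OF v r True] B True
    by (auto simp: ccoef_def tcoef_def abs_mult intro!: mult_right_mono mult_left_mono)
  also have "(1 / r) ^ (length (wcoords w) - k) = r ^ k * (1 / r) ^ length (wcoords w)"
    using r True by (simp add: power_diff power_one_over field_simps)
  finally show ?thesis by (simp add: kbd_def power_divide power_one_over mult_ac)
next
  case False
  then show ?thesis using r B tau_nonneg[of s k R v] kbd_nonneg[of "B / r" s w]
    by (simp add: ccoef_def)
qed

text \<open>The growth \<open>B\<close> per degree is compensated by the decay \<open>1 / R0\<close>
  per degree. The constant \<open>K\<close> depends neither on \<open>R\<close> nor on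
  \<open>v\<close>, so the solution becomes small as soon as \<open>tau\<close> does. The last two
  properties concern data integrable without the extra weight, whose full potential exists.\<close>

lemma tail_solver:
  assumes s: "0 < s" "s < 1" and sol: "mon_solver s M A (X :: 'n::finite list \<Rightarrow> _) C B" and M: "2 \<le> M"
  obtains R0 K where "3 < R0" "0 \<le> K"
    "\<And>R (v :: real ^ 'n \<Rightarrow> real). R0 \<le> R \<Longrightarrow> tint s k R v \<Longrightarrow> tadm M (tsa A s k R v) (tsx X)"
    "\<And>R (v :: real ^ 'n \<Rightarrow> real). R0 \<le> R \<Longrightarrow> tint s k R v \<Longrightarrow> tnorm M (tsa A s k R v) (tsx X) \<le> K * tau s k R v"
    "\<And>R (v :: real ^ 'n \<Rightarrow> real) x. R0 \<le> R \<Longrightarrow> tint s k R v \<Longrightarrow> x \<in> ball 0 1 \<Longrightarrow> has_frac_laplacian s (tsol A X s k R v) x (tail s k R v x)"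
    "\<And>R (v :: real ^ 'n \<Rightarrow> real) x. R0 \<le> R \<Longrightarrow> tint s k R v \<Longrightarrow> x \<in> ball 0 1 \<Longrightarrow> \<bar>tail s k R v x\<bar> \<le> K * tau s k R v"
    "\<And>R (v :: real ^ 'n \<Rightarrow> real) x. R0 \<le> R \<Longrightarrow> tint s k R v \<Longrightarrow> x \<in> ball 0 1 \<Longrightarrow> (\<lambda>w. ccoef s k R v w * mon (wcoords w) x) summable_on UNIV"
    "\<And>R (v :: real ^ 'n \<Rightarrow> real) x. R0 \<le> R \<Longrightarrow> tint s 0 R v \<Longrightarrow> x \<in> ball 0 1 \<Longrightarrow>
       integrable lebesgue (\<lambda>y. indicator {y. R \<le> norm y} y * (v y * fker s (x - y)))"
    "\<And>R (v :: real ^ 'n \<Rightarrow> real) x. R0 \<le> R \<Longrightarrow> tint s 0 R v \<Longrightarrow> x \<in> ball 0 1 \<Longrightarrow>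
       ((\<lambda>w. tcoef s R v w * mon (wcoords w) x) has_sum
         (\<integral>y. indicator {y. R \<le> norm y} y * (v y * fker s (x - y)) \<partial>lebesgue)) UNIV"
proof -
  have CB: "0 \<le> C" "1 \<le> B" using sol unfolding mon_solver_def by blast+
  \<comment> \<open>The first summand gives \<open>q = B / R0\<close> the bound of
    \<open>sum_letters_bound\<close>; the 4 secures \<open>3 < R0\<close> for the kernel
    expansion.\<close>
  define R0 where "R0 = 8 * real CARD('n) * B + 4"
  define q where "q = B / R0"
  have n1: "1 \<le> real CARD('n)" using zero_less_card_finite[where 'a='n] by linarith
  have "0 \<le> 8 * real CARD('n) * B" using CB by simp
  then have R0: "3 < R0" "1 \<le> R0" unfolding R0_def by linarith+
  have q: "0 \<le> q" "8 * real CARD('n) * q \<le> 1" "1 / R0 \<le> q"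
    using CB R0 by (auto simp: q_def R0_def field_simps)
  define \<beta> where "\<beta> = (kbd s q :: ('n \<times> bool) list \<Rightarrow> real)"
  have \<beta>: "\<beta> summable_on UNIV" unfolding \<beta>_def by (rule kbd_summable[OF q(1,2)])
  have \<beta>0: "0 \<le> \<beta> w" for w unfolding \<beta>_def by (rule kbd_nonneg[OF q(1)])
  define S where "S = infsum \<beta> UNIV"
  have S0: "0 \<le> S" unfolding S_def by (rule infsum_nonneg) (rule \<beta>0)
  \<comment> \<open>The \<open>C\<close> is for the norm of the solution, the 1 for the bound on
    \<open>tail\<close> itself.\<close>
  define K where "K = (C + 1) * (R0 ^ k * S)"
  have K0: "0 \<le> K" using CB S0 R0 by (simp add: K_def)
  have cb: "\<bar>ccoef s k R v w\<bar> * B ^ length (wcoords w) \<le> R0 ^ k * tau s k R v * \<beta> w"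
    if "R0 \<le> R" "tint s k R v" for R w and v :: "real ^ 'n \<Rightarrow> real"
    unfolding \<beta>_def q_def by (rule ccoef_bound[OF that(2) R0(2) that(1)]) (use CB in simp)
  have cs: "(\<lambda>w. \<bar>ccoef s k R v w\<bar> * B ^ length (wcoords w)) summable_on UNIV"
    and cS: "(\<Sum>\<^sub>\<infinity>w. \<bar>ccoef s k R v w\<bar> * B ^ length (wcoords w)) \<le> R0 ^ k * S * tau s k R v"
    if "R0 \<le> R" "tint s k R v" for R and v :: "real ^ 'n \<Rightarrow> real"
  proof -
    have sb: "(\<lambda>w. R0 ^ k * tau s k R v * \<beta> w) summable_on UNIV" by (rule summable_on_cmult_right[OF \<beta>])
    show su: "(\<lambda>w. \<bar>ccoef s k R v w\<bar> * B ^ length (wcoords w)) summable_on UNIV"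
      by (rule summable_on_bounded[OF sb]) (use cb[OF that] CB in \<open>simp add: abs_mult\<close>)
    have "(\<Sum>\<^sub>\<infinity>w. \<bar>ccoef s k R v w\<bar> * B ^ length (wcoords w)) \<le> (\<Sum>\<^sub>\<infinity>w. R0 ^ k * tau s k R v * \<beta> w)"
      by (rule infsum_mono[OF su sb cb[OF that]])
    then show "(\<Sum>\<^sub>\<infinity>w. \<bar>ccoef s k R v w\<bar> * B ^ length (wcoords w)) \<le> R0 ^ k * S * tau s k R v"
      by (simp only: infsum_cmult_right' S_def[symmetric]) (simp add: mult_ac)
  qed
  have mono_le: "norm (ccoef s k R v w * mon (wcoords w) x) \<le> \<bar>ccoef s k R v w\<bar> * B ^ length (wcoords w)"
    if "x \<in> ball 0 1" for R w x and v :: "real ^ 'n \<Rightarrow> real"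
  proof -
    have "\<bar>mon (wcoords w) x\<bar> \<le> B ^ length (wcoords w)"
      using abs_mon_le_1[OF that] one_le_power[OF CB(2)] order_trans by blast
    then show ?thesis by (simp add: abs_mult mult_left_mono)
  qed
  have expand: "integrable lebesgue (\<lambda>y. indicator {y. R \<le> norm y} y * (v y * fker s (x - y)))"
    "((\<lambda>w. tcoef s R v w * mon (wcoords w) x) has_sum
         (\<integral>y. indicator {y. R \<le> norm y} y * (v y * fker s (x - y)) \<partial>lebesgue)) UNIV"
    if R: "R0 \<le> R" and v: "tint s 0 R v" and x: "x \<in> ball 0 1" for R x and v :: "real ^ 'n \<Rightarrow> real"
  proof -
    define I where "I y = (indicator {y. R \<le> norm y} y :: real)" for y :: "real ^ 'n"
    have iv: "integrable lebesgue (\<lambda>y. I y * (\<bar>v y\<bar> * fker s y))" using v by (simp add: tint_def I_def)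
    have [measurable]: "v \<in> borel_measurable lebesgue" using v by (simp add: tint_def)
    have [measurable]: "(\<lambda>y. fker s (x - y)) \<in> borel_measurable lebesgue" "I \<in> borel_measurable lebesgue"
      unfolding I_def by (rule borel_measurable_lebesgueI, measurable)+
    define t where "t w y = kcoef s TYPE('n) (length w) * (fker s y * weta w y * mon (wcoords w) x)" for w and y :: "real ^ 'n"
    have tb: "norm (t w y) \<le> fker s y * \<beta> w" if y: "R0 \<le> norm y" for w y
    proof -
      have y0: "y \<noteq> 0" using y R0 by auto
      have "\<bar>weta w y\<bar> * \<bar>mon (wcoords w) x\<bar> \<le> (2 ^ length w * (1 / norm y) ^ length (wcoords w)) * 1"
        by (intro mult_mono weta_bound[OF y0] abs_mon_le_1[OF x]) auto
      also have "\<dots> \<le> 2 ^ length w * q ^ length (wcoords w)"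
      proof -
        have "1 / norm y \<le> 1 / R0" using y R0 by (intro divide_left_mono mult_pos_pos) auto
        then have "1 / norm y \<le> q" using q(3) by linarith
        then show ?thesis by (simp add: power_mono)
      qed
      finally have "fker s y * \<bar>kcoef s TYPE('n) (length w)\<bar> * (\<bar>weta w y\<bar> * \<bar>mon (wcoords w) x\<bar>)
         \<le> fker s y * \<bar>kcoef s TYPE('n) (length w)\<bar> * (2 ^ length w * q ^ length (wcoords w))"
        by (intro mult_left_mono) auto
      then show ?thesis by (simp add: t_def \<beta>_def kbd_def abs_mult mult_ac)
    qed
    have ts: "((\<lambda>w. t w y) has_sum fker s (x - y)) UNIV" if y: "R0 \<le> norm y" for y
      unfolding t_def
    proof (rule fker_expansion[OF x])
      show "3 < norm y" using y R0 by linarith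
      have y0: "y \<noteq> 0" using y R0 by auto
      have "1 / norm y \<le> 1 / R0" using y R0 by (intro divide_left_mono mult_pos_pos) auto
      then have yq: "1 / norm y \<le> q" using q(3) by linarith
      have lb: "\<bar>leta l y * mon (lcoords l) x\<bar> \<le> 2 * q ^ length (lcoords l)" for l
      proof -
        have "\<bar>leta l y\<bar> * \<bar>mon (lcoords l) x\<bar> \<le> (2 * (1 / norm y) ^ length (lcoords l)) * 1"
          by (intro mult_mono leta_bound[OF y0] abs_mon_le_1[OF x]) auto
        also have "\<dots> \<le> 2 * q ^ length (lcoords l)" using yq by (simp add: power_mono)
        finally show ?thesis by (simp add: abs_mult)
      qed
      have "(\<Sum>l\<in>UNIV. \<bar>leta l y * mon (lcoords l) x\<bar>) \<le> 1 / 2"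
        using order_trans[OF sum_mono[OF lb] sum_letters_bound[OF q(1,2)]] .
      then have p: "(\<Sum>l\<in>UNIV. \<bar>leta l y * mon (lcoords l) x\<bar>) ^ i \<le> (1 / 2) ^ i" for i
        by (intro power_mono) (auto simp: sum_nonneg)
      show sm: "summable (\<lambda>i. \<bar>kcoef s TYPE('n) i\<bar> * (\<Sum>l\<in>UNIV. \<bar>leta l y * mon (lcoords l) x\<bar>) ^ i)"
      proof (rule summable_comparison_test')
        show "summable (\<lambda>i. \<bar>- (real CARD('n) + 2 * s) / 2 gchoose i\<bar> * \<bar>1 / 2 :: real\<bar> ^ i)"
          by (rule binomial_series_summable) simp
        show "norm (\<bar>kcoef s TYPE('n) i\<bar> * (\<Sum>l\<in>UNIV. \<bar>leta l y * mon (lcoords l) x\<bar>) ^ i)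
          \<le> \<bar>- (real CARD('n) + 2 * s) / 2 gchoose i\<bar> * \<bar>1 / 2 :: real\<bar> ^ i" for i
          using p[of i] by (auto simp: kcoef_def abs_mult power_abs sum_nonneg intro!: mult_left_mono)
      qed
      show "(\<lambda>w. \<bar>kcoef s TYPE('n) (length w)\<bar> * prod_list (map (\<lambda>l. \<bar>leta l y * mon (lcoords l) x\<bar>) w)) summable_on UNIV"
        by (rule has_sum_words(1)[OF sm])
    qed
    \<comment> \<open>The truncation error of the expansion is uniform relative to
      \<open>fker s y\<close>. Integrated against \<open>v\<close>, it proves convergence of the
      expanded potential; for empty \<open>F\<close> it compares the two kernels and gives
      integrability.\<close>
    have fk: "\<bar>fker s (x - y) - (\<Sum>w\<in>F. t w y)\<bar> \<le> fker s y * (S - sum \<beta> F)" if y: "R0 \<le> norm y" and F: "finite F" for y F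
    proof -
      have sb: "(\<lambda>w. fker s y * \<beta> w) summable_on UNIV" by (rule summable_on_cmult_right[OF \<beta>])
      have "norm (infsum (\<lambda>w. t w y) UNIV - (\<Sum>w\<in>F. t w y)) \<le> infsum (\<lambda>w. fker s y * \<beta> w) UNIV - (\<Sum>w\<in>F. fker s y * \<beta> w)"
        by (rule infsum_tail_bound[OF sb tb[OF y] F]) simp
      then show ?thesis
        using infsumI[OF ts[OF y]] by (simp add: infsum_cmult_right' S_def sum_distrib_left[symmetric] right_diff_distrib)
    qed
    show int: "integrable lebesgue (\<lambda>y. indicator {y. R \<le> norm y} y * (v y * fker s (x - y)))"
      unfolding I_def[symmetric]
    proof (rule Bochner_Integration.integrable_bound)
      show "integrable lebesgue (\<lambda>y. S * (I y * (\<bar>v y\<bar> * fker s y)))" using iv by simp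
      show "AE y in lebesgue. norm (I y * (v y * fker s (x - y))) \<le> norm (S * (I y * (\<bar>v y\<bar> * fker s y)))"
      proof (rule AE_I2)
        fix y
        show "norm (I y * (v y * fker s (x - y))) \<le> norm (S * (I y * (\<bar>v y\<bar> * fker s y)))"
        proof (cases "R \<le> norm y")
          case True
          have "fker s (x - y) \<le> fker s y * S" using fk[of y "{}"] True R by simp
          then have "\<bar>v y\<bar> * fker s (x - y) \<le> \<bar>v y\<bar> * (fker s y * S)" by (rule mult_left_mono) simp
          then show ?thesis using True S0 by (simp add: I_def abs_mult mult_ac)
        qed (simp add: I_def)
      qed
    qed measurable
    show "((\<lambda>w. tcoef s R v w * mon (wcoords w) x) has_sum
         (\<integral>y. indicator {y. R \<le> norm y} y * (v y * fker s (x - y)) \<partial>lebesgue)) UNIV"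
      unfolding has_sum_def I_def[symmetric]
    proof (rule Lim_null[THEN iffD2], rule Lim_null_comparison)
      have R1: "1 \<le> R" using R R0 by linarith
      have wi: "integrable lebesgue (\<lambda>y. I y * (v y * fker s y * weta w y))" for w
        unfolding I_def by (rule word_integrable(1)[OF v order_refl R1]) simp
      have ti: "integrable lebesgue (\<lambda>y. I y * (v y * t w y))"
        and tI: "(\<integral>y. I y * (v y * t w y) \<partial>lebesgue) = tcoef s R v w * mon (wcoords w) x" for w
      proof -
        have e: "I y * (v y * t w y) = (kcoef s TYPE('n) (length w) * mon (wcoords w) x) * (I y * (v y * fker s y * weta w y))" for y
          by (simp add: t_def mult_ac)
        show "integrable lebesgue (\<lambda>y. I y * (v y * t w y))" unfolding e by (intro integrable_mult_right wi)
        show "(\<integral>y. I y * (v y * t w y) \<partial>lebesgue) = tcoef s R v w * mon (wcoords w) x"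
          unfolding e by (simp add: tcoef_def I_def)
      qed
      show "\<forall>\<^sub>F F in finite_subsets_at_top UNIV. norm ((\<Sum>w\<in>F. tcoef s R v w * mon (wcoords w) x) -
           (\<integral>y. I y * (v y * fker s (x - y)) \<partial>lebesgue)) \<le> (S - sum \<beta> F) * (\<integral>y. I y * (\<bar>v y\<bar> * fker s y) \<partial>lebesgue)"
      proof (rule eventually_finite_subsets_at_top_weakI)
        fix F :: "('n \<times> bool) list set" assume F: "finite F"
        have iF: "integrable lebesgue (\<lambda>y. \<Sum>w\<in>F. I y * (v y * t w y))"
          by (intro Bochner_Integration.integrable_sum ti)
        have IF: "(\<integral>y. (\<Sum>w\<in>F. I y * (v y * t w y)) \<partial>lebesgue) = (\<Sum>w\<in>F. tcoef s R v w * mon (wcoords w) x)"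
          using tI by (subst Bochner_Integration.integral_sum[OF ti]) simp
        have "\<bar>(\<integral>y. I y * (v y * fker s (x - y)) \<partial>lebesgue) - (\<Sum>w\<in>F. tcoef s R v w * mon (wcoords w) x)\<bar>
          = \<bar>\<integral>y. I y * (v y * fker s (x - y)) - (\<Sum>w\<in>F. I y * (v y * t w y)) \<partial>lebesgue\<bar>"
          using Bochner_Integration.integral_diff[OF int[folded I_def] iF] IF by simp
        also have "\<dots> \<le> (\<integral>y. (S - sum \<beta> F) * (I y * (\<bar>v y\<bar> * fker s y)) \<partial>lebesgue)"
        proof (rule integral_abs_bound_integral)
          show "integrable lebesgue (\<lambda>y. I y * (v y * fker s (x - y)) - (\<Sum>w\<in>F. I y * (v y * t w y)))"
            by (intro Bochner_Integration.integrable_diff int[folded I_def] iF)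
          show "integrable lebesgue (\<lambda>y. (S - sum \<beta> F) * (I y * (\<bar>v y\<bar> * fker s y)))" using iv by simp
          fix y
          have e: "I y * (v y * fker s (x - y)) - (\<Sum>w\<in>F. I y * (v y * t w y)) = I y * (v y * (fker s (x - y) - (\<Sum>w\<in>F. t w y)))"
            by (simp add: sum_distrib_left right_diff_distrib)
          show "\<bar>I y * (v y * fker s (x - y)) - (\<Sum>w\<in>F. I y * (v y * t w y))\<bar> \<le> (S - sum \<beta> F) * (I y * (\<bar>v y\<bar> * fker s y))"
            unfolding e
          proof (cases "R \<le> norm y")
            case True
            have "\<bar>v y\<bar> * \<bar>fker s (x - y) - (\<Sum>w\<in>F. t w y)\<bar> \<le> \<bar>v y\<bar> * (fker s y * (S - sum \<beta> F))"
              using fk[OF _ F, of y] True R by (intro mult_left_mono) auto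
            then show "\<bar>I y * (v y * (fker s (x - y) - (\<Sum>w\<in>F. t w y)))\<bar> \<le> (S - sum \<beta> F) * (I y * (\<bar>v y\<bar> * fker s y))"
              using True by (simp add: I_def abs_mult mult_ac)
          qed (simp add: I_def)
        qed
        finally show "norm ((\<Sum>w\<in>F. tcoef s R v w * mon (wcoords w) x) -
           (\<integral>y. I y * (v y * fker s (x - y)) \<partial>lebesgue)) \<le> (S - sum \<beta> F) * (\<integral>y. I y * (\<bar>v y\<bar> * fker s y) \<partial>lebesgue)"
          by (simp add: abs_minus_commute)
      qed
      show "((\<lambda>F. (S - sum \<beta> F) * (\<integral>y. I y * (\<bar>v y\<bar> * fker s y) \<partial>lebesgue)) \<longlongrightarrow> 0) (finite_subsets_at_top UNIV)"
        using tendsto_mult_right[OF infsum_tail_tendsto_0[OF \<beta>]] unfolding S_def by (simp add: tendsto_mult_left_zero)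
    qed
  qed
  show thesis
  proof (rule that[OF R0(1) K0])
    fix R and v :: "real ^ 'n \<Rightarrow> real" assume Rv: "R0 \<le> R" "tint s k R v"
    note P = superposed_solution[OF s sol M cs[OF Rv], folded tsa_def tsx_def]
    show "tadm M (tsa A s k R v) (tsx X)" by (rule P(1))
    have RS: "0 \<le> R0 ^ k * S * tau s k R v" using R0 S0 tau_nonneg[of s k R v] by simp
    have "tnorm M (tsa A s k R v) (tsx X) \<le> C * (R0 ^ k * S * tau s k R v)"
      using order_trans[OF P(2) mult_left_mono[OF cS[OF Rv] CB(1)]] .
    also have "\<dots> \<le> (C + 1) * (R0 ^ k * S * tau s k R v)" using RS by (intro mult_right_mono) auto
    finally show "tnorm M (tsa A s k R v) (tsx X) \<le> K * tau s k R v" by (simp add: K_def mult_ac)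
    fix x :: "real ^ 'n" assume x: "x \<in> ball 0 1"
    show "has_frac_laplacian s (tsol A X s k R v) x (tail s k R v x)"
      using P(3)[OF x] unfolding tsol_def[abs_def] tail_def .
    show "(\<lambda>w. ccoef s k R v w * mon (wcoords w) x) summable_on UNIV"
      by (rule summable_on_bounded[OF cs[OF Rv] mono_le[OF x]])
    have "\<bar>tail s k R v x\<bar> \<le> (\<Sum>\<^sub>\<infinity>w. \<bar>ccoef s k R v w\<bar> * B ^ length (wcoords w))"
      unfolding tail_def using norm_infsum_le_infsum[OF cs[OF Rv] mono_le[OF x]] by simp
    also have "\<dots> \<le> 1 * (R0 ^ k * S * tau s k R v)" using cS[OF Rv] by simp
    also have "\<dots> \<le> (C + 1) * (R0 ^ k * S * tau s k R v)" using CB RS by (intro mult_right_mono) auto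
    finally show "\<bar>tail s k R v x\<bar> \<le> K * tau s k R v" by (simp add: K_def mult_ac)
  qed (rule expand; assumption)+
qed

lemma tcoef_diff:
  fixes v1 v2 :: "real ^ 'n::finite \<Rightarrow> real"
  assumes "tint s k R v1" "tint s k R v2" "1 \<le> R" "k \<le> length (wcoords w)"
  shows "tcoef s R (\<lambda>y. v1 y - v2 y) w = tcoef s R v1 w - tcoef s R v2 w"
proof -
  have "(\<integral>y. indicator {y. R \<le> norm y} y * ((v1 y - v2 y) * fker s y * weta w y) \<partial>lebesgue)
     = (\<integral>y. indicator {y. R \<le> norm y} y * (v1 y * fker s y * weta w y) - indicator {y. R \<le> norm y} y * (v2 y * fker s y * weta w y) \<partial>lebesgue)"
    by (intro Bochner_Integration.integral_cong) (auto simp: algebra_simps)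
  also have "\<dots> = (\<integral>y. indicator {y. R \<le> norm y} y * (v1 y * fker s y * weta w y) \<partial>lebesgue)
     - (\<integral>y. indicator {y. R \<le> norm y} y * (v2 y * fker s y * weta w y) \<partial>lebesgue)"
    by (intro Bochner_Integration.integral_diff word_integrable(1)[OF assms(1) order_refl assms(3,4)]
        word_integrable(1)[OF assms(2) order_refl assms(3,4)])
  finally show ?thesis by (simp add: tcoef_def right_diff_distrib)
qed

text \<open>The solution is linear in the data because the frequencies are fixed and only the
  coefficients depend on \<open>v\<close>. The contraction estimate rests on this.\<close>

lemma tsol_diff:
  fixes v1 v2 :: "real ^ 'n::finite \<Rightarrow> real"
  assumes "tint s k R v1" "tint s k R v2" "1 \<le> R"
    and a: "tadm M (tsa A s k R v1) (tsx X)" "tadm M (tsa A s k R v2) (tsx X)"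
  shows "tsol A X s k R (\<lambda>y. v1 y - v2 y) x = tsol A X s k R v1 x - tsol A X s k R v2 x"
proof -
  have c: "ccoef s k R (\<lambda>y. v1 y - v2 y) w = ccoef s k R v1 w - ccoef s k R v2 w" for w
    using tcoef_diff[OF assms(1-3)] by (simp add: ccoef_def)
  have "tsa A s k R (\<lambda>y. v1 y - v2 y) = (\<lambda>p. tsa A s k R v1 p + (- 1) * tsa A s k R v2 p)"
    by (auto simp: tsa_def fun_eq_iff c algebra_simps)
  moreover have m: "tadm 0 (\<lambda>p. (- 1) * tsa A s k R v2 p) (tsx X)"
    using tadm_mono(1)[OF a(2), of 0] by (simp add: tadm_def)
  ultimately show ?thesis
    using tsum_add[OF tadm_mono(1)[OF a(1), of 0] m, of x] tsum_cmult[of "-1" "tsa A s k R v2" "tsx X" x]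
    by (simp add: tsol_def)
qed

lemma finite_short_words: "finite {w :: ('n::finite \<times> bool) list. length (wcoords w) < k}"
proof (rule finite_subset)
  show "{w :: ('n \<times> bool) list. length (wcoords w) < k} \<subseteq> (\<Union>i<k. {w. length w = i})"
    using length_wcoords by (auto intro: le_less_trans)
qed (use finite_words in blast)

lemma tail_split:
  fixes v :: "real ^ 'n::finite \<Rightarrow> real"
  assumes "((\<lambda>w. tcoef s R v w * mon (wcoords w) x) has_sum I) UNIV"
    and "(\<lambda>w. ccoef s k R v w * mon (wcoords w) x) summable_on UNIV"
  shows "I = (\<Sum>w | length (wcoords w) < k. tcoef s R v w * mon (wcoords w) x) + tail s k R v x"
proof -
  let ?f = "\<lambda>w. tcoef s R v w * mon (wcoords w) x"
  let ?W = "{w :: ('n \<times> bool) list. length (wcoords w) < k}"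
  have "((\<lambda>w. if w \<in> ?W then ?f w else 0) has_sum sum ?f ?W) UNIV"
    by (rule has_sum_finite_neutralI[of ?W]) (auto simp: finite_short_words)
  from has_sum_add[OF this has_sum_infsum[OF assms(2)]]
  have "((\<lambda>w. (if w \<in> ?W then ?f w else 0) + ccoef s k R v w * mon (wcoords w) x) has_sum (sum ?f ?W + tail s k R v x)) UNIV"
    by (simp add: tail_def)
  moreover have "(if w \<in> ?W then ?f w else 0) + ccoef s k R v w * mon (wcoords w) x = ?f w" for w
    by (auto simp: ccoef_def)
  ultimately show ?thesis using has_sum_unique[OF assms(1)] by simp
qed

subsection \<open>Plane waves\<close>

text \<open>The absolute norm of a power series in \<open>\<kappa> \<bullet> x\<close> on the disc
  of radius \<open>\<beta>\<close>. The radius will be large enough for the bounds of the monomial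
  solver after expansion into words.\<close>

definition seq_norm :: "real \<Rightarrow> (nat \<Rightarrow> real) \<Rightarrow> real" where
  "seq_norm \<beta> c = (\<Sum>\<^sub>\<infinity>i. \<bar>c i\<bar> * \<beta> ^ i)"

definition seq_adm :: "real \<Rightarrow> (nat \<Rightarrow> real) \<Rightarrow> bool" where
  "seq_adm \<beta> c \<longleftrightarrow> (\<lambda>i. \<bar>c i\<bar> * \<beta> ^ i) summable_on UNIV"

lemma seq_adm_lincomb:
  assumes c: "seq_adm \<beta> c" and d: "seq_adm \<beta> d" and \<beta>: "0 \<le> \<beta>"
  shows "seq_adm \<beta> (\<lambda>i. p * c i + q * d i)"
    "seq_norm \<beta> (\<lambda>i. p * c i + q * d i) \<le> \<bar>p\<bar> * seq_norm \<beta> c + \<bar>q\<bar> * seq_norm \<beta> d"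
proof -
  have s: "(\<lambda>i. \<bar>p\<bar> * (\<bar>c i\<bar> * \<beta> ^ i) + \<bar>q\<bar> * (\<bar>d i\<bar> * \<beta> ^ i)) summable_on UNIV"
    using c d unfolding seq_adm_def by (intro summable_on_add summable_on_cmult_right)
  have le: "\<bar>p * c i + q * d i\<bar> * \<beta> ^ i \<le> \<bar>p\<bar> * (\<bar>c i\<bar> * \<beta> ^ i) + \<bar>q\<bar> * (\<bar>d i\<bar> * \<beta> ^ i)" for i
    using mult_right_mono[OF abs_triangle_ineq[of "p * c i" "q * d i"], of "\<beta> ^ i"] \<beta>
    by (simp add: abs_mult algebra_simps)
  show a: "seq_adm \<beta> (\<lambda>i. p * c i + q * d i)"
    unfolding seq_adm_def by (rule summable_on_bounded[OF s]) (use le \<beta> in \<open>simp add: abs_mult\<close>)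
  have "seq_norm \<beta> (\<lambda>i. p * c i + q * d i) \<le> (\<Sum>\<^sub>\<infinity>i. \<bar>p\<bar> * (\<bar>c i\<bar> * \<beta> ^ i) + \<bar>q\<bar> * (\<bar>d i\<bar> * \<beta> ^ i))"
    unfolding seq_norm_def by (rule infsum_mono[OF a[unfolded seq_adm_def] s le])
  also have "\<dots> = \<bar>p\<bar> * seq_norm \<beta> c + \<bar>q\<bar> * seq_norm \<beta> d"
    unfolding seq_norm_def infsum_cmult_right'[symmetric]
    using c d unfolding seq_adm_def by (intro infsum_add summable_on_cmult_right)
  finally show "seq_norm \<beta> (\<lambda>i. p * c i + q * d i) \<le> \<bar>p\<bar> * seq_norm \<beta> c + \<bar>q\<bar> * seq_norm \<beta> d" .
qed

text \<open>\<open>srep\<close> relates a bounded function vanishing on the unit ball to the Taylor coefficients of its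
  potential, assumed to be a ridge function of \<open>\<kappa> \<bullet> x\<close>.\<close>

definition srep :: "real \<Rightarrow> real \<Rightarrow> real ^ 'n::finite \<Rightarrow> (real ^ 'n \<Rightarrow> real) \<Rightarrow> (nat \<Rightarrow> real) \<Rightarrow> bool" where
  "srep s \<beta> \<kappa> V c \<longleftrightarrow> V \<in> borel_measurable borel \<and> (\<exists>K. \<forall>y. \<bar>V y\<bar> \<le> K) \<and> (\<forall>y\<in>ball 0 1. V y = 0) \<and>
     seq_adm \<beta> c \<and> (\<forall>x\<in>ball 0 1. integrable lborel (\<lambda>y. V y * fker s (x - y)) \<and>
       ((\<lambda>i. c i * (\<kappa> \<bullet> x) ^ i) has_sum (\<integral>y. V y * fker s (x - y) \<partial>lborel)) UNIV)"

lemma srep_lincomb: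
  assumes V: "srep s \<beta> \<kappa> V c" and W: "srep s \<beta> \<kappa> W d" and \<beta>: "0 \<le> \<beta>"
  shows "srep s \<beta> \<kappa> (\<lambda>y. p * V y + q * W y) (\<lambda>i. p * c i + q * d i)"
  unfolding srep_def
proof (intro conjI ballI)
  have [measurable]: "V \<in> borel_measurable borel" "W \<in> borel_measurable borel" using V W by (auto simp: srep_def)
  show "(\<lambda>y. p * V y + q * W y) \<in> borel_measurable borel" by measurable
  obtain K L where "\<And>y. \<bar>V y\<bar> \<le> K" "\<And>y. \<bar>W y\<bar> \<le> L" using V W unfolding srep_def by blast
  then have "\<bar>p * V y + q * W y\<bar> \<le> \<bar>p\<bar> * K + \<bar>q\<bar> * L" for y
    by (intro order_trans[OF abs_triangle_ineq]) (simp add: abs_mult add_mono mult_left_mono)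
  then show "\<exists>K. \<forall>y. \<bar>p * V y + q * W y\<bar> \<le> K" by blast
  show "p * V y + q * W y = 0" if "y \<in> ball 0 1" for y using V W that by (simp add: srep_def)
  show "seq_adm \<beta> (\<lambda>i. p * c i + q * d i)" using V W \<beta> by (intro seq_adm_lincomb) (auto simp: srep_def)
  fix x :: "real ^ 'a" assume x: "x \<in> ball 0 1"
  have i: "integrable lborel (\<lambda>y. V y * fker s (x - y))" "integrable lborel (\<lambda>y. W y * fker s (x - y))"
    and h: "((\<lambda>i. c i * (\<kappa> \<bullet> x) ^ i) has_sum (\<integral>y. V y * fker s (x - y) \<partial>lborel)) UNIV"
     "((\<lambda>i. d i * (\<kappa> \<bullet> x) ^ i) has_sum (\<integral>y. W y * fker s (x - y) \<partial>lborel)) UNIV"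
    using V W x unfolding srep_def by blast+
  have e: "(p * V y + q * W y) * fker s (x - y) = p * (V y * fker s (x - y)) + q * (W y * fker s (x - y))" for y
    by (simp add: algebra_simps)
  show "integrable lborel (\<lambda>y. (p * V y + q * W y) * fker s (x - y))"
    unfolding e using i by simp
  have "(\<integral>y. (p * V y + q * W y) * fker s (x - y) \<partial>lborel)
     = p * (\<integral>y. V y * fker s (x - y) \<partial>lborel) + q * (\<integral>y. W y * fker s (x - y) \<partial>lborel)"
    unfolding e using i by simp
  then show "((\<lambda>i. (p * c i + q * d i) * (\<kappa> \<bullet> x) ^ i) has_sum (\<integral>y. (p * V y + q * W y) * fker s (x - y) \<partial>lborel)) UNIV"
    using has_sum_add[OF has_sum_cmult_right[OF h(1), of p] has_sum_cmult_right[OF h(2), of q]]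
    by (simp add: algebra_simps)
qed

text \<open>Single powers of \<open>\<kappa> \<bullet> x\<close> are only reached as limits of combinations of half-space potentials, as
  \<open>b\<close> tends to infinity.\<close>

definition sclo :: "real \<Rightarrow> real \<Rightarrow> real ^ 'n::finite \<Rightarrow> (nat \<Rightarrow> real) \<Rightarrow> bool" where
  "sclo s \<beta> \<kappa> c \<longleftrightarrow> seq_adm \<beta> c \<and> (\<forall>\<epsilon>>0. \<exists>V d. srep s \<beta> \<kappa> V d \<and> seq_norm \<beta> (\<lambda>i. c i - d i) \<le> \<epsilon>)"

lemma seq_norm_0 [simp]: "seq_norm \<beta> (\<lambda>i. 0) = 0" and seq_adm_0 [simp]: "seq_adm \<beta> (\<lambda>i. 0)"
  by (simp_all add: seq_norm_def seq_adm_def)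

lemma srep_imp_sclo: "srep s \<beta> \<kappa> V c \<Longrightarrow> sclo s \<beta> \<kappa> c"
  unfolding sclo_def by (auto simp: srep_def intro!: exI[of _ V] exI[of _ c])

lemma sclo_lincomb:
  assumes c: "sclo s \<beta> \<kappa> c" and d: "sclo s \<beta> \<kappa> d" and \<beta>: "0 \<le> \<beta>"
  shows "sclo s \<beta> \<kappa> (\<lambda>i. p * c i + q * d i)"
  unfolding sclo_def
proof (intro conjI allI impI)
  show "seq_adm \<beta> (\<lambda>i. p * c i + q * d i)" using c d \<beta> by (intro seq_adm_lincomb) (auto simp: sclo_def)
  fix \<epsilon> :: real assume \<epsilon>: "\<epsilon> > 0"
  define \<delta> where "\<delta> = \<epsilon> / (\<bar>p\<bar> + \<bar>q\<bar> + 1)"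
  have \<delta>: "\<delta> > 0" using \<epsilon> by (simp add: \<delta>_def)
  obtain V c' W d' where V: "srep s \<beta> \<kappa> V c'" "seq_norm \<beta> (\<lambda>i. c i - c' i) \<le> \<delta>"
    and W: "srep s \<beta> \<kappa> W d'" "seq_norm \<beta> (\<lambda>i. d i - d' i) \<le> \<delta>"
    using c d \<delta> unfolding sclo_def by blast
  have a: "seq_adm \<beta> (\<lambda>i. c i - c' i)" "seq_adm \<beta> (\<lambda>i. d i - d' i)"
    using seq_adm_lincomb(1)[of \<beta> c c' 1 "-1"] seq_adm_lincomb(1)[of \<beta> d d' 1 "-1"] c d V W \<beta>
    by (auto simp: sclo_def srep_def)
  have "seq_norm \<beta> (\<lambda>i. p * c i + q * d i - (p * c' i + q * d' i)) = seq_norm \<beta> (\<lambda>i. p * (c i - c' i) + q * (d i - d' i))"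
    by (simp add: algebra_simps)
  also have "\<dots> \<le> \<bar>p\<bar> * seq_norm \<beta> (\<lambda>i. c i - c' i) + \<bar>q\<bar> * seq_norm \<beta> (\<lambda>i. d i - d' i)"
    by (rule seq_adm_lincomb(2)[OF a \<beta>])
  also have "\<dots> \<le> \<bar>p\<bar> * \<delta> + \<bar>q\<bar> * \<delta>" by (intro add_mono mult_left_mono V W) auto
  also have "\<dots> \<le> \<epsilon>"
  proof -
    have "(\<bar>p\<bar> + \<bar>q\<bar> + 1) * \<delta> = \<epsilon>" by (simp add: \<delta>_def add_nonneg_eq_0_iff)
    then show ?thesis using \<delta> by (simp add: algebra_simps)
  qed
  finally show "\<exists>U e. srep s \<beta> \<kappa> U e \<and> seq_norm \<beta> (\<lambda>i. p * c i + q * d i - e i) \<le> \<epsilon>"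
    using srep_lincomb[OF V(1) W(1) \<beta>] by blast
qed

lemma sclo_0: "sclo s \<beta> \<kappa> (\<lambda>i. 0)"
  by (rule srep_imp_sclo[where V="\<lambda>_. 0"]) (auto simp: srep_def)

lemma sclo_sum:
  assumes "\<And>j. j \<in> J \<Longrightarrow> sclo s \<beta> \<kappa> (c j)" "0 \<le> \<beta>"
  shows "sclo s \<beta> \<kappa> (\<lambda>i. \<Sum>j\<in>J. r j * c j i)"
  using assms(1)
proof (induction J rule: infinite_finite_induct)
  case (insert j J)
  then show ?case
    using sclo_lincomb[of s \<beta> \<kappa> "c j" "\<lambda>i. \<Sum>j\<in>J. r j * c j i" "r j" 1] assms(2) by simp
qed (simp_all add: sclo_0)

lemma sclo_limit:
  assumes \<beta>: "0 \<le> \<beta>" and c: "seq_adm \<beta> c"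
    and lim: "\<And>\<epsilon>. \<epsilon> > 0 \<Longrightarrow> \<exists>d. sclo s \<beta> \<kappa> d \<and> seq_norm \<beta> (\<lambda>i. c i - d i) \<le> \<epsilon>"
  shows "sclo s \<beta> \<kappa> c"
  unfolding sclo_def
proof (intro conjI allI impI c)
  fix \<epsilon> :: real assume \<epsilon>: "\<epsilon> > 0"
  obtain d where d: "sclo s \<beta> \<kappa> d" "seq_norm \<beta> (\<lambda>i. c i - d i) \<le> \<epsilon> / 2" using lim[of "\<epsilon> / 2"] \<epsilon> by auto
  obtain V e where V: "srep s \<beta> \<kappa> V e" "seq_norm \<beta> (\<lambda>i. d i - e i) \<le> \<epsilon> / 2"
    using d(1) \<epsilon> unfolding sclo_def by (meson half_gt_zero)
  have a: "seq_adm \<beta> (\<lambda>i. c i - d i)" "seq_adm \<beta> (\<lambda>i. d i - e i)"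
    using seq_adm_lincomb(1)[of \<beta> c d 1 "-1"] seq_adm_lincomb(1)[of \<beta> d e 1 "-1"] c d V \<beta>
    by (auto simp: sclo_def srep_def)
  have "seq_norm \<beta> (\<lambda>i. c i - e i) \<le> \<epsilon>"
    using seq_adm_lincomb(2)[OF a \<beta>, of 1 1] d(2) V(2) by simp
  then show "\<exists>V e. srep s \<beta> \<kappa> V e \<and> seq_norm \<beta> (\<lambda>i. c i - e i) \<le> \<epsilon>" using V(1) by blast
qed

section \<open>Half-space potentials and their Taylor coefficients\<close>

definition gcoef :: "real \<Rightarrow> nat \<Rightarrow> real" where
  "gcoef s i = (- 2 * s gchoose i) * (-1) ^ i"

text \<open>The exponent \<open>- 2 * s\<close> is negative, so no factor of the generalised
  binomial coefficient vanishes. A zero coefficient would make the corresponding power of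
  \<open>\<kappa> \<bullet> x\<close> unreachable by the induction below.\<close>

lemma gcoef_nonzero:
  assumes "0 < s"
  shows "gcoef s i \<noteq> 0"
proof -
  have "(\<Prod>j = 0..<i. (- 2 * s - real j)) \<noteq> 0"
    using assms by (auto simp: prod_zero_iff)
  then show ?thesis by (simp add: gcoef_def gbinomial_prod_rev)
qed

lemma gcoef_summable:
  assumes "0 \<le> q" "q < 1"
  shows "summable (\<lambda>i. \<bar>gcoef s i\<bar> * q ^ i)"
  using binomial_series_summable[of q "- 2 * s"] assms by (simp add: gcoef_def abs_mult power_abs)

text \<open>The normalisation turns the potential into \<open>(1 - \<kappa> \<bullet> x / b)\<close>
  to the power \<open>- 2 * s\<close>. Since \<open>b\<close> exceeds \<open>\<beta>\<close>, hence
  \<open>norm \<kappa>\<close>, the half-space misses the ball and the coefficients are summable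
  with weight \<open>\<beta>\<close>.\<close>

lemma srep_half_space:
  fixes \<kappa> :: "real ^ 'n::finite"
  assumes s: "0 < s" "s < 1" and \<kappa>: "\<kappa> \<noteq> 0" "norm \<kappa> \<le> \<beta>" and b: "\<beta> < b"
  shows "srep s \<beta> \<kappa> (\<lambda>y. (1 / (b powr (- 2 * s) * hsc s \<kappa>)) * indicator {y. b < \<kappa> \<bullet> y} y) (\<lambda>i. gcoef s i * (1 / b) ^ i)"
  unfolding srep_def
proof (intro conjI ballI)
  define p where "p = 1 / (b powr (- 2 * s) * hsc s \<kappa>)"
  have nk: "0 < norm \<kappa>" using \<kappa>(1) by simp
  have b0: "0 < b" "0 \<le> \<beta>" using \<kappa> nk b by linarith+
  have h0: "0 < hsc s \<kappa>" by (rule hsc_pos[OF s \<kappa>(1)])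
  show "(\<lambda>y. (1 / (b powr (- 2 * s) * hsc s \<kappa>)) * indicator {y. b < \<kappa> \<bullet> y} y) \<in> borel_measurable borel" by measurable
  show "\<exists>K. \<forall>y. \<bar>(1 / (b powr (- 2 * s) * hsc s \<kappa>)) * indicator {y. b < \<kappa> \<bullet> y} y\<bar> \<le> K"
    by (intro exI[of _ "\<bar>p\<bar>"]) (auto simp: p_def indicator_def)
  have lt: "\<kappa> \<bullet> y < b" "\<bar>\<kappa> \<bullet> y\<bar> < b" if "y \<in> ball 0 1" for y
  proof -
    have "\<bar>\<kappa> \<bullet> y\<bar> \<le> norm \<kappa> * norm y" by (rule Cauchy_Schwarz_ineq2)
    also have "\<dots> \<le> norm \<kappa> * 1" using that by (intro mult_left_mono) auto
    finally show "\<kappa> \<bullet> y < b" "\<bar>\<kappa> \<bullet> y\<bar> < b" using \<kappa>(2) b by linarith+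
  qed
  show "(1 / (b powr (- 2 * s) * hsc s \<kappa>)) * indicator {y. b < \<kappa> \<bullet> y} y = 0" if "y \<in> ball 0 1" for y
    using lt(1)[OF that] by simp
  have "summable (\<lambda>i. \<bar>gcoef s i\<bar> * (\<beta> / b) ^ i)" by (rule gcoef_summable) (use b b0 in auto)
  then have "(\<lambda>i. \<bar>gcoef s i\<bar> * (\<beta> / b) ^ i) summable_on UNIV"
    by (rule summable_nonneg_imp_summable_on) (use b0 in simp)
  then show "seq_adm \<beta> (\<lambda>i. gcoef s i * (1 / b) ^ i)"
    using b0 by (simp add: seq_adm_def abs_mult power_divide power_abs)
  fix x :: "real ^ 'n" assume x: "x \<in> ball 0 1"
  have e: "(1 / (b powr (- 2 * s) * hsc s \<kappa>)) * indicator {y. b < \<kappa> \<bullet> y} y * fker s (x - y) = p * (indicator {y. b < \<kappa> \<bullet> y} y * fker s (x - y))" for y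
    by (simp add: p_def)
  show "integrable lborel (\<lambda>y. (1 / (b powr (- 2 * s) * hsc s \<kappa>)) * indicator {y. b < \<kappa> \<bullet> y} y * fker s (x - y))"
    unfolding e by (intro integrable_mult_right half_space_integrable s lt(1) x)
  define t where "t = \<kappa> \<bullet> x"
  have t: "\<bar>t / b\<bar> < 1" using lt(2)[OF x] b0 by (simp add: t_def abs_divide)
  have "(\<integral>y. (1 / (b powr (- 2 * s) * hsc s \<kappa>)) * indicator {y. b < \<kappa> \<bullet> y} y * fker s (x - y) \<partial>lborel)
     = p * ((b - t) powr (- 2 * s) * hsc s \<kappa>)"
    unfolding e integral_mult_right_zero t_def by (subst half_space_integral[OF lt(1)[OF x]]) simp
  also have "(b - t) powr (- 2 * s) = b powr (- 2 * s) * (1 + (- (t / b))) powr (- 2 * s)"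
  proof -
    have "b - t = b * (1 + (- (t / b)))" using b0 by (simp add: field_simps)
    moreover have "0 \<le> 1 + (- (t / b))" using t by linarith
    ultimately show ?thesis using b0 by (simp only: powr_mult)
  qed
  also have "p * (b powr (- 2 * s) * (1 + (- (t / b))) powr (- 2 * s) * hsc s \<kappa>) = (1 + (- (t / b))) powr (- 2 * s)"
    using h0 b0 by (simp add: p_def)
  finally have I: "(\<integral>y. (1 / (b powr (- 2 * s) * hsc s \<kappa>)) * indicator {y. b < \<kappa> \<bullet> y} y * fker s (x - y) \<partial>lborel)
     = (1 + (- (t / b))) powr (- 2 * s)" .
  have "(\<lambda>i. (- 2 * s gchoose i) * (- (t / b)) ^ i) sums (1 + (- (t / b))) powr (- 2 * s)"
    by (rule gen_binomial_real) (use t in simp)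
  moreover have "(- 2 * s gchoose i) * (- (t / b)) ^ i = gcoef s i * (1 / b) ^ i * t ^ i" for i
    by (simp add: gcoef_def power_minus[of "t / b"] power_divide)
  ultimately have "(\<lambda>i. gcoef s i * (1 / b) ^ i * t ^ i) sums (1 + (- (t / b))) powr (- 2 * s)" by simp
  moreover have "summable (\<lambda>i. norm (gcoef s i * (1 / b) ^ i * t ^ i))"
    using gcoef_summable[of "\<bar>t / b\<bar>" s] t b0 by (simp add: abs_mult power_abs power_divide abs_divide)
  ultimately show "((\<lambda>i. gcoef s i * (1 / b) ^ i * (\<kappa> \<bullet> x) ^ i) has_sum
      (\<integral>y. (1 / (b powr (- 2 * s) * hsc s \<kappa>)) * indicator {y. b < \<kappa> \<bullet> y} y * fker s (x - y) \<partial>lborel)) UNIV"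
    unfolding I t_def[symmetric] by (intro norm_summable_imp_has_sum)
qed

text \<open>Strong induction: the entries below \<open>j\<close> of a half-space sequence are
  subtracted, being reachable already, and the rest is scaled so that entry \<open>j\<close> becomes
  1. The entries beyond \<open>j\<close> then carry positive powers of \<open>\<beta> / b\<close>,
  which vanish as \<open>b\<close> grows.\<close>

lemma sclo_unit:
  fixes \<kappa> :: "real ^ 'n::finite"
  assumes s: "0 < s" "s < 1" and \<kappa>: "\<kappa> \<noteq> 0" "norm \<kappa> \<le> \<beta>"
  shows "sclo s \<beta> \<kappa> (\<lambda>i. of_bool (i = j))"
proof (induction j rule: less_induct)
  case (less j)
  have "0 < norm \<kappa>" using \<kappa>(1) by simp
  then have \<beta>0: "0 < \<beta>" using \<kappa>(2) by linarith
  define g where "g = gcoef s j"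
  have g: "g \<noteq> 0" unfolding g_def by (rule gcoef_nonzero[OF s(1)])
  have sG: "(\<lambda>i. \<bar>gcoef s i\<bar> * (1 / 2) ^ i) summable_on UNIV"
    by (rule summable_nonneg_imp_summable_on[OF gcoef_summable]) auto
  define G where "G = (\<Sum>\<^sub>\<infinity>i. \<bar>gcoef s i\<bar> * (1 / 2) ^ i)"
  define K where "K = (2 * \<beta>) ^ j / \<bar>g\<bar> * G"
  have K0: "0 \<le> K" using \<beta>0 by (auto simp: K_def G_def intro!: mult_nonneg_nonneg infsum_nonneg)
  show ?case
  proof (rule sclo_limit)
    have "((\<lambda>i. \<bar>of_bool (i = j)\<bar> * \<beta> ^ i) has_sum \<beta> ^ j) UNIV"
      by (rule has_sum_finite_neutralI[of "{j}"]) auto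
    then show "seq_adm \<beta> (\<lambda>i. of_bool (i = j))" unfolding seq_adm_def summable_on_def by blast
    fix \<epsilon> :: real assume \<epsilon>: "\<epsilon> > 0"
    \<comment> \<open>The remaining tail will be at most \<open>K / t\<close>. The factor 2 in
      \<open>b = 2 * \<beta> * t\<close> leaves powers of 1/2 for the convergence of the coefficient
      series, and one factor \<open>1 / t\<close> gives smallness.\<close>
    define t where "t = K / \<epsilon> + 1"
    have t: "1 \<le> t" "K / t \<le> \<epsilon>" using K0 \<epsilon> by (auto simp: t_def field_simps)
    define b where "b = 2 * \<beta> * t"
    have b: "\<beta> < b" using t(1) \<beta>0 by (simp add: b_def)
    have b0: "0 < b" using b \<beta>0 by linarith
    define \<phi> where "\<phi> i = gcoef s i * (1 / b) ^ i" for i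
    have \<phi>: "sclo s \<beta> \<kappa> \<phi>" unfolding \<phi>_def
      by (rule srep_imp_sclo[OF srep_half_space[OF s \<kappa> b]])
    define d where "d i = (b ^ j / g) * \<phi> i + (- (b ^ j / g)) * (\<Sum>l\<in>{..<j}. \<phi> l * of_bool (i = l))" for i
    have d: "sclo s \<beta> \<kappa> d" unfolding d_def
      by (intro sclo_lincomb \<phi> sclo_sum less) (use \<beta>0 in auto)
    have dv: "d i = (if i < j then 0 else (b ^ j / g) * \<phi> i)" for i
    proof -
      have "(\<Sum>l\<in>{..<j}. \<phi> l * of_bool (i = l)) = (if i < j then \<phi> i else 0)"
        by (simp add: of_bool_def if_distrib cong: if_cong)
      then show ?thesis by (simp add: d_def)
    qed
    have le: "\<bar>of_bool (i = j) - d i\<bar> * \<beta> ^ i \<le> (1 / t) * ((2 * \<beta>) ^ j / \<bar>g\<bar>) * (\<bar>gcoef s i\<bar> * (1 / 2) ^ i)" for i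
    proof -
      have nn: "0 \<le> (1 / t) * ((2 * \<beta>) ^ j / \<bar>g\<bar>) * (\<bar>gcoef s i\<bar> * (1 / 2) ^ i)" using t \<beta>0 by auto
      consider "i < j" | "i = j" | "j < i" by linarith
      then show ?thesis
      proof cases
        case 2
        then have "d i = 1" using g b0 by (simp add: dv \<phi>_def g_def power_one_over)
        then show ?thesis using 2 nn by simp
      next
        case 3
        then obtain n where n: "i = j + Suc n" by (metis less_imp_Suc_add add_Suc_right)
        have "\<bar>of_bool (i = j) - d i\<bar> * \<beta> ^ i = \<bar>gcoef s i\<bar> / \<bar>g\<bar> * (b ^ j * (1 / b) ^ i * \<beta> ^ i)"
          using 3 b0 by (simp add: dv \<phi>_def abs_mult power_abs)
        also have "b ^ j * (1 / b) ^ i * \<beta> ^ i = \<beta> ^ j * (\<beta> / b) ^ Suc n"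
          using b0 by (simp add: n power_add power_divide field_simps)
        also have "\<beta> / b = (1 / t) * (1 / 2)" using \<beta>0 t by (simp add: b_def)
        also have "\<bar>gcoef s i\<bar> / \<bar>g\<bar> * (\<beta> ^ j * ((1 / t) * (1 / 2)) ^ Suc n) \<le> \<bar>gcoef s i\<bar> / \<bar>g\<bar> * (\<beta> ^ j * ((1 / t) * (1 / 2) ^ Suc n))"
        proof (intro mult_left_mono)
          have "(1 / t) ^ Suc n \<le> (1 / t) ^ 1" using t by (intro power_decreasing) auto
          then show "((1 / t) * (1 / 2)) ^ Suc n \<le> (1 / t) * (1 / 2) ^ Suc n"
            unfolding power_mult_distrib by (intro mult_right_mono) auto
        qed (use \<beta>0 in auto)
        also have "\<dots> = (1 / t) * ((2 * \<beta>) ^ j / \<bar>g\<bar>) * (\<bar>gcoef s i\<bar> * (1 / 2) ^ i)"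
          by (simp add: n power_add power_mult_distrib power_divide mult_ac)
        finally show ?thesis .
      qed (use nn in \<open>simp add: dv\<close>)
    qed
    have sR: "(\<lambda>i. (1 / t) * ((2 * \<beta>) ^ j / \<bar>g\<bar>) * (\<bar>gcoef s i\<bar> * (1 / 2) ^ i)) summable_on UNIV"
      by (rule summable_on_cmult_right[OF sG])
    have "(\<lambda>i. \<bar>of_bool (i = j) - d i\<bar> * \<beta> ^ i) summable_on UNIV"
      by (rule summable_on_bounded[OF sR]) (use le \<beta>0 in \<open>simp add: abs_mult\<close>)
    from infsum_mono[OF this sR le]
    have "seq_norm \<beta> (\<lambda>i. of_bool (i = j) - d i) \<le> (1 / t) * ((2 * \<beta>) ^ j / \<bar>g\<bar>) * G"
      by (simp only: seq_norm_def infsum_cmult_right' G_def)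
    also have "\<dots> = K / t" by (simp add: K_def)
    finally show "\<exists>d. sclo s \<beta> \<kappa> d \<and> seq_norm \<beta> (\<lambda>i. of_bool (i = j) - d i) \<le> \<epsilon>"
      using d t(2) by force
  qed (use \<beta>0 in simp)
qed

lemma sclo_all:
  fixes \<kappa> :: "real ^ 'n::finite"
  assumes s: "0 < s" "s < 1" and \<kappa>: "\<kappa> \<noteq> 0" "norm \<kappa> \<le> \<beta>" and c: "seq_adm \<beta> c"
  shows "sclo s \<beta> \<kappa> c"
proof -
  have \<beta>0: "0 \<le> \<beta>" using \<kappa>(2) norm_ge_zero order_trans by blast
  show ?thesis
  proof (rule sclo_limit[OF \<beta>0 c])
    fix \<epsilon> :: real assume \<epsilon>: "\<epsilon> > 0"
    have hs: "((\<lambda>i. \<bar>c i\<bar> * \<beta> ^ i) has_sum seq_norm \<beta> c) UNIV"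
      using c unfolding seq_adm_def seq_norm_def by (rule has_sum_infsum)
    obtain F where F: "finite F" "dist (\<Sum>i\<in>F. \<bar>c i\<bar> * \<beta> ^ i) (seq_norm \<beta> c) \<le> \<epsilon>"
      using has_sum_finite_approximation[OF hs \<epsilon>] by blast
    define d where "d i = (\<Sum>j\<in>F. c j * of_bool (i = j))" for i
    have dv: "d i = (if i \<in> F then c i else 0)" for i
      using F(1) by (simp add: d_def of_bool_def if_distrib cong: if_cong)
    have "sclo s \<beta> \<kappa> d" unfolding d_def by (intro sclo_sum sclo_unit s \<kappa> \<beta>0)
    moreover have "seq_norm \<beta> (\<lambda>i. c i - d i) \<le> \<epsilon>"
    proof -
      have "((\<lambda>i. if i \<in> F then \<bar>c i\<bar> * \<beta> ^ i else 0) has_sum (\<Sum>i\<in>F. \<bar>c i\<bar> * \<beta> ^ i)) UNIV"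
        by (rule has_sum_finite_neutralI[of F]) (use F(1) in auto)
      from has_sum_minus[OF hs this]
      have "((\<lambda>i. \<bar>c i - d i\<bar> * \<beta> ^ i) has_sum (seq_norm \<beta> c - (\<Sum>i\<in>F. \<bar>c i\<bar> * \<beta> ^ i))) UNIV"
        by (rule has_sum_cong[THEN iffD1, rotated]) (simp add: dv)
      then have "seq_norm \<beta> (\<lambda>i. c i - d i) = seq_norm \<beta> c - (\<Sum>i\<in>F. \<bar>c i\<bar> * \<beta> ^ i)"
        unfolding seq_norm_def by (rule infsumI)
      then show ?thesis using F(2) by (simp add: dist_real_def)
    qed
    ultimately show "\<exists>d. sclo s \<beta> \<kappa> d \<and> seq_norm \<beta> (\<lambda>i. c i - d i) \<le> \<epsilon>" by blast
  qed
qed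

text \<open>The approximant is split because half-space indicators jump: \<open>T\<close> carries
  the regularity and the closeness, while \<open>V\<close> lives off the ball and only corrects the
  operator.\<close>

definition harm_approx :: "real \<Rightarrow> nat \<Rightarrow> real \<Rightarrow> (real ^ 'n::finite \<Rightarrow> real) \<Rightarrow> bool" where
  "harm_approx s N e P \<longleftrightarrow> (\<exists>T V K. C_on N UNIV T \<and> V \<in> borel_measurable borel \<and>
     (\<forall>x. \<bar>T x\<bar> \<le> K \<and> \<bar>V x\<bar> \<le> K) \<and> (\<forall>x\<in>ball 0 1. V x = 0) \<and>
     (\<forall>x\<in>ball 0 1. has_frac_laplacian s (\<lambda>y. T y + V y) x 0) \<and>
     (\<forall>ds x. length ds \<le> N \<longrightarrow> \<bar>iter_partial ds T x - iter_partial ds P x\<bar> \<le> e))"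

lemma tsum_unit: "tsum (\<lambda>_ :: unit. q) (\<lambda>_. \<kappa>) x = q * cis (\<kappa> \<bullet> x)"
  by (simp add: tsum_def UNIV_unit)

lemma tadm_unit: "tadm M (\<lambda>_ :: unit. q) (\<lambda>_. \<kappa>)"
  by (simp add: tadm_def UNIV_unit)

lemma plane_wave_C_on: "C_on N U (\<lambda>x. Re (q * cis (\<kappa> \<bullet> x)))"
  using tsum_C_on[OF tadm_unit, of N U q \<kappa>] by (simp add: tsum_unit)

lemma has_frac_laplacian_const: "has_frac_laplacian s (\<lambda>_. c) x 0"
  by (simp add: has_frac_laplacian_iff set_integrable_def set_lebesgue_integral_def)

text \<open>The coefficients \<open>c\<close> expand the fractional Laplacian of the wave in powers
  of \<open>\<kappa> \<bullet> x\<close>. A combination \<open>V\<close> of half-spaces has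
  potential coefficients \<open>d\<close> close to \<open>c\<close> and subtracts them; a solution
  \<open>W\<close> for the difference removes what is left, and its derivatives are bounded by
  \<open>C * \<delta>\<close>. For \<open>\<kappa> = 0\<close> the wave is constant and nothing has
  to be done.\<close>

lemma harm_approx_plane_wave:
  fixes \<kappa> :: "real ^ 'n::finite"
  assumes s: "0 < s" "s < 1" and e: "0 < e"
  shows "harm_approx s N e (\<lambda>x. Re (q * cis (\<kappa> \<bullet> x)))"
proof (cases "\<kappa> = 0")
  case True
  then show ?thesis unfolding harm_approx_def using e
    by (intro exI[of _ "\<lambda>_. Re q"] exI[of _ "\<lambda>_. 0"] exI[of _ "\<bar>Re q\<bar>"])
       (simp add: C_on_const has_frac_laplacian_const)
next
  case False
  define M where "M = N + 2"
  have M2: "2 \<le> M" by (simp add: M_def)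
  obtain A and X :: "'n list \<Rightarrow> nat \<Rightarrow> real ^ 'n" and C B where sol: "mon_solver s M A X C B"
    by (rule mon_solver_exists[OF s, where M=M])
  have CB: "0 \<le> C" "1 \<le> B" using sol unfolding mon_solver_def by blast+
  define \<sigma> where "\<sigma> = (\<Sum>k\<in>UNIV. \<bar>\<kappa> $ k\<bar>)"
  have \<sigma>0: "0 \<le> \<sigma>" by (simp add: \<sigma>_def sum_nonneg)
  \<comment> \<open>Expanding \<open>(\<kappa> \<bullet> x) ^ i\<close> into words, with weight
    \<open>B\<close> per letter, gives total absolute weight \<open>(B * \<sigma>) ^ i\<close>; this
    is why closeness of coefficient sequences is measured at this radius.\<close>
  define \<beta> where "\<beta> = B * \<sigma>"
  have \<sigma>\<beta>: "\<sigma> \<le> \<beta>" using CB \<sigma>0 mult_right_mono[of 1 B \<sigma>] by (simp add: \<beta>_def)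
  have \<beta>0: "0 \<le> \<beta>" using \<sigma>0 \<sigma>\<beta> by linarith
  have \<kappa>\<beta>: "norm \<kappa> \<le> \<beta>" using norm_le_l1_cart[of \<kappa>] \<sigma>\<beta> by (simp add: \<sigma>_def)
  define P where "P x = Re (q * cis (\<kappa> \<bullet> x))" for x
  define c where "c i = lam s \<kappa> * (Re (q * \<i> ^ i) / fact i)" for i
  have c_le: "\<bar>c i\<bar> * r ^ i \<le> (lam s \<kappa> * cmod q) * (r ^ i /\<^sub>R fact i)" if "0 \<le> r" for i r
  proof -
    have "\<bar>Re (q * \<i> ^ i)\<bar> \<le> cmod q" using abs_Re_le_cmod[of "q * \<i> ^ i"] by (simp add: norm_mult norm_power)
    then have "lam s \<kappa> * (\<bar>Re (q * \<i> ^ i)\<bar> / fact i) * r ^ i \<le> lam s \<kappa> * (cmod q / fact i) * r ^ i"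
      using that by (intro mult_right_mono mult_left_mono divide_right_mono lam_nonneg) auto
    then show ?thesis using lam_nonneg[of s \<kappa>] by (simp add: c_def abs_mult divide_inverse mult_ac)
  qed
  have sc: "summable (\<lambda>i. \<bar>c i\<bar> * r ^ i)" if "0 \<le> r" for r
    by (rule summable_comparison_test'[OF summable_mult[OF summable_exp_generic[of r]]])
       (use c_le[OF that] that in auto)
  have ca: "seq_adm \<beta> c"
    unfolding seq_adm_def by (rule summable_nonneg_imp_summable_on[OF sc[OF \<beta>0]]) (use \<beta>0 in simp)
  have c_sum: "((\<lambda>i. c i * t ^ i) has_sum (lam s \<kappa> * Re (q * cis t))) UNIV" for t
  proof (rule norm_summable_imp_has_sum)
    show "summable (\<lambda>i. norm (c i * t ^ i))" using sc[of "\<bar>t\<bar>"] by (simp add: abs_mult power_abs)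
    have "(\<lambda>i. q * ((\<i> * of_real t) ^ i /\<^sub>R fact i)) sums (q * exp (\<i> * of_real t))"
      by (intro sums_mult exp_converges)
    from sums_mult[OF sums_Re[OF this], of "lam s \<kappa>"]
    have "(\<lambda>i. lam s \<kappa> * Re (q * ((\<i> * of_real t) ^ i /\<^sub>R fact i))) sums (lam s \<kappa> * Re (q * cis t))"
      by (simp add: cis_conv_exp)
    moreover have "lam s \<kappa> * Re (q * ((\<i> * of_real t) ^ i /\<^sub>R fact i)) = c i * t ^ i" for i
    proof -
      have "q * ((\<i> * of_real t) ^ i /\<^sub>R fact i) = of_real (t ^ i / fact i) * (q * \<i> ^ i)"
        by (simp add: power_mult_distrib scaleR_conv_of_real divide_inverse mult_ac)
      then have "Re (q * ((\<i> * of_real t) ^ i /\<^sub>R fact i)) = t ^ i / fact i * Re (q * \<i> ^ i)"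
        by (simp only: times_complex.simps Re_complex_of_real Im_complex_of_real)
      then show ?thesis by (simp add: c_def)
    qed
    ultimately show "(\<lambda>i. c i * t ^ i) sums (lam s \<kappa> * Re (q * cis t))" by simp
  qed
  define \<delta> where "\<delta> = e / (C + 1)"
  have \<delta>: "\<delta> > 0" "C * \<delta> \<le> e" using e CB by (auto simp: \<delta>_def field_simps)
  obtain V d where V: "srep s \<beta> \<kappa> V d" and dn: "seq_norm \<beta> (\<lambda>i. c i - d i) \<le> \<delta>"
    using sclo_all[OF s False \<kappa>\<beta> ca] \<delta>(1) unfolding sclo_def by blast
  define \<epsilon> where "\<epsilon> i = c i - d i" for i
  have \<epsilon>a: "seq_adm \<beta> \<epsilon>"
    using seq_adm_lincomb(1)[OF ca _ \<beta>0, of d 1 "-1"] V unfolding srep_def \<epsilon>_def[abs_def] by simp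
  have \<epsilon>s: "summable (\<lambda>i. \<bar>\<epsilon> i\<bar> * \<beta> ^ i)" and \<epsilon>S: "(\<Sum>i. \<bar>\<epsilon> i\<bar> * \<beta> ^ i) \<le> \<delta>"
  proof -
    have h: "((\<lambda>i. \<bar>\<epsilon> i\<bar> * \<beta> ^ i) has_sum seq_norm \<beta> \<epsilon>) UNIV"
      using \<epsilon>a unfolding seq_adm_def seq_norm_def by (rule has_sum_infsum)
    then show "summable (\<lambda>i. \<bar>\<epsilon> i\<bar> * \<beta> ^ i)" "(\<Sum>i. \<bar>\<epsilon> i\<bar> * \<beta> ^ i) \<le> \<delta>"
      using has_sum_imp_sums[OF h] dn by (auto simp: sums_iff \<epsilon>_def[abs_def])
  qed
  \<comment> \<open>Word coefficients of the negative of the error series, because \<open>W\<close>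
    has to cancel it.\<close>
  define E where "E ks = - (\<epsilon> (length ks) * prod_list (map (\<lambda>k. \<kappa> $ k) ks))" for ks
  have absE: "\<bar>E ks\<bar> * B ^ length ks = \<bar>\<epsilon> (length ks)\<bar> * prod_list (map (\<lambda>k. B * \<bar>\<kappa> $ k\<bar>) ks)" for ks
  proof -
    have "\<bar>prod_list (map (\<lambda>k. \<kappa> $ k) ks)\<bar> * B ^ length ks = prod_list (map (\<lambda>k. B * \<bar>\<kappa> $ k\<bar>) ks)"
      by (induction ks) (auto simp: abs_mult mult_ac)
    then show ?thesis by (simp add: E_def abs_mult)
  qed
  have sB: "(\<Sum>k\<in>UNIV. \<bar>B * \<bar>\<kappa> $ k\<bar>\<bar>) = \<beta>" "(\<Sum>k\<in>UNIV. B * \<bar>\<kappa> $ k\<bar>) = \<beta>"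
    using CB by (simp_all add: \<beta>_def \<sigma>_def sum_distrib_left)
  have "((\<lambda>ks. \<bar>\<epsilon> (length ks)\<bar> * prod_list (map (\<lambda>k. B * \<bar>\<kappa> $ k\<bar>) ks)) has_sum (\<Sum>i. \<bar>\<epsilon> i\<bar> * \<beta> ^ i)) UNIV"
    using has_sum_words(2)[of "\<lambda>i. \<bar>\<epsilon> i\<bar>" "\<lambda>k. B * \<bar>\<kappa> $ k\<bar>"] \<epsilon>s by (simp add: sB)
  then have hE: "((\<lambda>ks. \<bar>E ks\<bar> * B ^ length ks) has_sum (\<Sum>i. \<bar>\<epsilon> i\<bar> * \<beta> ^ i)) UNIV"
    by (simp add: absE)
  then have E: "(\<lambda>ks. \<bar>E ks\<bar> * B ^ length ks) summable_on UNIV"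
    and ES: "(\<Sum>\<^sub>\<infinity>ks. \<bar>E ks\<bar> * B ^ length ks) \<le> \<delta>"
    using \<epsilon>S by (auto simp: summable_on_def infsumI)
  define a where "a = (\<lambda>(ks, j). complex_of_real (E ks) * A ks j)"
  define \<xi> where "\<xi> = (\<lambda>(ks, j). X ks j)"
  note S = superposed_solution[OF s sol M2, of E "\<lambda>ks. ks", OF E, folded a_def \<xi>_def]
  define W where "W x = Re (tsum a \<xi> x)" for x
  have Wf: "has_frac_laplacian s W x (- (\<Sum>\<^sub>\<infinity>i. \<epsilon> i * (\<kappa> \<bullet> x) ^ i))" if x: "x \<in> ball 0 1" for x
  proof -
    have le: "(\<Sum>k\<in>UNIV. \<bar>\<kappa> $ k * x $ k\<bar>) \<le> \<beta>"
    proof -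
      have "\<bar>\<kappa> $ k * x $ k\<bar> \<le> \<bar>\<kappa> $ k\<bar>" for k
        using abs_component_less_1[OF x, of k] by (simp add: abs_mult mult_left_le)
      then have "(\<Sum>k\<in>UNIV. \<bar>\<kappa> $ k * x $ k\<bar>) \<le> \<sigma>" unfolding \<sigma>_def by (intro sum_mono) auto
      then show ?thesis using \<sigma>\<beta> by linarith
    qed
    have ss: "summable (\<lambda>i. \<bar>\<epsilon> i\<bar> * (\<Sum>k\<in>UNIV. \<bar>\<kappa> $ k * x $ k\<bar>) ^ i)"
      by (rule summable_comparison_test'[OF \<epsilon>s])
         (use le in \<open>simp add: abs_mult sum_nonneg power_abs mult_left_mono power_mono\<close>)
    have dot: "(\<Sum>k\<in>UNIV. \<kappa> $ k * x $ k) = \<kappa> \<bullet> x" by (simp add: inner_vec_def)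
    have "\<bar>\<kappa> \<bullet> x\<bar> \<le> (\<Sum>k\<in>UNIV. \<bar>\<kappa> $ k * x $ k\<bar>)" unfolding dot[symmetric] by (rule sum_abs)
    then have sn: "summable (\<lambda>i. norm (\<epsilon> i * (\<kappa> \<bullet> x) ^ i))"
      by (intro summable_comparison_test'[OF ss])
         (simp add: abs_mult power_abs mult_left_mono power_mono)
    have "((\<lambda>i. \<epsilon> i * (\<kappa> \<bullet> x) ^ i) has_sum (\<Sum>i. \<epsilon> i * (\<kappa> \<bullet> x) ^ i)) UNIV"
      by (rule norm_summable_imp_has_sum[OF sn summable_sums[OF summable_norm_cancel[OF sn]]])
    then have inf: "(\<Sum>\<^sub>\<infinity>i. \<epsilon> i * (\<kappa> \<bullet> x) ^ i) = (\<Sum>i. \<epsilon> i * (\<kappa> \<bullet> x) ^ i)" by (rule infsumI)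
    have "((\<lambda>ks. \<epsilon> (length ks) * prod_list (map (\<lambda>k. \<kappa> $ k * x $ k) ks)) has_sum (\<Sum>i. \<epsilon> i * (\<kappa> \<bullet> x) ^ i)) UNIV"
      using has_sum_words(2)[OF ss] by (simp only: dot)
    moreover have "\<epsilon> (length ks) * prod_list (map (\<lambda>k. \<kappa> $ k * x $ k) ks) = - (E ks * mon ks x)" for ks
      by (simp add: E_def mon_def prod_list_map_mult)
    ultimately have "((\<lambda>ks. E ks * mon ks x) has_sum - (\<Sum>i. \<epsilon> i * (\<kappa> \<bullet> x) ^ i)) UNIV"
      by (simp add: has_sum_uminus)
    then show ?thesis using S(3)[OF x] inf infsumI unfolding W_def by metis
  qed
  have Pf: "has_frac_laplacian s P x (lam s \<kappa> * Re (q * cis (\<kappa> \<bullet> x)))" for x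
    using tsum_has_frac_laplacian[OF s tadm_unit, of q \<kappa> x] tsum_unit[of "of_real (lam s \<kappa>) * q" \<kappa> x]
    unfolding P_def by (simp add: tsum_unit mult.assoc)
  have Vf: "has_frac_laplacian s V x (- (\<integral>y. V y * fker s (x - y) \<partial>lborel))" if x: "x \<in> ball 0 1" for x
  proof -
    have i: "integrable lborel (\<lambda>y. V y * fker s (x - y))" using V x by (simp add: srep_def)
    then have m: "(\<lambda>y. V y * fker s (x - y)) \<in> borel_measurable lborel" by (rule borel_measurable_integrable)
    have "V x = 0" using V x by (simp add: srep_def)
    from has_frac_laplacian_vanishing[of V, OF this, of s] i m show ?thesis
      by (simp add: integrable_completion integral_completion)
  qed
  have adm: "tadm (N + 2) a \<xi>" using S(1) by (simp add: M_def)
  have CW: "C_on N U W" for U unfolding W_def by (rule tsum_C_on[OF adm])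
  have Wb: "\<bar>iter_partial ds W x\<bar> \<le> e" if "length ds \<le> N" for ds x
  proof -
    have "\<bar>iter_partial ds W x\<bar> \<le> tnorm N a \<xi>" unfolding W_def by (rule iter_partial_tsum_bound[OF adm that])
    also have "\<dots> \<le> tnorm M a \<xi>" by (rule tadm_mono(2)[OF S(1)]) (simp add: M_def)
    also have "\<dots> \<le> C * \<delta>" using S(2) mult_left_mono[OF ES CB(1)] by linarith
    finally show ?thesis using \<delta>(2) by linarith
  qed
  have CP: "C_on N U P" for U unfolding P_def by (rule plane_wave_C_on)
  obtain K where K: "\<And>y. \<bar>V y\<bar> \<le> K" using V unfolding srep_def by blast
  show ?thesis unfolding harm_approx_def P_def[symmetric]
  proof (intro exI conjI allI ballI impI)
    show "C_on N UNIV (\<lambda>x. P x + W x)" by (intro C_on_add CP CW) simp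
    show "V \<in> borel_measurable borel" using V by (simp add: srep_def)
    fix x :: "real ^ 'n"
    have "\<bar>P x\<bar> \<le> cmod q" using abs_Re_le_cmod[of "q * cis (\<kappa> \<bullet> x)"] by (simp add: P_def norm_mult)
    moreover have "\<bar>W x\<bar> \<le> e" using Wb[of "[]" x] by simp
    ultimately show "\<bar>P x + W x\<bar> \<le> cmod q + e + \<bar>K\<bar>" by linarith
    show "\<bar>V x\<bar> \<le> cmod q + e + \<bar>K\<bar>" using K[of x] e by (smt (verit) norm_ge_zero)
    fix ds :: "'n list" assume ds: "length ds \<le> N"
    show "\<bar>iter_partial ds (\<lambda>x. P x + W x) x - iter_partial ds P x\<bar> \<le> e"
      using iter_partial_add[OF open_UNIV CP CW ds, of x] Wb[OF ds, of x] by simp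
  next
    fix x :: "real ^ 'n" assume x: "x \<in> ball 0 1"
    show "V x = 0" using V x by (simp add: srep_def)
    have d: "((\<lambda>i. d i * (\<kappa> \<bullet> x) ^ i) has_sum (\<integral>y. V y * fker s (x - y) \<partial>lborel)) UNIV"
      using V x by (simp add: srep_def)
    have "((\<lambda>i. \<epsilon> i * (\<kappa> \<bullet> x) ^ i) has_sum (lam s \<kappa> * Re (q * cis (\<kappa> \<bullet> x)) - (\<integral>y. V y * fker s (x - y) \<partial>lborel))) UNIV"
      using has_sum_minus[OF c_sum d] by (simp add: \<epsilon>_def left_diff_distrib)
    then have z: "lam s \<kappa> * Re (q * cis (\<kappa> \<bullet> x)) + - (\<Sum>\<^sub>\<infinity>i. \<epsilon> i * (\<kappa> \<bullet> x) ^ i) + - (\<integral>y. V y * fker s (x - y) \<partial>lborel) = 0"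
      by (simp add: infsumI)
    show "has_frac_laplacian s (\<lambda>y. P y + W y + V y) x 0"
      using has_frac_laplacian_add[OF has_frac_laplacian_add[OF Pf Wf[OF x]] Vf[OF x]] unfolding z .
  qed
qed

lemma harm_approx_add:
  assumes P: "harm_approx s N e P" "C_on N UNIV P" and Q: "harm_approx s N e' Q" "C_on N UNIV Q"
  shows "harm_approx s N (e + e') (\<lambda>x. P x + Q x)"
proof -
  obtain T V K where T: "C_on N UNIV T" "V \<in> borel_measurable borel" "\<And>x. \<bar>T x\<bar> \<le> K \<and> \<bar>V x\<bar> \<le> K"
     "\<And>x. x\<in>ball 0 1 \<Longrightarrow> V x = 0" "\<And>x. x\<in>ball 0 1 \<Longrightarrow> has_frac_laplacian s (\<lambda>y. T y + V y) x 0"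
     "\<And>ds x. length ds \<le> N \<Longrightarrow> \<bar>iter_partial ds T x - iter_partial ds P x\<bar> \<le> e"
    using P(1) unfolding harm_approx_def by blast
  obtain S U L where S: "C_on N UNIV S" "U \<in> borel_measurable borel" "\<And>x. \<bar>S x\<bar> \<le> L \<and> \<bar>U x\<bar> \<le> L"
     "\<And>x. x\<in>ball 0 1 \<Longrightarrow> U x = 0" "\<And>x. x\<in>ball 0 1 \<Longrightarrow> has_frac_laplacian s (\<lambda>y. S y + U y) x 0"
     "\<And>ds x. length ds \<le> N \<Longrightarrow> \<bar>iter_partial ds S x - iter_partial ds Q x\<bar> \<le> e'"
    using Q(1) unfolding harm_approx_def by blast
  show ?thesis unfolding harm_approx_def
  proof (intro exI conjI allI ballI impI)
    show "C_on N UNIV (\<lambda>x. T x + S x)" by (intro C_on_add T S) simp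
    show "(\<lambda>x. V x + U x) \<in> borel_measurable borel" using T(2) S(2) by measurable
    show "\<bar>T x + S x\<bar> \<le> K + L" "\<bar>V x + U x\<bar> \<le> K + L" for x
      using T(3)[of x] S(3)[of x] by linarith+
    show "V x + U x = 0" if "x \<in> ball 0 1" for x using T(4) S(4) that by simp
    show "has_frac_laplacian s (\<lambda>y. T y + S y + (V y + U y)) x 0" if "x \<in> ball 0 1" for x
      using has_frac_laplacian_add[OF T(5)[OF that] S(5)[OF that]] by (simp add: algebra_simps)
    show "\<bar>iter_partial ds (\<lambda>x. T x + S x) x - iter_partial ds (\<lambda>x. P x + Q x) x\<bar> \<le> e + e'" if "length ds \<le> N" for ds x
      using T(6)[OF that, of x] S(6)[OF that, of x] iter_partial_add[OF open_UNIV T(1) S(1) that, of x]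
        iter_partial_add[OF open_UNIV P(2) Q(2) that, of x] by simp
  qed
qed

section \<open>Finite superpositions of plane waves\<close>

definition trig_poly :: "(complex \<times> (real ^ 'n::finite)) list \<Rightarrow> real ^ 'n \<Rightarrow> complex" where
  "trig_poly ps x = sum_list (map (\<lambda>(a, \<kappa>). a * cis (\<kappa> \<bullet> x)) ps)"

lemma trig_poly_Nil [simp]: "trig_poly [] x = 0"
  and trig_poly_Cons [simp]: "trig_poly ((a, \<kappa>) # ps) x = a * cis (\<kappa> \<bullet> x) + trig_poly ps x"
  by (simp_all add: trig_poly_def)

lemma trig_poly_C_on: "C_on N U (\<lambda>x. Re (trig_poly ps x))"
proof -
  have "C_on N UNIV (\<lambda>x. Re (trig_poly ps x))"
  proof (induction ps)
    case (Cons p ps)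
    then show ?case by (cases p) (auto intro!: C_on_add plane_wave_C_on simp del: Re_complex_of_real times_complex.simps cis.simps)
  qed (simp add: C_on_const)
  then show ?thesis by (rule C_on_subset) simp
qed

lemma harm_approx_trig_poly:
  assumes s: "0 < s" "s < 1" and "0 < e"
  shows "harm_approx s N e (\<lambda>x. Re (trig_poly ps x))"
  using assms(3)
proof (induction ps arbitrary: e)
  case Nil
  then show ?case unfolding harm_approx_def
    by (intro exI[of _ "\<lambda>_. 0"] exI[of _ 0]) (simp add: C_on_const has_frac_laplacian_const)
next
  case (Cons p ps)
  obtain a \<kappa> where p: "p = (a, \<kappa>)" by (cases p)
  have "harm_approx s N (e / 2 + e / 2) (\<lambda>x. Re (a * cis (\<kappa> \<bullet> x)) + Re (trig_poly ps x))"
    using Cons.prems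
    by (intro harm_approx_add harm_approx_plane_wave s Cons.IH plane_wave_C_on trig_poly_C_on) auto
  then show ?case by (simp add: p)
qed

subsection \<open>Approximation in $C^m$ by trigonometric polynomials\<close>

lemma C_on_Un:
  assumes "open U" "open V" "C_on m U f" "C_on m V f"
  shows "C_on m (U \<union> V) f"
  using assms unfolding C_on_def by (auto intro: continuous_on_open_Un)

lemma C_on_iter_partial:
  assumes "C_on (j + length ds) U f"
  shows "C_on j U (iter_partial ds f)"
  using assms unfolding C_on_def iter_partial_append[symmetric] by simp

lemma finite_short_lists: "finite {ds :: 'n::finite list. length ds \<le> m}"
  using finite_lists_length_le[of "UNIV :: 'n set" m] by simp

text \<open>The function \<open>u\<close> is regular only up to the sphere. Its dilation is C^m on a
  ball strictly larger than the unit ball, so it can be cut off, and uniform continuity of the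
  extended derivatives keeps it close. The bound \<open>1/2 < r\<close> keeps that ball within
  radius 2.\<close>

lemma dilation_close:
  fixes u :: "real ^ 'n::finite \<Rightarrow> real"
  assumes u: "C_closure m (ball 0 1) u" and e: "0 < e"
  obtains r where "1/2 < r" "r < 1" "C_on m (ball 0 (1/r)) (\<lambda>x. u (r *\<^sub>R x))"
    "\<And>ds x. length ds \<le> m \<Longrightarrow> x \<in> ball 0 1 \<Longrightarrow> \<bar>iter_partial ds (\<lambda>x. u (r *\<^sub>R x)) x - iter_partial ds u x\<bar> \<le> e"
proof -
  have C: "C_on m (ball 0 1) u" using u by (simp add: C_closure_def)
  have cl: "closure (ball 0 1) = cball (0 :: real ^ 'n) 1" by simp
  have ev01: "\<forall>\<^sub>F r in at_left (1::real). 1/2 < r \<and> r < 1"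
    by (intro eventually_at_left_field[THEN iffD2]) (auto intro!: exI[of _ "1/2"])
  have "\<forall>\<^sub>F r in at_left 1. \<forall>x\<in>ball 0 1. \<bar>iter_partial ds (\<lambda>x. u (r *\<^sub>R x)) x - iter_partial ds u x\<bar> \<le> e"
    if ds: "length ds \<le> m" for ds
  proof -
    obtain g where g: "continuous_on (cball 0 1) g" "\<And>x. x \<in> ball 0 1 \<Longrightarrow> g x = iter_partial ds u x"
      using u ds unfolding C_closure_def cl by blast
    have uc: "uniformly_continuous_on (cball 0 1) g" by (rule compact_uniformly_continuous[OF g(1) compact_cball])
    obtain d where d: "d > 0" "\<And>x x'. x \<in> cball 0 1 \<Longrightarrow> x' \<in> cball 0 1 \<Longrightarrow> dist x' x < d \<Longrightarrow> dist (g x') (g x) < e / 2"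
      using uc e unfolding uniformly_continuous_on_def by (meson half_gt_zero)
    have "bounded (g ` cball 0 1)" by (intro compact_imp_bounded compact_continuous_image g compact_cball)
    then obtain G where G: "G > 0" "\<And>x. x \<in> cball 0 1 \<Longrightarrow> \<bar>g x\<bar> \<le> G" unfolding bounded_pos by auto
    have "((\<lambda>r::real. r ^ length ds) \<longlongrightarrow> 1 ^ length ds) (at_left 1)" by (intro tendsto_intros)
    then have "\<forall>\<^sub>F r in at_left (1::real). dist (r ^ length ds) 1 < e / (2 * G)"
      using G e by (intro tendstoD) auto
    moreover have "\<forall>\<^sub>F r in at_left (1::real). 1 - d < r"
      using d(1) by (intro eventually_at_left_field[THEN iffD2]) (auto intro!: exI[of _ "1 - d"])
    ultimately show ?thesis using ev01
    proof eventually_elim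
      case (elim r)
      show ?case
      proof
        fix x :: "real ^ 'n" assume x: "x \<in> ball 0 1"
        have nx: "norm x < 1" using x by simp
        have "r * norm x \<le> 1 * norm x" using elim by (intro mult_right_mono) auto
        then have rx: "r *\<^sub>R x \<in> ball 0 1" using nx elim by simp
        have "iter_partial ds (\<lambda>x. u (r *\<^sub>R x)) x = r ^ length ds * g (r *\<^sub>R x)"
          using C_on_dilation[OF open_ball C, of r] ds rx g(2) by auto
        moreover have "dist (r *\<^sub>R x) x < d"
        proof -
          have "dist (r *\<^sub>R x) x = (1 - r) * norm x"
            using elim by (simp add: dist_norm scaleR_left_diff_distrib[of r 1 x, simplified, symmetric])
          also have "\<dots> \<le> (1 - r) * 1" using nx elim by (intro mult_left_mono) auto
          also have "(1 - r) * 1 < d" using elim by simp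
          finally show ?thesis .
        qed
        then have "\<bar>g (r *\<^sub>R x) - g x\<bar> < e / 2" using d(2)[of x "r *\<^sub>R x"] x rx by (simp add: dist_real_def)
        moreover have "\<bar>(r ^ length ds - 1) * g (r *\<^sub>R x)\<bar> \<le> e / 2"
        proof -
          have "\<bar>r ^ length ds - 1\<bar> * \<bar>g (r *\<^sub>R x)\<bar> \<le> (e / (2 * G)) * G"
            using elim(1) G(2)[of "r *\<^sub>R x"] rx e G(1) by (intro mult_mono) (auto simp: dist_real_def)
          then show ?thesis using G(1) by (simp add: abs_mult)
        qed
        ultimately show "\<bar>iter_partial ds (\<lambda>x. u (r *\<^sub>R x)) x - iter_partial ds u x\<bar> \<le> e"
          using g(2)[OF x] unfolding left_diff_distrib mult_1_left by linarith
      qed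
    qed
  qed
  then have "\<forall>\<^sub>F r in at_left 1. \<forall>ds\<in>{ds. length ds \<le> m}. \<forall>x\<in>ball 0 1. \<bar>iter_partial ds (\<lambda>x. u (r *\<^sub>R x)) x - iter_partial ds u x\<bar> \<le> e"
    by (intro eventually_ball_finite finite_short_lists) auto
  with ev01 have "\<forall>\<^sub>F r in at_left (1::real). (1/2 < r \<and> r < 1) \<and> (\<forall>ds\<in>{ds. length ds \<le> m}. \<forall>x\<in>ball 0 1. \<bar>iter_partial ds (\<lambda>x. u (r *\<^sub>R x)) x - iter_partial ds u x\<bar> \<le> e)"
    by (rule eventually_conj)
  from eventually_happens[OF this] obtain r where r: "1/2 < r" "r < 1"
    "\<And>ds x. length ds \<le> m \<Longrightarrow> x \<in> ball 0 1 \<Longrightarrow> \<bar>iter_partial ds (\<lambda>x. u (r *\<^sub>R x)) x - iter_partial ds u x\<bar> \<le> e"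
    by (auto simp: trivial_limit_at_left_real)
  have "{x. r *\<^sub>R x \<in> ball 0 1} = ball (0 :: real ^ 'n) (1/r)" using r by (auto simp: field_simps)
  then have "C_on m (ball 0 (1/r)) (\<lambda>x. u (r *\<^sub>R x))"
    using C_on_dilation[OF open_ball C, of r] by simp
  then show thesis using r by (intro that)
qed

text \<open>The cutoff is a truncated power of a truncated power of a quadratic polynomial in
  \<open>x\<close>: \<open>g\<close> is nonpositive on the unit ball and at least 1 beyond radius
  \<open>\<rho>\<close>, and exponents \<open>m + 1\<close> give class C^m. As
  \<open>\<rho> < t\<close>, the two open sets overlap and regularity glues.\<close>

lemma C_on_cutoff_extension:
  fixes f :: "real ^ 'n::finite \<Rightarrow> real"
  assumes t: "1 < t" "t < 2" and f: "C_on m (ball 0 t) f"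
  obtains v where "C_on m UNIV v" "\<And>x. x \<in> ball 0 1 \<Longrightarrow> v x = f x" "\<And>x. 2 \<le> norm x \<Longrightarrow> v x = 0"
proof -
  define \<rho> where "\<rho> = (1 + t) / 2"
  have \<rho>: "1 < \<rho>" "\<rho> < t" using t by (auto simp: \<rho>_def)
  have \<rho>2: "0 < \<rho>^2 - 1" using \<rho> by (simp add: one_less_power)
  define g where "g x = ((\<Sum>k\<in>UNIV. x $ k * x $ k) - 1) / (\<rho>^2 - 1)" for x :: "real ^ 'n"
  have nrm: "(\<Sum>k\<in>UNIV. x $ k * x $ k) = (norm x)^2" for x :: "real ^ 'n"
    by (simp add: power2_norm_eq_inner inner_vec_def)
  define \<eta> where "\<eta> x = (max 0 (1 - (max 0 (g x)) ^ (m + 1))) ^ (m + 1)" for x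
  have g_C: "C_on m UNIV g"
  proof -
    have "C_on m UNIV (\<lambda>x :: real ^ 'n. (1 / (\<rho>^2 - 1)) * ((\<Sum>k\<in>UNIV. x $ k * x $ k) - 1))"
      by (intro C_on_cmult C_on_diff C_on_sum C_on_mult C_on_component C_on_const open_UNIV)
    then show ?thesis by (simp add: g_def[abs_def])
  qed
  have \<eta>_C: "C_on m UNIV \<eta>"
    unfolding \<eta>_def[abs_def] by (intro C_on_max_power C_on_diff C_on_const open_UNIV g_C) auto
  have \<eta>1: "\<eta> x = 1" if "x \<in> ball 0 1" for x
  proof -
    have "(norm x)^2 \<le> 1" using that by (intro power_le_one) auto
    then have "g x \<le> 0" using \<rho>2 by (simp add: g_def nrm divide_le_0_iff)
    then show ?thesis by (simp add: \<eta>_def max_def)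
  qed
  have \<eta>0: "\<eta> x = 0" if "\<rho> \<le> norm x" for x
  proof -
    have "\<rho>^2 \<le> (norm x)^2" using that \<rho> by (intro power_mono) auto
    then have "1 \<le> g x" using \<rho>2 by (simp add: g_def nrm)
    then have "1 \<le> (max 0 (g x)) ^ (m + 1)" by (intro one_le_power) auto
    then show ?thesis by (simp add: \<eta>_def max_def)
  qed
  define v where "v x = (if x \<in> ball 0 t then f x * \<eta> x else 0)" for x
  have 1: "C_on m (ball 0 t) v"
    by (rule C_on_cong[OF open_ball _ C_on_mult[OF open_ball f C_on_subset[OF \<eta>_C]]]) (auto simp: v_def)
  have 2: "C_on m (- cball 0 \<rho>) v"
    by (rule C_on_cong[OF _ _ C_on_const[of _ _ 0]]) (use \<eta>0 in \<open>auto simp: v_def\<close>)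
  have "ball 0 t \<union> - cball 0 \<rho> = (UNIV :: (real ^ 'n) set)" using \<rho> by auto
  then have "C_on m UNIV v" using C_on_Un[OF open_ball open_Compl[OF closed_cball] 1 2] by simp
  then show thesis
    by (rule that) (use \<eta>1 t in \<open>auto simp: v_def\<close>)
qed

subsubsection \<open>Convolution\<close>

text \<open>The half-side 3 satisfies two constraints: it is at least 1 + 2, the radii of the unit
  ball and of the support, and it is below \<open>pi\<close>.\<close>

abbreviation Box :: "(real ^ 'n::finite) set" where
  "Box \<equiv> cbox (\<chi> i. - 3) (\<chi> i. 3)"

definition conv :: "(real ^ 'n::finite \<Rightarrow> real) \<Rightarrow> (real ^ 'n \<Rightarrow> real) \<Rightarrow> real ^ 'n \<Rightarrow> real" where
  "conv w K x = integral Box (\<lambda>z. w (x - z) * K z)"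

text \<open>The derivatives fall on \<open>w\<close> and not on the kernel. Approximating each
  derivative of \<open>w\<close> uniformly is then the same problem as approximating a continuous
  function.\<close>

lemma conv_has_derivative:
  fixes w :: "real ^ 'n::finite \<Rightarrow> real"
  assumes w: "C_on 1 UNIV w" and K: "continuous_on UNIV K"
  shows "(conv w K has_derivative (\<lambda>h. \<Sum>k\<in>UNIV. h $ k * conv (iter_partial [k] w) K x)) (at x)"
proof -
  have cw: "continuous_on UNIV w" using w by (rule C_on_imp_continuous_on)
  have dw: "w differentiable (at y)" for y using w by (simp add: C_on_Suc)
  have cp: "continuous_on UNIV (iter_partial [k] w)" for k
    using w unfolding One_nat_def C_on_Suc[OF open_UNIV] C_on_0 by blast
  define fx where "fx x t = (\<Sum>k\<in>UNIV. (iter_partial [k] w (x - t) * K t) *\<^sub>R blinfun_inner_left (axis k (1::real)))"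
    for x t :: "real ^ 'n"
  have fx_app: "blinfun_apply (fx x t) h = (\<Sum>k\<in>UNIV. h $ k * (iter_partial [k] w (x - t) * K t))" for x t h
    by (simp add: fx_def blinfun.sum_left blinfun.scaleR_left inner_axis mult.commute del: iter_partial.simps)
  have "((\<lambda>x. integral Box (\<lambda>t. w (x - t) * K t)) has_derivative blinfun_apply (integral Box (fx x))) (at x within UNIV)"
  proof (rule leibniz_rule)
    fix y t :: "real ^ 'n"
    have "((\<lambda>y. y - t) has_derivative (\<lambda>h. h)) (at y)" by (auto intro!: derivative_eq_intros)
    from has_derivative_compose[OF this dw[of "y - t", unfolded frechet_derivative_works]]
    have "((\<lambda>y. w (y - t) * K t) has_derivative (\<lambda>h. frechet_derivative w (at (y - t)) h * K t)) (at y)"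
      by (rule has_derivative_mult_left)
    moreover have "blinfun_apply (fx y t) = (\<lambda>h. frechet_derivative w (at (y - t)) h * K t)"
      by (rule ext) (simp add: fx_app frechet_derivative_expand[OF dw] sum_distrib_right mult.assoc del: iter_partial.simps)
    ultimately show "((\<lambda>y. w (y - t) * K t) has_derivative blinfun_apply (fx y t)) (at y within UNIV)" by simp
  next
    show "(\<lambda>t. w (y - t) * K t) integrable_on Box" for y
      by (intro integrable_continuous continuous_intros continuous_on_compose2[OF cw] continuous_on_subset[OF K]) auto
    show "continuous_on (UNIV \<times> Box) (\<lambda>(x, t). fx x t)"
      unfolding fx_def split_beta
      by (intro continuous_intros continuous_on_compose2[OF cp] continuous_on_compose2[OF K]) auto
  qed auto
  moreover have bi: "blinfun_apply (integral Box (fx x)) h = (\<Sum>k\<in>UNIV. h $ k * conv (iter_partial [k] w) K x)" for h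
  proof -
    have "fx x integrable_on Box"
      unfolding fx_def
      by (intro integrable_continuous continuous_intros continuous_on_compose2[OF cp] continuous_on_subset[OF K]) auto
    from integral_linear[OF this blinfun.bounded_linear_left[of h]]
    have "blinfun_apply (integral Box (fx x)) h = integral Box (\<lambda>t. \<Sum>k\<in>UNIV. h $ k * (iter_partial [k] w (x - t) * K t))"
      by (simp add: comp_def fx_app del: iter_partial.simps)
    also have "\<dots> = (\<Sum>k\<in>UNIV. integral Box (\<lambda>t. h $ k * (iter_partial [k] w (x - t) * K t)))"
      by (intro integral_sum finite integrable_continuous continuous_intros continuous_on_compose2[OF cp] continuous_on_subset[OF K]) auto
    finally show ?thesis by (simp add: conv_def del: iter_partial.simps)
  qed
  moreover have "conv w K = (\<lambda>x. integral Box (\<lambda>t. w (x - t) * K t))" by (rule ext) (simp add: conv_def)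
  moreover have "blinfun_apply (integral Box (fx x)) = (\<lambda>h. \<Sum>k\<in>UNIV. h $ k * conv (iter_partial [k] w) K x)"
    by (rule ext) (rule bi)
  ultimately show ?thesis by (simp only:)
qed

lemma iter_partial_conv:
  fixes w :: "real ^ 'n::finite \<Rightarrow> real"
  assumes K: "continuous_on UNIV K" and w: "C_on m UNIV w" and "length ds \<le> m"
  shows "iter_partial ds (conv w K) = conv (iter_partial ds w) K"
  using assms(3)
proof (induction ds)
  case (Cons k ds)
  have "C_on (1 + length ds) UNIV w" by (rule C_on_mono[OF w]) (use Cons.prems in simp)
  then have "C_on 1 UNIV (iter_partial ds w)" by (rule C_on_iter_partial)
  note D = conv_has_derivative[OF this K]
  have "iter_partial (k # ds) (conv w K) x = conv (iter_partial (k # ds) w) K x" for x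
  proof -
    have "iter_partial (k # ds) (conv w K) x = frechet_derivative (conv (iter_partial ds w) K) (at x) (axis k 1)"
      using Cons by simp
    also have "\<dots> = (\<Sum>i\<in>UNIV. axis k 1 $ i * conv (iter_partial [i] (iter_partial ds w)) K x)"
      unfolding frechet_derivative_at[OF D, symmetric] ..
    also have "\<dots> = (\<Sum>i\<in>UNIV. if i = k then conv (iter_partial [i] (iter_partial ds w)) K x else 0)"
      by (rule sum.cong) (auto simp: axis_def simp del: iter_partial.simps)
    also have "\<dots> = conv (iter_partial (k # ds) w) K x" by simp
    finally show ?thesis .
  qed
  then show ?case by blast
qed simp

text \<open>High powers of \<open>QQ\<close> are, up to normalisation, an approximate identity consisting of trigonometric
  polynomials: for \<open>x\<close> in the unit ball and functions vanishing outside the ball of radius 2 only \<open>Box\<close>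
  matters, where 0 is the only maximum of \<open>QQ\<close>.\<close>

definition QQ :: "real ^ 'n::finite \<Rightarrow> real" where
  "QQ z = (\<Prod>i\<in>UNIV. (1 + cos (z $ i)) / 2)"

lemma half_one_plus_cos: "0 \<le> (1 + cos t) / 2 \<and> (1 + cos t) / 2 \<le> 1" for t :: real
proof -
  have "0 \<le> 1 + cos t" using cos_ge_minus_one[of t] by linarith
  then show ?thesis by simp
qed

lemma QQ_bounds: "0 \<le> QQ z" "QQ z \<le> 1"
proof -
  have "0 \<le> (1 + cos (z $ i)) / 2 \<and> (1 + cos (z $ i)) / 2 \<le> 1" for i
    by (rule half_one_plus_cos)
  then show "0 \<le> QQ z" "QQ z \<le> 1" unfolding QQ_def by (auto intro!: prod_nonneg prod_le_1)
qed

lemma QQ_power_nonneg [simp]: "0 \<le> QQ z ^ N"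
  by (rule zero_le_power[OF QQ_bounds(1)])

lemma continuous_QQ: "continuous_on U QQ"
  unfolding QQ_def by (intro continuous_intros) auto

lemma mem_Box: "z \<in> Box \<longleftrightarrow> (\<forall>i. \<bar>z $ i\<bar> \<le> 3)"
  by (auto simp: mem_box_cart abs_le_iff) (metis minus_le_iff)+

lemma QQ_less_1:
  assumes z: "z \<in> Box" "z \<noteq> 0"
  shows "QQ z < 1"
proof -
  obtain i where i: "z $ i \<noteq> 0" using z(2) by (auto simp: vec_eq_iff)
  have "\<bar>z $ i\<bar> \<le> 3" using z(1) mem_Box by blast
  then have "0 < \<bar>z $ i\<bar> / 2" "\<bar>z $ i\<bar> / 2 < pi" using i pi_gt3 by auto
  then have "0 < sin (\<bar>z $ i\<bar> / 2)" by (rule sin_gt_zero)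
  then have "sin (\<bar>z $ i\<bar> / 2) ^ 2 > 0" by simp
  then have "cos \<bar>z $ i\<bar> < 1" using cos_double_sin[of "\<bar>z $ i\<bar> / 2"] by simp
  then have lt: "(1 + cos (z $ i)) / 2 < 1" by simp
  have b: "0 \<le> (1 + cos (z $ j)) / 2 \<and> (1 + cos (z $ j)) / 2 \<le> 1" for j
    by (rule half_one_plus_cos)
  have "QQ z = (1 + cos (z $ i)) / 2 * (\<Prod>j\<in>UNIV - {i}. (1 + cos (z $ j)) / 2)"
    unfolding QQ_def by (rule prod.remove) auto
  also have "\<dots> \<le> (1 + cos (z $ i)) / 2 * 1"
    using b by (intro mult_left_mono prod_le_1) auto
  finally show ?thesis using lt by simp
qed

text \<open>Away from 0 the powers decay like \<open>q ^ N\<close>, while on a small cube they stay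
  above \<open>q' ^ N\<close> with \<open>q < q'\<close>, so the outer part becomes negligible
  against the total mass. Concentration is expressed by the second moment, the only quantity that
  \<open>conv_close\<close> needs.\<close>

lemma QQ_concentrates:
  assumes \<tau>: "0 < \<tau>"
  obtains N where "0 < integral (Box :: (real ^ 'n::finite) set) (\<lambda>z. QQ z ^ N)"
    "integral (Box :: (real ^ 'n) set) (\<lambda>z. (norm z)^2 * QQ z ^ N) \<le> \<tau> * integral (Box :: (real ^ 'n) set) (\<lambda>z. QQ z ^ N)"
proof -
  let ?B = "Box :: (real ^ 'n) set"
  define S where "S = {z \<in> ?B. \<tau> / 2 \<le> (norm z)^2}"
  have "S = ?B \<inter> {z. \<tau> / 2 \<le> (norm z)^2}" by (auto simp: S_def)
  moreover have "closed {z :: real ^ 'n. \<tau> / 2 \<le> (norm z)^2}" by (intro closed_Collect_le continuous_intros)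
  ultimately have cS: "compact S" by (simp add: compact_Int_closed)
  have "\<exists>q. 0 \<le> q \<and> q < 1 \<and> (\<forall>z\<in>S. QQ z \<le> q)"
  proof (cases "S = {}")
    case False
    obtain w where w: "w \<in> S" "\<forall>z\<in>S. QQ z \<le> QQ w"
      using continuous_attains_sup[OF cS False continuous_QQ] by blast
    then have "w \<noteq> 0" "w \<in> ?B" using \<tau> by (auto simp: S_def)
    then show ?thesis using w QQ_less_1[of w] QQ_bounds(1)[of w] by blast
  qed (auto intro: exI[of _ 0])
  then obtain q where q: "0 \<le> q" "q < 1" "\<And>z. z \<in> S \<Longrightarrow> QQ z \<le> q" by blast
  define q' where "q' = (1 + q) / 2"
  have q': "q < q'" "q' < 1" "0 < q'" using q by (auto simp: q'_def)
  have "isCont QQ (0 :: real ^ 'n)" using continuous_QQ[of "UNIV :: (real ^ 'n) set"] by (simp add: continuous_on_eq_continuous_at)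
  moreover have "QQ (0 :: real ^ 'n) = 1" by (simp add: QQ_def)
  ultimately have "\<forall>\<^sub>F z in nhds (0 :: real ^ 'n). q' < QQ z"
    using q'(2) by (intro order_tendstoD(1)[of QQ 1]) (auto simp: continuous_at_imp_continuous_at_within tendsto_nhds_iff isCont_def)
  then obtain d where d: "d > 0" "\<And>z :: real ^ 'n. dist z 0 < d \<Longrightarrow> q' < QQ z"
    by (auto simp: eventually_nhds_metric)
  \<comment> \<open>The cube of half-side \<open>c\<close> lies in \<open>Box\<close>, and its
    points have norm at most \<open>d / 2\<close> by the estimate with the sum of the
    coordinates.\<close>
  define c where "c = min 3 (d / (2 * real CARD('n)))"
  have c: "0 < c" "c \<le> 3" using d(1) by (auto simp: c_def)
  let ?b = "cbox (\<chi> i. - c) (\<chi> i. c) :: (real ^ 'n) set"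
  have sub: "?b \<subseteq> ?B"
  proof
    fix z assume "z \<in> ?b"
    then have "- c \<le> z $ i \<and> z $ i \<le> c" for i by (simp add: mem_box_cart)
    then have "\<bar>z $ i\<bar> \<le> 3" for i using c(2) by (smt (verit))
    then show "z \<in> ?B" by (simp only: mem_Box) simp
  qed
  have Qb: "q' ^ N \<le> QQ z ^ N" if "z \<in> ?b" for z N
  proof -
    have "norm z \<le> (\<Sum>i\<in>UNIV. \<bar>z $ i\<bar>)" by (rule norm_le_l1_cart)
    also have "\<dots> \<le> (\<Sum>i\<in>(UNIV :: 'n set). c)"
    proof (rule sum_mono)
      fix i
      have "- c \<le> z $ i" "z $ i \<le> c" using that by (auto simp: mem_box_cart)
      then show "\<bar>z $ i\<bar> \<le> c" by linarith
    qed
    also have "\<dots> = real CARD('n) * c" by simp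
    also have "\<dots> \<le> real CARD('n) * (d / (2 * real CARD('n)))"
    proof (rule mult_left_mono)
      show "c \<le> d / (2 * real CARD('n))" unfolding c_def by (rule min.cobounded2)
    qed simp
    also have "\<dots> < d" using d(1) by simp
    finally have "q' < QQ z" using d(2) by simp
    then show ?thesis using q' by (intro power_mono) auto
  qed
  define D where "D = 9 * real CARD('n)"
  have D: "(norm z)^2 \<le> D" if "z \<in> ?B" for z
  proof -
    have "(norm z)^2 = z \<bullet> z" by (rule power2_norm_eq_inner)
    also have "\<dots> = (\<Sum>i\<in>UNIV. (z $ i)^2)" by (simp add: inner_vec_def power2_eq_square)
    also have "\<dots> \<le> (\<Sum>i\<in>(UNIV :: 'n set). 3^2)"
    proof (rule sum_mono)
      fix i
      have "\<bar>z $ i\<bar> \<le> \<bar>3\<bar>" using that unfolding mem_Box by simp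
      then show "(z $ i)^2 \<le> 3^2" unfolding abs_le_square_iff .
    qed
    finally show ?thesis by (simp add: D_def)
  qed
  have iQ: "(\<lambda>z. QQ z ^ N) integrable_on cbox a b" for N and a b :: "real ^ 'n"
    by (intro integrable_continuous continuous_intros continuous_QQ)
  have cb: "0 < measure lborel ?b" using c by (subst content_pos_lt_eq) (auto simp: Basis_vec_def inner_axis)
  have low: "q' ^ N * measure lborel ?b \<le> integral ?B (\<lambda>z. QQ z ^ N)" for N
  proof -
    have "q' ^ N * measure lborel ?b = integral ?b (\<lambda>z. q' ^ N)" by simp
    also have "\<dots> \<le> integral ?b (\<lambda>z. QQ z ^ N)" by (intro integral_le iQ Qb) auto
    also have "\<dots> \<le> integral ?B (\<lambda>z. QQ z ^ N)" by (intro integral_subset_le sub iQ) (auto simp: QQ_bounds)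
    finally show ?thesis .
  qed
  have "(\<lambda>N. D * measure lborel ?B * (q / q') ^ N) \<longlonglongrightarrow> D * measure lborel ?B * 0"
    using q q' by (intro tendsto_mult tendsto_const LIMSEQ_power_zero) auto
  then have "\<forall>\<^sub>F N in sequentially. D * measure lborel ?B * (q / q') ^ N < \<tau> / 2 * measure lborel ?b"
    using cb \<tau> by (intro order_tendstoD(2)[where y="D * measure lborel ?B * 0"]) auto
  then obtain N where N: "D * measure lborel ?B * (q / q') ^ N < \<tau> / 2 * measure lborel ?b"
    by (auto simp: eventually_sequentially)
  have qN: "D * measure lborel ?B * q ^ N \<le> \<tau> / 2 * (q' ^ N * measure lborel ?b)"
    using mult_right_mono[OF less_imp_le[OF N], of "q' ^ N"] q'(3) by (simp add: power_divide mult_ac)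
  show thesis
  proof (rule that[of N])
    show "0 < integral ?B (\<lambda>z. QQ z ^ N)" using low[of N] cb q'(3) by (smt (verit) mult_pos_pos zero_less_power)
    have "integral ?B (\<lambda>z. (norm z)^2 * QQ z ^ N) \<le> integral ?B (\<lambda>z. \<tau> / 2 * QQ z ^ N + D * q ^ N)"
    proof (intro integral_le integrable_continuous continuous_intros continuous_QQ)
      fix z assume z: "z \<in> ?B"
      show "(norm z)^2 * QQ z ^ N \<le> \<tau> / 2 * QQ z ^ N + D * q ^ N"
      proof (cases "z \<in> S")
        case True
        have "(norm z)^2 * QQ z ^ N \<le> D * q ^ N"
          using D[OF z] q(3)[OF True] QQ_bounds by (intro mult_mono power_mono) (auto simp: D_def)
        moreover have "0 \<le> \<tau> / 2 * QQ z ^ N" using \<tau> by (intro mult_nonneg_nonneg) auto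
        ultimately show ?thesis by linarith
      next
        case False
        then have "(norm z)^2 * QQ z ^ N \<le> \<tau> / 2 * QQ z ^ N"
          using z QQ_bounds by (intro mult_right_mono) (auto simp: S_def)
        moreover have "0 \<le> D * q ^ N" using q by (simp add: D_def)
        ultimately show ?thesis by linarith
      qed
    qed
    also have "\<dots> = \<tau> / 2 * integral ?B (\<lambda>z. QQ z ^ N) + D * q ^ N * measure lborel ?B"
      by (subst integral_add) (auto intro!: integrable_continuous continuous_intros continuous_QQ)
    also have "D * q ^ N * measure lborel ?B \<le> \<tau> / 2 * integral ?B (\<lambda>z. QQ z ^ N)"
    proof -
      have "D * q ^ N * measure lborel ?B \<le> \<tau> / 2 * (q' ^ N * measure lborel ?b)" using qN by (simp add: mult_ac)
      also have "\<dots> \<le> \<tau> / 2 * integral ?B (\<lambda>z. QQ z ^ N)" using low[of N] \<tau> by (intro mult_left_mono) auto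
      finally show ?thesis .
    qed
    finally show "integral ?B (\<lambda>z. (norm z)^2 * QQ z ^ N) \<le> \<tau> * integral ?B (\<lambda>z. QQ z ^ N)" by simp
  qed
qed

text \<open>A Chebyshev type argument: the oscillation of \<open>w\<close> is at most
  \<open>e / 2\<close> within distance \<open>d\<close> and at most \<open>2 * G\<close> beyond,
  hence everywhere at most \<open>e / 2\<close> plus \<open>2 * G / d^2\<close> times the squared
  distance. The choice of \<open>\<tau>\<close> makes the second part \<open>e / 2\<close>
  too.\<close>

lemma conv_close:
  fixes w :: "real ^ 'n::finite \<Rightarrow> real"
  assumes w: "continuous_on UNIV w" and e: "0 < e"
  obtains \<tau> where "0 < \<tau>" "\<And>K x. continuous_on UNIV K \<Longrightarrow> (\<And>z. 0 \<le> K z) \<Longrightarrow> integral Box K = 1 \<Longrightarrow>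
     integral Box (\<lambda>z. (norm z)^2 * K z) \<le> \<tau> \<Longrightarrow> x \<in> ball 0 1 \<Longrightarrow> \<bar>conv w K x - w x\<bar> \<le> e"
proof -
  obtain R where R: "\<And>z :: real ^ 'n. z \<in> Box \<Longrightarrow> norm z \<le> R" using bounded_cbox[of "\<chi> i. - 3" "\<chi> i. 3 :: real ^ 'n"] unfolding bounded_iff by blast
  define Z where "Z = cball (0 :: real ^ 'n) (1 + R)"
  have cw: "continuous_on Z w" by (rule continuous_on_subset[OF w]) simp
  have R0: "0 \<le> R" using R[of 0] by (simp add: mem_Box)
  have mem: "x - z \<in> Z" "x \<in> Z" if "x \<in> ball 0 1" "z \<in> Box" for x z :: "real ^ 'n"
    using norm_triangle_ineq4[of x z] R[OF that(2)] that(1) R0 by (auto simp: Z_def)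
  obtain d where d: "d > 0" "\<And>x x'. x \<in> Z \<Longrightarrow> x' \<in> Z \<Longrightarrow> dist x' x < d \<Longrightarrow> dist (w x') (w x) < e / 2"
    using compact_uniformly_continuous[OF cw] e unfolding uniformly_continuous_on_def Z_def by (meson compact_cball half_gt_zero)
  have "bounded (w ` Z)" unfolding Z_def by (intro compact_imp_bounded compact_continuous_image cw[unfolded Z_def] compact_cball)
  then obtain G where G: "G > 0" "\<And>x. x \<in> Z \<Longrightarrow> \<bar>w x\<bar> \<le> G" unfolding bounded_pos by auto
  define \<tau> where "\<tau> = e * d^2 / (4 * G)"
  have \<tau>: "0 < \<tau>" using e d G by (simp add: \<tau>_def)
  show thesis
  proof (rule that[OF \<tau>])
    fix K :: "real ^ 'n \<Rightarrow> real" and x :: "real ^ 'n" assume K: "continuous_on UNIV K" "\<And>z. 0 \<le> K z" "integral Box K = 1"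
      "integral Box (\<lambda>z. (norm z)^2 * K z) \<le> \<tau>" and x: "x \<in> ball 0 1"
    have cK: "continuous_on Box K" by (rule continuous_on_subset[OF K(1)]) simp
    have cwx: "continuous_on Box (\<lambda>z. w (x - z))" by (intro continuous_on_compose2[OF w] continuous_intros) auto
    have i1: "(\<lambda>z. w (x - z) * K z) integrable_on Box" "(\<lambda>z. w x * K z) integrable_on Box"
      "(\<lambda>z. (e / 2) * K z) integrable_on Box" "(\<lambda>z. (2 * G / d^2) * ((norm z)^2 * K z)) integrable_on Box"
      by (intro integrable_continuous continuous_intros cK cwx)+
    have "conv w K x - w x = integral Box (\<lambda>z. w (x - z) * K z) - integral Box (\<lambda>z. w x * K z)"
      using K(3) by (simp add: conv_def)
    also have "\<dots> = integral Box (\<lambda>z. w (x - z) * K z - w x * K z)"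
      by (rule integral_diff[symmetric, OF i1(1,2)])
    finally have "\<bar>conv w K x - w x\<bar> = norm (integral Box (\<lambda>z. w (x - z) * K z - w x * K z))" by simp
    also have "\<dots> \<le> integral Box (\<lambda>z. (e / 2) * K z + (2 * G / d^2) * ((norm z)^2 * K z))"
    proof (rule Henstock_Kurzweil_Integration.integral_norm_bound_integral)
      show "(\<lambda>z. w (x - z) * K z - w x * K z) integrable_on Box" by (intro integrable_diff i1)
      show "(\<lambda>z. (e / 2) * K z + (2 * G / d^2) * ((norm z)^2 * K z)) integrable_on Box" by (intro integrable_add i1)
      fix z :: "real ^ 'n" assume z: "z \<in> Box"
      have "\<bar>w (x - z) - w x\<bar> \<le> e / 2 + 2 * G / d^2 * (norm z)^2"
      proof (cases "norm z < d")
        case True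
        have "dist (w (x - z)) (w x) < e / 2"
          by (rule d(2)[OF mem(2)[OF x z] mem(1)[OF x z]]) (use True in \<open>simp add: dist_norm\<close>)
        moreover have "0 \<le> 2 * G / d^2 * (norm z)^2" using G by simp
        ultimately show ?thesis unfolding dist_real_def by linarith
      next
        case False
        then have "d^2 \<le> (norm z)^2" using d(1) by (intro power_mono) auto
        then have "2 * G / d^2 * d^2 \<le> 2 * G / d^2 * (norm z)^2" using G by (intro mult_left_mono) auto
        moreover have "\<bar>w (x - z) - w x\<bar> \<le> 2 * G" using G(2)[OF mem(1)[OF x z]] G(2)[OF mem(2)[OF x z]] by linarith
        ultimately show ?thesis using d(1) e by simp
      qed
      then have "\<bar>w (x - z) - w x\<bar> * K z \<le> (e / 2 + 2 * G / d^2 * (norm z)^2) * K z" by (rule mult_right_mono) (rule K(2))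
      then show "norm (w (x - z) * K z - w x * K z) \<le> (e / 2) * K z + (2 * G / d^2) * ((norm z)^2 * K z)"
        unfolding left_diff_distrib[symmetric] real_norm_def abs_mult abs_of_nonneg[OF K(2)]
        by (simp only: distrib_right mult.assoc)
    qed
    also have "\<dots> = (e / 2) * integral Box K + (2 * G / d^2) * integral Box (\<lambda>z. (norm z)^2 * K z)"
      by (subst integral_add[OF i1(3,4)]) (simp only: integral_mult_right)
    also have "\<dots> \<le> (e / 2) * 1 + (2 * G / d^2) * \<tau>"
      unfolding K(3) using K(4) G by (intro add_left_mono mult_left_mono) auto
    also have "\<dots> = e" using d(1) G(1) by (simp add: \<tau>_def)
    finally show "\<bar>conv w K x - w x\<bar> \<le> e" .
  qed
qed

subsubsection \<open>Trigonometric polynomial kernels\<close>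

lemma trig_poly_append: "trig_poly (ps @ qs) x = trig_poly ps x + trig_poly qs x"
  by (simp add: trig_poly_def)

lemma trig_poly_shift: "trig_poly (map (\<lambda>(b, \<eta>). (a * b, \<kappa> + \<eta>)) qs) x = a * cis (\<kappa> \<bullet> x) * trig_poly qs x"
  by (induction qs) (auto simp: inner_add_left cis_mult[symmetric] algebra_simps)

lemma trig_poly_mult: "\<exists>rs. \<forall>x. trig_poly rs x = trig_poly ps x * trig_poly qs x"
proof (induction ps)
  case Nil
  show ?case by (intro exI[of _ "[]"]) simp
next
  case (Cons p ps)
  then obtain rs where rs: "\<And>x. trig_poly rs x = trig_poly ps x * trig_poly qs x" by blast
  obtain a \<kappa> where p: "p = (a, \<kappa>)" by (cases p)
  show ?case
    by (intro exI[of _ "map (\<lambda>(b, \<eta>). (a * b, \<kappa> + \<eta>)) qs @ rs"])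
       (simp add: p trig_poly_append trig_poly_shift rs distrib_right)
qed

lemma QQ_trig_poly: "\<exists>ps. \<forall>z :: real ^ 'n::finite. trig_poly ps z = of_real (c * QQ z ^ N)"
proof -
  have c1: "\<exists>ps. \<forall>z :: real ^ 'n. trig_poly ps z = of_real ((1 + cos (z $ i)) / 2)" for i
    by (intro exI[of _ "[(1/2, 0), (1/4, axis i 1), (1/4, axis i (-1))]"])
       (simp add: inner_axis' complex_eq_iff)
  have P: "\<exists>ps. \<forall>z :: real ^ 'n. trig_poly ps z = of_real (\<Prod>i\<in>I. (1 + cos (z $ i)) / 2)" if "finite I" for I
    using that
  proof (induction I rule: finite_induct)
    case empty
    show ?case by (intro exI[of _ "[(1, 0)]"]) simp
  next
    case (insert i I)
    then obtain ps where "\<And>z :: real ^ 'n. trig_poly ps z = of_real (\<Prod>i\<in>I. (1 + cos (z $ i)) / 2)" by blast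
    moreover obtain qs where "\<And>z :: real ^ 'n. trig_poly qs z = of_real ((1 + cos (z $ i)) / 2)" using c1 by blast
    moreover obtain rs where "\<And>z. trig_poly rs z = trig_poly qs z * trig_poly ps z" using trig_poly_mult by blast
    ultimately show ?case using insert by (intro exI[of _ rs]) simp
  qed
  obtain qs where qs: "\<And>z :: real ^ 'n. trig_poly qs z = of_real (QQ z)" using P[OF finite_class.finite_UNIV] unfolding QQ_def by blast
  show ?thesis
  proof (induction N)
    case 0
    show ?case by (intro exI[of _ "[(of_real c, 0)]"]) simp
  next
    case (Suc N)
    then obtain ps where "\<And>z :: real ^ 'n. trig_poly ps z = of_real (c * QQ z ^ N)" by blast
    moreover obtain rs where "\<And>z. trig_poly rs z = trig_poly qs z * trig_poly ps z" using trig_poly_mult by blast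
    ultimately show ?case using qs by (intro exI[of _ rs]) simp
  qed
qed

text \<open>The factor depending on \<open>x\<close> leaves the integral, and the rest is a Fourier
  coefficient of \<open>v\<close>; the frequencies do not change.\<close>

lemma trig_poly_convolution:
  fixes v :: "real ^ 'n::finite \<Rightarrow> real"
  assumes v: "integrable lborel v"
  shows "\<exists>qs. \<forall>x. integrable lborel (\<lambda>y. of_real (v y) * trig_poly ps (x - y)) \<and>
     (\<integral>y. of_real (v y) * trig_poly ps (x - y) \<partial>lborel) = trig_poly qs x"
proof (induction ps)
  case Nil
  show ?case by (intro exI[of _ "[]"]) simp
next
  case (Cons p ps)
  then obtain qs where qs: "\<And>x. integrable lborel (\<lambda>y. of_real (v y) * trig_poly ps (x - y))"
     "\<And>x. (\<integral>y. of_real (v y) * trig_poly ps (x - y) \<partial>lborel) = trig_poly qs x" by blast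
  obtain a \<kappa> where p: "p = (a, \<kappa>)" by (cases p)
  have vc: "integrable lborel (\<lambda>y. complex_of_real (v y))" using v by simp
  have i: "integrable lborel (\<lambda>y. of_real (v y) * cis (- (\<kappa> \<bullet> y)))"
  proof (rule Bochner_Integration.integrable_bound[OF vc])
    have "continuous_on UNIV (\<lambda>y. cis (- (\<kappa> \<bullet> y)))" by (intro continuous_intros continuous_on_compose2[OF continuous_on_cis])  auto
    then have [measurable]: "(\<lambda>y. cis (- (\<kappa> \<bullet> y))) \<in> borel_measurable borel" by (rule borel_measurable_continuous_onI)
    have [measurable]: "v \<in> borel_measurable borel" using borel_measurable_integrable[OF v] by simp
    show "(\<lambda>y. complex_of_real (v y) * cis (- (\<kappa> \<bullet> y))) \<in> borel_measurable lborel" by measurable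
  qed (simp add: norm_mult)
  define b where "b = a * (\<integral>y. of_real (v y) * cis (- (\<kappa> \<bullet> y)) \<partial>lborel)"
  have e: "of_real (v y) * trig_poly (p # ps) (x - y)
     = (a * cis (\<kappa> \<bullet> x)) * (of_real (v y) * cis (- (\<kappa> \<bullet> y))) + of_real (v y) * trig_poly ps (x - y)" for x y
  proof -
    have "cis (\<kappa> \<bullet> (x - y)) = cis (\<kappa> \<bullet> x) * cis (- (\<kappa> \<bullet> y))" by (simp add: inner_diff_right cis_mult)
    then show ?thesis by (simp only: p trig_poly_Cons distrib_left mult_ac)
  qed
  have i2: "integrable lborel (\<lambda>y. (a * cis (\<kappa> \<bullet> x)) * (of_real (v y) * cis (- (\<kappa> \<bullet> y))))" for x
    by (intro integrable_mult_right i)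
  have I: "(\<integral>y. (a * cis (\<kappa> \<bullet> x)) * (of_real (v y) * cis (- (\<kappa> \<bullet> y))) \<partial>lborel)
     = (a * cis (\<kappa> \<bullet> x)) * (\<integral>y. of_real (v y) * cis (- (\<kappa> \<bullet> y)) \<partial>lborel)" for x
    by (rule integral_mult_right_zero)
  have "integrable lborel (\<lambda>y. of_real (v y) * trig_poly (p # ps) (x - y))" for x
    unfolding e by (intro Bochner_Integration.integrable_add i2 qs)
  moreover have "(\<integral>y. of_real (v y) * trig_poly (p # ps) (x - y) \<partial>lborel) = trig_poly ((b, \<kappa>) # qs) x" for x
    unfolding e Bochner_Integration.integral_add[OF i2 qs(1)] I qs(2) by (simp add: b_def mult_ac)
  ultimately have "integrable lborel (\<lambda>y. of_real (v y) * trig_poly (p # ps) (x - y)) \<and>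
     (\<integral>y. of_real (v y) * trig_poly (p # ps) (x - y) \<partial>lborel) = trig_poly ((b, \<kappa>) # qs) x" for x
    by blast
  then show ?case by blast
qed

text \<open>The form over \<open>Box\<close> suits differentiation, the form over the whole space
  shows that the result is a trigonometric polynomial. They agree because for \<open>x\<close> in
  the ball the support of \<open>v (x - z)\<close> lies in \<open>Box\<close>.\<close>

lemma conv_eq_lborel:
  fixes v :: "real ^ 'n::finite \<Rightarrow> real"
  assumes v: "continuous_on UNIV v" "\<And>x. 2 \<le> norm x \<Longrightarrow> v x = 0" and K: "continuous_on UNIV K" and x: "x \<in> ball 0 1"
  shows "conv v K x = (\<integral>y. v y * K (x - y) \<partial>lborel)"
proof -
  define \<phi> where "\<phi> z = v (x - z) * K z" for z
  have c\<phi>: "continuous_on UNIV \<phi>" unfolding \<phi>_def by (intro continuous_intros K continuous_on_compose2[OF v(1)]) auto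
  have z: "\<phi> z = 0" if "z \<notin> Box" for z
  proof -
    have "\<not> (\<forall>i. \<bar>z $ i\<bar> \<le> 3)" using that unfolding mem_Box .
    then obtain i where "3 < \<bar>z $ i\<bar>" by (auto simp: not_le)
    then have "3 < norm z" using component_le_norm_cart[of z i] by linarith
    moreover have "norm z \<le> norm x + norm (x - z)" using norm_triangle_ineq4[of x "x - z"] by simp
    ultimately have "2 \<le> norm (x - z)" using x by simp
    then show ?thesis by (simp add: \<phi>_def v(2))
  qed
  have \<phi>i: "indicator Box z *\<^sub>R \<phi> z = \<phi> z" for z using z[of z] by (auto simp: indicator_def)
  have "integrable lborel (\<lambda>z. indicator Box z *\<^sub>R \<phi> z)"
    by (rule borel_integrable_compact[OF compact_cbox continuous_on_subset[OF c\<phi>]]) simp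
  then have int: "integrable lborel \<phi>" by (simp only: \<phi>i)
  have "conv v K x = integral Box \<phi>" by (simp add: conv_def \<phi>_def[abs_def])
  also have "\<dots> = integral UNIV (\<lambda>z. if z \<in> Box then \<phi> z else 0)" by (rule integral_restrict_UNIV[symmetric])
  also have "(\<lambda>z. if z \<in> Box then \<phi> z else 0) = \<phi>" using z by auto
  also have "integral UNIV \<phi> = (\<integral>z. \<phi> z \<partial>lborel)" by (rule integral_lborel[OF int])
  also have "\<dots> = (\<integral>z. \<phi> (- z) \<partial>lborel)"
    by (rule lborel_integral_reflect(1)[symmetric]) (rule borel_measurable_continuous_onI[OF c\<phi>])
  also have "\<dots> = (\<integral>z. \<phi> (- (- x + z)) \<partial>lborel)"
    by (rule lborel_integral_translate(1)[symmetric])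
       (intro borel_measurable_continuous_onI continuous_on_compose2[OF c\<phi>] continuous_intros, simp)
  also have "\<dots> = (\<integral>y. v y * K (x - y) \<partial>lborel)" by (simp add: \<phi>_def)
  finally show ?thesis .
qed

lemma trig_poly_approx:
  fixes u :: "real ^ 'n::finite \<Rightarrow> real"
  assumes u: "C_closure m (ball 0 1) u" and e: "0 < e"
  obtains ps where "\<And>ds x. length ds \<le> m \<Longrightarrow> x \<in> ball 0 1 \<Longrightarrow>
    \<bar>iter_partial ds (\<lambda>x. Re (trig_poly ps x)) x - iter_partial ds u x\<bar> \<le> e"
proof -
  obtain r where r: "1/2 < r" "r < 1" "C_on m (ball 0 (1/r)) (\<lambda>x. u (r *\<^sub>R x))"
    "\<And>ds x. length ds \<le> m \<Longrightarrow> x \<in> ball 0 1 \<Longrightarrow> \<bar>iter_partial ds (\<lambda>x. u (r *\<^sub>R x)) x - iter_partial ds u x\<bar> \<le> e / 2"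
    using dilation_close[OF u, of "e / 2"] e by auto
  have t: "1 < 1 / r" "1 / r < 2" using r by (auto simp: field_simps)
  obtain v where v: "C_on m UNIV v" "\<And>x. x \<in> ball 0 1 \<Longrightarrow> v x = u (r *\<^sub>R x)" "\<And>x. 2 \<le> norm x \<Longrightarrow> v x = 0"
    using C_on_cutoff_extension[OF t r(3)] by blast
  have cv: "continuous_on UNIV v" by (rule C_on_imp_continuous_on[OF v(1)])
  define P where "P ds \<tau> \<longleftrightarrow> (\<forall>K x. continuous_on UNIV K \<longrightarrow> (\<forall>z. 0 \<le> K z) \<longrightarrow> integral Box K = 1 \<longrightarrow>
     integral Box (\<lambda>z. (norm z)^2 * K z) \<le> \<tau> \<longrightarrow> x \<in> ball 0 1 \<longrightarrow> \<bar>conv (iter_partial ds v) K x - iter_partial ds v x\<bar> \<le> e / 2)"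
    for ds and \<tau> :: real
  have "\<exists>\<tau>. length ds \<le> m \<longrightarrow> 0 < \<tau> \<and> P ds \<tau>" for ds
  proof (cases "length ds \<le> m")
    case True
    then have c: "continuous_on UNIV (iter_partial ds v)" using v(1) by (simp add: C_on_def)
    show ?thesis
    proof (rule conv_close[OF c, of "e / 2"])
      fix \<tau> :: real assume "0 < \<tau>" and "\<And>K x. continuous_on UNIV K \<Longrightarrow> (\<And>z. 0 \<le> K z) \<Longrightarrow> integral Box K = 1 \<Longrightarrow>
        integral Box (\<lambda>z. (norm z)^2 * K z) \<le> \<tau> \<Longrightarrow> x \<in> ball 0 1 \<Longrightarrow>
        \<bar>conv (iter_partial ds v) K x - iter_partial ds v x\<bar> \<le> e / 2"
      then have "0 < \<tau> \<and> P ds \<tau>" unfolding P_def by blast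
      then show ?thesis by blast
    qed (use e in simp)
  qed blast
  then have "\<exists>T. \<forall>ds. length ds \<le> m \<longrightarrow> 0 < T ds \<and> P ds (T ds)" by (intro choice allI)
  then obtain T where T1: "\<And>ds. length ds \<le> m \<Longrightarrow> 0 < T ds \<and> P ds (T ds)" by blast
  have T: "0 < T ds" "\<And>K x. continuous_on UNIV K \<Longrightarrow> (\<And>z. 0 \<le> K z) \<Longrightarrow> integral Box K = 1 \<Longrightarrow>
     integral Box (\<lambda>z. (norm z)^2 * K z) \<le> T ds \<Longrightarrow> x \<in> ball 0 1 \<Longrightarrow> \<bar>conv (iter_partial ds v) K x - iter_partial ds v x\<bar> \<le> e / 2"
    if "length ds \<le> m" for ds
    using T1[OF that] unfolding P_def by blast+
  \<comment> \<open>One kernel must serve all derivatives simultaneously; there are only finitely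
    many lists of length at most \<open>m\<close>.\<close>
  define \<tau> where "\<tau> = Min (T ` {ds. length ds \<le> m})"
  have ne: "{ds :: 'n list. length ds \<le> m} \<noteq> {}" by (auto intro: exI[of _ "[]"])
  have \<tau>: "0 < \<tau>" "\<And>ds. length ds \<le> m \<Longrightarrow> \<tau> \<le> T ds"
    using T(1) ne finite_short_lists[where 'n='n and m=m] by (auto simp: \<tau>_def)
  obtain N where N: "0 < integral (Box :: (real ^ 'n) set) (\<lambda>z. QQ z ^ N)"
    "integral (Box :: (real ^ 'n) set) (\<lambda>z. (norm z)^2 * QQ z ^ N) \<le> \<tau> * integral (Box :: (real ^ 'n) set) (\<lambda>z. QQ z ^ N)"
    using QQ_concentrates[OF \<tau>(1)] by blast
  define c where "c = 1 / integral (Box :: (real ^ 'n) set) (\<lambda>z. QQ z ^ N)"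
  have c: "0 < c" using N(1) by (simp add: c_def)
  define K where "K z = c * QQ z ^ N" for z :: "real ^ 'n"
  have cK: "continuous_on UNIV K" unfolding K_def by (intro continuous_intros continuous_QQ)
  have K0: "0 \<le> K z" for z using c QQ_bounds(1)[of z] by (simp add: K_def)
  have K1: "integral Box K = 1" unfolding K_def using N(1) by (simp add: c_def)
  have K2: "integral Box (\<lambda>z. (norm z)^2 * K z) \<le> \<tau>"
  proof -
    have "integral Box (\<lambda>z. (norm z)^2 * K z) = c * integral (Box :: (real ^ 'n) set) (\<lambda>z. (norm z)^2 * QQ z ^ N)"
      unfolding K_def by (subst integral_mult_right[symmetric]) (simp add: mult_ac)
    also have "\<dots> \<le> c * (\<tau> * integral (Box :: (real ^ 'n) set) (\<lambda>z. QQ z ^ N))" using N(2) c by (intro mult_left_mono) auto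
    also have "\<dots> = \<tau>" using N(1) by (simp add: c_def)
    finally show ?thesis .
  qed
  obtain ks where ks: "\<And>z :: real ^ 'n. trig_poly ks z = of_real (K z)" using QQ_trig_poly[of c N] unfolding K_def by blast
  have iv: "integrable lborel v"
  proof -
    have "integrable lborel (\<lambda>x. indicator (cball 0 2) x *\<^sub>R v x)"
      by (rule borel_integrable_compact[OF compact_cball continuous_on_subset[OF cv]]) simp
    moreover have "(\<lambda>x. indicator (cball 0 2) x *\<^sub>R v x) = v" using v(3) by (auto simp: indicator_def fun_eq_iff)
    ultimately show ?thesis by (simp only:)
  qed
  obtain ps where ps: "\<And>x. (\<integral>y. of_real (v y) * trig_poly ks (x - y) \<partial>lborel) = trig_poly ps x"
    using trig_poly_convolution[OF iv, of ks] by blast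
  have eq: "Re (trig_poly ps x) = conv v K x" if "x \<in> ball 0 1" for x
  proof -
    have "trig_poly ps x = (\<integral>y. complex_of_real (v y * K (x - y)) \<partial>lborel)"
      unfolding ps[symmetric] ks by simp
    also have "\<dots> = of_real (\<integral>y. v y * K (x - y) \<partial>lborel)" by (rule integral_complex_of_real)
    also have "\<dots> = of_real (conv v K x)" using conv_eq_lborel[OF cv v(3) cK that] by simp
    finally show ?thesis by simp
  qed
  show thesis
  proof (rule that[of ps])
    fix ds :: "'n list" and x :: "real ^ 'n" assume ds: "length ds \<le> m" and x: "x \<in> ball 0 1"
    have "iter_partial ds (\<lambda>x. Re (trig_poly ps x)) x = iter_partial ds (conv v K) x"
      by (rule iter_partial_cong[OF open_ball eq x])
    also have "\<dots> = conv (iter_partial ds v) K x" by (simp add: iter_partial_conv[OF cK v(1) ds])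
    finally have 1: "\<bar>iter_partial ds (\<lambda>x. Re (trig_poly ps x)) x - iter_partial ds v x\<bar> \<le> e / 2"
      using T(2)[OF ds cK K0 K1 order_trans[OF K2 \<tau>(2)[OF ds]] x] by simp
    have "iter_partial ds v x = iter_partial ds (\<lambda>x. u (r *\<^sub>R x)) x"
      by (rule iter_partial_cong[OF open_ball v(2) x])
    then show "\<bar>iter_partial ds (\<lambda>x. Re (trig_poly ps x)) x - iter_partial ds u x\<bar> \<le> e"
      using 1 r(4)[OF ds x] by linarith
  qed
qed

subsection \<open>Tails\<close>

lemma fker_measurable_lebesgue [measurable]: "fker s \<in> borel_measurable lebesgue"
  by (rule borel_measurable_lebesgueI) measurable

lemma fker_translate_measurable_lebesgue [measurable]: "(\<lambda>y. fker s (x - y)) \<in> borel_measurable lebesgue"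
  by (rule borel_measurable_lebesgueI) measurable

lemma far_indicator_measurable [measurable]:
  "(\<lambda>y. indicator {y. R \<le> norm y} (y :: real ^ 'n::finite) :: real) \<in> borel_measurable lebesgue"
  by (rule borel_measurable_lebesgueI) measurable

lemma inverse_norm_power_measurable [measurable]:
  "(\<lambda>y :: real ^ 'n::finite. (1 / norm y) ^ k) \<in> borel_measurable lebesgue"
  by (rule borel_measurable_lebesgueI) measurable

lemma tint_comparison:
  fixes v :: "real ^ 'n::finite \<Rightarrow> real"
  assumes "tint s k R v" and w[measurable]: "w \<in> borel_measurable lebesgue"
    and le: "\<And>y. R \<le> norm y \<Longrightarrow> \<bar>w y\<bar> * (1 / norm y) ^ j \<le> c * (\<bar>v y\<bar> * (1 / norm y) ^ k)"
  shows "tint s j R w" "tau s j R w \<le> c * tau s k R v"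
proof -
  let ?v = "\<lambda>y. c * (indicator {y. R \<le> norm y} y * (\<bar>v y\<bar> * fker s y * (1 / norm y) ^ k))"
  let ?w = "\<lambda>y. indicator {y. R \<le> norm y} y * (\<bar>w y\<bar> * fker s y * (1 / norm y) ^ j)"
  have v: "integrable lebesgue ?v" using assms(1) by (simp add: tint_def)
  have le': "?w y \<le> ?v y" for y
    using mult_right_mono[OF le[of y], of "fker s y"] by (cases "R \<le> norm y") (simp_all add: mult_ac)
  have i: "integrable lebesgue ?w"
  proof (rule Bochner_Integration.integrable_bound[OF v])
    show "AE y in lebesgue. norm (?w y) \<le> norm (?v y)"
    proof (rule AE_I2)
      fix y
      have "norm (?w y) = ?w y" by simp
      also have "\<dots> \<le> ?v y" by (rule le')
      also have "\<dots> \<le> norm (?v y)" unfolding real_norm_def by (rule abs_ge_self)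
      finally show "norm (?w y) \<le> norm (?v y)" .
    qed
  qed measurable
  then show "tint s j R w" using w by (simp add: tint_def)
  have "tau s j R w \<le> (\<integral>y. ?v y \<partial>lebesgue)" unfolding tau_def by (rule integral_mono[OF i v le'])
  then show "tau s j R w \<le> c * tau s k R v" by (simp add: tau_def)
qed

lemma tint_1:
  assumes s: "0 < s" "s < 1" and "1 \<le> R"
  shows "tint s k R (\<lambda>_ :: real ^ 'n::finite. 1)"
proof (rule tint_mono[OF _ assms(3), of s 0])
  have "integrable lborel (\<lambda>z :: real ^ 'n. indicator {z. R \<le> norm z} z * fker s z)"
    by (rule integrable_fker_far[OF s]) (use assms(3) in simp)
  then show "tint s 0 R (\<lambda>_ :: real ^ 'n. 1)"
    by (simp add: tint_def integrable_completion)
qed simp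

lemma tint_bounded:
  fixes v :: "real ^ 'n::finite \<Rightarrow> real"
  assumes s: "0 < s" "s < 1" and R: "1 \<le> R" and v: "v \<in> borel_measurable lebesgue" "\<And>y. \<bar>v y\<bar> \<le> L"
  shows "tint s k R v" "tau s k R v \<le> L * tau s k R (\<lambda>_ :: real ^ 'n. 1)"
proof -
  have le: "\<bar>v y\<bar> * (1 / norm y) ^ k \<le> L * (\<bar>1\<bar> * (1 / norm y) ^ k)" for y
    using mult_right_mono[OF v(2)[of y], of "(1 / norm y) ^ k"] by simp
  show "tint s k R v" by (rule tint_comparison(1)[OF tint_1[OF s R, of k] v(1) le])
  show "tau s k R v \<le> L * tau s k R (\<lambda>_ :: real ^ 'n. 1)"
    by (rule tint_comparison(2)[OF tint_1[OF s R, of k] v(1) le])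
qed

lemma tint_diff:
  fixes v w :: "real ^ 'n::finite \<Rightarrow> real"
  assumes v: "tint s k R v" and w: "tint s k R w"
  shows "tint s k R (\<lambda>y. v y - w y)" "tau s k R (\<lambda>y. v y - w y) \<le> tau s k R v + tau s k R w"
proof -
  let ?f = "\<lambda>v y. indicator {y. R \<le> norm y} y * (\<bar>v y\<bar> * fker s y * (1 / norm y) ^ k)"
  have i: "integrable lebesgue (?f v)" "integrable lebesgue (?f w)" using v w by (simp_all add: tint_def)
  have [measurable]: "v \<in> borel_measurable lebesgue" "w \<in> borel_measurable lebesgue" using v w by (simp_all add: tint_def)
  have le: "?f (\<lambda>y. v y - w y) y \<le> ?f v y + ?f w y" for y
  proof -
    have "\<bar>v y - w y\<bar> \<le> \<bar>v y\<bar> + \<bar>w y\<bar>" by (rule abs_triangle_ineq4)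
    from mult_right_mono[OF this, of "fker s y * (1 / norm y) ^ k"]
    show ?thesis by (auto simp: indicator_def algebra_simps)
  qed
  have d: "integrable lebesgue (?f (\<lambda>y. v y - w y))"
  proof (rule Bochner_Integration.integrable_bound[OF Bochner_Integration.integrable_add[OF i]])
    show "AE y in lebesgue. norm (?f (\<lambda>y. v y - w y) y) \<le> norm (?f v y + ?f w y)"
    proof (rule AE_I2)
      fix y
      have "norm (?f (\<lambda>y. v y - w y) y) = ?f (\<lambda>y. v y - w y) y" by simp
      also have "\<dots> \<le> ?f v y + ?f w y" by (rule le)
      also have "\<dots> \<le> norm (?f v y + ?f w y)" unfolding real_norm_def by (rule abs_ge_self)
      finally show "norm (?f (\<lambda>y. v y - w y) y) \<le> norm (?f v y + ?f w y)" .
    qed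
  qed measurable
  then show "tint s k R (\<lambda>y. v y - w y)" by (simp add: tint_def)
  have "tau s k R (\<lambda>y. v y - w y) \<le> (\<integral>y. ?f v y + ?f w y \<partial>lebesgue)"
    unfolding tau_def by (rule integral_mono[OF d Bochner_Integration.integrable_add[OF i] le])
  also have "\<dots> = tau s k R v + tau s k R w" unfolding tau_def by (rule Bochner_Integration.integral_add[OF i])
  finally show "tau s k R (\<lambda>y. v y - w y) \<le> tau s k R v + tau s k R w" .
qed

lemma tint_radius:
  fixes v :: "real ^ 'n::finite \<Rightarrow> real"
  assumes v: "tint s k R v" and "R \<le> R'"
  shows "tint s k R' v"
proof -
  have [measurable]: "v \<in> borel_measurable lebesgue" using v by (simp add: tint_def)
  have "integrable lebesgue (\<lambda>y. indicator {y. R' \<le> norm y} y * (\<bar>v y\<bar> * fker s y * (1 / norm y) ^ k))"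
  proof (rule Bochner_Integration.integrable_bound)
    show "integrable lebesgue (\<lambda>y. indicator {y. R \<le> norm y} y * (\<bar>v y\<bar> * fker s y * (1 / norm y) ^ k))"
      using v by (simp add: tint_def)
    show "AE y in lebesgue. norm (indicator {y. R' \<le> norm y} y * (\<bar>v y\<bar> * fker s y * (1 / norm y) ^ k))
      \<le> norm (indicator {y. R \<le> norm y} y * (\<bar>v y\<bar> * fker s y * (1 / norm y) ^ k))"
      using assms(2) by (auto simp: indicator_def intro!: AE_I2)
  qed measurable
  then show ?thesis by (simp add: tint_def)
qed

lemma far_integral_tendsto_0:
  fixes f :: "real ^ 'n::finite \<Rightarrow> real"
  assumes [measurable]: "f \<in> borel_measurable lebesgue"
    and i: "integrable lebesgue (\<lambda>y. indicator {y. R \<le> norm y} y * f y)"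
  shows "((\<lambda>r. \<integral>y. indicator {y. r \<le> norm y} y * f y \<partial>lebesgue) \<longlongrightarrow> 0) at_top"
proof -
  let ?f = "\<lambda>r y. indicator {y. r \<le> norm y} y * f y"
  have "((\<lambda>r. \<integral>y. ?f r y \<partial>lebesgue) \<longlongrightarrow> integral\<^sup>L lebesgue (\<lambda>_ :: real ^ 'n. 0)) at_top"
  proof (rule integral_dominated_convergence_at_top)
    show "integrable lebesgue (\<lambda>y. \<bar>?f R y\<bar>)" using i by (rule integrable_abs)
    show "\<forall>\<^sub>F r in at_top. AE y in lebesgue. norm (?f r y) \<le> \<bar>?f R y\<bar>"
      using eventually_ge_at_top[of R]
    proof eventually_elim
      case (elim r)
      show ?case
      proof (rule AE_I2)
        fix y :: "real ^ 'n"
        show "norm (?f r y) \<le> \<bar>?f R y\<bar>" using elim by (simp add: indicator_def)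
      qed
    qed
    show "AE y in lebesgue. ((\<lambda>r. ?f r y) \<longlongrightarrow> 0) at_top"
    proof (rule AE_I2)
      fix y :: "real ^ 'n"
      have "\<forall>\<^sub>F r in at_top. ?f r y = 0"
        using eventually_gt_at_top[of "norm y"] by eventually_elim simp
      then show "((\<lambda>r. ?f r y) \<longlongrightarrow> 0) at_top" by (rule tendsto_eventually)
    qed
  qed measurable
  then show ?thesis by simp
qed

lemma tau_tendsto_0:
  fixes v :: "real ^ 'n::finite \<Rightarrow> real"
  assumes v: "tint s k R v"
  shows "((\<lambda>R. tau s k R v) \<longlongrightarrow> 0) at_top"
proof -
  have [measurable]: "v \<in> borel_measurable lebesgue" using v by (simp add: tint_def)
  have "integrable lebesgue (\<lambda>y. indicator {y. R \<le> norm y} y * (\<bar>v y\<bar> * fker s y * (1 / norm y) ^ k))"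
    using v by (simp add: tint_def)
  from far_integral_tendsto_0[OF _ this] show ?thesis unfolding tau_def by simp
qed

lemma tail_diff:
  fixes v1 v2 :: "real ^ 'n::finite \<Rightarrow> real"
  assumes "tint s k R v1" "tint s k R v2" "1 \<le> R"
    "(\<lambda>w. ccoef s k R v1 w * mon (wcoords w) x) summable_on UNIV"
    "(\<lambda>w. ccoef s k R v2 w * mon (wcoords w) x) summable_on UNIV"
  shows "tail s k R (\<lambda>y. v1 y - v2 y) x = tail s k R v1 x - tail s k R v2 x"
proof -
  have "ccoef s k R (\<lambda>y. v1 y - v2 y) w = ccoef s k R v1 w - ccoef s k R v2 w" for w
    using tcoef_diff[OF assms(1-3)] by (simp add: ccoef_def)
  then show ?thesis
    unfolding tail_def left_diff_distrib
    by (simp only: left_diff_distrib infsumI[OF has_sum_minus[OF has_sum_infsum[OF assms(4)] has_sum_infsum[OF assms(5)]]])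
qed

lemma tint_of_weight:
  fixes u :: "real ^ 'n::finite \<Rightarrow> real"
  assumes [measurable]: "u \<in> borel_measurable lebesgue"
    and i: "set_integrable lebesgue (- ball 0 1) (\<lambda>x. \<bar>u x\<bar> / norm x powr (real CARD('n) + 2 * s + real k))"
  shows "tint s k 1 u"
proof -
  have "indicator (- ball 0 1) y *\<^sub>R (\<bar>u y\<bar> / norm y powr (real CARD('n) + 2 * s + real k))
     = indicator {y. 1 \<le> norm y} y * (\<bar>u y\<bar> * fker s y * (1 / norm y) ^ k)" for y :: "real ^ 'n"
  proof (cases "1 \<le> norm y")
    case True
    then have "norm y powr (real CARD('n) + 2 * s + real k) = norm y powr (real CARD('n) + 2 * s) * norm y ^ k"
      using powr_realpow[of "norm y" k] by (simp only: powr_add)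
    then have "\<bar>u y\<bar> / norm y powr (real CARD('n) + 2 * s + real k) = (\<bar>u y\<bar> / norm y powr (real CARD('n) + 2 * s)) * (1 / norm y) ^ k"
      by (simp add: power_one_over)
    then show ?thesis using True by (simp only: divide_norm_powr) simp
  qed simp
  then show ?thesis using i by (simp add: tint_def set_integrable_def)
qed

lemma weighted_L1_I:
  fixes u :: "real ^ 'n::finite \<Rightarrow> real"
  assumes u: "u \<in> borel_measurable lebesgue" and t: "tint s k R u" and R: "1 \<le> R"
    and L: "\<And>y. norm y < R \<Longrightarrow> \<bar>u y\<bar> \<le> L"
  shows "u \<in> weighted_L1 s k"
proof -
  define p where "p = real CARD('n) + 2 * s + real k"
  note u[measurable]
  have [measurable]: "(\<lambda>x :: real ^ 'n. 1 + norm x powr p) \<in> borel_measurable lebesgue"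
    by (rule borel_measurable_lebesgueI) measurable
  have "integrable lebesgue (\<lambda>x. \<bar>u x\<bar> / (1 + norm x powr p))"
  proof (rule Bochner_Integration.integrable_bound)
    have "integrable lborel (\<lambda>x :: real ^ 'n. indicator (ball 0 R) x * \<bar>L\<bar>)"
      using emeasure_lborel_ball_finite[of "0 :: real ^ 'n" R]
      by (intro integrable_mult_left integrable_real_indicator) (auto simp: less_top)
    then have "integrable lebesgue (\<lambda>x :: real ^ 'n. indicator (ball 0 R) x * \<bar>L\<bar>)"
      by (subst integrable_completion) (simp_all add: borel_measurable_indicator borel_measurable_times del: integrable_mult_left_iff integrable_mult_right_iff)
    then show "integrable lebesgue (\<lambda>x. indicator (ball 0 R) x * \<bar>L\<bar> + indicator {y. R \<le> norm y} x * (\<bar>u x\<bar> * fker s x * (1 / norm x) ^ k))"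
      using t by (intro Bochner_Integration.integrable_add) (auto simp: tint_def)
    show "AE x in lebesgue. norm (\<bar>u x\<bar> / (1 + norm x powr p))
       \<le> norm (indicator (ball 0 R) x * \<bar>L\<bar> + indicator {y. R \<le> norm y} x * (\<bar>u x\<bar> * fker s x * (1 / norm x) ^ k))"
    proof (rule AE_I2)
      fix x :: "real ^ 'n"
      have pos: "1 \<le> 1 + norm x powr p" by simp
      show "norm (\<bar>u x\<bar> / (1 + norm x powr p))
       \<le> norm (indicator (ball 0 R) x * \<bar>L\<bar> + indicator {y. R \<le> norm y} x * (\<bar>u x\<bar> * fker s x * (1 / norm x) ^ k))"
      proof (cases "norm x < R")
        case True
        have "\<bar>u x\<bar> / (1 + norm x powr p) \<le> \<bar>u x\<bar> / 1"
          using pos by (intro divide_left_mono) (auto intro: add_pos_nonneg)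
        also have "\<dots> \<le> \<bar>L\<bar>" using L[OF True] by simp
        finally show ?thesis using True pos by simp
      next
        case False
        then have x: "0 < norm x" using R by linarith
        have "\<bar>u x\<bar> / (1 + norm x powr p) \<le> \<bar>u x\<bar> / norm x powr p" using x by (intro divide_left_mono mult_pos_pos add_pos_pos) auto
        also have "\<dots> = \<bar>u x\<bar> / (norm x powr (real CARD('n) + 2 * s) * norm x ^ k)"
          unfolding p_def using powr_realpow[OF x, of k] by (simp only: powr_add)
        also have "\<dots> = (\<bar>u x\<bar> / norm x powr (real CARD('n) + 2 * s)) * (1 / norm x) ^ k"
          by (simp add: power_one_over)
        also have "\<dots> = \<bar>u x\<bar> * fker s x * (1 / norm x) ^ k" by (simp only: divide_norm_powr)
        finally show ?thesis using False pos by simp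
      qed
    qed
  qed measurable
  then show ?thesis using u by (simp add: weighted_L1_def p_def)
qed

text \<open>On a bounded set all the weights are comparable, so truncation passes from order
  \<open>k\<close> to any order, in particular to the order 0 required of viscosity
  solutions.\<close>

lemma weighted_L1_truncate:
  fixes u :: "real ^ 'n::finite \<Rightarrow> real"
  assumes s: "0 < s" and u: "u \<in> weighted_L1 s k"
  shows "(\<lambda>x. indicator (ball 0 R) x * u x) \<in> weighted_L1 s j"
proof -
  define p where "p = real CARD('n) + 2 * s + real k"
  define q where "q = real CARD('n) + 2 * s + real j"
  have p0: "0 \<le> p" using s by (simp add: p_def)
  have [measurable]: "u \<in> borel_measurable lebesgue" and i: "integrable lebesgue (\<lambda>x. \<bar>u x\<bar> / (1 + norm x powr p))"
    using u by (auto simp: weighted_L1_def p_def)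
  have [measurable]: "(\<lambda>x :: real ^ 'n. indicator (ball 0 R) x :: real) \<in> borel_measurable lebesgue"
    by (rule borel_measurable_lebesgueI) (simp add: borel_measurable_indicator)
  have [measurable]: "(\<lambda>x :: real ^ 'n. 1 + norm x powr q) \<in> borel_measurable lebesgue"
    by (rule borel_measurable_lebesgueI) measurable
  have "integrable lebesgue (\<lambda>x. \<bar>indicator (ball 0 R) x * u x\<bar> / (1 + norm x powr q))"
  proof (rule Bochner_Integration.integrable_bound)
    show "integrable lebesgue (\<lambda>x. (1 + \<bar>R\<bar> powr p) * (\<bar>u x\<bar> / (1 + norm x powr p)))" by (rule integrable_mult_right) (rule i)
    show "AE x in lebesgue. norm (\<bar>indicator (ball 0 R) x * u x\<bar> / (1 + norm x powr q))
       \<le> norm ((1 + \<bar>R\<bar> powr p) * (\<bar>u x\<bar> / (1 + norm x powr p)))"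
    proof (rule AE_I2)
      fix x :: "real ^ 'n"
      have pos: "1 \<le> 1 + norm x powr p" "1 \<le> 1 + norm x powr q" "1 \<le> 1 + \<bar>R\<bar> powr p" by auto
      have nz: "1 + norm x powr p \<noteq> 0" using pos(1) by linarith
      show "norm (\<bar>indicator (ball 0 R) x * u x\<bar> / (1 + norm x powr q))
       \<le> norm ((1 + \<bar>R\<bar> powr p) * (\<bar>u x\<bar> / (1 + norm x powr p)))"
      proof (cases "norm x < R")
        case True
        have "\<bar>u x\<bar> / (1 + norm x powr q) \<le> \<bar>u x\<bar> / 1"
          using pos by (intro divide_left_mono) (auto intro: add_pos_nonneg)
        also have "\<dots> = (1 + norm x powr p) * (\<bar>u x\<bar> / (1 + norm x powr p))" using nz by simp
        also have "\<dots> \<le> (1 + \<bar>R\<bar> powr p) * (\<bar>u x\<bar> / (1 + norm x powr p))"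
          using True p0 pos by (intro mult_right_mono add_left_mono powr_mono2) auto
        finally show ?thesis using True pos by (simp add: abs_mult)
      qed (use pos in simp)
    qed
  qed measurable
  moreover have "(\<lambda>x. indicator (ball 0 R) x * u x) \<in> borel_measurable lebesgue" by measurable
  ultimately show ?thesis by (simp add: weighted_L1_def q_def)
qed


lemma harmonic_approximation:
  fixes u :: "real ^ 'n::finite \<Rightarrow> real"
  assumes s: "0 < s" "s < 1" and u: "C_closure m (ball 0 1) u" and e: "0 < e" and N: "m \<le> N"
  obtains T V L where "C_on N UNIV T" "V \<in> borel_measurable borel" "\<And>x. \<bar>T x\<bar> \<le> L" "\<And>x. \<bar>V x\<bar> \<le> L"
    "\<And>x. x \<in> ball 0 1 \<Longrightarrow> V x = 0"
    "\<And>x. x \<in> ball 0 1 \<Longrightarrow> has_frac_laplacian s (\<lambda>y. T y + V y) x 0"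
    "\<And>ds x. length ds \<le> m \<Longrightarrow> x \<in> ball 0 1 \<Longrightarrow> \<bar>iter_partial ds T x - iter_partial ds u x\<bar> \<le> e"
proof -
  obtain ps where ps: "\<And>ds (x :: real ^ 'n). length ds \<le> m \<Longrightarrow> x \<in> ball 0 1 \<Longrightarrow>
      \<bar>iter_partial ds (\<lambda>x. Re (trig_poly ps x)) x - iter_partial ds u x\<bar> \<le> e / 2"
    using trig_poly_approx[OF u, of "e / 2"] e by auto
  have "harm_approx s N (e / 2) (\<lambda>x. Re (trig_poly ps x))"
    by (rule harm_approx_trig_poly[OF s]) (use e in simp)
  then obtain T V L where TV: "C_on N UNIV T" "V \<in> borel_measurable borel" "\<forall>x. \<bar>T x\<bar> \<le> L \<and> \<bar>V x\<bar> \<le> L"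
    "\<forall>x\<in>ball 0 1. V x = 0" "\<forall>x\<in>ball 0 1. has_frac_laplacian s (\<lambda>y. T y + V y) x 0"
    and d: "\<forall>ds x. length ds \<le> N \<longrightarrow> \<bar>iter_partial ds T x - iter_partial ds (\<lambda>x. Re (trig_poly ps x)) x\<bar> \<le> e / 2"
    unfolding harm_approx_def by blast
  show ?thesis
  proof (rule that)
    fix ds :: "'n list" and x :: "real ^ 'n" assume ds: "length ds \<le> m" and x: "x \<in> ball 0 1"
    have "length ds \<le> N" using ds N by simp
    then have "\<bar>iter_partial ds T x - iter_partial ds (\<lambda>x. Re (trig_poly ps x)) x\<bar> \<le> e / 2" using d by blast
    with ps[OF ds x] show "\<bar>iter_partial ds T x - iter_partial ds u x\<bar> \<le> e" by linarith
  qed (use TV in blast)+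
qed

subsection \<open>Correcting the tail\<close>

text \<open>On bounded continuous functions the map from \<open>w\<close> to the solution with data
  \<open>g - w\<close> has Lipschitz constant at most
  \<open>K * tau s k R (\<lambda>_. 1) \<le> 1 / 2\<close>. A fixed point satisfies
  \<open>norm W \<le> e + norm W / 2\<close>, hence the bound \<open>2 * e\<close>. No derivative
  enters the contraction: regularity and derivative bounds follow afterwards because
  \<open>w\<close> is itself a trigonometric series.\<close>

lemma tail_fixed_point:
  fixes g :: "real ^ 'n::finite \<Rightarrow> real"
  assumes s: "0 < s" "s < 1" and R: "1 \<le> R" and g: "tint s k R g" and K: "0 \<le> K"
    and adm: "\<And>v :: real ^ 'n \<Rightarrow> real. tint s k R v \<Longrightarrow> tadm (N + 2) (tsa A s k R v) (tsx X)"
    and bd: "\<And>v :: real ^ 'n \<Rightarrow> real. tint s k R v \<Longrightarrow> tnorm (N + 2) (tsa A s k R v) (tsx X) \<le> K * tau s k R v"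
    and small: "K * tau s k R (\<lambda>_ :: real ^ 'n. 1) \<le> 1 / 2" "K * tau s k R g \<le> e"
  obtains w where "w = tsol A X s k R (\<lambda>y. g y - w y)" "w \<in> borel_measurable borel" "\<And>y. \<bar>w y\<bar> \<le> 2 * e"
    "tint s k R (\<lambda>y. g y - w y)" "C_on N UNIV w"
    "\<And>ds x. length ds \<le> N \<Longrightarrow> \<bar>iter_partial ds w x\<bar> \<le> 2 * e"
proof -
  let ?\<tau> = "tau s k R (\<lambda>_ :: real ^ 'n. 1)"
  have sol_bound: "\<bar>tsol A X s k R v x\<bar> \<le> K * tau s k R v" if v: "tint s k R v" for v x
  proof -
    have "\<bar>tsol A X s k R v x\<bar> \<le> cmod (tsum (tsa A s k R v) (tsx X) x)"
      unfolding tsol_def by (rule abs_Re_le_cmod)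
    also have "\<dots> \<le> tnorm 0 (tsa A s k R v) (tsx X)" by (rule tsum_bound[OF tadm_mono(1)[OF adm[OF v]]]) simp
    also have "\<dots> \<le> tnorm (N + 2) (tsa A s k R v) (tsx X)" by (rule tadm_mono(2)[OF adm[OF v]]) simp
    also have "\<dots> \<le> K * tau s k R v" by (rule bd[OF v])
    finally show ?thesis .
  qed
  have bc_meas: "apply_bcontfun W \<in> borel_measurable lebesgue" for W :: "(real ^ 'n) \<Rightarrow>\<^sub>C real"
    by (rule borel_measurable_lebesgueI) (intro borel_measurable_continuous_onI continuous_on_apply_bcontfun continuous_on_id)
  have bc_tint: "tint s k R (\<lambda>y. g y - apply_bcontfun W y)" for W
  proof -
    have "\<bar>apply_bcontfun W y\<bar> \<le> norm W" for y using norm_bounded[of W y] by simp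
    then show ?thesis by (rule tint_diff(1)[OF g tint_bounded(1)[OF s R bc_meas]])
  qed
  define \<Psi> where "\<Psi> W = Bcontfun (tsol A X s k R (\<lambda>y. g y - apply_bcontfun W y))" for W :: "(real ^ 'n) \<Rightarrow>\<^sub>C real"
  have \<Psi>: "apply_bcontfun (\<Psi> W) = tsol A X s k R (\<lambda>y. g y - apply_bcontfun W y)" for W
    unfolding \<Psi>_def
  proof (rule Bcontfun_inverse, rule bcontfun_normI)
    show "continuous_on UNIV (tsol A X s k R (\<lambda>y. g y - apply_bcontfun W y))"
      unfolding tsol_def by (rule tsum_continuous_on, rule tadm_mono(1)[OF adm[OF bc_tint]]) simp
    show "norm (tsol A X s k R (\<lambda>y. g y - apply_bcontfun W y) x) \<le> K * tau s k R (\<lambda>y. g y - apply_bcontfun W y)" for x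
      using sol_bound[OF bc_tint] by simp
  qed
  have lip: "dist (\<Psi> W1) (\<Psi> W2) \<le> 1 / 2 * dist W1 W2" for W1 W2
  proof (rule dist_bound)
    fix x
    let ?v = "\<lambda>W y. g y - apply_bcontfun W y"
    have t: "tint s k R (\<lambda>y. ?v W1 y - ?v W2 y)" "tau s k R (\<lambda>y. ?v W1 y - ?v W2 y) \<le> dist W1 W2 * ?\<tau>"
    proof -
      have m: "(\<lambda>y. ?v W1 y - ?v W2 y) \<in> borel_measurable lebesgue"
        using tint_diff(1)[OF bc_tint[of W1] bc_tint[of W2]] by (simp only: tint_def)
      have le: "\<bar>?v W1 y - ?v W2 y\<bar> \<le> dist W1 W2" for y
        using dist_bounded[of W1 y W2] by (simp add: dist_real_def abs_minus_commute)
      show "tint s k R (\<lambda>y. ?v W1 y - ?v W2 y)" "tau s k R (\<lambda>y. ?v W1 y - ?v W2 y) \<le> dist W1 W2 * ?\<tau>"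
        by (rule tint_bounded[OF s R m le])+
    qed
    have "dist (apply_bcontfun (\<Psi> W1) x) (apply_bcontfun (\<Psi> W2) x) = \<bar>tsol A X s k R (\<lambda>y. ?v W1 y - ?v W2 y) x\<bar>"
      unfolding \<Psi> tsol_diff[OF bc_tint bc_tint R adm[OF bc_tint] adm[OF bc_tint]] by (simp add: dist_real_def)
    also have "\<dots> \<le> K * tau s k R (\<lambda>y. ?v W1 y - ?v W2 y)" by (rule sol_bound[OF t(1)])
    also have "\<dots> \<le> K * (dist W1 W2 * ?\<tau>)" by (rule mult_left_mono[OF t(2) K])
    also have "\<dots> = (K * ?\<tau>) * dist W1 W2" by simp
    also have "\<dots> \<le> 1 / 2 * dist W1 W2" by (rule mult_right_mono[OF small(1)]) simp
    finally show "dist (apply_bcontfun (\<Psi> W1) x) (apply_bcontfun (\<Psi> W2) x) \<le> 1 / 2 * dist W1 W2" .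
  qed
  have "\<exists>!W. \<Psi> W = W"
    by (rule banach_fix_type[of "1 / 2"]) (use lip in auto)
  then obtain W where W: "\<Psi> W = W" by blast
  define w where "w = apply_bcontfun W"
  define v where "v = (\<lambda>y. g y - w y)"
  have fp: "w = tsol A X s k R v" using \<Psi>[of W] by (simp add: W w_def v_def)
  have tv: "tint s k R v" using bc_tint[of W] by (simp add: v_def w_def)
  have wle: "\<bar>w y\<bar> \<le> norm W" for y using norm_bounded[of W y] by (simp add: w_def)
  have "w \<in> borel_measurable lebesgue" using bc_meas by (simp add: w_def)
  note tw = tint_bounded[OF s R this wle]
  have "tau s k R v \<le> tau s k R g + norm W * ?\<tau>"
    using order_trans[OF tint_diff(2)[OF g tw(1)] add_left_mono[OF tw(2)]] by (simp only: v_def)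
  from mult_left_mono[OF this K] have "K * tau s k R v \<le> K * tau s k R g + (K * ?\<tau>) * norm W"
    by (simp add: algebra_simps)
  moreover have "(K * ?\<tau>) * norm W \<le> 1 / 2 * norm W" by (rule mult_right_mono[OF small(1)]) simp
  ultimately have Kv: "K * tau s k R v \<le> e + norm W / 2" using small(2) by linarith
  have "norm W \<le> K * tau s k R v"
  proof (rule norm_bound)
    show "norm (apply_bcontfun W x) \<le> K * tau s k R v" for x
      using sol_bound[OF tv] by (simp add: fp[symmetric] w_def[symmetric])
  qed
  with Kv have W_le: "norm W \<le> 2 * e" "K * tau s k R v \<le> 2 * e" by linarith+
  have wt: "w = (\<lambda>x. Re (tsum (tsa A s k R v) (tsx X) x))" unfolding fp by (simp add: tsol_def fun_eq_iff)
  show ?thesis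
  proof (rule that[of w])
    show "w = tsol A X s k R (\<lambda>y. g y - w y)" using fp by (simp add: v_def)
    show "w \<in> borel_measurable borel" unfolding w_def
      by (intro borel_measurable_continuous_onI continuous_on_apply_bcontfun continuous_on_id)
    show "\<bar>w y\<bar> \<le> 2 * e" for y using wle[of y] W_le(1) by linarith
    show "tint s k R (\<lambda>y. g y - w y)" using tv by (simp add: v_def)
    show "C_on N UNIV w" unfolding wt by (rule tsum_C_on[OF adm[OF tv]])
    fix ds :: "'n list" and x :: "real ^ 'n" assume ds: "length ds \<le> N"
    have "\<bar>iter_partial ds w x\<bar> \<le> tnorm N (tsa A s k R v) (tsx X)"
      unfolding wt by (rule iter_partial_tsum_bound[OF adm[OF tv] ds])
    also have "\<dots> \<le> tnorm (N + 2) (tsa A s k R v) (tsx X)" by (rule tadm_mono(2)[OF adm[OF tv]]) simp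
    also have "\<dots> \<le> K * tau s k R v" by (rule bd[OF tv])
    also note W_le(2)
    finally show "\<bar>iter_partial ds w x\<bar> \<le> 2 * e" .
  qed
qed

subsection \<open>The truncated equations\<close>

text \<open>On the ball the operator applied to \<open>b\<close> equals the tail of
  \<open>v\<close>, and adding the far data \<open>v\<close> contributes minus its potential.
  Truncated at radius \<open>r\<close>, that potential splits into a polynomial, which may diverge
  with \<open>r\<close> and is absorbed in \<open>P\<close>, and a tail, which converges to the one
  produced by \<open>b\<close>.\<close>

lemma div_frac_laplacian_eq_0I:
  fixes U b T v :: "real ^ 'n::finite \<Rightarrow> real"
  assumes s: "0 < s" "s < 1" and R: "1 \<le> R"
    and tail_bound: "\<And>(v :: real ^ 'n \<Rightarrow> real) x. tint s k R v \<Longrightarrow> x \<in> ball 0 1 \<Longrightarrow> \<bar>tail s k R v x\<bar> \<le> K * tau s k R v"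
    and coef: "\<And>(v :: real ^ 'n \<Rightarrow> real) x. tint s k R v \<Longrightarrow> x \<in> ball 0 1 \<Longrightarrow> (\<lambda>w. ccoef s k R v w * mon (wcoords w) x) summable_on UNIV"
    and far_int: "\<And>(v :: real ^ 'n \<Rightarrow> real) r x. R \<le> r \<Longrightarrow> tint s 0 r v \<Longrightarrow> x \<in> ball 0 1 \<Longrightarrow>
       integrable lebesgue (\<lambda>y. indicator {y. r \<le> norm y} y * (v y * fker s (x - y)))"
    and far_sum: "\<And>(v :: real ^ 'n \<Rightarrow> real) x. tint s 0 R v \<Longrightarrow> x \<in> ball 0 1 \<Longrightarrow>
       ((\<lambda>w. tcoef s R v w * mon (wcoords w) x) has_sum
         (\<integral>y. indicator {y. R \<le> norm y} y * (v y * fker s (x - y)) \<partial>lebesgue)) UNIV"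
    and v: "tint s k R v" and b: "b \<in> borel_measurable lebesgue" "\<And>y. \<bar>b y\<bar> \<le> L"
    and lap: "\<And>x. x \<in> ball 0 1 \<Longrightarrow> has_frac_laplacian s b x (tail s k R v x)"
    and T: "C_on 2 UNIV T" "\<And>y. y \<in> ball 0 1 \<Longrightarrow> b y = T y"
    and U: "\<And>y. U y = b y + indicator {y. R \<le> norm y} y * v y"
  shows "div_frac_laplacian_eq s k U (\<lambda>x. 0)"
proof -
  have vm[measurable]: "v \<in> borel_measurable lebesgue" using v by (simp add: tint_def)
  note b(1)[measurable]
  have Ueq: "U = (\<lambda>y. b y + indicator {y. R \<le> norm y} y * v y)" using U by (rule ext)
  have Um[measurable]: "U \<in> borel_measurable lebesgue" unfolding Ueq by measurable
  have tb: "tint s j r b" if "1 \<le> r" for j r by (rule tint_bounded(1)[OF s that b])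
  \<comment> \<open>Outside radius \<open>R\<close> this difference is the negative of
    \<open>U\<close>, so the estimate for differences also covers the sum.\<close>
  have "tint s k R (\<lambda>y. (- v y) - b y)"
    by (rule tint_diff(1)[OF tint_comparison(1)[OF v, where c = 1] tb[OF R]]) simp_all
  then have tU: "tint s k R U"
    by (rule tint_comparison(1)[where c = 1]) (use U in \<open>auto simp: abs_minus_commute algebra_simps\<close>)
  have UL: "\<bar>U y\<bar> \<le> L" if "norm y < R" for y using b(2)[of y] that by (simp add: U)
  have U_weighted: "U \<in> weighted_L1 s k" by (rule weighted_L1_I[OF Um tU R UL])
  have U_T: "U y = T y" if "y \<in> ball 0 1" for y using T(2)[OF that] that R by (simp add: U)
  have "continuous_on (ball 0 1) T" by (rule continuous_on_subset[OF C_on_imp_continuous_on[OF T(1)]]) simp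
  then have "continuous_on (ball 0 1) U" by (subst continuous_on_cong[OF refl U_T]) simp_all
  with U_weighted have U_class: "U \<in> U_class s k" by (simp add: U_class_def)
  define cut where "cut r y = indicator (ball 0 r) y * v y" for r y
  define far where "far r x = (\<integral>y. indicator {y. r \<le> norm y} y * (b y * fker s (x - y)) \<partial>lebesgue)" for r x
  define P where "P r x = (\<Sum>w | length (wcoords w) < k. (- tcoef s R (cut r) w) * mon (wcoords w) x)" for r x
  \<comment> \<open>Two errors are collected: the tail of the part of \<open>v\<close> cut away
    beyond \<open>r\<close>, and the part of \<open>b\<close> that is also removed there.\<close>
  define F where "F r x = tail s k R v x - tail s k R (cut r) x + far r x" for r x
  have cutm[measurable]: "cut r \<in> borel_measurable lebesgue" for r
  proof -
    have [measurable]: "(\<lambda>x :: real ^ 'n. indicator (ball 0 r) x :: real) \<in> borel_measurable lebesgue"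
      by (rule borel_measurable_lebesgueI) (simp add: borel_measurable_indicator)
    show ?thesis unfolding cut_def by measurable
  qed
  have cutk: "tint s k R (cut r)" for r
    by (rule tint_comparison(1)[OF v cutm, where c = 1]) (simp add: cut_def indicator_def)
  have cut0: "tint s 0 R (cut r)" if r: "R \<le> r" for r
  proof (rule tint_comparison(1)[OF v cutm, where c = "r ^ k"])
    fix y :: "real ^ 'n" assume y: "R \<le> norm y"
    show "\<bar>cut r y\<bar> * (1 / norm y) ^ 0 \<le> r ^ k * (\<bar>v y\<bar> * (1 / norm y) ^ k)"
    proof (cases "norm y < r")
      case True
      \<comment> \<open>Inside radius \<open>r\<close> the missing weight costs at most
        \<open>r ^ k\<close>, so the cut data have a genuine potential.\<close>
      have "1 \<le> (r / norm y) ^ k" using True order_less_le_trans[OF zero_less_one order_trans[OF R y]]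
        by (intro one_le_power) (simp add: pos_le_divide_eq)
      then have "\<bar>v y\<bar> * 1 \<le> \<bar>v y\<bar> * (r / norm y) ^ k" by (rule mult_left_mono) simp
      then show ?thesis using True by (simp add: cut_def power_divide mult_ac)
    next
      case False
      then show ?thesis using r R by (simp add: cut_def)
    qed
  qed
  have sol: "viscosity_solution s (ball 0 1) (\<lambda>x. indicator (ball 0 r) x * U x) (\<lambda>x. F r x + P r x)" if r: "R \<le> r" for r
  proof (rule viscosity_solutionI[OF s T(1)])
    show "indicator (ball 0 r) y * U y = T y" if "y \<in> ball 0 1" for y
      using U_T[OF that] that r R by simp
    show "(\<lambda>x. indicator (ball 0 r) x * U x) \<in> weighted_L1 s 0" by (rule weighted_L1_truncate[OF s(1) U_weighted])
    fix x :: "real ^ 'n" assume x: "x \<in> ball 0 1"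
    \<comment> \<open>What must be added to \<open>b\<close> to obtain the truncation of
      \<open>U\<close>. It vanishes at \<open>x\<close>, so the operator acts on it by a plain
      integral.\<close>
    define h where "h y = indicator {y. R \<le> norm y} y * cut r y - indicator {y. r \<le> norm y} y * b y" for y
    define I where "I = (\<integral>y. indicator {y. R \<le> norm y} y * (cut r y * fker s (x - y)) \<partial>lebesgue)"
    have i1: "integrable lebesgue (\<lambda>y. indicator {y. R \<le> norm y} y * (cut r y * fker s (x - y)))"
      by (rule far_int[OF order_refl cut0[OF r] x])
    have r1: "1 \<le> r" using r R by linarith
    have i2: "integrable lebesgue (\<lambda>y. indicator {y. r \<le> norm y} y * (b y * fker s (x - y)))"
      by (rule far_int[OF r tb[OF r1] x])
    have eq: "(\<lambda>y. h y * fker s (x - y)) = (\<lambda>y. indicator {y. R \<le> norm y} y * (cut r y * fker s (x - y))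
        - indicator {y. r \<le> norm y} y * (b y * fker s (x - y)))"
      by (simp add: h_def fun_eq_iff algebra_simps)
    have hi: "integrable lebesgue (\<lambda>y. h y * fker s (x - y))" unfolding eq by (rule Bochner_Integration.integrable_diff[OF i1 i2])
    have hI: "(\<integral>y. h y * fker s (x - y) \<partial>lebesgue) = I - far r x"
      unfolding eq far_def I_def by (rule Bochner_Integration.integral_diff[OF i1 i2])
    have "h x = 0" using x r R by (simp add: h_def)
    from has_frac_laplacian_add[OF lap[OF x] has_frac_laplacian_vanishing[OF this hi]]
    have "has_frac_laplacian s (\<lambda>y. b y + h y) x (tail s k R v x + - (I - far r x))" by (simp only: hI)
    moreover have "(\<lambda>y. b y + h y) = (\<lambda>y. indicator (ball 0 r) y * U y)"
      using r by (auto simp: h_def U cut_def indicator_def fun_eq_iff)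
    moreover have "I = - P r x + tail s k R (cut r) x"
      unfolding I_def using tail_split[OF far_sum[OF cut0[OF r] x] coef[OF cutk x]]
      by (simp add: P_def sum_negf)
    then have "tail s k R v x + - (I - far r x) = F r x + P r x" by (simp add: F_def)
    ultimately show "has_frac_laplacian s (\<lambda>x. indicator (ball 0 r) x * U x) x (F r x + P r x)"
      by (simp only:)
  qed
  have lim: "((\<lambda>r. F r x) \<longlongrightarrow> 0) at_top" if x: "x \<in> ball 0 1" for x
  proof (rule Lim_null_comparison)
    show "\<forall>\<^sub>F r in at_top. norm (F r x) \<le> K * tau s k r v + \<bar>far r x\<bar>"
      using eventually_ge_at_top[of R]
    proof eventually_elim
      case (elim r)
      have "tau s k R (\<lambda>y. v y - cut r y) = tau s k r v"
        unfolding tau_def using elim by (intro Bochner_Integration.integral_cong refl) (auto simp: cut_def indicator_def)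
      then have "\<bar>tail s k R v x - tail s k R (cut r) x\<bar> \<le> K * tau s k r v"
        using tail_bound[OF tint_diff(1)[OF v cutk] x, of r]
        by (simp only: tail_diff[OF v cutk R coef[OF v x] coef[OF cutk x]])
      then show ?case by (simp add: F_def)
    qed
    have "((\<lambda>r. far r x) \<longlongrightarrow> 0) at_top"
      unfolding far_def by (rule far_integral_tendsto_0[OF _ far_int[OF order_refl tb[OF R] x]]) measurable
    then have "((\<lambda>r. K * tau s k r v + \<bar>far r x\<bar>) \<longlongrightarrow> K * 0 + \<bar>0\<bar>) at_top"
      by (intro tendsto_intros tau_tendsto_0[OF v])
    then show "((\<lambda>r. K * tau s k r v + \<bar>far r x\<bar>) \<longlongrightarrow> 0) at_top" by simp
  qed
  have "poly_degree_less k (P r)" for r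
    unfolding P_def by (rule poly_degree_less_sum) (rule poly_degree_less_mon, simp)
  moreover have "\<forall>\<^sub>F r in at_top. viscosity_solution s (ball 0 1) (\<lambda>x. indicator (ball 0 r) x * U x) (\<lambda>x. F r x + P r x)"
    using eventually_ge_at_top[of R] by eventually_elim (rule sol)
  ultimately show ?thesis
    unfolding div_frac_laplacian_eq_def using U_class lim by (intro conjI exI[of _ P] exI[of _ F]) auto
qed

theorem theorem1p1:
  fixes s :: real and k m :: nat and u :: "real ^ 'n::finite \<Rightarrow> real"
  assumes "0 < s" and "s < 1"
    and "u \<in> borel_measurable lebesgue"
    and "C_closure m (ball 0 1) u"
    and "set_integrable lebesgue (- ball 0 1)
           (\<lambda>x. \<bar>u x\<bar> / norm x powr (real CARD('n) + 2 * s + real k))"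
  shows "\<forall>\<epsilon>>0. \<exists>(u\<^sub>\<epsilon> :: real ^ 'n \<Rightarrow> real) R\<^sub>\<epsilon>. R\<^sub>\<epsilon> > 1 \<and>
           div_frac_laplacian_eq s k u\<^sub>\<epsilon> (\<lambda>x. 0) \<and>
           C_norm m (ball 0 1) (\<lambda>x. u\<^sub>\<epsilon> x - u x) \<le> ennreal \<epsilon> \<and>
           (\<forall>x\<in>- ball 0 R\<^sub>\<epsilon>. u\<^sub>\<epsilon> x = u x)"
proof (intro allI impI)
  fix \<epsilon> :: real assume \<epsilon>: "0 < \<epsilon>"
  note s = assms(1,2)
  \<comment> \<open>Order \<open>m\<close> is for the approximation, order 2 for comparison with
    touching functions.\<close>
  define N where "N = max m 2"
  have N: "m \<le> N" "2 \<le> N" by (simp_all add: N_def)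
  obtain T V L where C_T: "C_on N UNIV T" and Vm: "V \<in> borel_measurable borel"
    and TL: "\<And>x. \<bar>T x\<bar> \<le> L" and VL: "\<And>x. \<bar>V x\<bar> \<le> L"
    and V0: "\<And>x :: real ^ 'n. x \<in> ball 0 1 \<Longrightarrow> V x = 0"
    and TV: "\<And>x. x \<in> ball 0 1 \<Longrightarrow> has_frac_laplacian s (\<lambda>y. T y + V y) x 0"
    and close: "\<And>ds x. length ds \<le> m \<Longrightarrow> x \<in> ball 0 1 \<Longrightarrow> \<bar>iter_partial ds T x - iter_partial ds u x\<bar> \<le> \<epsilon> / 2"
    using harmonic_approximation[OF s assms(4) _ N(1), of "\<epsilon> / 2"] \<epsilon> by auto
  \<comment> \<open>A series of weight \<open>N + 2\<close> is needed to conclude class C^N.\<close>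
  obtain A and X :: "'n list \<Rightarrow> nat \<Rightarrow> real ^ 'n" and C B where mon_sol: "mon_solver s (N + 2) A X C B"
    using mon_solver_exists[OF s, where M = "N + 2"] by blast
  obtain R0 K where R0: "3 < R0" and K: "0 \<le> K"
    and solver: "\<And>R (v :: real ^ 'n \<Rightarrow> real). R0 \<le> R \<Longrightarrow> tint s k R v \<Longrightarrow> tadm (N + 2) (tsa A s k R v) (tsx X)"
    "\<And>R (v :: real ^ 'n \<Rightarrow> real). R0 \<le> R \<Longrightarrow> tint s k R v \<Longrightarrow> tnorm (N + 2) (tsa A s k R v) (tsx X) \<le> K * tau s k R v"
    "\<And>R (v :: real ^ 'n \<Rightarrow> real) x. R0 \<le> R \<Longrightarrow> tint s k R v \<Longrightarrow> x \<in> ball 0 1 \<Longrightarrow> has_frac_laplacian s (tsol A X s k R v) x (tail s k R v x)"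
    "\<And>R (v :: real ^ 'n \<Rightarrow> real) x. R0 \<le> R \<Longrightarrow> tint s k R v \<Longrightarrow> x \<in> ball 0 1 \<Longrightarrow> \<bar>tail s k R v x\<bar> \<le> K * tau s k R v"
    "\<And>R (v :: real ^ 'n \<Rightarrow> real) x. R0 \<le> R \<Longrightarrow> tint s k R v \<Longrightarrow> x \<in> ball 0 1 \<Longrightarrow> (\<lambda>w. ccoef s k R v w * mon (wcoords w) x) summable_on UNIV"
    "\<And>R (v :: real ^ 'n \<Rightarrow> real) x. R0 \<le> R \<Longrightarrow> tint s 0 R v \<Longrightarrow> x \<in> ball 0 1 \<Longrightarrow>
       integrable lebesgue (\<lambda>y. indicator {y. R \<le> norm y} y * (v y * fker s (x - y)))"
    "\<And>R (v :: real ^ 'n \<Rightarrow> real) x. R0 \<le> R \<Longrightarrow> tint s 0 R v \<Longrightarrow> x \<in> ball 0 1 \<Longrightarrow>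
       ((\<lambda>w. tcoef s R v w * mon (wcoords w) x) has_sum
         (\<integral>y. indicator {y. R \<le> norm y} y * (v y * fker s (x - y)) \<partial>lebesgue)) UNIV"
    using tail_solver[OF s mon_sol, of k] by auto
  \<comment> \<open>The mismatch between \<open>u\<close> and the harmonic approximant. The data to
    be cancelled are \<open>g - w\<close>, the mismatch that remains after correction by
    \<open>w\<close>.\<close>
  define g where "g y = u y - (T y + V y)" for y
  have Tm: "T \<in> borel_measurable borel"
    by (rule borel_measurable_continuous_onI[OF C_on_imp_continuous_on[OF C_T]])
  have A_meas: "(\<lambda>y. T y + V y) \<in> borel_measurable lebesgue"
    by (rule borel_measurable_lebesgueI) (use Tm Vm in measurable)
  have A_le: "\<bar>T y + V y\<bar> \<le> 2 * L" for y using TL[of y] VL[of y] by linarith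
  have tg1: "tint s k 1 g"
    unfolding g_def by (rule tint_diff(1)[OF tint_of_weight[OF assms(3,5)] tint_bounded(1)[OF s order_refl A_meas A_le]])
  have "((\<lambda>R. K * tau s k R (\<lambda>_ :: real ^ 'n. 1)) \<longlongrightarrow> K * 0) at_top"
    by (intro tendsto_intros tau_tendsto_0[OF tint_1[OF s order_refl]])
  then have ev1: "\<forall>\<^sub>F R in at_top. K * tau s k R (\<lambda>_ :: real ^ 'n. 1) < 1 / 2" by (rule order_tendstoD(2)) simp
  have "((\<lambda>R. K * tau s k R g) \<longlongrightarrow> K * 0) at_top" by (intro tendsto_intros tau_tendsto_0[OF tg1])
  \<comment> \<open>The fixed point doubles the bound \<open>\<epsilon> / 4\<close>, which leaves
    \<open>\<epsilon> / 2\<close> for \<open>w\<close> and \<open>\<epsilon> / 2\<close> for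
    \<open>T\<close>.\<close>
  then have ev2: "\<forall>\<^sub>F R in at_top. K * tau s k R g < \<epsilon> / 4" by (rule order_tendstoD(2)) (use \<epsilon> in simp)
  from eventually_happens[OF eventually_conj[OF eventually_conj[OF ev1 ev2] eventually_ge_at_top[of R0]]]
  obtain R where small: "K * tau s k R (\<lambda>_ :: real ^ 'n. 1) < 1 / 2" "K * tau s k R g < \<epsilon> / 4" and RR: "R0 \<le> R"
    by auto
  have R: "1 \<le> R" "1 < R" using R0 RR by linarith+
  obtain w where w: "w = tsol A X s k R (\<lambda>y. g y - w y)" and wm: "w \<in> borel_measurable borel"
    and w_le: "\<And>y. \<bar>w y\<bar> \<le> 2 * (\<epsilon> / 4)" and tv: "tint s k R (\<lambda>y. g y - w y)" and C_w: "C_on N UNIV w"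
    and w_part: "\<And>ds x. length ds \<le> N \<Longrightarrow> \<bar>iter_partial ds w x\<bar> \<le> 2 * (\<epsilon> / 4)"
  proof (rule tail_fixed_point[OF s R(1) tint_radius[OF tg1 R(1)] K solver(1)[OF RR] solver(2)[OF RR]
          less_imp_le[OF small(1)] less_imp_le[OF small(2)]])
    fix w assume h: "w = tsol A X s k R (\<lambda>y. g y - w y)" "w \<in> borel_measurable borel"
      "\<And>y. \<bar>w y\<bar> \<le> 2 * (\<epsilon> / 4)" "tint s k R (\<lambda>y. g y - w y)" "C_on N UNIV w"
      "\<And>ds x. length ds \<le> N \<Longrightarrow> \<bar>iter_partial ds w x\<bar> \<le> 2 * (\<epsilon> / 4)"
    show thesis by (rule that) (fact h)+
  qed
  \<comment> \<open>On the unit ball \<open>V\<close> vanishes, so the distance to \<open>u\<close>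
    is governed by \<open>T + w\<close> alone; the jump across radius \<open>R\<close> is harmless
    because \<open>1 < R\<close>.\<close>
  define U where "U y = (if norm y < R then T y + V y + w y else u y)" for y
  have U_ball: "U y = T y + w y" if "y \<in> ball 0 1" for y
    using that V0[OF that] R by (simp add: U_def)
  have C_Tw: "C_on N UNIV (\<lambda>y. T y + w y)" by (rule C_on_add[OF open_UNIV C_T C_w])
  have eq: "div_frac_laplacian_eq s k U (\<lambda>x. 0)"
  proof (rule div_frac_laplacian_eq_0I[where b = "\<lambda>y. (T y + V y) + w y" and T = "\<lambda>y. T y + w y"
        and v = "\<lambda>y. g y - w y" and K = K and R = R and L = "2 * L + \<epsilon>"])
    show "(\<lambda>y. (T y + V y) + w y) \<in> borel_measurable lebesgue"
      by (rule borel_measurable_lebesgueI) (use Tm Vm wm in measurable)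
    show "\<bar>(T y + V y) + w y\<bar> \<le> 2 * L + \<epsilon>" for y using A_le[of y] w_le[of y] \<epsilon> by linarith
    show "has_frac_laplacian s (\<lambda>y. (T y + V y) + w y) x (tail s k R (\<lambda>y. g y - w y) x)" if x: "x \<in> ball 0 1" for x
      using has_frac_laplacian_add[OF TV[OF x] solver(3)[OF RR tv x]] unfolding w[symmetric] by simp
    show "C_on 2 UNIV (\<lambda>y. T y + w y)" by (rule C_on_mono[OF C_Tw N(2)])
    show "(T y + V y) + w y = T y + w y" if "y \<in> ball 0 1" for y using V0[OF that] by simp
    show "U y = (T y + V y) + w y + indicator {y. R \<le> norm y} y * (g y - w y)" for y
      by (simp add: U_def g_def)
    show "integrable lebesgue (\<lambda>y. indicator {y. r \<le> norm y} y * (v y * fker s (x - y)))"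
      if "R \<le> r" "tint s 0 r v" "x \<in> ball 0 1" for v :: "real ^ 'n \<Rightarrow> real" and r x
      by (rule solver(6)[OF order_trans[OF RR that(1)] that(2,3)])
  qed (fact s R(1) tv solver(4)[OF RR] solver(5)[OF RR] solver(7)[OF RR])+
  have C_u: "C_on m (ball 0 1) u" using assms(4) by (simp add: C_closure_def)
  have C_Tm: "C_on m (ball 0 1) T" and C_wm: "C_on m (ball 0 1) w"
    by (rule C_on_subset[OF C_on_mono[OF C_T N(1)] subset_UNIV], rule C_on_subset[OF C_on_mono[OF C_w N(1)] subset_UNIV])
  have C_Twm: "C_on m (ball 0 1) (\<lambda>y. T y + w y)" by (rule C_on_add[OF open_ball C_Tm C_wm])
  have U_eq: "T y + w y - u y = U y - u y" if "y \<in> ball 0 1" for y using U_ball[OF that] by simp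
  have C_Uu: "C_on m (ball 0 1) (\<lambda>y. U y - u y)"
    by (rule C_on_cong[OF open_ball U_eq C_on_diff[OF open_ball C_Twm C_u]])
  have "C_norm m (ball 0 1) (\<lambda>x. U x - u x) \<le> ennreal \<epsilon>"
    unfolding C_norm_def if_P[OF C_Uu]
  proof (intro SUP_least ennreal_leI)
    fix ds :: "'n list" and x :: "real ^ 'n" assume "ds \<in> {ds. length ds \<le> m}" and x: "x \<in> ball 0 1"
    then have ds: "length ds \<le> m" by simp
    have "iter_partial ds (\<lambda>x. U x - u x) x = iter_partial ds (\<lambda>x. T x + w x - u x) x"
      by (rule iter_partial_cong[OF open_ball U_eq x, symmetric])
    also have "\<dots> = iter_partial ds (\<lambda>x. T x + w x) x - iter_partial ds u x"
      by (rule iter_partial_diff[OF open_ball C_Twm C_u ds x])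
    also have "iter_partial ds (\<lambda>x. T x + w x) x = iter_partial ds T x + iter_partial ds w x"
      by (rule iter_partial_add[OF open_ball C_Tm C_wm ds x])
    finally show "\<bar>iter_partial ds (\<lambda>x. U x - u x) x\<bar> \<le> \<epsilon>"
      using close[OF ds x] w_part[OF order_trans[OF ds N(1)], of x] by linarith
  qed
  moreover have "\<forall>x\<in>- ball 0 R. U x = u x" by (simp add: U_def)
  ultimately show "\<exists>(u\<^sub>\<epsilon> :: real ^ 'n \<Rightarrow> real) R\<^sub>\<epsilon>. R\<^sub>\<epsilon> > 1 \<and>
           div_frac_laplacian_eq s k u\<^sub>\<epsilon> (\<lambda>x. 0) \<and>
           C_norm m (ball 0 1) (\<lambda>x. u\<^sub>\<epsilon> x - u x) \<le> ennreal \<epsilon> \<and>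
           (\<forall>x\<in>- ball 0 R\<^sub>\<epsilon>. u\<^sub>\<epsilon> x = u x)"
    using eq R(2) by blast
qed

end
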